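(* Let $k_{\mathrm{NN}}$ be the neural tangent kernel of a fully-connected ReLU network with $L$ hidden layers, and let $\delta\in(0,1)$. There is a coefficient $C_{\mathrm{NN}}(d,L)$, depending on the eigenvalue decay of $k_{\mathrm{NN}}$, such that the following hold. (1) (GP assumption) If $f\sim\mathrm{GP}(0,k_{\mathrm{NN}})$, the noise is i.i.d. zero-mean Gaussian with variance $\sigma^2>0$, and $\beta_t=2\log(|\mathcal{A}|t^2\pi^2/(6\delta))$, then with high probability (greater than $1-\delta$) NTK-UCB has sublinear regret $R(T)=\tilde{\mathcal{O}}\big(C_{\mathrm{NN}}(d,L)\,T^{\frac{2d-1}{2d}}\big)$. (2) (RKHS assumption) If $f$ lies in the reproducing kernel Hilbert space of $k_{\mathrm{NN}}$ with $\|f\|_{k_{\mathrm{NN}}}\le B$, the noise is i.i.d. zero-mean sub-Gaussian with variance proxy $\sigma^2>0$, and $\beta_t=2\log(2T|\mathcal{A}|/\delta)$ is constant, then with high probability (greater than $1-\delta$) SupNTK-UCB has sublinear regret $R(T)=\tilde{\mathcal{O}}\big(C_{\mathrm{NN}}(d,L)\,T^{\frac{2d-1}{2d}}\big)$.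
   Context: Contextual bandit problem: $\mathcal{A}$ is a finite set of actions, represented as one-hot vectors in $\mathbb{R}^{|\mathcal{A}|}$. There is an arbitrary sequence of context matrices $z_t\in\mathbb{R}^{d\times|\mathcal{A}|}$, whose columns lie in the input space $\mathcal{X}\subset\mathbb{S}^{d-1}$ (the unit sphere of $\mathbb{R}^d$). At round $t\le T$ the learner observes $z_t$, picks $a_t\in\mathcal{A}$, sets $x_t=z_ta_t$, and receives $y_t=f(x_t)+\epsilon_t$. The regret is $R(T)=\sum_{t=1}^T\big(f(x_t^* )-f(x_t)\big)$ with $x_t^*\in\arg\max_{x=z_ta,\,a\in\mathcal{A}}f(x)$. Neural tangent kernel: for the fully-connected ReLU network with $L$ hidden layers of width $m$, $f^{(1)}(x)=W^{(1)}x$, $f^{(l)}(x)=\sqrt{2/m}\,W^{(l)}\sigma_{\mathrm{relu}}(f^{(l-1)}(x))$ for $1<l\le L$, $f(x;\theta)=\sqrt2\,W^{(L+1)}\sigma_{\mathrm{relu}}(f^{(L)}(x))$, with i.i.d. standard normal weights $\theta=(W^{(i)})_{i\le L+1}$ and gradient $g=\nabla_\theta f$, $k_{\mathrm{NN}}(x,x')$ is the deterministic limit of $\langle g(x;\theta),g(x';\theta)\rangle/m$ as $m\to\infty$. On $\mathbb{S}^{d-1}$ it has the Mercer decomposition $\sum_k\mu_k\sum_{j\le N(d,k)}Y_{j,k}(x)Y_{j,k}(x')$ in spherical harmonics $Y_{j,k}$ of degree $k$, with known eigenvalue decay $\mu_k\simeq C(d,L)k^{-d}$. Posterior from an index set $\Psi\subset\{1,\dots,t-1\}$: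 with $K=[k_{\mathrm{NN}}(x_i,x_j)]_{i,j\in\Psi}$, $\mathbf k(x)=[k_{\mathrm{NN}}(x_i,x)]_{i\in\Psi}$, $\mathbf y=[y_i]_{i\in\Psi}$, put $\mu_\Psi(x)=\mathbf k(x)^T(K+\sigma^2I)^{-1}\mathbf y$, $\sigma_\Psi(x)=\sqrt{k_{\mathrm{NN}}(x,x)-\mathbf k(x)^T(K+\sigma^2I)^{-1}\mathbf k(x)}$. NTK-UCB: at round $t$ use $\Psi=\{1,\dots,t-1\}$ and select $x_t\in\arg\max_{x=z_ta,\,a\in\mathcal{A}}\mu_\Psi(x)+\sqrt{\beta_t}\,\sigma_\Psi(x)$. SupNTK-UCB: let $S=\log T$ (number of levels, rounded up), $\Psi_1^{(s)}=\emptyset$ for $s\le S$, and write $\mu_{t-1}^{(s)},\sigma_{t-1}^{(s)}$ for $\mu_\Psi,\sigma_\Psi$ with $\Psi=\Psi_t^{(s)}$. At each round $t$ set $s=1$, $A_1=\mathcal{A}$ and repeat until an action is chosen: (i) if $\sqrt{\beta_t}\,\sigma_{t-1}^{(s)}(z_ta)\le\sigma/\sqrt T$ for all $a\in A_s$, choose $a_t\in\arg\max_{a\in A_s}\mu_{t-1}^{(s)}(z_ta)+\sqrt{\beta_t}\,\sigma_{t-1}^{(s)}(z_ta)$ and keep $\Psi_{t+1}^{(s')}=\Psi_t^{(s')}$ for all $s'$; (ii) else if $\sqrt{\beta_t}\,\sigma_{t-1}^{(s)}(z_ta)\le\sigma2^{-s}$ for all $a\in A_s$, set $A_{s+1}=\{a\in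 A_s:\mu_{t-1}^{(s)}(z_ta)+\sqrt{\beta_t}\sigma_{t-1}^{(s)}(z_ta)\ge\max_{a'\in A_s}[\mu_{t-1}^{(s)}(z_ta')+\sqrt{\beta_t}\sigma_{t-1}^{(s)}(z_ta')]-\sigma2^{1-s}\}$ and $s\leftarrow s+1$; (iii) else choose (at random) some $a_t\in A_s$ with $\sqrt{\beta_t}\,\sigma_{t-1}^{(s)}(z_ta_t)>\sigma2^{-s}$, set $\Psi_{t+1}^{(s)}=\Psi_t^{(s)}\cup\{t\}$ and $\Psi_{t+1}^{(s')}=\Psi_t^{(s')}$ for $s'\ne s$. $\tilde{\mathcal{O}}$ describes growth in $T$ and omits factors of order $\log T$ (polylogarithmic) or slower. *)

theory Defs
  imports
    "HOL-Probability.Probability"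
    "Jordan_Normal_Form.Gauss_Jordan_Elimination"
begin

text \<open>
  Vectors and matrices are those of Jordan_Normal_Form, so that the input dimension, the width and
  the number of arms are ordinary natural numbers. A parameter vector is a function on index
  triples (l, i, j), the entry (i, j) of the weight matrix of layer l, for l from 1 to L + 1.
  The first matrix has size m x d, the last 1 x m, and all others m x m.
\<close>

definition layer_rows :: "nat \<Rightarrow> nat \<Rightarrow> nat \<Rightarrow> nat" where
  "layer_rows L m l = (if l = L + 1 then 1 else m)"

definition layer_cols :: "nat \<Rightarrow> nat \<Rightarrow> nat \<Rightarrow> nat" where
  "layer_cols d m l = (if l = 1 then d else m)"

definition params :: "nat \<Rightarrow> nat \<Rightarrow> nat \<Rightarrow> (nat \<times> nat \<times> nat) set" where
  "params d L m = (SIGMA l:{1..L+1}. {..<layer_rows L m l} \<times> {..<layer_cols d m l})"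

definition weight :: "nat \<Rightarrow> nat \<Rightarrow> nat \<Rightarrow> (nat \<times> nat \<times> nat \<Rightarrow> real) \<Rightarrow> nat \<Rightarrow> real mat" where
  "weight d L m \<theta> l =
     Matrix.mat (layer_rows L m l) (layer_cols d m l) (\<lambda>(i, j). \<theta> (l, i, j))"

definition relu :: "real \<Rightarrow> real" where
  "relu u = max 0 u"

text \<open>The layers are numbered from 1; level 0 is only a placeholder.\<close>

fun hidden :: "nat \<Rightarrow> nat \<Rightarrow> nat \<Rightarrow> (nat \<times> nat \<times> nat \<Rightarrow> real) \<Rightarrow> real vec \<Rightarrow> nat \<Rightarrow> real vec" where
  "hidden d L m \<theta> x 0 = x"
| "hidden d L m \<theta> x (Suc 0) = weight d L m \<theta> 1 *\<^sub>v x"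
| "hidden d L m \<theta> x (Suc (Suc l)) =
     sqrt (2 / real m) \<cdot>\<^sub>v
       (weight d L m \<theta> (Suc (Suc l)) *\<^sub>v map_vec relu (hidden d L m \<theta> x (Suc l)))"

definition network :: "nat \<Rightarrow> nat \<Rightarrow> nat \<Rightarrow> (nat \<times> nat \<times> nat \<Rightarrow> real) \<Rightarrow> real vec \<Rightarrow> real" where
  "network d L m \<theta> x =
     sqrt 2 * vec_index (weight d L m \<theta> (L + 1) *\<^sub>v map_vec relu (hidden d L m \<theta> x L)) 0"

definition network_grad ::
  "nat \<Rightarrow> nat \<Rightarrow> nat \<Rightarrow> (nat \<times> nat \<times> nat \<Rightarrow> real) \<Rightarrow> real vec \<Rightarrow> nat \<times> nat \<times> nat \<Rightarrow> real" where
  "network_grad d L m \<theta> x p = deriv (\<lambda>v. network d L m (\<theta>(p := v)) x) (\<theta> p)"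

definition empirical_ntk ::
  "nat \<Rightarrow> nat \<Rightarrow> nat \<Rightarrow> (nat \<times> nat \<times> nat \<Rightarrow> real) \<Rightarrow> real vec \<Rightarrow> real vec \<Rightarrow> real" where
  "empirical_ntk d L m \<theta> x x' =
     (\<Sum>p\<in>params d L m. network_grad d L m \<theta> x p * network_grad d L m \<theta> x' p) / real m"

text \<open>
  The law of the initial weights (independent standard normal entries). The measure is completed
  because the gradient exists only almost everywhere, and its value elsewhere is a convention.
\<close>

definition init_law :: "nat \<Rightarrow> nat \<Rightarrow> nat \<Rightarrow> (nat \<times> nat \<times> nat \<Rightarrow> real) measure" where
  "init_law d L m = completion (PiM (params d L m) (\<lambda>_. std_normal_distribution))"

text \<open>The deterministic limit is the limit in probability as the width tends to infinity.\<close>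

definition ntk :: "nat \<Rightarrow> nat \<Rightarrow> real vec \<Rightarrow> real vec \<Rightarrow> real" where
  "ntk d L x x' = (THE c. \<forall>e>0.
     (\<lambda>m. measure (init_law d L m)
        {\<theta> \<in> space (init_law d L m). \<bar>empirical_ntk d L m \<theta> x x' - c\<bar> > e}) \<longlonglongrightarrow> 0)"

definition unit_sphere :: "nat \<Rightarrow> real vec set" where
  "unit_sphere d = {x \<in> carrier_vec d. scalar_prod x x = 1}"

text \<open>
  With N actions, the i-th action (i < N) is the one-hot vector \<^term>\<open>unit_vec N i\<close>; actions
  are referred to by their index i. Rounds are numbered from 1.
\<close>

definition arm :: "real mat \<Rightarrow> nat \<Rightarrow> real vec" where
  "arm Z i = Z *\<^sub>v unit_vec (dim_col Z) i"

definition contexts :: "nat \<Rightarrow> nat \<Rightarrow> real vec set \<Rightarrow> (nat \<Rightarrow> real mat) \<Rightarrow> bool" where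
  "contexts d N X z \<longleftrightarrow>
     X \<subseteq> unit_sphere d \<and>
     (\<forall>t\<ge>1. z t \<in> carrier_mat d N \<and> (\<forall>i<N. col (z t) i \<in> X))"

definition played :: "(nat \<Rightarrow> real mat) \<Rightarrow> (nat \<Rightarrow> nat) \<Rightarrow> nat \<Rightarrow> real vec" where
  "played z a t = arm (z t) (a t)"

definition reward ::
  "(real vec \<Rightarrow> real) \<Rightarrow> (nat \<Rightarrow> real mat) \<Rightarrow> (nat \<Rightarrow> nat) \<Rightarrow> (nat \<Rightarrow> real) \<Rightarrow> nat \<Rightarrow> real" where
  "reward f z a \<epsilon> t = f (played z a t) + \<epsilon> t"

definition regret ::
  "(real vec \<Rightarrow> real) \<Rightarrow> nat \<Rightarrow> (nat \<Rightarrow> real mat) \<Rightarrow> (nat \<Rightarrow> nat) \<Rightarrow> nat \<Rightarrow> real" where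
  "regret f N z a T =
     (\<Sum>t=1..T. Max ((\<lambda>i. f (arm (z t) i)) ` {..<N}) - f (played z a t))"

text \<open>The points x and observations y are indexed by rounds; only those in the index set are used.\<close>

definition kernel_inv ::
  "(real vec \<Rightarrow> real vec \<Rightarrow> real) \<Rightarrow> real \<Rightarrow> nat set \<Rightarrow> (nat \<Rightarrow> real vec) \<Rightarrow> real mat" where
  "kernel_inv k \<sigma> \<Psi> x =
     (let r = sorted_list_of_set \<Psi>; n = card \<Psi> in
      the (mat_inverse
        (Matrix.mat n n (\<lambda>(i, j). k (x (r ! i)) (x (r ! j))) + \<sigma>\<^sup>2 \<cdot>\<^sub>m 1\<^sub>m n)))"

definition kernel_col ::
  "(real vec \<Rightarrow> real vec \<Rightarrow> real) \<Rightarrow> nat set \<Rightarrow> (nat \<Rightarrow> real vec) \<Rightarrow> real vec \<Rightarrow> real vec" where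
  "kernel_col k \<Psi> x x' = Matrix.vec (card \<Psi>) (\<lambda>i. k (x (sorted_list_of_set \<Psi> ! i)) x')"

definition post_mean ::
  "(real vec \<Rightarrow> real vec \<Rightarrow> real) \<Rightarrow> real \<Rightarrow> nat set \<Rightarrow> (nat \<Rightarrow> real vec) \<Rightarrow> (nat \<Rightarrow> real) \<Rightarrow>
    real vec \<Rightarrow> real" where
  "post_mean k \<sigma> \<Psi> x y x' =
     scalar_prod (kernel_col k \<Psi> x x')
       (kernel_inv k \<sigma> \<Psi> x *\<^sub>v Matrix.vec (card \<Psi>) (\<lambda>i. y (sorted_list_of_set \<Psi> ! i)))"

definition post_sd ::
  "(real vec \<Rightarrow> real vec \<Rightarrow> real) \<Rightarrow> real \<Rightarrow> nat set \<Rightarrow> (nat \<Rightarrow> real vec) \<Rightarrow> real vec \<Rightarrow> real" where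
  "post_sd k \<sigma> \<Psi> x x' =
     sqrt (k x' x' -
       scalar_prod (kernel_col k \<Psi> x x') (kernel_inv k \<sigma> \<Psi> x *\<^sub>v kernel_col k \<Psi> x x'))"

definition ucb ::
  "(real vec \<Rightarrow> real vec \<Rightarrow> real) \<Rightarrow> real \<Rightarrow> real \<Rightarrow> nat set \<Rightarrow> (nat \<Rightarrow> real vec) \<Rightarrow> (nat \<Rightarrow> real) \<Rightarrow>
    real vec \<Rightarrow> real" where
  "ucb k \<sigma> \<beta> \<Psi> x y x' = post_mean k \<sigma> \<Psi> x y x' + sqrt \<beta> * post_sd k \<sigma> \<Psi> x x'"

definition generated_by :: "'w measure \<Rightarrow> 'b measure \<Rightarrow> ('w \<Rightarrow> 'b) \<Rightarrow> 'w set set" where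
  "generated_by M S V = sets (vimage_algebra (space M) V S)"

text \<open>The centred normal law with variance v, a point mass at 0 if v = 0.\<close>

definition centred_normal :: "real \<Rightarrow> real measure" where
  "centred_normal v = distr std_normal_distribution borel (\<lambda>u. sqrt v * u)"

text \<open>
  A centred Gaussian process on X: its finite-dimensional marginals are multivariate normal, that
  is, all linear combinations are univariate normal, with covariances given by k.
\<close>

definition gaussian_process ::
  "'w measure \<Rightarrow> 'x set \<Rightarrow> ('x \<Rightarrow> 'x \<Rightarrow> real) \<Rightarrow> ('w \<Rightarrow> 'x \<Rightarrow> real) \<Rightarrow> bool" where
  "gaussian_process M X k f \<longleftrightarrow>
     (\<forall>x\<in>X. (\<lambda>\<omega>. f \<omega> x) \<in> borel_measurable M) \<and>
     (\<forall>n x c. (\<forall>i<n. x i \<in> X) \<longrightarrow>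
        distr M borel (\<lambda>\<omega>. \<Sum>i<(n::nat). c i * f \<omega> (x i)) =
        centred_normal (\<Sum>i<n. \<Sum>j<n. c i * c j * k (x i) (x j)))"

definition iid_gaussian_noise :: "'w measure \<Rightarrow> nat set \<Rightarrow> real \<Rightarrow> ('w \<Rightarrow> nat \<Rightarrow> real) \<Rightarrow> bool" where
  "iid_gaussian_noise M I \<sigma> \<epsilon> \<longleftrightarrow>
     prob_space.indep_vars M (\<lambda>_. borel) (\<lambda>t \<omega>. \<epsilon> \<omega> t) I \<and>
     (\<forall>t\<in>I. distributed M lborel (\<lambda>\<omega>. \<epsilon> \<omega> t) (normal_density 0 \<sigma>))"

definition iid_subgaussian_noise :: "'w measure \<Rightarrow> nat set \<Rightarrow> real \<Rightarrow> ('w \<Rightarrow> nat \<Rightarrow> real) \<Rightarrow> bool" where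
  "iid_subgaussian_noise M I \<sigma> \<epsilon> \<longleftrightarrow>
     prob_space.indep_vars M (\<lambda>_. borel) (\<lambda>t \<omega>. \<epsilon> \<omega> t) I \<and>
     (\<forall>s\<in>I. \<forall>t\<in>I. distr M borel (\<lambda>\<omega>. \<epsilon> \<omega> s) = distr M borel (\<lambda>\<omega>. \<epsilon> \<omega> t)) \<and>
     (\<forall>t\<in>I. integrable M (\<lambda>\<omega>. \<epsilon> \<omega> t) \<and> (\<integral>\<omega>. \<epsilon> \<omega> t \<partial>M) = 0 \<and>
        (\<forall>u. integrable M (\<lambda>\<omega>. exp (u * \<epsilon> \<omega> t)) \<and>
             (\<integral>\<omega>. exp (u * \<epsilon> \<omega> t) \<partial>M) \<le> exp (u\<^sup>2 * \<sigma>\<^sup>2 / 2)))"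

text \<open>
  H with inner product ip is the reproducing kernel Hilbert space of k on X. Functions on X are
  represented by their extensions by 0.
\<close>

definition rkhs ::
  "'x set \<Rightarrow> ('x \<Rightarrow> 'x \<Rightarrow> real) \<Rightarrow> ('x \<Rightarrow> real) set \<Rightarrow> (('x \<Rightarrow> real) \<Rightarrow> ('x \<Rightarrow> real) \<Rightarrow> real) \<Rightarrow> bool"
where
  "rkhs X k H ip \<longleftrightarrow>
     (\<forall>g\<in>H. \<forall>x. x \<notin> X \<longrightarrow> g x = 0) \<and>
     (\<lambda>_. 0) \<in> H \<and>
     (\<forall>g\<in>H. \<forall>h\<in>H. (\<lambda>x. g x + h x) \<in> H) \<and>
     (\<forall>c. \<forall>g\<in>H. (\<lambda>x. c * g x) \<in> H) \<and>
     (\<forall>g\<in>H. \<forall>h\<in>H. ip g h = ip h g) \<and>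
     (\<forall>g\<in>H. \<forall>g'\<in>H. \<forall>h\<in>H. ip (\<lambda>x. g x + g' x) h = ip g h + ip g' h) \<and>
     (\<forall>c. \<forall>g\<in>H. \<forall>h\<in>H. ip (\<lambda>x. c * g x) h = c * ip g h) \<and>
     (\<forall>g\<in>H. 0 \<le> ip g g \<and> (ip g g = 0 \<longrightarrow> g = (\<lambda>_. 0))) \<and>
     (\<forall>F :: nat \<Rightarrow> 'x \<Rightarrow> real.
        (\<forall>n. F n \<in> H) \<and>
        (\<forall>e>0. \<exists>n0. \<forall>m\<ge>n0. \<forall>n\<ge>n0.
           sqrt (ip (\<lambda>x. F m x - F n x) (\<lambda>x. F m x - F n x)) < e) \<longrightarrow>
        (\<exists>g\<in>H. (\<lambda>n. sqrt (ip (\<lambda>x. F n x - g x) (\<lambda>x. F n x - g x))) \<longlonglongrightarrow> 0)) \<and>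
     (\<forall>x\<in>X. (\<lambda>x'. if x' \<in> X then k x x' else 0) \<in> H \<and>
        (\<forall>g\<in>H. ip g (\<lambda>x'. if x' \<in> X then k x x' else 0) = g x))"

definition in_rkhs_ball ::
  "'x set \<Rightarrow> ('x \<Rightarrow> 'x \<Rightarrow> real) \<Rightarrow> real \<Rightarrow> ('x \<Rightarrow> real) \<Rightarrow> bool" where
  "in_rkhs_ball X k B f \<longleftrightarrow> (\<exists>H ip. rkhs X k H ip \<and> f \<in> H \<and> sqrt (ip f f) \<le> B)"

text \<open>
  The seed U is the internal randomness of the learner, available for breaking ties: the action of
  round t is a function of the seed and of the rewards observed in rounds 1, ..., t - 1.
\<close>

definition history ::
  "'w measure \<Rightarrow> ('w \<Rightarrow> real) \<Rightarrow> ('w \<Rightarrow> nat \<Rightarrow> real) \<Rightarrow> nat \<Rightarrow> 'w measure" where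
  "history M U y t =
     vimage_algebra (space M) (\<lambda>\<omega>. (U \<omega>, restrict (y \<omega>) {1..<t}))
       (borel \<Otimes>\<^sub>M PiM {1..<t} (\<lambda>_. borel))"

definition ntk_ucb ::
  "(real vec \<Rightarrow> real vec \<Rightarrow> real) \<Rightarrow> real \<Rightarrow> (nat \<Rightarrow> real) \<Rightarrow> nat \<Rightarrow> (nat \<Rightarrow> real mat) \<Rightarrow>
    'w measure \<Rightarrow> ('w \<Rightarrow> real) \<Rightarrow> ('w \<Rightarrow> nat \<Rightarrow> nat) \<Rightarrow> ('w \<Rightarrow> nat \<Rightarrow> real) \<Rightarrow> bool" where
  "ntk_ucb k \<sigma> \<beta> N z M U a y \<longleftrightarrow>
     (\<forall>t\<ge>1.
        (\<lambda>\<omega>. a \<omega> t) \<in> measurable (history M U y t) (count_space {..<N}) \<and>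
        (\<forall>\<omega>\<in>space M.
           is_arg_max (\<lambda>i. ucb k \<sigma> (\<beta> t) {1..<t} (played z (a \<omega>)) (y \<omega>) (arm (z t) i))
             (\<lambda>i. i < N) (a \<omega> t)))"

text \<open>
  The set of actions still active at level s of a round with context matrix Z, when
  \<^term>\<open>\<Psi> s\<close> is the index set of level s. Levels are numbered from 1.
\<close>

fun active ::
  "(real vec \<Rightarrow> real vec \<Rightarrow> real) \<Rightarrow> real \<Rightarrow> real \<Rightarrow> nat \<Rightarrow> (nat \<Rightarrow> nat set) \<Rightarrow> (nat \<Rightarrow> real vec) \<Rightarrow>
    (nat \<Rightarrow> real) \<Rightarrow> real mat \<Rightarrow> nat \<Rightarrow> nat set" where
  "active k \<sigma> \<beta> N \<Psi> x y Z 0 = {}"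
| "active k \<sigma> \<beta> N \<Psi> x y Z (Suc 0) = {..<N}"
| "active k \<sigma> \<beta> N \<Psi> x y Z (Suc (Suc r)) =
     (let s = Suc r; A = active k \<sigma> \<beta> N \<Psi> x y Z s;
          u = (\<lambda>i. ucb k \<sigma> \<beta> (\<Psi> s) x y (arm Z i))
      in {i \<in> A. u i \<ge> Max (u ` A) - \<sigma> * 2 powr (1 - real s)})"

definition width ::
  "(real vec \<Rightarrow> real vec \<Rightarrow> real) \<Rightarrow> real \<Rightarrow> real \<Rightarrow> nat set \<Rightarrow> (nat \<Rightarrow> real vec) \<Rightarrow> real vec \<Rightarrow> real" where
  "width k \<sigma> \<beta> \<Psi> x x' = sqrt \<beta> * post_sd k \<sigma> \<Psi> x x'"

text \<open>
  A run over T rounds with actions a and rewards y. In round t the level is increased until the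
  first s at which the round stops, either because all active actions have width at most
  \<^term>\<open>\<sigma> / sqrt T\<close>, or because some active action has width above \<^term>\<open>\<sigma> * 2 powr - s\<close>.
  The function pick makes the random choice in the second case: it selects an element of the set
  it is given, and is supplied by the learner's internal randomness. Ties in the first case may be
  broken in any way.
\<close>

definition sup_ntk_ucb ::
  "(real vec \<Rightarrow> real vec \<Rightarrow> real) \<Rightarrow> real \<Rightarrow> real \<Rightarrow> nat \<Rightarrow> nat \<Rightarrow> (nat \<Rightarrow> real mat) \<Rightarrow>
    (nat \<Rightarrow> nat set \<Rightarrow> nat) \<Rightarrow> (nat \<Rightarrow> nat) \<Rightarrow> (nat \<Rightarrow> real) \<Rightarrow> bool" where
  "sup_ntk_ucb k \<sigma> \<beta> N T z pick a y \<longleftrightarrow>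
     (\<exists>\<Psi> :: nat \<Rightarrow> nat \<Rightarrow> nat set.
        \<Psi> 1 = (\<lambda>_. {}) \<and>
        (\<forall>t\<in>{1..T}. \<exists>s\<in>{1..nat \<lceil>ln (real T)\<rceil>}.
           let x = played z a;
               A = active k \<sigma> \<beta> N (\<Psi> t) x y (z t);
               w = (\<lambda>r i. width k \<sigma> \<beta> (\<Psi> t r) x (arm (z t) i));
               settled = (\<lambda>r. \<forall>i\<in>A r. w r i \<le> \<sigma> / sqrt (real T));
               narrow = (\<lambda>r. \<forall>i\<in>A r. w r i \<le> \<sigma> * 2 powr (- real r))
           in (\<forall>r\<in>{1..<s}. \<not> settled r \<and> narrow r) \<and>
              (settled s \<and>
                 is_arg_max (\<lambda>i. ucb k \<sigma> \<beta> (\<Psi> t s) x y (arm (z t) i)) (\<lambda>i. i \<in> A s) (a t) \<and>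
                 \<Psi> (Suc t) = \<Psi> t
               \<or>
               \<not> settled s \<and> \<not> narrow s \<and>
                 a t = pick t {i \<in> A s. w s i > \<sigma> * 2 powr (- real s)} \<and>
                 \<Psi> (Suc t) = (\<Psi> t)(s := insert t (\<Psi> t s)))))"

text \<open>
  Any distribution over the eligible actions is allowed (uniform choice in particular), as long as
  the choice depends only on the round, the set of eligible actions E and the seed u.
\<close>

definition choice_rule :: "nat \<Rightarrow> (real \<Rightarrow> nat \<Rightarrow> nat set \<Rightarrow> nat) \<Rightarrow> bool" where
  "choice_rule N pick \<longleftrightarrow>
     (\<forall>t E. E \<noteq> {} \<and> E \<subseteq> {..<N} \<longrightarrow>
        (\<lambda>u. pick u t E) \<in> measurable borel (count_space UNIV) \<and> (\<forall>u. pick u t E \<in> E))"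

text \<open>
  K is the constant and p the power of the logarithm hidden by the soft-O notation. They are meant
  to be chosen independently of d and L: this is what gives the coefficient C, which carries the
  whole dependence on the kernel, its meaning.
\<close>

definition regret_rate :: "real \<Rightarrow> real \<Rightarrow> nat \<Rightarrow> nat \<Rightarrow> nat \<Rightarrow> real" where
  "regret_rate C K p d T =
     K * (C * real T powr ((2 * real d - 1) / (2 * real d)) * ln (real T) ^ p)"

end

theory Submission
  imports Defs "Jordan_Normal_Form.Determinant"
begin

text \<open>
  The kernel is computed by a forward induction over the layers: given the lower layers, the weights
  of a layer are fresh Gaussians, and conditional second moments show that the empirical kernel
  converges in probability to the usual arc-cosine recursion. That recursion gives a positive
  semidefinite kernel with constant diagonal and with
  \<open>k x x + k x' x' - 2 * k x x' \<le> C * norm (x - x')\<close>, and this replaces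
  the eigenvalue decay: in a cell of diameter \<open>\<rho>\<close> of the sphere the posterior variance after n
  observations is at most a multiple of \<open>\<rho> + \<sigma>\<^sup>2 / n\<close>, so with about \<open>\<rho> powr - (d - 1)\<close> cells and
  \<open>\<rho> = T powr - (1 / d)\<close> the posterior variances along any sequence of T inputs sum up to
  \<open>O(T powr ((d - 1) / d) * ln T)\<close>. By Cauchy-Schwarz the widths then sum up to the claimed rate.

  Under the Gaussian process assumption the posterior residual is independent of the history by a
  computation of characteristic functions, and a union bound over rounds and actions remains.

  Under the RKHS assumption bias and noise are combined by Cauchy-Schwarz, so that a confidence bound
  fails with probability at most \<open>exp (B\<^sup>2 / 2) * \<delta> / (T * N)\<close>. A union bound over the levels would
  exceed \<open>\<delta>\<close>; but by Markov's inequality only \<open>O(ln T)\<close> rounds are affected with probability above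
  \<open>1 - \<delta>\<close>, and each of them costs a bounded amount.
\<close>

section \<open>Characteristic functions of random vectors\<close>

text \<open>Every bound collects the dependence on \<open>d\<close> and \<open>L\<close> in one
  factor. Under the RKHS assumption it enters twice, through the widths and through a bound on the
  values of \<open>f\<close>, so the final witness is a square.

  The derivative of the activation is a step function. Its Gaussian expectation has a square root
  singularity at correlation 1, which limits the bound on the kernel to a linear one in the distance
  of the inputs; the exponent of the rate comes from there.

  In both parts the obstacle is adaptivity: the inputs depend on earlier rewards, while posterior
  formulas concern fixed inputs. The probability space is cut along the finitely many possible
  pasts, and on each piece the posterior mean is a fixed linear form. The random part of the error
  must be independent of the choice of the piece. For the Gaussian process the posterior residual
  is. For the elimination algorithm it is the noise of one level, because decisions up to a level
  never read the rewards of that level. This is proved for a simulated run, since the given actions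
  may break ties in settled rounds by looking at any of the noise.\<close>

lemma weighted_char_unique:
 fixes X Y :: "'a => real" and w v :: "'a => real"
 assumes "prob_space M" "prob_space N"
  and [measurable]: "X \<in> borel_measurable M" "Y \<in> borel_measurable N"
   "w \<in> borel_measurable M" "v \<in> borel_measurable N"
  and w: "\<And>x. 0 \<le> w x" "\<And>x. w x \<le> K" and v: "\<And>x. 0 \<le> v x" "\<And>x. v x \<le> K"
  and eq: "\<And>t. (CLINT x|M. w x * iexp (t * X x)) = (CLINT x|N. v x * iexp (t * Y x))"
  and [measurable]: "B \<in> sets borel"
 shows "(\<integral>x. w x * indicator B (X x) \<partial>M) = (\<integral>x. v x * indicator B (Y x) \<partial>N)"
proof -
 interpret M: prob_space M by fact
 interpret N: prob_space N by fact
 have iw: "integrable M w" by (rule M.integrable_const_bound[of _ K]) (use w in auto)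
 have iv: "integrable N v" by (rule N.integrable_const_bound[of _ K]) (use v in auto)
 define c where "c = (\<integral>x. w x \<partial>M)"
 \<comment> \<open>Frequency 0 shows that both weights have the same total mass
   \<open>c\<close>.\<close>
 have "complex_of_real (\<integral>x. w x \<partial>M) = complex_of_real (\<integral>x. v x \<partial>N)"
  using eq[of 0] by (simp flip: integral_complex_of_real)
 then have c2: "c = (\<integral>x. v x \<partial>N)" by (simp add: c_def)
 have "c \<ge> 0" unfolding c_def by (simp add: w)
 show ?thesis
 proof (cases "c = 0")
  case True
  have "AE x in M. w x = 0"
   using True integral_nonneg_eq_0_iff_AE[OF iw] w by (simp add: c_def)
  then have "(\<integral>x. w x * indicator B (X x) \<partial>M) = (\<integral>x. 0 \<partial>M)"
   by (intro integral_cong_AE) (auto elim!: eventually_mono)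
  moreover have "AE x in N. v x = 0"
   using True integral_nonneg_eq_0_iff_AE[OF iv] v by (simp add: c2)
  then have "(\<integral>x. v x * indicator B (Y x) \<partial>N) = (\<integral>x. 0 \<partial>N)"
   by (intro integral_cong_AE) (auto elim!: eventually_mono)
  ultimately show ?thesis by simp
 next
  case False
  with \<open>c \<ge> 0\<close> have c: "c > 0" by simp
  \<comment> \<open>Divided by \<open>c\<close>, each weight becomes a probability density; the
    uniqueness theorem of Levy is then applied to the laws of \<open>X\<close> and \<open>Y\<close>
    under the reweighted measures.\<close>
  have aux: "real_distribution (distr (density O' (\<lambda>x. ennreal (u x / c))) borel Z) \<and>
    (\<forall>t. char (distr (density O' (\<lambda>x. ennreal (u x / c))) borel Z) t = (CLINT x|O'. u x * iexp (t * Z x)) / c) \<and>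
    measure (distr (density O' (\<lambda>x. ennreal (u x / c))) borel Z) B = (\<integral>x. u x * indicator B (Z x) \<partial>O') / c"
   if "prob_space O'" and [measurable]: "Z \<in> borel_measurable O'" "u \<in> borel_measurable O'"
    and u: "\<And>x. 0 \<le> u x" and iu: "integrable O' u" and cu: "c = (\<integral>x. u x \<partial>O')" for O' :: "'a measure" and u Z :: "'a => real"
  proof -
   interpret O: prob_space O' by fact
   have p: "prob_space (density O' (\<lambda>x. ennreal (u x / c)))"
   proof
    have "emeasure (density O' (\<lambda>x. ennreal (u x / c))) (space (density O' (\<lambda>x. ennreal (u x / c))))
     = (\<integral>\<^sup>+x. ennreal (u x / c) \<partial>O')"
     by (subst emeasure_density) (auto intro!: nn_integral_cong)
    also have "\<dots> = ennreal (\<integral>x. u x / c \<partial>O')"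
     by (rule nn_integral_eq_integral) (use iu u c in auto)
    also have "\<dots> = 1" using c cu by simp
    finally show "emeasure (density O' (\<lambda>x. ennreal (u x / c))) (space (density O' (\<lambda>x. ennreal (u x / c)))) = 1" .
   qed
   then interpret D: prob_space "density O' (\<lambda>x. ennreal (u x / c))" .
   have 1: "real_distribution (distr (density O' (\<lambda>x. ennreal (u x / c))) borel Z)"
    by (rule D.real_distribution_distr) simp
   have 2: "char (distr (density O' (\<lambda>x. ennreal (u x / c))) borel Z) t = (CLINT x|O'. u x * iexp (t * Z x)) / c" for t
   proof -
    have "char (distr (density O' (\<lambda>x. ennreal (u x / c))) borel Z) t
     = (CLINT x|density O' (\<lambda>x. ennreal (u x / c)). iexp (t * Z x))"
     unfolding char_def by (subst integral_distr) auto
    also have "\<dots> = (CLINT x|O'. (u x / c) *\<^sub>R iexp (t * Z x))"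
     by (subst integral_density) (use u c in auto)
    also have "\<dots> = (CLINT x|O'. (u x * iexp (t * Z x)) / c)"
     by (intro Bochner_Integration.integral_cong) (auto simp: scaleR_conv_of_real)
    finally show ?thesis by simp
   qed
   have "measure (distr (density O' (\<lambda>x. ennreal (u x / c))) borel Z) B = (\<integral>x. indicator B (Z x) \<partial>density O' (\<lambda>x. ennreal (u x / c)))"
   proof -
    have "measure (distr (density O' (\<lambda>x. ennreal (u x / c))) borel Z) B = (\<integral>x. indicator B x \<partial>distr (density O' (\<lambda>x. ennreal (u x / c))) borel Z)"
     by simp
    then show ?thesis by (subst (asm) integral_distr) auto
   qed
   also have "\<dots> = (\<integral>x. (u x / c) *\<^sub>R indicator B (Z x) \<partial>O')"
    by (subst integral_density) (use u c in auto)
   finally have 3: "measure (distr (density O' (\<lambda>x. ennreal (u x / c))) borel Z) B = (\<integral>x. u x * indicator B (Z x) \<partial>O') / c"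
    by simp
   show ?thesis using 1 2 3 by blast
  qed
  note a1 = aux[OF \<open>prob_space M\<close> _ _ w(1) iw c_def, of X]
  note a2 = aux[OF \<open>prob_space N\<close> _ _ v(1) iv c2, of Y]
  have "distr (density M (\<lambda>x. ennreal (w x / c))) borel X = distr (density N (\<lambda>x. ennreal (v x / c))) borel Y"
   by (rule Levy_uniqueness) (use a1 a2 eq in \<open>auto intro!: ext\<close>)
  then show ?thesis using a1 a2 c by simp
 qed
qed

lemma iexp_add_real: "iexp (a + b) = iexp a * iexp b"
 by (simp add: distrib_left exp_add)

lemma cos_iexp: "complex_of_real (cos a) = (iexp a + iexp (- a)) / 2"
 by (simp add: cos_exp_eq flip: cos_of_real)

lemma sin_iexp: "complex_of_real (sin a) = (iexp a - iexp (- a)) / (2 * \<i>)"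
 by (simp add: sin_exp_eq flip: sin_of_real)

text \<open>\<open>weighted_char_unique\<close> wants nonnegative weights. The functions
  \<open>1 + cos\<close> and \<open>1 + sin\<close> are nonnegative, and subtracting the mean of
  \<open>q\<close> recovers the complex exponential from them.\<close>

lemma (in prob_space) expectation_mult_iexp:
 fixes q h :: "'a => real"
 assumes [measurable]: "q \<in> borel_measurable M" and q: "\<And>x. \<bar>q x\<bar> \<le> 1" and [measurable]: "h \<in> borel_measurable M"
 shows "(CLINT x|M. complex_of_real (q x) * iexp (h x)) =
   complex_of_real ((\<integral>x. q x * (1 + cos (h x)) \<partial>M) - (\<integral>x. q x \<partial>M)) +
    \<i> * complex_of_real ((\<integral>x. q x * (1 + sin (h x)) \<partial>M) - (\<integral>x. q x \<partial>M))"
proof -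
 have bd: "\<bar>q x * y\<bar> \<le> 1" if "\<bar>y\<bar> \<le> 1" for x y
  using mult_mono[OF q[of x] that] by (simp add: abs_mult)
 have i0: "integrable M q" by (rule integrable_const_bound[of _ 1]) (simp_all add: q)
 have i1: "integrable M (\<lambda>x. q x * cos (h x))" by (rule integrable_const_bound[of _ 1]) (simp_all add: bd)
 have i2: "integrable M (\<lambda>x. q x * sin (h x))" by (rule integrable_const_bound[of _ 1]) (simp_all add: bd)
 have e: "complex_of_real (q x) * iexp (h x) = complex_of_real (q x * cos (h x)) + \<i> * complex_of_real (q x * sin (h x))" for x
  by (simp add: exp_Euler distrib_left mult.left_commute flip: cos_of_real sin_of_real)
 have "(CLINT x|M. complex_of_real (q x) * iexp (h x)) = complex_of_real (\<integral>x. q x * cos (h x) \<partial>M) + \<i> * complex_of_real (\<integral>x. q x * sin (h x) \<partial>M)"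
  unfolding e using i1 i2
  by (subst Bochner_Integration.integral_add) (simp_all only: complex_of_real_integrable_eq integrable_mult_right integral_mult_right_zero integral_complex_of_real)
 then show ?thesis using i0 i1 i2 by (simp only: distrib_left mult_1_right Bochner_Integration.integral_add) simp
qed

text \<open>Coordinates are exchanged one at a time: in the claim, those in \<open>J\<close> already
  carry indicators of Borel sets and the others still carry the exponential. To move
  \<open>k\<close> into \<open>J\<close>, everything except the factor in \<open>x k\<close> is
  regarded as a weight, and the one-dimensional uniqueness is applied in \<open>x k\<close>. With
  \<open>J = I\<close> the claim gives the measures of boxes, which determine the law.\<close>

theorem multivariate_char_unique:
 fixes M N :: "('i => real) measure"
 assumes I: "finite I" and "prob_space M" "prob_space N"
  and sM[measurable_cong]: "sets M = sets (PiM I (\<lambda>_. borel))" and sN[measurable_cong]: "sets N = sets (PiM I (\<lambda>_. borel))"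
  and eq: "\<And>u. (CLINT x|M. iexp (\<Sum>i\<in>I. u i * x i)) = (CLINT x|N. iexp (\<Sum>i\<in>I. u i * x i))"
 shows "M = N"
proof -
 interpret M: prob_space M by fact
 interpret N: prob_space N by fact
 have claim: "(CLINT x|M. (\<Prod>j\<in>J. indicator (B j) (x j)) * iexp (\<Sum>i\<in>I - J. u i * x i)) =
       (CLINT x|N. (\<Prod>j\<in>J. indicator (B j) (x j)) * iexp (\<Sum>i\<in>I - J. u i * x i))"
  if "finite J" "J \<subseteq> I" "\<And>j. j \<in> J ==> B j \<in> sets borel" for J u and B :: "'i => real set"
  using that
 proof (induction J arbitrary: u B rule: finite_induct)
  case empty
  then show ?case using eq[of u] by simp
 next
  case (insert k J)
  have [measurable]: "B k \<in> sets borel" "\<And>j. j \<in> J ==> B j \<in> sets borel" using insert by auto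
  have kI: "k \<in> I" "J \<subseteq> I" and [simp]: "finite J" using insert by auto
  define p where "p x = (\<Prod>j\<in>J. indicator (B j) (x j) :: real)" for x :: "'i => real"
  define th where "th x = (\<Sum>i\<in>I - insert k J. u i * x i)" for x
  have pm[measurable]: "p \<in> borel_measurable (PiM I (\<lambda>_. borel))"
   unfolding p_def using kI by (intro borel_measurable_prod borel_measurable_indicator') auto
  have mth[measurable]: "th \<in> borel_measurable (PiM I (\<lambda>_. borel))"
   unfolding th_def by measurable
  have km[measurable]: "(\<lambda>x. x k) \<in> borel_measurable (PiM I (\<lambda>_. borel))" using kI by measurable
  have p01: "0 \<le> p x" "p x \<le> 1" for x unfolding p_def
   by (auto intro!: prod_nonneg prod_le_1 simp: indicator_def)
  \<comment> \<open>The frequencies of the untouched coordinates are scaled by \<open>s\<close>,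
    because \<open>cos (th x)\<close> and \<open>sin (th x)\<close> are combinations of the
    exponentials with \<open>s\<close> equal to 1 and -1; the constant 1 needs
    \<open>s = 0\<close>.\<close>
  have IH: "(CLINT x|M. p x * (iexp (s * th x) * iexp (t * x k))) = (CLINT x|N. p x * (iexp (s * th x) * iexp (t * x k)))" for s t
  proof -
   have sum: "(\<Sum>i\<in>I - J. (\<lambda>i. if i = k then t else s * u i) i * x i) = s * th x + t * x k" for x
   proof -
    have IJ: "I - J = insert k (I - insert k J)" using kI insert by auto
    have "(\<Sum>i\<in>I - J. (if i = k then t else s * u i) * x i) =
     t * x k + (\<Sum>i\<in>I - insert k J. (if i = k then t else s * u i) * x i)"
     unfolding IJ by (subst sum.insert) (use I in simp_all)
    also have "(\<Sum>i\<in>I - insert k J. (if i = k then t else s * u i) * x i) = s * th x"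
     unfolding th_def sum_distrib_left by (intro sum.cong) auto
    finally show ?thesis by simp
   qed
   have pc: "(\<Prod>j\<in>J. indicator (B j) (x j)) = complex_of_real (p x)" for x
    unfolding p_def of_real_prod by (intro prod.cong) (auto simp: indicator_def)
   show ?thesis
    using insert.IH[of B "\<lambda>i. if i = k then t else s * u i"] insert.prems
    unfolding sum pc iexp_add_real by simp
  qed
  have int: "integrable O' (\<lambda>x. complex_of_real (p x) * (iexp (a x)))"
   if "prob_space O'" and [measurable_cong]: "sets O' = sets (PiM I (\<lambda>_. borel))" and [measurable]: "a \<in> borel_measurable (PiM I (\<lambda>_. borel))"
   for O' :: "('i => real) measure" and a :: "_ => real"
  proof -
   interpret O: prob_space O' by fact
   show ?thesis
    by (rule O.integrable_const_bound[of _ 1]) (auto simp: norm_mult p01)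
  qed
  have ints: "integrable O' (\<lambda>x. complex_of_real (p x) * (iexp (s * th x) * iexp (t * x k)))"
   if "prob_space O'" "sets O' = sets (PiM I (\<lambda>_. borel))" for O' s t
   using int[OF that, of "\<lambda>x. s * th x + t * x k"] unfolding iexp_add_real by simp
  note iM = ints[OF \<open>prob_space M\<close> sM] and iN = ints[OF \<open>prob_space N\<close> sN]
  have c1: "(CLINT x|M. complex_of_real (p x * (1 + cos (th x))) * iexp (t * x k)) = (CLINT x|N. complex_of_real (p x * (1 + cos (th x))) * iexp (t * x k))" for t
  proof -
   have e: "complex_of_real (p x * (1 + cos (th x))) * iexp (t * x k) =
    p x * (iexp (0 * th x) * iexp (t * x k)) + p x * (iexp (1 * th x) * iexp (t * x k)) / 2 + p x * (iexp ((-1) * th x) * iexp (t * x k)) / 2" for x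
    by (simp add: cos_iexp algebra_simps add_divide_distrib)
   show ?thesis unfolding e
    by (simp only: Bochner_Integration.integral_add Bochner_Integration.integral_divide_zero
       Bochner_Integration.integrable_add integrable_divide iM iN IH)
  qed
  have c2: "(CLINT x|M. complex_of_real (p x * (1 + sin (th x))) * iexp (t * x k)) = (CLINT x|N. complex_of_real (p x * (1 + sin (th x))) * iexp (t * x k))" for t
  proof -
   have e: "complex_of_real (p x * (1 + sin (th x))) * iexp (t * x k) =
    p x * (iexp (0 * th x) * iexp (t * x k)) + p x * (iexp (1 * th x) * iexp (t * x k)) / (2*\<i>) - p x * (iexp ((-1) * th x) * iexp (t * x k)) / (2*\<i>)" for x
    by (simp add: sin_iexp algebra_simps diff_divide_distrib)
   show ?thesis unfolding e
    by (simp only: Bochner_Integration.integral_add Bochner_Integration.integral_diff Bochner_Integration.integral_divide_zero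
       Bochner_Integration.integrable_add integrable_divide iM iN IH)
  qed
  have c0: "(CLINT x|M. complex_of_real (p x) * iexp (t * x k)) = (CLINT x|N. complex_of_real (p x) * iexp (t * x k))" for t
   using IH[of 0 t] by simp
  have pos: "0 \<le> 1 + cos (th x)" "1 + cos (th x) \<le> 2" "0 \<le> 1 + sin (th x)" "1 + sin (th x) \<le> 2" for x
   using cos_ge_minus_one[of "th x"] sin_ge_minus_one[of "th x"] cos_le_one[of "th x"] sin_le_one[of "th x"]
   by linarith+
  have bd: "0 \<le> p x * (1 + cos (th x))" "p x * (1 + cos (th x)) \<le> 2"
    "0 \<le> p x * (1 + sin (th x))" "p x * (1 + sin (th x)) \<le> 2" "p x \<le> 2" for x
   using mult_mono[OF p01(2) pos(2) _ pos(1), of x] mult_mono[OF p01(2) pos(4) _ pos(3), of x]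
    mult_nonneg_nonneg[OF p01(1) pos(1), of x] mult_nonneg_nonneg[OF p01(1) pos(3), of x] p01[of x] by simp_all
  note W = weighted_char_unique[OF \<open>prob_space M\<close> \<open>prob_space N\<close>, where X="\<lambda>x. x k" and Y="\<lambda>x. x k" and B="B k" and K=2]
  have w0: "(\<integral>x. p x * indicator (B k) (x k) \<partial>M) = (\<integral>x. p x * indicator (B k) (x k) \<partial>N)"
   by (rule W) (use bd p01 c0 in \<open>auto simp: of_real_mult[symmetric] simp del: of_real_mult\<close>)
  have w1: "(\<integral>x. p x * (1 + cos (th x)) * indicator (B k) (x k) \<partial>M) = (\<integral>x. p x * (1 + cos (th x)) * indicator (B k) (x k) \<partial>N)"
   by (rule W) (use bd c1 in \<open>auto simp del: of_real_mult of_real_add\<close>)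
  have w2: "(\<integral>x. p x * (1 + sin (th x)) * indicator (B k) (x k) \<partial>M) = (\<integral>x. p x * (1 + sin (th x)) * indicator (B k) (x k) \<partial>N)"
   by (rule W) (use bd c2 in \<open>auto simp del: of_real_mult of_real_add\<close>)
  define q where "q x = p x * indicator (B k) (x k)" for x
  have qm[measurable]: "q \<in> borel_measurable (PiM I (\<lambda>_. borel))" unfolding q_def by measurable
  have q01: "\<bar>q x\<bar> \<le> 1" for x unfolding q_def using p01[of x] by (auto simp: indicator_def)
  have qmM: "q \<in> borel_measurable M" "q \<in> borel_measurable N" and thM: "th \<in> borel_measurable M" "th \<in> borel_measurable N"
   using qm mth by (auto simp: measurable_cong_sets[OF sM refl] measurable_cong_sets[OF sN refl])
  have pc: "(\<Prod>j\<in>insert k J. indicator (B j) (x j)) = complex_of_real (q x)" for x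
   unfolding q_def p_def of_real_mult of_real_prod using insert
   by (subst prod.insert) (auto simp: indicator_def intro!: prod.cong)
  have qq: "q x * y = p x * y * indicator (B k) (x k)" for x y by (simp add: q_def)
  have q0: "(\<integral>x. q x \<partial>M) = (\<integral>x. q x \<partial>N)" using w0 by (simp only: q_def)
  have "(CLINT x|M. complex_of_real (q x) * iexp (th x)) = (CLINT x|N. complex_of_real (q x) * iexp (th x))"
   unfolding M.expectation_mult_iexp[OF qmM(1) q01 thM(1)] N.expectation_mult_iexp[OF qmM(2) q01 thM(2)] q0 unfolding qq w1 w2 ..
  then show ?case unfolding pc th_def[symmetric] .
 qed
 show ?thesis
 proof (rule measure_eqI_PiM_finite[OF I sM sN, where A="\<lambda>_. \<Pi>\<^sub>E i\<in>I. UNIV"])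
  show "range (\<lambda>_::nat. \<Pi>\<^sub>E i\<in>I. UNIV :: real set) \<subseteq> prod_algebra I (\<lambda>_. borel)"
   using prod_algebraI_finite[OF I, of "\<lambda>_. UNIV" "\<lambda>_. borel :: real measure"] by auto
  show "(\<Union>i::nat. \<Pi>\<^sub>E i\<in>I. UNIV) = space (PiM I (\<lambda>_. borel :: real measure))"
   by (simp add: space_PiM)
  fix A :: "'i => real set" assume A: "\<And>i. i \<in> I ==> A i \<in> sets borel"
  have *: "emeasure O' (Pi\<^sub>E I A) = ennreal (Re (CLINT x|O'. (\<Prod>j\<in>I. indicator (A j) (x j)) * iexp (\<Sum>i\<in>I - I. 0 * x i)))"
   if "prob_space O'" and s: "sets O' = sets (PiM I (\<lambda>_. borel))" for O'
  proof -
   interpret O: prob_space O' by fact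
   have sp: "space O' = (\<Pi>\<^sub>E i\<in>I. UNIV)" using sets_eq_imp_space_eq[OF s] by (simp add: space_PiM)
   have ind: "(\<Prod>j\<in>I. indicator (A j) (x j)) = complex_of_real (indicator (Pi\<^sub>E I A) x)" if "x \<in> space O'" for x
   proof (cases "x \<in> Pi\<^sub>E I A")
    case True
    then show ?thesis by (auto intro!: prod.neutral simp: PiE_iff)
   next
    case False
    moreover have "x \<in> extensional I" using that unfolding sp by (simp add: PiE_iff)
    ultimately obtain j where j: "j \<in> I" "x j \<notin> A j" by (auto simp: PiE_iff)
    then have "(\<Prod>j\<in>I. indicator (A j) (x j)) = (0::complex)" using I by (intro prod_zero bexI[of _ j]) auto
    then show ?thesis using False by simp
   qed
   have m: "Pi\<^sub>E I A \<in> sets O'" unfolding s using A by (intro sets_PiM_I_finite I) auto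
   have "(CLINT x|O'. (\<Prod>j\<in>I. indicator (A j) (x j)) * iexp (\<Sum>i\<in>I - I. 0 * x i)) = (CLINT x|O'. complex_of_real (indicator (Pi\<^sub>E I A) x))"
    by (intro Bochner_Integration.integral_cong refl) (simp only: ind Diff_cancel sum.empty of_real_0 mult_zero_right exp_zero mult_1_right)
   also have "\<dots> = complex_of_real (\<integral>x. indicator (Pi\<^sub>E I A) x \<partial>O')"
    by (rule integral_complex_of_real)
   also have "(\<integral>x. indicator (Pi\<^sub>E I A) x \<partial>O') = measure O' (Pi\<^sub>E I A)"
    using sets.Int_space_eq2[OF m] by (simp del: PiE_Int)
   finally show ?thesis by (simp add: O.emeasure_eq_measure)
  qed
  show "emeasure M (Pi\<^sub>E I A) = emeasure N (Pi\<^sub>E I A)"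
   unfolding *[OF \<open>prob_space M\<close> sM] *[OF \<open>prob_space N\<close> sN]
   using claim[of I A "\<lambda>_. 0"] I A by simp
 qed simp
qed

section \<open>Gaussian vectors and independence\<close>

text \<open>The joint law of the vector and \<open>R\<close> is compared with its law on the product
  of \<open>M\<close> with itself, where \<open>R\<close> reads the second component. The
  factorization says that both have the same characteristic function. The index \<open>n\<close> is
  a fresh coordinate that holds \<open>R\<close>.\<close>

lemma (in prob_space) indep_of_char_factorizes:
 fixes V :: "'i => 'a => real" and R :: "'a => real"
 assumes I: "finite I" "n \<notin> I"
  and V[measurable]: "\<And>i. i \<in> I ==> V i \<in> borel_measurable M" and R[measurable]: "R \<in> borel_measurable M"
  and eq: "\<And>u r. (CLINT \<omega>|M. iexp ((\<Sum>i\<in>I. u i * V i \<omega>) + r * R \<omega>)) =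
   (CLINT \<omega>|M. iexp (\<Sum>i\<in>I. u i * V i \<omega>)) * (CLINT \<omega>|M. iexp (r * R \<omega>))"
  and S[measurable]: "S \<in> sets (PiM I (\<lambda>_. borel))" and C[measurable]: "C \<in> sets borel"
 shows "prob {\<omega> \<in> space M. (\<lambda>i\<in>I. V i \<omega>) \<in> S \<and> R \<omega> \<in> C} =
  prob {\<omega> \<in> space M. (\<lambda>i\<in>I. V i \<omega>) \<in> S} * prob {\<omega> \<in> space M. R \<omega> \<in> C}"
proof -
 interpret MM: pair_prob_space M M ..
 define J where "J = insert n I"
 define X where "X \<omega> \<omega>' = (\<lambda>i\<in>J. if i = n then R \<omega>' else V i \<omega>)" for \<omega> \<omega>'
 have X1[measurable]: "(\<lambda>\<omega>. X \<omega> \<omega>) \<in> measurable M (PiM J (\<lambda>_. borel))"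
  unfolding X_def by (rule measurable_restrict) (auto simp: J_def)
 have X2[measurable]: "(\<lambda>\<omega>. X (fst \<omega>) (snd \<omega>)) \<in> measurable (M \<Otimes>\<^sub>M M) (PiM J (\<lambda>_. borel))"
  unfolding X_def by (rule measurable_restrict) (auto simp: J_def)
 have sumJ: "(\<Sum>i\<in>J. u i * X \<omega> \<omega>' i) = (\<Sum>i\<in>I. u i * V i \<omega>) + u n * R \<omega>'" for u \<omega> \<omega>'
  unfolding J_def X_def using I by (subst sum.insert) (auto intro!: sum.cong)
 have meq: "distr M (PiM J (\<lambda>_. borel)) (\<lambda>\<omega>. X \<omega> \<omega>) = distr (M \<Otimes>\<^sub>M M) (PiM J (\<lambda>_. borel)) (\<lambda>\<omega>. X (fst \<omega>) (snd \<omega>))"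
 proof (rule multivariate_char_unique[of J])
  fix u
  have "(CLINT x|distr M (PiM J (\<lambda>_. borel)) (\<lambda>\<omega>. X \<omega> \<omega>). iexp (\<Sum>i\<in>J. u i * x i)) =
   (CLINT \<omega>|M. iexp ((\<Sum>i\<in>I. u i * V i \<omega>) + u n * R \<omega>))"
   by (subst integral_distr) (auto simp: sumJ)
  also have "\<dots> = (CLINT \<omega>|M. iexp (\<Sum>i\<in>I. u i * V i \<omega>)) * (CLINT \<omega>|M. iexp (u n * R \<omega>))" by (rule eq)
  also have "\<dots> = (CLINT \<omega>|M \<Otimes>\<^sub>M M. iexp (\<Sum>i\<in>I. u i * V i (fst \<omega>)) * iexp (u n * R (snd \<omega>)))"
  proof -
   have "integrable (M \<Otimes>\<^sub>M M) (\<lambda>\<omega>. iexp (\<Sum>i\<in>I. u i * V i (fst \<omega>)) * iexp (u n * R (snd \<omega>)))"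
    by (rule MM.P.integrable_const_bound[of _ 1]) (auto simp: norm_mult)
   then have "(CLINT \<omega>|M \<Otimes>\<^sub>M M. iexp (\<Sum>i\<in>I. u i * V i (fst \<omega>)) * iexp (u n * R (snd \<omega>))) =
    (CLINT \<omega>|M. (CLINT \<omega>'|M. iexp (\<Sum>i\<in>I. u i * V i \<omega>) * iexp (u n * R \<omega>')))"
    using MM.integral_fst'[of "\<lambda>\<omega>. iexp (\<Sum>i\<in>I. u i * V i (fst \<omega>)) * iexp (u n * R (snd \<omega>))"] by simp
   then show ?thesis by simp
  qed
  also have "\<dots> = (CLINT x|distr (M \<Otimes>\<^sub>M M) (PiM J (\<lambda>_. borel)) (\<lambda>\<omega>. X (fst \<omega>) (snd \<omega>)). iexp (\<Sum>i\<in>J. u i * x i))"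
   by (subst integral_distr) (auto simp: sumJ distrib_left exp_add)
  finally show "(CLINT x|distr M (PiM J (\<lambda>_. borel)) (\<lambda>\<omega>. X \<omega> \<omega>). iexp (\<Sum>i\<in>J. u i * x i)) =
   (CLINT x|distr (M \<Otimes>\<^sub>M M) (PiM J (\<lambda>_. borel)) (\<lambda>\<omega>. X (fst \<omega>) (snd \<omega>)). iexp (\<Sum>i\<in>J. u i * x i))" .
 qed (use I in \<open>auto simp: J_def intro!: prob_space_distr MM.P.prob_space_distr X1[unfolded J_def] X2[unfolded J_def]\<close>)
 define A where "A = {x \<in> space (PiM J (\<lambda>_. borel :: real measure)). restrict x I \<in> S \<and> x n \<in> C}"
 have [measurable]: "n \<in> J" "(\<lambda>x. restrict x I) \<in> measurable (PiM J (\<lambda>_. borel)) (PiM I (\<lambda>_. borel :: real measure))"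
  unfolding J_def by (auto intro!: measurable_restrict_subset)
 have [measurable]: "A \<in> sets (PiM J (\<lambda>_. borel))" unfolding A_def by measurable
 have rX: "restrict (X \<omega> \<omega>') I = (\<lambda>i\<in>I. V i \<omega>)" "X \<omega> \<omega>' n = R \<omega>'" for \<omega> \<omega>'
  using I by (auto simp: X_def J_def restrict_def fun_eq_iff)
 have "prob {\<omega> \<in> space M. (\<lambda>i\<in>I. V i \<omega>) \<in> S \<and> R \<omega> \<in> C} = measure (distr M (PiM J (\<lambda>_. borel)) (\<lambda>\<omega>. X \<omega> \<omega>)) A"
  by (subst measure_distr) (use measurable_space[OF X1] in \<open>auto simp: A_def rX intro!: arg_cong[where f=prob]\<close>)
 also have "\<dots> = measure (M \<Otimes>\<^sub>M M) ({\<omega> \<in> space M. (\<lambda>i\<in>I. V i \<omega>) \<in> S} \<times> {\<omega> \<in> space M. R \<omega> \<in> C})"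
  unfolding meq
  by (subst measure_distr) (use measurable_space[OF X2] in \<open>auto simp: A_def rX space_pair_measure intro!: arg_cong[where f="measure _"]\<close>)
 also have "\<dots> = prob {\<omega> \<in> space M. (\<lambda>i\<in>I. V i \<omega>) \<in> S} * prob {\<omega> \<in> space M. R \<omega> \<in> C}"
 proof -
  have [measurable]: "(\<lambda>\<omega>. \<lambda>i\<in>I. V i \<omega>) \<in> measurable M (PiM I (\<lambda>_. borel))"
   by (rule measurable_restrict) auto
  show ?thesis by (simp add: measure_def emeasure_pair_measure_Times enn2real_mult)
 qed
 finally show ?thesis .
qed

lemma pair_law_unique:
 fixes X Y :: "'a => real" and X' Y' :: "'b => real"
 assumes "prob_space M" "prob_space N"
  and [measurable]: "X \<in> borel_measurable M" "Y \<in> borel_measurable M" "X' \<in> borel_measurable N" "Y' \<in> borel_measurable N"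
  and eq: "\<And>s t. (CLINT x|M. iexp (s * X x + t * Y x)) = (CLINT x|N. iexp (s * X' x + t * Y' x))"
 shows "distr M borel (\<lambda>x. (X x, Y x)) = distr N borel (\<lambda>x. (X' x, Y' x))"
proof -
 interpret M: prob_space M by fact
 interpret N: prob_space N by fact
 let ?P = "PiM (UNIV :: bool set) (\<lambda>_. borel :: real measure)"
 have [measurable]: "(\<lambda>x b. if b then X x else Y x) \<in> measurable M ?P"
  "(\<lambda>x b. if b then X' x else Y' x) \<in> measurable N ?P"
  by (auto intro!: measurable_PiM_single' simp: PiE_UNIV_domain)
 have "distr M ?P (\<lambda>x b. if b then X x else Y x) = distr N ?P (\<lambda>x b. if b then X' x else Y' x)"
 proof (rule multivariate_char_unique[of UNIV])
  fix u :: "bool => real"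
  have s: "(\<Sum>i\<in>UNIV. u i * x i) = u True * x True + u False * x False" for x by (simp add: UNIV_bool)
  show "(CLINT x|distr M ?P (\<lambda>x b. if b then X x else Y x). iexp (\<Sum>i\<in>UNIV. u i * x i)) =
   (CLINT x|distr N ?P (\<lambda>x b. if b then X' x else Y' x). iexp (\<Sum>i\<in>UNIV. u i * x i))"
   unfolding s by (subst integral_distr, simp, simp)+ (simp only: eq if_True if_False)
 qed (auto intro!: M.prob_space_distr N.prob_space_distr)
 then have "distr (distr M ?P (\<lambda>x b. if b then X x else Y x)) borel (\<lambda>x. (x True, x False)) =
   distr (distr N ?P (\<lambda>x b. if b then X' x else Y' x)) borel (\<lambda>x. (x True, x False))" by simp
 then show ?thesis by (simp add: distr_distr comp_def)
qed

section \<open>Standard Gaussian vectors and their linear forms\<close>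

abbreviation gauss :: "'i set => ('i => real) measure" where
 "gauss J \<equiv> PiM J (\<lambda>_. std_normal_distribution)"

lemma product_prob_space_gauss: "product_prob_space (\<lambda>_::'i. std_normal_distribution)"
 by (intro product_prob_spaceI prob_space_normal_density) simp

lemma prob_space_gauss: "prob_space (gauss J)"
 by (intro prob_space_PiM prob_space_normal_density) simp

lemma space_gauss: "space (gauss J) = (\<Pi>\<^sub>E i\<in>J. UNIV)"
 by (simp add: space_PiM)

lemma gauss_component: "i \<in> J ==> (\<lambda>w. w i) \<in> borel_measurable (gauss J)"
 by measurable

lemma char_gauss:
 assumes "finite J"
 shows "(CLINT w|gauss J. iexp (\<Sum>j\<in>J. c j * w j)) = exp (- (\<Sum>j\<in>J. (c j)\<^sup>2) / 2)"
proof -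
 interpret product_prob_space "\<lambda>_. std_normal_distribution" J by (rule product_prob_space_gauss)
 have "(CLINT w|gauss J. iexp (\<Sum>j\<in>J. c j * w j)) = (CLINT w|gauss J. (\<Prod>j\<in>J. iexp (c j * w j)))"
  using assms by (simp add: sum_distrib_left exp_sum)
 also have "\<dots> = (\<Prod>j\<in>J. (CLINT x|std_normal_distribution. iexp (c j * x)))"
  using assms
  by (intro product_integral_prod)
   (auto intro!: finite_measure.integrable_const_bound[OF prob_space.finite_measure[OF prob_space_normal_density], where B=1])
 also have "\<dots> = (\<Prod>j\<in>J. complex_of_real (exp (- (c j)\<^sup>2 / 2)))"
  using char_std_normal_distribution by (intro prod.cong refl) (simp add: char_def fun_eq_iff)
 also have "\<dots> = exp (- (\<Sum>j\<in>J. (c j)\<^sup>2) / 2)"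
  using assms by (simp add: exp_sum[symmetric] sum_negf sum_divide_distrib flip: of_real_prod)
 finally show ?thesis .
qed

lemma char_gauss_inj:
 assumes "finite J" "finite I" "inj_on e I" "e ` I \<subseteq> J"
 shows "(CLINT w|gauss J. iexp (\<Sum>i\<in>I. c i * w (e i))) = exp (- (\<Sum>i\<in>I. (c i)\<^sup>2) / 2)"
proof -
 define c' where "c' j = (if j \<in> e ` I then c (the_inv_into I e j) else 0)" for j
 have s: "(\<Sum>j\<in>J. g (c' j) j) = (\<Sum>i\<in>I. g (c i) (e i))" if "\<And>j. g 0 j = 0" for g :: "real => _ => real"
 proof -
  have "(\<Sum>j\<in>J. g (c' j) j) = (\<Sum>j\<in>e ` I. g (c' j) j)"
   using assms that by (intro sum.mono_neutral_right) (auto simp: c'_def)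
  also have "\<dots> = (\<Sum>i\<in>I. g (c i) (e i))"
   using assms by (subst sum.reindex) (auto simp: c'_def the_inv_into_f_f)
  finally show ?thesis .
 qed
 show ?thesis
  using char_gauss[OF assms(1), of c'] s[of "\<lambda>x j. x\<^sup>2"] s[of "\<lambda>x j. x * w j" for w] by simp
qed

text \<open>A Cholesky factor applied to two independent standard normals: for a covariance matrix
  with variances \<open>a\<close>, \<open>b\<close> and covariance \<open>c\<close> this is the
  centred Gaussian pair. For \<open>a = 0\<close> division by zero gives 0, which is right because
  then \<open>c = 0\<close>.\<close>

definition gpair :: "real => real => real => (bool => real) => real \<times> real" where
 "gpair a b c z = (sqrt a * z True, c / sqrt a * z True + sqrt (b - c\<^sup>2 / a) * z False)"

lemma gpair_measurable [measurable]: "gpair a b c \<in> borel_measurable (gauss UNIV)"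
 unfolding gpair_def by measurable

lemma law_linear_pair:
 fixes v v' :: "'i => real"
 assumes J: "finite J" "finite I" "inj_on e I" "e ` I \<subseteq> J"
 shows "distr (gauss J) borel (\<lambda>w. (\<Sum>i\<in>I. v i * w (e i), \<Sum>i\<in>I. v' i * w (e i))) =
  distr (gauss UNIV) borel (gpair (\<Sum>i\<in>I. (v i)\<^sup>2) (\<Sum>i\<in>I. (v' i)\<^sup>2) (\<Sum>i\<in>I. v i * v' i))"
proof -
 define a b c where "a = (\<Sum>i\<in>I. (v i)\<^sup>2)" and "b = (\<Sum>i\<in>I. (v' i)\<^sup>2)" and "c = (\<Sum>i\<in>I. v i * v' i)"
 have a0: "a \<ge> 0" unfolding a_def by (simp add: sum_nonneg)
 have cs: "c\<^sup>2 \<le> a * b" unfolding a_def b_def c_def by (rule Cauchy_Schwarz_ineq_sum)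
 have bc: "b - c\<^sup>2 / a \<ge> 0"
  using a0 cs by (cases "a = 0") (auto simp: b_def sum_nonneg field_simps)
 have ca: "c / sqrt a * sqrt a = c" using cs a0 by (cases "a = 0") auto
 have ca2: "(c / sqrt a)\<^sup>2 = c\<^sup>2 / a" using a0 by (simp add: power_divide)
 have lin: "(\<lambda>w. \<Sum>i\<in>I. f i * w (e i)) \<in> borel_measurable (gauss J)" for f :: "'i => real"
  using J by (intro borel_measurable_sum borel_measurable_times gauss_component) auto
 have "distr (gauss J) borel (\<lambda>w. (\<Sum>i\<in>I. v i * w (e i), \<Sum>i\<in>I. v' i * w (e i))) =
  distr (gauss UNIV) borel (\<lambda>z::bool=>real. (sqrt a * z True, c / sqrt a * z True + sqrt (b - c\<^sup>2 / a) * z False))"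
 proof (rule pair_law_unique[OF prob_space_gauss prob_space_gauss])
  fix s t :: real
  have "(CLINT w|gauss J. iexp (s * (\<Sum>i\<in>I. v i * w (e i)) + t * (\<Sum>i\<in>I. v' i * w (e i)))) =
    (CLINT w|gauss J. iexp (\<Sum>i\<in>I. (s * v i + t * v' i) * w (e i)))"
   by (simp add: sum_distrib_left sum.distrib algebra_simps)
  also have "\<dots> = exp (- (\<Sum>i\<in>I. (s * v i + t * v' i)\<^sup>2) / 2)" by (rule char_gauss_inj[OF J])
  also have "(\<Sum>i\<in>I. (s * v i + t * v' i)\<^sup>2) = s\<^sup>2 * a + 2 * s * t * c + t\<^sup>2 * b"
   unfolding a_def b_def c_def by (simp add: power2_sum power_mult_distrib sum.distrib sum_distrib_left algebra_simps)
  also have "\<dots> = (\<Sum>x\<in>(UNIV::bool set). (if x then s * sqrt a + t * (c / sqrt a) else t * sqrt (b - c\<^sup>2 / a))\<^sup>2)"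
  proof -
   have "(s * sqrt a + t * (c / sqrt a))\<^sup>2 = s\<^sup>2 * (sqrt a)\<^sup>2 + 2 * s * t * (c / sqrt a * sqrt a) + t\<^sup>2 * (c / sqrt a)\<^sup>2"
    by (simp only: power2_eq_square) (simp add: algebra_simps)
   also have "\<dots> = s\<^sup>2 * a + 2 * s * t * c + t\<^sup>2 * (c\<^sup>2 / a)" unfolding ca ca2 using a0 by simp
   finally show ?thesis using bc by (simp add: UNIV_bool power_mult_distrib algebra_simps)
  qed
  also have "complex_of_real (exp (- \<dots> / 2)) = (CLINT z|gauss UNIV. iexp (\<Sum>x\<in>(UNIV::bool set). (if x then s * sqrt a + t * (c / sqrt a) else t * sqrt (b - c\<^sup>2 / a)) * z x))"
   by (subst char_gauss) auto
  also have "\<dots> = (CLINT z|gauss UNIV. iexp (s * (sqrt a * z True) + t * (c / sqrt a * z True + sqrt (b - c\<^sup>2 / a) * z False)))"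
   by (simp add: UNIV_bool algebra_simps)
  finally show "(CLINT w|gauss J. iexp (s * (\<Sum>i\<in>I. v i * w (e i)) + t * (\<Sum>i\<in>I. v' i * w (e i)))) =
   (CLINT z|gauss UNIV. iexp (s * (sqrt a * z True) + t * (c / sqrt a * z True + sqrt (b - c\<^sup>2 / a) * z False)))" .
 next
  show "(\<lambda>z. sqrt a * z True) \<in> borel_measurable (gauss (UNIV :: bool set))"
   "(\<lambda>z. c / sqrt a * z True + sqrt (b - c\<^sup>2 / a) * z False) \<in> borel_measurable (gauss (UNIV :: bool set))"
   by (intro borel_measurable_add borel_measurable_times borel_measurable_const gauss_component UNIV_I)+
 qed (rule lin)+
 then show ?thesis unfolding a_def b_def c_def gpair_def[abs_def] .
qed

section \<open>Moments of products of Gaussian coordinates\<close>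

definition gmom :: "nat => real" where "gmom k = (\<integral>x. x ^ k \<partial>std_normal_distribution)"

lemma gmom_simps [simp]: "gmom 0 = 1" "gmom (Suc 0) = 0" "gmom 2 = 1" "gmom 3 = 0" "gmom 4 = 3"
 using std_normal_distribution_even_moments(1)[of 0] std_normal_distribution_even_moments(1)[of 1]
  std_normal_distribution_even_moments(1)[of 2] integral_std_normal_distribution_moment_odd[of 1] integral_std_normal_distribution_moment_odd[of 3]
 by (auto simp: gmom_def fact_numeral)

lemma gmom_Suc [simp]: "gmom (Suc (Suc 0)) = 1" "gmom (Suc (Suc (Suc 0))) = 0" "gmom (Suc (Suc (Suc (Suc 0)))) = 3"
 using gmom_simps(3-5) by (simp_all only: eval_nat_numeral BitM.simps One_nat_def)

lemma gauss_monomial: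
 assumes "finite J"
 shows "integrable (gauss J) (\<lambda>w. \<Prod>j\<in>J. w j ^ n j)" "(\<integral>w. (\<Prod>j\<in>J. w j ^ n j) \<partial>gauss J) = (\<Prod>j\<in>J. gmom (n j))"
proof -
 interpret product_prob_space "\<lambda>_. std_normal_distribution" J by (rule product_prob_space_gauss)
 show "integrable (gauss J) (\<lambda>w. \<Prod>j\<in>J. w j ^ n j)"
  using assms by (intro product_integrable_prod integrable_std_normal_distribution_moment)
 show "(\<integral>w. (\<Prod>j\<in>J. w j ^ n j) \<partial>gauss J) = (\<Prod>j\<in>J. gmom (n j))"
  unfolding gmom_def using assms by (intro product_integral_prod integrable_std_normal_distribution_moment)
qed

text \<open>Wick's formula. The product is rewritten as a monomial with exponents
  \<open>n j\<close>, which factors over the coordinates; the three pairings appear by comparing the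
  four indices.\<close>

lemma gauss_mom4:
 assumes J: "finite J" and "p \<in> J" "q \<in> J" "r \<in> J" "s \<in> J"
 shows "integrable (gauss J) (\<lambda>w. w p * w q * w r * w s)"
  and "(\<integral>w. w p * w q * w r * w s \<partial>gauss J) =
   of_bool (p = q) * of_bool (r = s) + of_bool (p = r) * of_bool (q = s) + of_bool (p = s) * of_bool (q = r)"
proof -
 define n :: "'a => nat" where "n j = of_bool (j = p) + of_bool (j = q) + of_bool (j = r) + of_bool (j = s)" for j
 have 1: "(\<Prod>j\<in>J. w j ^ of_bool (j = x)) = w x" if "x \<in> J" for w :: "'a => real" and x
 proof -
  have "(\<Prod>j\<in>J. w j ^ of_bool (j = x)) = (\<Prod>j\<in>J. if j = x then w j else 1)" by (intro prod.cong) auto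
  then show ?thesis using J that by simp
 qed
 have m: "(\<Prod>j\<in>J. w j ^ n j) = w p * w q * w r * w s" for w :: "'a => real"
  unfolding n_def power_add prod.distrib using assms by (simp add: 1)
 show "integrable (gauss J) (\<lambda>w. w p * w q * w r * w s)" using gauss_monomial(1)[OF J, of n] unfolding m .
 have "(\<Prod>j\<in>J. gmom (n j)) = (\<Prod>j\<in>{p,q,r,s}. gmom (n j))"
  using assms by (intro prod.mono_neutral_right) (auto simp: n_def)
 also have "\<dots> = of_bool (p = q) * of_bool (r = s) + of_bool (p = r) * of_bool (q = s) + of_bool (p = s) * of_bool (q = r)"
  by (cases "p = q"; cases "p = r"; cases "p = s"; cases "q = r"; cases "q = s"; cases "r = s")
   (simp_all add: n_def insert_commute)
 finally show "(\<integral>w. w p * w q * w r * w s \<partial>gauss J) =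
   of_bool (p = q) * of_bool (r = s) + of_bool (p = r) * of_bool (q = s) + of_bool (p = s) * of_bool (q = r)"
  using gauss_monomial(2)[OF J, of n] unfolding m by simp
qed

lemma gauss_mom2:
 assumes J: "finite J" and "p \<in> J" "q \<in> J"
 shows "integrable (gauss J) (\<lambda>w. w p * w q)"
  and "(\<integral>w. w p * w q \<partial>gauss J) = of_bool (p = q)"
proof -
 define n :: "'a => nat" where "n j = of_bool (j = p) + of_bool (j = q)" for j
 have 1: "(\<Prod>j\<in>J. w j ^ of_bool (j = x)) = w x" if "x \<in> J" for w :: "'a => real" and x
 proof -
  have "(\<Prod>j\<in>J. w j ^ of_bool (j = x)) = (\<Prod>j\<in>J. if j = x then w j else 1)" by (intro prod.cong) auto
  then show ?thesis using J that by simp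
 qed
 have m: "(\<Prod>j\<in>J. w j ^ n j) = w p * w q" for w :: "'a => real"
  unfolding n_def power_add prod.distrib using assms by (simp add: 1)
 show "integrable (gauss J) (\<lambda>w. w p * w q)" using gauss_monomial(1)[OF J, of n] unfolding m .
 have "(\<Prod>j\<in>J. gmom (n j)) = (\<Prod>j\<in>{p,q}. gmom (n j))"
  using assms by (intro prod.mono_neutral_right) (auto simp: n_def)
 also have "\<dots> = of_bool (p = q)"
  by (cases "p = q") (simp_all add: n_def)
 finally show "(\<integral>w. w p * w q \<partial>gauss J) = of_bool (p = q)"
  using gauss_monomial(2)[OF J, of n] unfolding m by simp
qed

text \<open>For bilinear forms in two rows of a weight matrix, possibly the same row. By Wick's
  formula the centred products have covariance identity plus \<open>ch\<close>, where
  \<open>ch\<close> matches a pair of positions with its transposed pair. Each row and each column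
  of \<open>ch\<close> contains at most one entry 1, so it contributes at most another copy of the
  sum of squares; hence the factor 2.\<close>

lemma gauss_quadratic_form:
 fixes u v :: "nat => 'i"
 assumes J: "finite J" and u: "inj_on u {..<n}" "u ` {..<n} \<subseteq> J" and v: "inj_on v {..<n}" "v ` {..<n} \<subseteq> J"
 shows "integrable (gauss J) (\<lambda>w. (\<Sum>i<n. \<Sum>j<n. C i j * (w (u i) * w (v j) - of_bool (u i = v j)))\<^sup>2)" (is ?A)
  and "(\<integral>w. (\<Sum>i<n. \<Sum>j<n. C i j * (w (u i) * w (v j) - of_bool (u i = v j)))\<^sup>2 \<partial>gauss J) \<le> 2 * (\<Sum>i<n. \<Sum>j<n. (C i j)\<^sup>2)" (is ?B)
proof -
 interpret P: prob_space "gauss J" by (rule prob_space_gauss)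
 let ?D = "{..<n} \<times> {..<n}"
 define Z where "Z e w = w (u (fst e)) * w (v (snd e)) - of_bool (u (fst e) = v (snd e))" for e and w :: "'i => real"
 define c where "c e = C (fst e) (snd e)" for e
 have S: "(\<Sum>i<n. \<Sum>j<n. C i j * (w (u i) * w (v j) - of_bool (u i = v j))) = (\<Sum>e\<in>?D. c e * Z e w)" for w
  by (simp add: sum.cartesian_product Z_def c_def case_prod_beta)
 have S2: "(\<Sum>i<n. \<Sum>j<n. (C i j)\<^sup>2) = (\<Sum>e\<in>?D. (c e)\<^sup>2)"
  by (simp add: sum.cartesian_product c_def case_prod_beta)
 have sq: "(\<Sum>e\<in>?D. c e * Z e w)\<^sup>2 = (\<Sum>e\<in>?D. \<Sum>e'\<in>?D. c e * c e' * (Z e w * Z e' w))" for w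
  by (simp add: power2_eq_square sum_product mult_ac)
 have Zexp: "Z e w * Z e' w = w (u (fst e)) * w (v (snd e)) * w (u (fst e')) * w (v (snd e'))
  - of_bool (u (fst e') = v (snd e')) * (w (u (fst e)) * w (v (snd e))) - of_bool (u (fst e) = v (snd e)) * (w (u (fst e')) * w (v (snd e')))
  + of_bool (u (fst e) = v (snd e)) * of_bool (u (fst e') = v (snd e'))" for e e' w
  by (simp add: Z_def algebra_simps)
 have mem: "u (fst e) \<in> J" "v (snd e) \<in> J" if "e \<in> ?D" for e using that u v by auto
 have Zi: "integrable (gauss J) (\<lambda>w. Z e w * Z e' w)"
  and Ze: "(\<integral>w. Z e w * Z e' w \<partial>gauss J) = of_bool (e = e') + of_bool (u (fst e) = v (snd e')) * of_bool (v (snd e) = u (fst e'))"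
  if e: "e \<in> ?D" "e' \<in> ?D" for e e'
 proof -
  note m = mem[OF e(1)] mem[OF e(2)]
  note g4 = gauss_mom4[OF J m] and g2 = gauss_mom2[OF J m(1,2)] and g2' = gauss_mom2[OF J m(3,4)]
  show "integrable (gauss J) (\<lambda>w. Z e w * Z e' w)" unfolding Zexp
   by (intro Bochner_Integration.integrable_add Bochner_Integration.integrable_diff integrable_mult_right g4(1) g2(1) g2'(1)) simp
  have ee: "(e = e') = (u (fst e) = u (fst e') \<and> v (snd e) = v (snd e'))"
   using e inj_onD[OF u(1)] inj_onD[OF v(1)] by (auto simp: prod_eq_iff)
  have "(\<integral>w. Z e w * Z e' w \<partial>gauss J) = (\<integral>w. w (u (fst e)) * w (v (snd e)) * w (u (fst e')) * w (v (snd e')) \<partial>gauss J)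
    - of_bool (u (fst e') = v (snd e')) * (\<integral>w. w (u (fst e)) * w (v (snd e)) \<partial>gauss J)
    - of_bool (u (fst e) = v (snd e)) * (\<integral>w. w (u (fst e')) * w (v (snd e')) \<partial>gauss J)
    + of_bool (u (fst e) = v (snd e)) * of_bool (u (fst e') = v (snd e'))"
  proof -
   have "(\<integral>w. w (u (fst e)) * w (v (snd e)) * w (u (fst e')) * w (v (snd e')) - b' * (w (u (fst e)) * w (v (snd e)))
     - b * (w (u (fst e')) * w (v (snd e'))) + b * b' \<partial>gauss J) =
    (\<integral>w. w (u (fst e)) * w (v (snd e)) * w (u (fst e')) * w (v (snd e')) \<partial>gauss J)
    - b' * (\<integral>w. w (u (fst e)) * w (v (snd e)) \<partial>gauss J) - b * (\<integral>w. w (u (fst e')) * w (v (snd e')) \<partial>gauss J) + b * b'" for b b' :: real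
    using g4(1) g2(1) g2'(1) by (simp add: P.prob_space)
   then show ?thesis unfolding Zexp .
  qed
  also have "\<dots> = of_bool (e = e') + of_bool (u (fst e) = v (snd e')) * of_bool (v (snd e) = u (fst e'))"
   unfolding g4(2) g2(2) g2'(2) ee by auto
  finally show "(\<integral>w. Z e w * Z e' w \<partial>gauss J) = of_bool (e = e') + of_bool (u (fst e) = v (snd e')) * of_bool (v (snd e) = u (fst e'))" .
 qed
 show ?A unfolding S sq by (intro Bochner_Integration.integrable_sum integrable_mult_right Zi)
 define ch :: "nat \<times> nat => nat \<times> nat => real" where "ch e e' = of_bool (u (fst e) = v (snd e')) * of_bool (v (snd e) = u (fst e'))" for e e'
 have chi1: "(\<Sum>e'\<in>?D. ch e e') \<le> 1" if "e \<in> ?D" for e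
 proof -
  let ?F = "{e' \<in> ?D. u (fst e) = v (snd e') \<and> v (snd e) = u (fst e')}"
  have "(\<Sum>e'\<in>?D. ch e e') = (\<Sum>e'\<in>?D. of_bool (u (fst e) = v (snd e') \<and> v (snd e) = u (fst e')))"
   unfolding ch_def by (intro sum.cong) auto
  also have "\<dots> = real (card ?F)" by (simp add: Int_def)
  also have "card ?F \<le> 1"
  proof -
   have "\<forall>x\<in>?F. \<forall>y\<in>?F. x = y" using inj_onD[OF u(1)] inj_onD[OF v(1)] by (auto simp: prod_eq_iff)
   then show ?thesis by (subst card_le_Suc0_iff_eq[unfolded One_nat_def[symmetric]]) auto
  qed
  finally show ?thesis by simp
 qed
 have chi2: "(\<Sum>e\<in>?D. ch e e') \<le> 1" if "e' \<in> ?D" for e'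
 proof -
  let ?F = "{e \<in> ?D. u (fst e) = v (snd e') \<and> v (snd e) = u (fst e')}"
  have "(\<Sum>e\<in>?D. ch e e') = (\<Sum>e\<in>?D. of_bool (u (fst e) = v (snd e') \<and> v (snd e) = u (fst e')))"
   unfolding ch_def by (intro sum.cong) auto
  also have "\<dots> = real (card ?F)" by (simp add: Int_def)
  also have "card ?F \<le> 1"
  proof -
   have "\<forall>x\<in>?F. \<forall>y\<in>?F. x = y" using inj_onD[OF u(1)] inj_onD[OF v(1)] by (auto simp: prod_eq_iff)
   then show ?thesis by (subst card_le_Suc0_iff_eq[unfolded One_nat_def[symmetric]]) auto
  qed
  finally show ?thesis by simp
 qed
 have "(\<integral>w. (\<Sum>e\<in>?D. c e * Z e w)\<^sup>2 \<partial>gauss J) = (\<Sum>e\<in>?D. \<Sum>e'\<in>?D. c e * c e' * (of_bool (e = e') + ch e e'))"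
  unfolding sq ch_def
  by (simp add: Zi Ze Bochner_Integration.integral_sum Bochner_Integration.integrable_sum cong: sum.cong)
 also have "\<dots> = (\<Sum>e\<in>?D. (c e)\<^sup>2) + (\<Sum>e\<in>?D. \<Sum>e'\<in>?D. c e * c e' * ch e e')"
  by (simp add: distrib_left sum.distrib of_bool_def if_distrib[of "\<lambda>x. _ * x"] sum.delta power2_eq_square cong: if_cong)
 also have "(\<Sum>e\<in>?D. \<Sum>e'\<in>?D. c e * c e' * ch e e') \<le> (\<Sum>e\<in>?D. \<Sum>e'\<in>?D. ((c e)\<^sup>2 / 2 + (c e')\<^sup>2 / 2) * ch e e')"
 proof (intro sum_mono mult_right_mono)
  show "c e * c e' \<le> (c e)\<^sup>2 / 2 + (c e')\<^sup>2 / 2" for e e'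
   using sum_squares_bound[of "c e" "c e'"] by simp
  show "0 \<le> ch e e'" for e e' by (simp add: ch_def)
 qed
 also have "\<dots> = (\<Sum>e\<in>?D. (c e)\<^sup>2 / 2 * (\<Sum>e'\<in>?D. ch e e')) + (\<Sum>e'\<in>?D. (c e')\<^sup>2 / 2 * (\<Sum>e\<in>?D. ch e e'))"
  unfolding distrib_right sum.distrib sum_distrib_left by (subst sum.swap[of _ ?D ?D]) (rule refl)
 also have "\<dots> \<le> (\<Sum>e\<in>?D. (c e)\<^sup>2 / 2 * 1) + (\<Sum>e\<in>?D. (c e)\<^sup>2 / 2 * 1)"
  by (intro add_mono sum_mono mult_left_mono chi1 chi2) auto
 finally show ?B unfolding S S2 by (simp add: sum_divide_distrib[symmetric])
qed

lemma (in prob_space) second_moment_indep_sum: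
 fixes Y :: "nat => 'a => real"
 assumes ind: "indep_vars (\<lambda>_. borel) Y {..<r}"
  and int: "\<And>k. k < r ==> integrable M (\<lambda>\<omega>. (Y k \<omega>)\<^sup>2)" and mean: "\<And>k. k < r ==> expectation (Y k) = 0"
  and V: "\<And>k. k < r ==> expectation (\<lambda>\<omega>. (Y k \<omega>)\<^sup>2) \<le> V"
 shows "integrable M (\<lambda>\<omega>. (\<Sum>k<r. Y k \<omega>)\<^sup>2)" "expectation (\<lambda>\<omega>. (\<Sum>k<r. Y k \<omega>)\<^sup>2) \<le> real r * V"
proof -
 have rv: "Y k \<in> borel_measurable M" if "k < r" for k
  using ind that unfolding indep_vars_def by blast
 have i1: "integrable M (Y k)" if "k < r" for k
  by (rule square_integrable_imp_integrable[OF rv[OF that] int[OF that]])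
 have sq: "(\<Sum>k<r. Y k \<omega>)\<^sup>2 = (\<Sum>k<r. \<Sum>l<r. Y k \<omega> * Y l \<omega>)" for \<omega>
  by (simp add: power2_eq_square sum_product)
 have *: "integrable M (\<lambda>\<omega>. Y k \<omega> * Y l \<omega>) \<and> expectation (\<lambda>\<omega>. Y k \<omega> * Y l \<omega>) \<le> (if k = l then V else 0)" if "k < r" "l < r" for k l
 proof (cases "k = l")
  case True
  then show ?thesis using int[OF that(1)] V[OF that(1)] by (simp add: power2_eq_square)
 next
  case False
  have "indep_var borel ((\<lambda>f. f k) \<circ> (\<lambda>\<omega>. restrict (\<lambda>i. Y i \<omega>) {k})) borel ((\<lambda>f. f l) \<circ> (\<lambda>\<omega>. restrict (\<lambda>i. Y i \<omega>) {l}))"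
   by (rule indep_var_compose[OF indep_var_restrict[OF ind]]) (use that False in auto)
  then have "indep_var borel (Y k) borel (Y l)" by (simp add: comp_def)
  from indep_var_integrable[OF this i1 i1] indep_var_lebesgue_integral[OF this i1 i1] that mean False
  show ?thesis by simp
 qed
 show "integrable M (\<lambda>\<omega>. (\<Sum>k<r. Y k \<omega>)\<^sup>2)" unfolding sq using * by (intro Bochner_Integration.integrable_sum) auto
 have i: "integrable M (\<lambda>\<omega>. Y k \<omega> * Y l \<omega>)" if "k < r" "l < r" for k l using *[OF that] by blast
 have "expectation (\<lambda>\<omega>. (\<Sum>k<r. Y k \<omega>)\<^sup>2) = (\<Sum>k<r. expectation (\<lambda>\<omega>. \<Sum>l<r. Y k \<omega> * Y l \<omega>))"
  unfolding sq by (rule Bochner_Integration.integral_sum) (use i in \<open>auto intro!: Bochner_Integration.integrable_sum\<close>)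
 also have "\<dots> = (\<Sum>k<r. \<Sum>l<r. expectation (\<lambda>\<omega>. Y k \<omega> * Y l \<omega>))"
  by (intro sum.cong refl Bochner_Integration.integral_sum) (use i in auto)
 also have "\<dots> \<le> (\<Sum>k<r. \<Sum>l<r. if k = l then V else 0)" using * by (intro sum_mono) auto
 also have "\<dots> = real r * V" by simp
 finally show "expectation (\<lambda>\<omega>. (\<Sum>k<r. Y k \<omega>)\<^sup>2) \<le> real r * V" .
qed

text \<open>Given the inputs \<open>v\<close> and \<open>v'\<close> of a layer, its units are
  independent, and the preactivations of a unit at the two inputs form the pair
  \<open>gpair\<close>. So the variance of an average over \<open>r\<close> units is at most the
  second moment divided by \<open>r\<close>. The bound is a nonnegative integral because it will
  serve as a bound on a conditional expectation.\<close>

lemma gauss_rows_lln: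
 fixes v v' :: "nat => real" and f :: "real \<times> real => real" and e :: "nat => nat => 'i"
 assumes J: "finite J" and e: "inj_on (\<lambda>(k, j). e k j) ({..<r} \<times> {..<c})" "\<And>k j. k < r ==> j < c ==> e k j \<in> J"
  and [measurable]: "f \<in> borel_measurable borel"
 defines "g \<equiv> gpair (\<Sum>j<c. (v j)\<^sup>2) (\<Sum>j<c. (v' j)\<^sup>2) (\<Sum>j<c. v j * v' j)"
 assumes f2: "integrable (gauss UNIV) (\<lambda>z. (f (g z))\<^sup>2)" and r: "r > 0"
 shows "(\<integral>\<^sup>+w. ennreal (((\<Sum>k<r. f (\<Sum>j<c. v j * w (e k j), \<Sum>j<c. v' j * w (e k j))) / r - (\<integral>z. f (g z) \<partial>gauss UNIV))\<^sup>2) \<partial>gauss J)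
  \<le> ennreal ((\<integral>z. (f (g z))\<^sup>2 \<partial>gauss UNIV) / r)"
proof -
 interpret P: product_prob_space "\<lambda>_. std_normal_distribution" J by (rule product_prob_space_gauss)
 interpret G: prob_space "gauss (UNIV::bool set)" by (rule prob_space_gauss)
 have g[measurable]: "g \<in> borel_measurable (gauss UNIV)" unfolding g_def by simp
 define \<mu> where "\<mu> = (\<integral>z. f (g z) \<partial>gauss UNIV)"
 define X where "X k w = (\<Sum>j<c. v j * w (e k j), \<Sum>j<c. v' j * w (e k j))" for k and w :: "'i => real"
 define Y where "Y k w = f (X k w) - \<mu>" for k w
 have f1: "integrable (gauss UNIV) (\<lambda>z. f (g z))"
  by (rule G.square_integrable_imp_integrable[OF _ f2]) measurable
 have inj: "inj_on (e k) {..<c}" if "k < r" for k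
  using e(1) that by (auto simp: inj_on_def)
 have lin[measurable]: "(\<lambda>w. \<Sum>j<c. x j * w (e k j)) \<in> borel_measurable (gauss J)" if "k < r" for k and x :: "nat => real"
  using e(2) that by (intro borel_measurable_sum borel_measurable_times gauss_component) auto
 have X[measurable]: "X k \<in> borel_measurable (gauss J)" if "k < r" for k
  using lin that unfolding X_def[abs_def] by (intro borel_measurable_Pair) auto
 have law: "distr (gauss J) borel (X k) = distr (gauss UNIV) borel g" if "k < r" for k
  unfolding X_def[abs_def] g_def using inj e(2) that J by (intro law_linear_pair) auto
 have tr: "integrable (gauss J) (\<lambda>w. h (X k w)) = integrable (gauss UNIV) (\<lambda>z. h (g z))"
  "(\<integral>w. h (X k w) \<partial>gauss J) = (\<integral>z. h (g z) \<partial>gauss UNIV)"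
  if "k < r" and [measurable]: "h \<in> borel_measurable borel" for k and h :: "real \<times> real => real"
  using integral_distr[OF X[OF that(1)], of h] integral_distr[OF g, of h] integrable_distr_eq[OF X[OF that(1)], of h] integrable_distr_eq[OF g, of h] law[OF that(1)]
  by auto
 have i2: "integrable (gauss UNIV) (\<lambda>z. (f (g z) - \<mu>)\<^sup>2)"
  using f1 f2 by (simp add: power2_diff)
 have Ymean: "(\<integral>w. Y k w \<partial>gauss J) = 0" if "k < r" for k
  unfolding Y_def using tr(2)[OF that, of "\<lambda>p. f p - \<mu>"] f1 by (simp add: \<mu>_def G.prob_space)
 have Y2: "integrable (gauss J) (\<lambda>w. (Y k w)\<^sup>2)" "(\<integral>w. (Y k w)\<^sup>2 \<partial>gauss J) \<le> (\<integral>z. (f (g z))\<^sup>2 \<partial>gauss UNIV)" if "k < r" for k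
 proof -
  show "integrable (gauss J) (\<lambda>w. (Y k w)\<^sup>2)"
   unfolding Y_def using tr(1)[OF that, of "\<lambda>p. (f p - \<mu>)\<^sup>2"] i2 by simp
  have "(\<integral>w. (Y k w)\<^sup>2 \<partial>gauss J) = (\<integral>z. (f (g z) - \<mu>)\<^sup>2 \<partial>gauss UNIV)"
   unfolding Y_def using tr(2)[OF that, of "\<lambda>p. (f p - \<mu>)\<^sup>2"] by simp
  also have "\<dots> = (\<integral>z. (f (g z))\<^sup>2 \<partial>gauss UNIV) - \<mu>\<^sup>2"
   unfolding \<mu>_def using f1 f2 by (rule G.variance_eq)
  finally show "(\<integral>w. (Y k w)\<^sup>2 \<partial>gauss J) \<le> (\<integral>z. (f (g z))\<^sup>2 \<partial>gauss UNIV)" by simp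
 qed
 define K where "K k = e k ` {..<c}" for k
 have coord: "P.indep_vars (\<lambda>_. std_normal_distribution) (\<lambda>i w. w i) J"
 proof (cases "J = {}")
  case True then show ?thesis unfolding P.indep_vars_def P.indep_sets_def by simp
 next
  case False
  have "distr (gauss J) (gauss J) (\<lambda>w. restrict w J) = gauss J"
   by (subst distr_cong[OF refl refl, of _ _ "\<lambda>w. w"]) (auto simp: space_PiM distr_id2)
  moreover have "(\<Pi>\<^sub>M i\<in>J. distr (gauss J) std_normal_distribution (\<lambda>w. w i)) = gauss J"
   by (intro PiM_cong refl P.PiM_component)
  ultimately show ?thesis
   using False by (subst P.indep_vars_iff_distr_eq_PiM') (simp_all add: gauss_component)
 qed
 \<comment> \<open>Disjoint groups of independent coordinates are independent; \<open>K k\<close>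
   holds the coordinates of row \<open>k\<close>.\<close>
 have "P.indep_vars (\<lambda>k. PiM (K k) (\<lambda>_. std_normal_distribution)) (\<lambda>k w. restrict (\<lambda>i. w i) (K k)) {..<r}"
 proof (rule P.indep_vars_restrict[OF coord])
  show "K j \<subseteq> J" if "j \<in> {..<r}" for j using e(2) that by (auto simp: K_def)
  show "disjoint_family_on K {..<r}"
   using e(1) by (fastforce simp: disjoint_family_on_def K_def inj_on_def)
 qed
 then have "P.indep_vars (\<lambda>_. borel) (\<lambda>k w. Y k (restrict (\<lambda>i. w i) (K k))) {..<r}"
 proof (rule P.indep_vars_compose2)
  fix k assume "k \<in> {..<r}"
  show "Y k \<in> borel_measurable (PiM (K k) (\<lambda>_. std_normal_distribution))"
  proof -
   have "(\<lambda>w. \<Sum>j<c. x j * w (e k j)) \<in> borel_measurable (gauss (K k))" for x :: "nat => real"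
    by (intro borel_measurable_sum borel_measurable_times gauss_component) (auto simp: K_def)
   then have "X k \<in> borel_measurable (gauss (K k))"
    unfolding X_def[abs_def] by (intro borel_measurable_Pair) auto
   then show ?thesis unfolding Y_def by measurable
  qed
 qed
 then have ind: "P.indep_vars (\<lambda>_. borel) Y {..<r}"
  by (rule P.indep_vars_cong[THEN iffD1, rotated -1]) (auto simp: Y_def X_def K_def fun_eq_iff)
 note sm = P.second_moment_indep_sum[OF ind Y2(1) Ymean Y2(2)]
 have eq: "((\<Sum>k<r. f (X k w)) / r - \<mu>)\<^sup>2 = (\<Sum>k<r. Y k w)\<^sup>2 / (real r)\<^sup>2" for w
  using r by (simp add: Y_def sum_subtractf power_divide[symmetric] diff_divide_distrib)
 have "(\<integral>\<^sup>+w. ennreal (((\<Sum>k<r. f (X k w)) / r - \<mu>)\<^sup>2) \<partial>gauss J) = ennreal (\<integral>w. (\<Sum>k<r. Y k w)\<^sup>2 / (real r)\<^sup>2 \<partial>gauss J)"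
  unfolding eq using sm(1) by (intro nn_integral_eq_integral) auto
 also have "\<dots> \<le> ennreal (real r * (\<integral>z. (f (g z))\<^sup>2 \<partial>gauss UNIV) / (real r)\<^sup>2)"
  using sm(2) by (intro ennreal_leI) (simp add: divide_right_mono)
 also have "real r * (\<integral>z. (f (g z))\<^sup>2 \<partial>gauss UNIV) / (real r)\<^sup>2 = (\<integral>z. (f (g z))\<^sup>2 \<partial>gauss UNIV) / r"
  using r by (simp add: power2_eq_square)
 finally show ?thesis unfolding X_def \<mu>_def .
qed

section \<open>The gradient of the network\<close>

text \<open>The value 0 at the origin is what the chain rule requires when a preactivation vanishes
  in a whole neighbourhood.\<close>

definition heaviside :: "real => real" where "heaviside u = of_bool (u > 0)"

text \<open>The factor \<open>sqrt (2 / real m)\<close> is attached to the inputs of a layer and not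
  to its outputs. Preactivations are then plain linear forms in the weights of their own layer, and
  their conditional covariances are the entries of \<open>gram\<close>.\<close>

fun inp :: "nat => nat => (nat \<times> nat \<times> nat => real) => real vec => nat => nat => real" where
 "inp d m W x 0 j = 0"
| "inp d m W x (Suc 0) j = vec_index x j"
| "inp d m W x (Suc (Suc l)) j =
  sqrt (2 / real m) * relu (\<Sum>i<layer_cols d m (Suc l). W (Suc l, j, i) * inp d m W x (Suc l) i)"

definition pre :: "nat => nat => (nat \<times> nat \<times> nat => real) => real vec => nat => nat => real" where
 "pre d m W x l i = (\<Sum>j<layer_cols d m l. W (l, i, j) * inp d m W x l j)"

definition gram :: "nat => nat => (nat \<times> nat \<times> nat => real) => real vec => real vec => nat => real" where
 "gram d m W x x' l = (\<Sum>j<layer_cols d m l. inp d m W x l j * inp d m W x' l j)"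

text \<open>Partial derivatives computed formally by the chain rule. They are defined for all
  parameters, and so is everything built from them; the link with the actual gradient is made at
  parameters that satisfy \<open>regular_at\<close>.\<close>

fun pre_grad :: "nat => nat => (nat \<times> nat \<times> nat => real) => real vec => nat => nat => nat \<times> nat \<times> nat => real" where
 "pre_grad d m W x 0 i p = 0"
| "pre_grad d m W x (Suc l) i p =
  (\<Sum>j<layer_cols d m (Suc l). of_bool (p = (Suc l, i, j)) * inp d m W x (Suc l) j) +
  sqrt (2 / real m) * (\<Sum>j<m. W (Suc l, i, j) * (heaviside (pre d m W x l j) * pre_grad d m W x l j p))"

text \<open>A finite-width tangent kernel for the preactivations \<open>k\<close> and
  \<open>k'\<close> of layer \<open>l\<close>, summed over the parameters of the layers up to
  \<open>l\<close>. As a recursion it shows the weights of the newest layer explicitly, in a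
  quadratic form whose coefficients depend on the lower layers only.\<close>

fun tangent :: "nat => nat => (nat \<times> nat \<times> nat => real) => real vec => real vec => nat => nat => nat => real" where
 "tangent d m W x x' 0 k k' = 0"
| "tangent d m W x x' (Suc l) k k' =
  of_bool (k = k') * gram d m W x x' (Suc l) +
  2 / real m * (\<Sum>i<m. \<Sum>j<m. heaviside (pre d m W x l i) * heaviside (pre d m W x' l j) *
    tangent d m W x x' l i j * (W (Suc l, k, i) * W (Suc l, k', j)))"

lemma inp_Suc: "l \<ge> 1 ==> inp d m W x (Suc l) j = sqrt (2 / real m) * relu (pre d m W x l j)"
 by (cases l) (auto simp: pre_def)

lemma hidden_eq_pre:
 assumes x: "x \<in> carrier_vec d" and "l \<ge> 1" "l \<le> L"
 shows "dim_vec (hidden d L m W x l) = m \<and> (\<forall>i<m. vec_index (hidden d L m W x l) i = pre d m W x l i)"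
 using assms(2,3)
proof (induction l rule: nat_induct_at_least)
 case base
 then show ?case using x
  by (auto simp: weight_def layer_rows_def layer_cols_def pre_def scalar_prod_def atLeast0LessThan row_def intro!: sum.cong)
next
 case (Suc l)
 then obtain k where k: "l = Suc k" by (cases l) auto
 from Suc have IH: "dim_vec (hidden d L m W x l) = m" "\<And>i. i < m ==> vec_index (hidden d L m W x l) i = pre d m W x l i" by auto
 show ?case
  using IH Suc.prems unfolding k
  by (auto simp: weight_def layer_rows_def layer_cols_def scalar_prod_def atLeast0LessThan row_def
    pre_def[of d m W x "Suc (Suc k)"] inp_Suc sum_distrib_left simp del: inp.simps(3) intro!: sum.cong)
qed

text \<open>The output is treated as a preactivation of layer \<open>Suc L\<close>; the square of
  the factor \<open>sqrt m\<close> cancels the division by \<open>m\<close> in the empirical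
  kernel.\<close>

lemma network_eq_pre:
 assumes x: "x \<in> carrier_vec d" and L: "L \<ge> 1" and m: "m \<ge> 1"
 shows "network d L m W x = sqrt m * pre d m W x (Suc L) 0"
proof -
 have 1: "sqrt (real m) * sqrt (2 / real m) = sqrt 2" using m by (simp add: real_sqrt_mult[symmetric])
 have "network d L m W x = sqrt 2 * (\<Sum>j<m. W (Suc L, 0, j) * relu (pre d m W x L j))"
  using hidden_eq_pre[OF x L order_refl, of m W] L
  by (auto simp: network_def weight_def layer_rows_def layer_cols_def scalar_prod_def atLeast0LessThan row_def intro!: sum.cong)
 also have "\<dots> = sqrt m * pre d m W x (Suc L) 0"
  unfolding 1[symmetric] using L by (simp add: pre_def layer_cols_def inp_Suc sum_distrib_left mult_ac)
 finally show ?thesis .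
qed

text \<open>
 A preactivation may vanish identically near a parameter, namely when all units of the previous layer are
 inactive; this happens with positive probability, but is harmless.
\<close>

definition regular_at :: "nat => nat => nat => (nat \<times> nat \<times> nat => real) => real vec => bool" where
 "regular_at d L m W x \<longleftrightarrow> (\<forall>l\<in>{1..L}. \<forall>i<m. pre d m W x l i \<noteq> 0 \<or> (\<forall>j<layer_cols d m l. inp d m W x l j = 0) \<and> l > 1)"

lemma relu_eq_0_iff: "relu u = 0 \<longleftrightarrow> u \<le> 0"
 by (simp add: relu_def max_def)

lemma eventually_less_isCont:
 fixes g :: "real => real"
 assumes "isCont g a" "g a < 0"
 shows "eventually (\<lambda>v. g v < 0) (nhds a)"
 using assms order_tendstoD(2)[of g "g a" "nhds a" 0] by (simp add: continuous_within tendsto_at_iff_tendsto_nhds)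

lemma has_field_derivative_relu_pre:
 fixes f :: "real => real"
 assumes f: "(f has_field_derivative f') (at a)" and z: "f a \<noteq> 0 \<or> eventually (\<lambda>v. f v = 0) (nhds a)"
 shows "((\<lambda>v. relu (f v)) has_field_derivative heaviside (f a) * f') (at a)"
proof -
 have c: "isCont f a" using f by (rule DERIV_isCont)
 consider "f a > 0" | "f a < 0" | "eventually (\<lambda>v. f v = 0) (nhds a)" using z by linarith
 then show ?thesis
 proof cases
  case 1
  have "eventually (\<lambda>v. f v > 0) (nhds a)"
   using c 1 order_tendstoD(1)[of f "f a" "nhds a" 0] by (simp add: continuous_within tendsto_at_iff_tendsto_nhds)
  then have "eventually (\<lambda>v. relu (f v) = f v) (nhds a)" by eventually_elim (simp add: relu_def)
  then show ?thesis using f 1 by (subst DERIV_cong_ev[OF refl _ refl, where g=f]) (auto simp: heaviside_def)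
 next
  case 2
  have "eventually (\<lambda>v. f v < 0) (nhds a)"
   using c 2 order_tendstoD(2)[of f "f a" "nhds a" 0] by (simp add: continuous_within tendsto_at_iff_tendsto_nhds)
  then have "eventually (\<lambda>v. relu (f v) = 0) (nhds a)" by eventually_elim (simp add: relu_def)
  then show ?thesis using 2 by (subst DERIV_cong_ev[OF refl _ refl, where g="\<lambda>_. 0"]) (auto simp: heaviside_def)
 next
  case 3
  then have "eventually (\<lambda>v. relu (f v) = 0) (nhds a)" by eventually_elim (simp add: relu_def)
  moreover have "f a = 0" using 3 by (rule eventually_nhds_x_imp_x)
  ultimately show ?thesis by (subst DERIV_cong_ev[OF refl _ refl, where g="\<lambda>_. 0"]) (auto simp: heaviside_def)
 qed
qed

text \<open>The third conjunct keeps the induction going: a preactivation is nonzero or vanishes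
  identically near the parameter, and in both cases \<open>relu\<close> can be differentiated there.
  If it vanishes at a regular parameter, all units of the previous layer are inactive; each of them
  is negative, hence negative nearby, or by induction zero nearby, so the preactivation stays
  zero.\<close>

lemma pre_has_derivative:
 assumes reg: "regular_at d L m W x" and "l \<ge> 1" "l \<le> Suc L"
 shows "(\<forall>j. j < layer_cols d m l \<longrightarrow>
      ((\<lambda>v. inp d m (W(p := v)) x l j) has_field_derivative
       (if l = 1 then 0 else sqrt (2 / real m) * (heaviside (pre d m W x (l - 1) j) * pre_grad d m W x (l - 1) j p))) (at (W p))) \<and>
    (\<forall>i. ((\<lambda>v. pre d m (W(p := v)) x l i) has_field_derivative pre_grad d m W x l i p) (at (W p))) \<and>
    (\<forall>i. l \<le> L \<longrightarrow> i < m \<longrightarrow> pre d m W x l i \<noteq> 0 \<or> eventually (\<lambda>v. pre d m (W(p := v)) x l i = 0) (nhds (W p)))"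
 (is "?I l \<and> ?C l \<and> ?Z l")
proof -
 have q: "((\<lambda>v. (W(p := v)) q) has_field_derivative of_bool (p = q)) (at (W p))" for q
  by (cases "p = q") auto
 show ?thesis
 using assms(2,3)
proof (induction l rule: nat_induct_at_least)
 case base
 have C: "?C (Suc 0)"
 proof
  fix i
  have "((\<lambda>v. pre d m (W(p := v)) x (Suc 0) i) has_field_derivative
   (\<Sum>j<layer_cols d m (Suc 0). of_bool (p = (Suc 0, i, j)) * inp d m (W(p := W p)) x (Suc 0) j + 0 * (W(p := W p)) (Suc 0, i, j))) (at (W p))"
   unfolding pre_def by (intro DERIV_sum DERIV_mult q) simp
  then show "((\<lambda>v. pre d m (W(p := v)) x (Suc 0) i) has_field_derivative pre_grad d m W x (Suc 0) i p) (at (W p))"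
   by (rule DERIV_cong) simp
 qed
 have Z: "?Z (Suc 0)" using reg by (auto simp: regular_at_def)
 have I: "?I (Suc 0)" by simp
 show ?case using I C Z unfolding One_nat_def by (intro conjI)
next
 case (Suc l)
 then have l: "l \<ge> 1" "l \<le> L" by auto
 have IH: "?I l \<and> ?C l \<and> ?Z l" by (rule Suc.IH) (use l in simp)
 have C: "\<And>i. ((\<lambda>v. pre d m (W(p := v)) x l i) has_field_derivative pre_grad d m W x l i p) (at (W p))"
  and Z: "\<And>i. i < m ==> pre d m W x l i \<noteq> 0 \<or> eventually (\<lambda>v. pre d m (W(p := v)) x l i = 0) (nhds (W p))"
  using IH l(2) by blast+
 have cols: "layer_cols d m (Suc l) = m" using l by (simp add: layer_cols_def)
 have I: "((\<lambda>v. inp d m (W(p := v)) x (Suc l) j) has_field_derivative sqrt (2 / real m) * (heaviside (pre d m W x l j) * pre_grad d m W x l j p)) (at (W p))"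
  if "j < m" for j
  unfolding inp_Suc[OF l(1)]
  using has_field_derivative_relu_pre[OF C, of j] Z[OF that] by (intro DERIV_cmult) simp
 have C': "?C (Suc l)"
 proof
  fix i
  have "((\<lambda>v. pre d m (W(p := v)) x (Suc l) i) has_field_derivative
   (\<Sum>j<m. of_bool (p = (Suc l, i, j)) * inp d m (W(p := W p)) x (Suc l) j +
     (sqrt (2 / real m) * (heaviside (pre d m W x l j) * pre_grad d m W x l j p)) * (W(p := W p)) (Suc l, i, j))) (at (W p))"
   unfolding pre_def[of _ _ _ _ "Suc l"] cols
   by (intro DERIV_sum DERIV_mult q I) auto
  then show "((\<lambda>v. pre d m (W(p := v)) x (Suc l) i) has_field_derivative pre_grad d m W x (Suc l) i p) (at (W p))"
   by (rule DERIV_cong) (simp add: cols sum.distrib sum_distrib_left mult_ac)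
 qed
 have Z': "?Z (Suc l)"
 proof (intro allI impI)
  fix i assume i: "Suc l \<le> L" "i < m"
  show "pre d m W x (Suc l) i \<noteq> 0 \<or> eventually (\<lambda>v. pre d m (W(p := v)) x (Suc l) i = 0) (nhds (W p))"
  proof (cases "pre d m W x (Suc l) i = 0")
   case True
   with reg i have "\<forall>j<m. inp d m W x (Suc l) j = 0"
    using cols by (auto simp: regular_at_def)
   then have neg: "pre d m W x l j \<le> 0" if "j < m" for j
    using that i by (auto simp: inp_Suc[OF l(1)] relu_eq_0_iff)
   have "eventually (\<lambda>v. pre d m (W(p := v)) x l j \<le> 0) (nhds (W p))" if j: "j < m" for j
    using Z[OF j]
   proof
    assume "pre d m W x l j \<noteq> 0"
    then have "pre d m W x l j < 0" using neg[OF j] by simp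
    moreover have "isCont (\<lambda>v. pre d m (W(p := v)) x l j) (W p)" using C by (rule DERIV_isCont)
    ultimately have "eventually (\<lambda>v. pre d m (W(p := v)) x l j < 0) (nhds (W p))"
     using eventually_less_isCont[of "W p" "\<lambda>v. pre d m (W(p := v)) x l j"] by simp
    then show ?thesis by eventually_elim simp
   qed (auto elim!: eventually_mono)
   then have "eventually (\<lambda>v. \<forall>j\<in>{..<m}. pre d m (W(p := v)) x l j \<le> 0) (nhds (W p))"
    by (intro eventually_ball_finite) auto
   then have "eventually (\<lambda>v. pre d m (W(p := v)) x (Suc l) i = 0) (nhds (W p))"
    by eventually_elim (auto simp: pre_def[of _ _ _ _ "Suc l"] cols inp_Suc[OF l(1)] relu_eq_0_iff intro!: sum.neutral)
   then show ?thesis by simp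
  qed simp
 qed
 have I': "?I (Suc l)" using I l cols by (simp del: fun_upd_apply)
 show ?case using I' C' Z' by (intro conjI)
qed
qed

lemma network_grad_eq:
 assumes "x \<in> carrier_vec d" "L \<ge> 1" "m \<ge> 1" "regular_at d L m W x"
 shows "network_grad d L m W x p = sqrt m * pre_grad d m W x (Suc L) 0 p"
proof -
 have "((\<lambda>v. sqrt m * pre d m (W(p := v)) x (Suc L) 0) has_field_derivative sqrt m * pre_grad d m W x (Suc L) 0 p) (at (W p))"
  using pre_has_derivative[OF assms(4), of "Suc L" p] by (intro DERIV_cmult) auto
 then show ?thesis unfolding network_grad_def network_eq_pre[OF assms(1-3)] by (rule DERIV_imp_deriv)
qed

lemma pre_grad_eq_0: "fst p > l ==> pre_grad d m W x l i p = 0"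
proof (induction l arbitrary: i)
 case (Suc l)
 then have "p \<noteq> (Suc l, i, j)" for j by auto
 then show ?case using Suc by simp
qed simp

lemma sum_swap_inner:
 fixes h :: "'b => 'c => real"
 shows "(\<Sum>p\<in>P. \<Sum>i\<in>A. \<Sum>j\<in>B. h i j * g p i j * w i j) = (\<Sum>i\<in>A. \<Sum>j\<in>B. h i j * (\<Sum>p\<in>P. g p i j) * w i j)"
 by (subst sum.swap, rule sum.cong[OF refl], subst sum.swap) (simp add: sum_distrib_left sum_distrib_right)

text \<open>The parameters of layer \<open>Suc l\<close> contribute only if both units are the same
  row, through the inputs of that layer, while those of lower layers act through the preactivations
  of layer \<open>l\<close>; this is the recursion of \<open>tangent\<close>.\<close>

lemma sum_pre_grad:
 assumes "k < layer_rows L m l" "k' < layer_rows L m l" "l \<le> Suc L"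
 shows "(\<Sum>p\<in>(SIGMA l:{1..l}. {..<layer_rows L m l} \<times> {..<layer_cols d m l}). pre_grad d m W x l k p * pre_grad d m W x' l k' p)
  = tangent d m W x x' l k k'"
 using assms
proof (induction l arbitrary: k k')
 case 0
 then show ?case by simp
next
 case (Suc l)
 let ?P = "\<lambda>l. SIGMA l:{1..l}. {..<layer_rows L m l} \<times> {..<layer_cols d m l}"
 let ?Q = "Pair (Suc l) ` ({..<layer_rows L m (Suc l)} \<times> {..<layer_cols d m (Suc l)})"
 let ?g = "pre_grad d m W x" and ?g' = "pre_grad d m W x'"
 have PQ: "?P (Suc l) = ?Q \<union> ?P l" "?Q \<inter> ?P l = {}" by (auto simp: le_Suc_eq)
 have "(\<Sum>p\<in>?Q. ?g (Suc l) k p * ?g' (Suc l) k' p) =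
  (\<Sum>q\<in>{..<layer_rows L m (Suc l)} \<times> {..<layer_cols d m (Suc l)}. ?g (Suc l) k (Suc l, q) * ?g' (Suc l) k' (Suc l, q))"
  by (subst sum.reindex) (auto intro: inj_onI)
 also have "\<dots> = (\<Sum>i<layer_rows L m (Suc l). \<Sum>j<layer_cols d m (Suc l). of_bool (i = k) * of_bool (i = k') * (inp d m W x (Suc l) j * inp d m W x' (Suc l) j))"
 proof -
  have g: "pre_grad d m W y (Suc l) k (Suc l, i, j) = of_bool (i = k) * inp d m W y (Suc l) j" if "j < layer_cols d m (Suc l)" for i j k y
  proof -
   have "{..<layer_cols d m (Suc l)} \<inter> {j'. (Suc l, i, j) = (Suc l, k, j')} = (if i = k then {j} else {})"
    using that by auto
   then show ?thesis by (simp add: pre_grad_eq_0)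
  qed
  have "(\<Sum>q\<in>{..<layer_rows L m (Suc l)} \<times> {..<layer_cols d m (Suc l)}. ?g (Suc l) k (Suc l, q) * ?g' (Suc l) k' (Suc l, q)) =
   (\<Sum>i<layer_rows L m (Suc l). \<Sum>j<layer_cols d m (Suc l). ?g (Suc l) k (Suc l, i, j) * ?g' (Suc l) k' (Suc l, i, j))"
   unfolding sum.cartesian_product by (simp add: case_prod_beta del: pre_grad.simps)
  also have "\<dots> = (\<Sum>i<layer_rows L m (Suc l). \<Sum>j<layer_cols d m (Suc l). of_bool (i = k) * of_bool (i = k') * (inp d m W x (Suc l) j * inp d m W x' (Suc l) j))"
   by (intro sum.cong refl, subst g, simp, subst g, simp) (simp only: mult_ac)
  finally show ?thesis .
 qed
 also have "\<dots> = (\<Sum>i<layer_rows L m (Suc l). of_bool (i = k) * of_bool (i = k')) * gram d m W x x' (Suc l)"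
  unfolding gram_def sum_product ..
 also have "(\<Sum>i<layer_rows L m (Suc l). of_bool (i = k) * of_bool (i = k')) = (\<Sum>i<layer_rows L m (Suc l). if i = k then of_bool (k = k') else (0::real))"
  by (intro sum.cong) auto
 also have "\<dots> = of_bool (k = k')" using Suc.prems by simp
 finally have 1: "(\<Sum>p\<in>?Q. ?g (Suc l) k p * ?g' (Suc l) k' p) = of_bool (k = k') * gram d m W x x' (Suc l)" .
 have low: "pre_grad d m W y (Suc l) k p = sqrt (2 / m) * (\<Sum>j<m. W (Suc l, k, j) * (heaviside (pre d m W y l j) * pre_grad d m W y l j p))"
  if "p \<in> ?P l" for y k p
 proof -
  have "p \<noteq> (Suc l, k, j)" for j using that by auto
  then show ?thesis by simp
 qed
 have s2: "sqrt (2 / m) * sqrt (2 / m) = 2 / real m" by simp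
 have "(\<Sum>p\<in>?P l. ?g (Suc l) k p * ?g' (Suc l) k' p) = (\<Sum>p\<in>?P l. 2 / real m * (\<Sum>i<m. \<Sum>j<m. heaviside (pre d m W x l i) * heaviside (pre d m W x' l j) *
    (?g l i p * ?g' l j p) * (W (Suc l, k, i) * W (Suc l, k', j))))"
 proof (rule sum.cong[OF refl])
  fix p assume p: "p \<in> ?P l"
  have "?g (Suc l) k p * ?g' (Suc l) k' p = (sqrt (2 / m) * sqrt (2 / m)) *
   ((\<Sum>i<m. W (Suc l, k, i) * (heaviside (pre d m W x l i) * ?g l i p)) * (\<Sum>j<m. W (Suc l, k', j) * (heaviside (pre d m W x' l j) * ?g' l j p)))"
   unfolding low[OF p] by (simp only: mult_ac)
  then show "?g (Suc l) k p * ?g' (Suc l) k' p = 2 / real m * (\<Sum>i<m. \<Sum>j<m. heaviside (pre d m W x l i) * heaviside (pre d m W x' l j) *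
    (?g l i p * ?g' l j p) * (W (Suc l, k, i) * W (Suc l, k', j)))"
   unfolding s2 sum_product by (simp only: mult_ac)
 qed
 also have "\<dots> = 2 / real m * (\<Sum>i<m. \<Sum>j<m. heaviside (pre d m W x l i) * heaviside (pre d m W x' l j) *
    (\<Sum>p\<in>?P l. ?g l i p * ?g' l j p) * (W (Suc l, k, i) * W (Suc l, k', j)))"
  unfolding sum_distrib_left[symmetric] sum_swap_inner ..
 also have "\<dots> = 2 / real m * (\<Sum>i<m. \<Sum>j<m. heaviside (pre d m W x l i) * heaviside (pre d m W x' l j) *
    tangent d m W x x' l i j * (W (Suc l, k, i) * W (Suc l, k', j)))"
  using Suc by (intro arg_cong[where f="\<lambda>x. 2 / real m * x"] sum.cong refl) (simp add: layer_rows_def)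
 finally have 2: "(\<Sum>p\<in>?P l. ?g (Suc l) k p * ?g' (Suc l) k' p) = \<dots>" .
 show ?case
  unfolding PQ(1) by (subst sum.union_disjoint) (use PQ(2) in \<open>simp_all only: 1 2 tangent.simps, auto\<close>)
qed

lemma empirical_ntk_eq_tangent:
 assumes "x \<in> carrier_vec d" "x' \<in> carrier_vec d" "L \<ge> 1" "m \<ge> 1" "regular_at d L m W x" "regular_at d L m W x'"
 shows "empirical_ntk d L m W x x' = tangent d m W x x' (Suc L) 0 0"
proof -
 have "empirical_ntk d L m W x x' = (\<Sum>p\<in>params d L m. m * (pre_grad d m W x (Suc L) 0 p * pre_grad d m W x' (Suc L) 0 p)) / m"
  unfolding empirical_ntk_def network_grad_eq[OF assms(1,3,4,5)] network_grad_eq[OF assms(2,3,4,6)]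
  by (intro arg_cong[where f="\<lambda>x. x / _"] sum.cong) auto
 also have "\<dots> = (\<Sum>p\<in>params d L m. pre_grad d m W x (Suc L) 0 p * pre_grad d m W x' (Suc L) 0 p)"
  using assms(4) by (simp add: sum_distrib_left[symmetric])
 also have "\<dots> = tangent d m W x x' (Suc L) 0 0"
  using sum_pre_grad[of 0 L m "Suc L" 0 d W x x'] by (simp add: params_def layer_rows_def)
 finally show ?thesis .
qed

section \<open>Convergence in probability by resampling a layer\<close>

definition override :: "'i set => ('i => 'b) => ('i => 'b) => 'i => 'b" where
 "override J W w = (\<lambda>p. if p \<in> J then w p else W p)"

text \<open>Takes the place of conditional expectations: drawing the coordinates in \<open>J\<close>
  afresh does not change the law, and the inner integral is the expectation given all the other
  coordinates.\<close>

lemma nn_integral_gauss_resample: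
 assumes I: "finite I" and J: "J \<subseteq> I" and f: "f \<in> borel_measurable (gauss I)"
 shows "(\<integral>\<^sup>+W. f W \<partial>gauss I) = (\<integral>\<^sup>+W. (\<integral>\<^sup>+w. f (override J W w) \<partial>gauss J) \<partial>gauss I)"
proof -
 interpret P: product_prob_space "\<lambda>_. std_normal_distribution" I by (rule product_prob_space_gauss)
 interpret GJ: prob_space "gauss J" by (rule prob_space_gauss)
 define K where "K = I - J"
 have K: "K \<inter> J = {}" "finite K" "finite J" "K \<union> J = I" using I J finite_subset by (auto simp: K_def)
 have ov: "(\<lambda>p. override J (fst p) (snd p)) \<in> measurable (gauss I \<Otimes>\<^sub>M gauss J) (gauss I)"
 proof -
  have "(\<lambda>p. \<lambda>i\<in>I. if i \<in> J then snd p i else fst p i) \<in> measurable (gauss I \<Otimes>\<^sub>M gauss J) (gauss I)"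
  proof (rule measurable_restrict)
   fix i assume i: "i \<in> I"
   show "(\<lambda>p. if i \<in> J then snd p i else fst p i) \<in> measurable (gauss I \<Otimes>\<^sub>M gauss J) std_normal_distribution"
   proof (cases "i \<in> J")
    case True
    then show ?thesis
     using measurable_compose[OF measurable_snd gauss_component[OF True], of "gauss I"] by simp
   next
    case False
    then show ?thesis
     using measurable_compose[OF measurable_fst gauss_component[OF i], of "gauss J"] by simp
   qed
  qed
  moreover have "(\<lambda>i\<in>I. if i \<in> J then snd p i else fst p i) = override J (fst p) (snd p)"
   if "p \<in> space (gauss I \<Otimes>\<^sub>M gauss J)" for p
   using that J by (auto simp: space_pair_measure space_gauss override_def PiE_iff extensional_def restrict_def fun_eq_iff)
  ultimately show ?thesis by (simp cong: measurable_cong)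
 qed
 define h where "h W = (\<integral>\<^sup>+w. f (override J W w) \<partial>gauss J)" for W
 have hm: "h \<in> borel_measurable (gauss I)"
  unfolding h_def[abs_def]
  by (rule GJ.borel_measurable_nn_integral_fst[of "\<lambda>p. f (override J (fst p) (snd p))", simplified])
   (rule measurable_compose[OF ov f])
 note fold = P.product_nn_integral_fold[OF K(1-3), unfolded K(4)]
 have "(\<integral>\<^sup>+W. h W \<partial>gauss I) = (\<integral>\<^sup>+x. \<integral>\<^sup>+y. h (merge K J (x, y)) \<partial>gauss J \<partial>gauss K)"
  by (rule fold[OF hm])
 also have "\<dots> = (\<integral>\<^sup>+x. \<integral>\<^sup>+y. f (merge K J (x, y)) \<partial>gauss J \<partial>gauss K)"
 proof (rule nn_integral_cong)
  fix x assume "x \<in> space (gauss K)"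
  have "h (merge K J (x, y)) = (\<integral>\<^sup>+w. f (merge K J (x, w)) \<partial>gauss J)" if "y \<in> space (gauss J)" for y
   unfolding h_def
  proof (intro nn_integral_cong arg_cong[where f=f])
   fix w assume "w \<in> space (gauss J)"
   then show "override J (merge K J (x, y)) w = merge K J (x, w)"
    using K(1) by (auto simp: override_def merge_def fun_eq_iff)
  qed
  then have "(\<integral>\<^sup>+y. h (merge K J (x, y)) \<partial>gauss J) = (\<integral>\<^sup>+y. (\<integral>\<^sup>+w. f (merge K J (x, w)) \<partial>gauss J) \<partial>gauss J)"
   by (rule nn_integral_cong)
  then show "(\<integral>\<^sup>+y. h (merge K J (x, y)) \<partial>gauss J) = (\<integral>\<^sup>+y. f (merge K J (x, y)) \<partial>gauss J)"
   by (simp add: GJ.emeasure_space_1)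
 qed
 also have "\<dots> = (\<integral>\<^sup>+W. f W \<partial>gauss I)" by (rule fold[OF f, symmetric])
 finally show ?thesis unfolding h_def ..
qed

section \<open>Convergence in probability\<close>

definition plim :: "(nat => 'a measure) => (nat => 'a => real) => real => bool" where
 "plim P X c \<longleftrightarrow> (\<forall>e>0. (\<lambda>m. measure (P m) {W \<in> space (P m). \<bar>X m W - c\<bar> > e}) \<longlonglongrightarrow> 0)"

lemma dist_pair_le: "dist (x, y) (a, b) \<le> dist x a + dist y b"
 unfolding dist_Pair_Pair by (rule sqrt_sum_squares_le_sum) simp_all

locale prob_seq =
 fixes P :: "nat => 'a measure"
 assumes prob: "\<And>m. prob_space (P m)"
begin

lemma plim_seq:
 assumes "a \<longlonglongrightarrow> c"
 shows "plim P (\<lambda>m _. a m) c"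
 unfolding plim_def
proof (intro allI impI)
 fix e :: real assume "e > 0"
 then have "eventually (\<lambda>m. \<bar>a m - c\<bar> < e) sequentially" using assms by (auto simp: tendsto_iff dist_real_def)
 then have "eventually (\<lambda>m. 0 = measure (P m) {W \<in> space (P m). \<bar>a m - c\<bar> > e}) sequentially"
  by eventually_elim auto
 then show "(\<lambda>m. measure (P m) {W \<in> space (P m). \<bar>a m - c\<bar> > e}) \<longlonglongrightarrow> 0"
  by (rule Lim_transform_eventually[OF tendsto_const])
qed

lemma plim_bound:
 assumes Y: "plim P Y 0" and mY: "\<And>m. Y m \<in> borel_measurable (P m)"
  and XY: "\<And>m W. m \<ge> 1 ==> W \<in> space (P m) ==> \<bar>X m W - c\<bar> \<le> Y m W"
 shows "plim P X c"
 unfolding plim_def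
proof (intro allI impI)
 fix e :: real assume e: "e > 0"
 have "eventually (\<lambda>m. measure (P m) {W \<in> space (P m). \<bar>X m W - c\<bar> > e} \<le> measure (P m) {W \<in> space (P m). \<bar>Y m W - 0\<bar> > e}) sequentially"
  using eventually_ge_at_top[of "1::nat"]
 proof eventually_elim
  case (elim m)
  interpret prob_space "P m" by (rule prob)
  note [measurable] = mY[of m]
  show ?case
  proof (rule finite_measure_mono)
   show "{W \<in> space (P m). \<bar>X m W - c\<bar> > e} \<subseteq> {W \<in> space (P m). \<bar>Y m W - 0\<bar> > e}"
    using XY[OF elim] by force
  qed measurable
 qed
 moreover have "(\<lambda>m. measure (P m) {W \<in> space (P m). \<bar>Y m W - 0\<bar> > e}) \<longlonglongrightarrow> 0"
  using Y e unfolding plim_def by blast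
 ultimately show "(\<lambda>m. measure (P m) {W \<in> space (P m). \<bar>X m W - c\<bar> > e}) \<longlonglongrightarrow> 0"
  by (rule tendsto_sandwich[OF always_eventually[OF allI[OF measure_nonneg]] _ tendsto_const])
qed

lemma plim_cont:
 fixes F :: "real \<times> real \<times> real => real"
 assumes X: "plim P X a" and Y: "plim P Y b" and Z: "plim P Z c"
  and mX: "\<And>m. X m \<in> borel_measurable (P m)" and mY: "\<And>m. Y m \<in> borel_measurable (P m)" and mZ: "\<And>m. Z m \<in> borel_measurable (P m)"
  and F: "isCont F (a, b, c)"
 shows "plim P (\<lambda>m W. F (X m W, Y m W, Z m W)) (F (a, b, c))"
 unfolding plim_def
proof (intro allI impI)
 fix e :: real assume e: "e > 0"
 obtain \<delta> where \<delta>: "\<delta> > 0" "\<And>p. dist p (a, b, c) < \<delta> ==> dist (F p) (F (a, b, c)) < e"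
  using F e unfolding continuous_at_eps_delta by blast
 let ?B = "\<lambda>m U u. measure (P m) {W \<in> space (P m). \<bar>U m W - u\<bar> > \<delta> / 4}"
 have le: "measure (P m) {W \<in> space (P m). \<bar>F (X m W, Y m W, Z m W) - F (a, b, c)\<bar> > e} \<le> ?B m X a + ?B m Y b + ?B m Z c" for m
 proof -
  interpret prob_space "P m" by (rule prob)
  note [measurable] = mX[of m] mY[of m] mZ[of m]
  let ?S = "\<lambda>U u. {W \<in> space (P m). \<bar>U m W - u\<bar> > \<delta> / 4}"
  have "measure (P m) {W \<in> space (P m). \<bar>F (X m W, Y m W, Z m W) - F (a, b, c)\<bar> > e} \<le> prob (?S X a \<union> ?S Y b \<union> ?S Z c)"
  proof (rule finite_measure_mono)
   show "{W \<in> space (P m). \<bar>F (X m W, Y m W, Z m W) - F (a, b, c)\<bar> > e} \<subseteq> ?S X a \<union> ?S Y b \<union> ?S Z c"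
   proof (rule ccontr)
    assume "\<not> ?thesis"
    then obtain W where W: "W \<in> space (P m)" "\<bar>F (X m W, Y m W, Z m W) - F (a, b, c)\<bar> > e"
     "\<bar>X m W - a\<bar> \<le> \<delta> / 4" "\<bar>Y m W - b\<bar> \<le> \<delta> / 4" "\<bar>Z m W - c\<bar> \<le> \<delta> / 4" by force
    have "dist (X m W, Y m W, Z m W) (a, b, c) \<le> dist (X m W) a + dist (Y m W, Z m W) (b, c)"
     by (rule dist_pair_le)
    also have "dist (Y m W, Z m W) (b, c) \<le> dist (Y m W) b + dist (Z m W) c"
     by (rule dist_pair_le)
    finally have "dist (X m W, Y m W, Z m W) (a, b, c) < \<delta>" using W \<delta>(1) by (simp add: dist_real_def)
    from \<delta>(2)[OF this] W(2) show False by (simp add: dist_real_def)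
   qed
  qed measurable
  also have "\<dots> \<le> prob (?S X a \<union> ?S Y b) + prob (?S Z c)" by (rule measure_Un_le) measurable
  also have "prob (?S X a \<union> ?S Y b) \<le> prob (?S X a) + prob (?S Y b)" by (rule measure_Un_le) measurable
  finally show ?thesis by simp
 qed
 have "(\<lambda>m. ?B m X a + ?B m Y b + ?B m Z c) \<longlonglongrightarrow> 0 + 0 + 0"
  using X[unfolded plim_def, rule_format, of "\<delta> / 4"] Y[unfolded plim_def, rule_format, of "\<delta> / 4"] Z[unfolded plim_def, rule_format, of "\<delta> / 4"] \<delta>(1)
  by (intro tendsto_add) simp_all
 then have "(\<lambda>m. ?B m X a + ?B m Y b + ?B m Z c) \<longlonglongrightarrow> 0" by simp
 then show "(\<lambda>m. measure (P m) {W \<in> space (P m). \<bar>F (X m W, Y m W, Z m W) - F (a, b, c)\<bar> > e}) \<longlonglongrightarrow> 0"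
  by (rule tendsto_sandwich[OF always_eventually[OF allI[OF measure_nonneg]] always_eventually[OF allI[OF le]] tendsto_const])
qed

lemma plim_cont1:
 fixes F :: "real => real"
 assumes X: "plim P X a" and mX: "\<And>m. X m \<in> borel_measurable (P m)" and F: "isCont F a"
 shows "plim P (\<lambda>m W. F (X m W)) (F a)"
 using plim_cont[OF X X X mX mX mX, of "\<lambda>p. F (fst p)"] isCont_o2[of "(a, a, a)" fst F] F by (simp add: isCont_fst)

lemma plim_add:
 assumes "plim P X a" "plim P Y b" "\<And>m. X m \<in> borel_measurable (P m)" "\<And>m. Y m \<in> borel_measurable (P m)"
 shows "plim P (\<lambda>m W. X m W + Y m W) (a + b)"
 using plim_cont[OF assms(1,2,2,3,4,4), of "\<lambda>p. fst p + fst (snd p)"]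
 by (simp add: continuous_intros)

text \<open>A conditional Markov inequality. \<open>g\<close> bounds the conditional mean of
  \<open>X\<close> and tends to 0 in probability, which says nothing about its mean; therefore
  \<open>X\<close> is integrated only over the event that \<open>g\<close> is at most
  \<open>c\<close>.\<close>

lemma plim_markov:
 assumes g: "plim P g 0" and mg: "\<And>m. g m \<in> borel_measurable (P m)" and mX: "\<And>m. X m \<in> borel_measurable (P m)"
  and nn: "\<And>m W. 0 \<le> X m W"
  and cond: "\<And>m c. m \<ge> 1 ==> c > 0 ==> (\<integral>\<^sup>+W. ennreal (X m W) * indicator {W. g m W \<le> c} W \<partial>P m) \<le> ennreal c"
 shows "plim P X 0"
 unfolding plim_def
proof (intro allI impI)
 fix e :: real assume e: "e > 0"
 show "(\<lambda>m. measure (P m) {W \<in> space (P m). \<bar>X m W - 0\<bar> > e}) \<longlonglongrightarrow> 0"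
  unfolding tendsto_iff
 proof (intro allI impI)
  fix r :: real assume r: "r > 0"
  \<comment> \<open>With this \<open>c\<close> Markov's inequality leaves
    \<open>c / e = r / 2\<close>; the other half is the probability that \<open>g\<close> exceeds
    \<open>c\<close>.\<close>
  define c where "c = r * e / 2"
  have c: "c > 0" using r e by (simp add: c_def)
  have "eventually (\<lambda>m. measure (P m) {W \<in> space (P m). \<bar>g m W - 0\<bar> > c} < r / 2) sequentially"
   using g[unfolded plim_def, rule_format, OF c] r by (intro order_tendstoD(2)[of _ 0]) simp_all
  then show "eventually (\<lambda>m. dist (measure (P m) {W \<in> space (P m). \<bar>X m W - 0\<bar> > e}) 0 < r) sequentially"
   using eventually_ge_at_top[of "1::nat"]
  proof eventually_elim
   case (elim m)
   interpret prob_space "P m" by (rule prob)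
   note [measurable] = mX[of m] mg[of m]
   let ?A = "{W \<in> space (P m). X m W > e \<and> g m W \<le> c}"
   have "ennreal e * emeasure (P m) ?A = (\<integral>\<^sup>+W. ennreal e * indicator ?A W \<partial>P m)"
    by (subst nn_integral_cmult_indicator) simp_all
   also have "\<dots> \<le> (\<integral>\<^sup>+W. ennreal (X m W) * indicator {W. g m W \<le> c} W \<partial>P m)"
    by (intro nn_integral_mono) (auto simp: indicator_def intro: ennreal_leI)
   also have "\<dots> \<le> ennreal c" using elim c by (intro cond) auto
   finally have "e * prob ?A \<le> c"
    using e c by (simp add: emeasure_eq_measure ennreal_mult[symmetric])
   then have A: "prob ?A \<le> r / 2" using e by (simp add: c_def field_simps)
   have "prob {W \<in> space (P m). \<bar>X m W - 0\<bar> > e} \<le> prob (?A \<union> {W \<in> space (P m). \<bar>g m W - 0\<bar> > c})"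
   proof (rule finite_measure_mono)
    show "{W \<in> space (P m). \<bar>X m W - 0\<bar> > e} \<subseteq> ?A \<union> {W \<in> space (P m). \<bar>g m W - 0\<bar> > c}"
     using nn by auto
   qed measurable
   also have "\<dots> \<le> prob ?A + prob {W \<in> space (P m). \<bar>g m W - 0\<bar> > c}" by (rule measure_Un_le) measurable
   also have "\<dots> < r" using A elim by simp
   finally show ?case by simp
  qed
 qed
qed

end

text \<open>Supplies the last hypothesis of \<open>plim_markov\<close>. As \<open>g\<close> does not
  see the coordinates in \<open>J\<close>, the indicator is constant in the inner integral, where
  the conditional bound applies.\<close>

lemma resample_cond:
 assumes I: "finite I" and J: "J \<subseteq> I" and X: "X \<in> borel_measurable (gauss I)" and g: "g \<in> borel_measurable (gauss I)"
  and gov: "\<And>W w. W \<in> space (gauss I) ==> w \<in> space (gauss J) ==> g (override J W w) = g W"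
  and le: "\<And>W. W \<in> space (gauss I) ==> (\<integral>\<^sup>+w. ennreal (X (override J W w)) \<partial>gauss J) \<le> ennreal (g W)"
 shows "(\<integral>\<^sup>+W. ennreal (X W) * indicator {W. g W \<le> c} W \<partial>gauss I) \<le> ennreal c"
proof -
 interpret prob_space "gauss I" by (rule prob_space_gauss)
 note [measurable] = X g
 have "(\<lambda>W. ennreal (X W) * indicator {W \<in> space (gauss I). g W \<le> c} W) \<in> borel_measurable (gauss I)"
  by measurable
 then have m: "(\<lambda>W. ennreal (X W) * indicator {W. g W \<le> c} W) \<in> borel_measurable (gauss I)"
  by (rule measurable_cong[THEN iffD1, rotated]) (auto simp: indicator_def)
 have "(\<integral>\<^sup>+W. ennreal (X W) * indicator {W. g W \<le> c} W \<partial>gauss I) =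
  (\<integral>\<^sup>+W. (\<integral>\<^sup>+w. ennreal (X (override J W w)) * indicator {W. g W \<le> c} (override J W w) \<partial>gauss J) \<partial>gauss I)"
  by (rule nn_integral_gauss_resample[OF I J m])
 also have "\<dots> \<le> (\<integral>\<^sup>+W. ennreal c \<partial>gauss I)"
 proof (rule nn_integral_mono)
  fix W assume W: "W \<in> space (gauss I)"
  show "(\<integral>\<^sup>+w. ennreal (X (override J W w)) * indicator {W. g W \<le> c} (override J W w) \<partial>gauss J) \<le> ennreal c"
  proof (cases "g W \<le> c")
   case True
   have "(\<integral>\<^sup>+w. ennreal (X (override J W w)) * indicator {W. g W \<le> c} (override J W w) \<partial>gauss J) \<le>
    (\<integral>\<^sup>+w. ennreal (X (override J W w)) \<partial>gauss J)"
    by (intro nn_integral_mono) (auto simp: indicator_def)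
   also have "\<dots> \<le> ennreal (g W)" by (rule le[OF W])
   also have "\<dots> \<le> ennreal c" using True by (rule ennreal_leI)
   finally show ?thesis .
  next
   case False
   have "(\<integral>\<^sup>+w. ennreal (X (override J W w)) * indicator {W. g W \<le> c} (override J W w) \<partial>gauss J) = (\<integral>\<^sup>+w. 0 \<partial>gauss J)"
    using False gov[OF W] by (intro nn_integral_cong) (auto simp: indicator_def)
   then show ?thesis by simp
  qed
 qed
 also have "\<dots> = ennreal c" by (simp add: emeasure_space_1)
 finally show ?thesis .
qed

section \<open>Gaussian expectations of the activation function\<close>

lemma law_linear:
 fixes v :: "'i => real"
 assumes J: "finite J" "finite I" "inj_on e I" "e ` I \<subseteq> J"
 shows "distr (gauss J) borel (\<lambda>w. \<Sum>i\<in>I. v i * w (e i)) = distr (gauss UNIV) borel (\<lambda>z. sqrt (\<Sum>i\<in>I. (v i)\<^sup>2) * z True)"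
proof -
 have m: "(\<lambda>w. \<Sum>i\<in>I. v i * w (e i)) \<in> borel_measurable (gauss J)"
  using J by (intro borel_measurable_sum borel_measurable_times gauss_component) auto
 have "distr (distr (gauss J) borel (\<lambda>w. (\<Sum>i\<in>I. v i * w (e i), \<Sum>i\<in>I. v i * w (e i)))) borel fst =
  distr (distr (gauss UNIV) borel (gpair (\<Sum>i\<in>I. (v i)\<^sup>2) (\<Sum>i\<in>I. (v i)\<^sup>2) (\<Sum>i\<in>I. v i * v i))) borel fst"
  unfolding law_linear_pair[OF J] ..
 moreover have "(\<lambda>w. (\<Sum>i\<in>I. v i * w (e i), \<Sum>i\<in>I. v i * w (e i))) \<in> borel_measurable (gauss J)"
  by (intro borel_measurable_Pair m)
 moreover have "fst \<in> borel_measurable (borel :: (real \<times> real) measure)"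
  by (intro borel_measurable_continuous_onI continuous_intros)
 ultimately show ?thesis
  using distr_distr[of fst borel borel "gpair _ _ _" "gauss UNIV"] by (simp add: distr_distr comp_def gpair_def)
qed

lemma AE_std_normal_nz: "AE x in std_normal_distribution. x \<noteq> 0"
 using AE_lborel_singleton[of "0::real"] by (subst AE_density) (auto elim: eventually_mono)

lemma AE_gauss_component_nz: "j \<in> J ==> AE w in gauss J. w j \<noteq> 0"
 using AE_PiM_component[of J "\<lambda>_. std_normal_distribution" j "\<lambda>x. x \<noteq> 0"] AE_std_normal_nz
 by (simp add: prob_space_normal_density)

lemma AE_gauss_linear_nz:
 fixes v :: "'i => real"
 assumes J: "finite J" "finite I" "inj_on e I" "e ` I \<subseteq> J" and nz: "\<exists>i\<in>I. v i \<noteq> 0"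
 shows "AE w in gauss J. (\<Sum>i\<in>I. v i * w (e i)) \<noteq> 0"
proof -
 have m: "(\<lambda>w. \<Sum>i\<in>I. v i * w (e i)) \<in> borel_measurable (gauss J)"
  using J by (intro borel_measurable_sum borel_measurable_times gauss_component) auto
 have mz: "(\<lambda>z. sqrt (\<Sum>i\<in>I. (v i)\<^sup>2) * z True) \<in> borel_measurable (gauss (UNIV::bool set))"
  by (intro borel_measurable_times borel_measurable_const gauss_component) simp
 have pos: "(\<Sum>i\<in>I. (v i)\<^sup>2) \<noteq> 0"
  using nz J(2) by (subst sum_nonneg_eq_0_iff) auto
 have "AE z in gauss (UNIV::bool set). sqrt (\<Sum>i\<in>I. (v i)\<^sup>2) * z True \<noteq> 0"
  using AE_gauss_component_nz[of True UNIV] pos by (auto elim: eventually_mono)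
 then have "AE x in distr (gauss UNIV) borel (\<lambda>z::bool=>real. sqrt (\<Sum>i\<in>I. (v i)\<^sup>2) * z True). x \<noteq> 0"
  by (subst AE_distr_iff[OF mz]) auto
 then have "AE x in distr (gauss J) borel (\<lambda>w. \<Sum>i\<in>I. v i * w (e i)). x \<noteq> 0"
  unfolding law_linear[OF J] .
 then show ?thesis by (subst (asm) AE_distr_iff[OF m]) auto
qed

text \<open>The dual activation: the conditional mean of an average of \<open>f\<close> over the
  units of a layer, as a function of the Gram matrix of the two inputs.\<close>

definition psi :: "(real \<times> real => real) => real => real => real => real" where
 "psi f a b c = (\<integral>z. f (gpair a b c z) \<partial>gauss (UNIV::bool set))"

text \<open>The factor 2 compensates for the half of the mass that the activation cuts off, so that
  the diagonal of the kernel is preserved from layer to layer.\<close>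

definition relu2 :: "real \<times> real => real" where "relu2 p = 2 * relu (fst p) * relu (snd p)"
definition step2 :: "real \<times> real => real" where "step2 p = 2 * heaviside (fst p) * heaviside (snd p)"

lemma relu_measurable [measurable]: "relu \<in> borel_measurable borel"
 unfolding relu_def[abs_def] by measurable
lemma heaviside_measurable [measurable]: "heaviside \<in> borel_measurable borel"
 unfolding heaviside_def[abs_def] by measurable
lemma relu2_measurable [measurable]: "relu2 \<in> borel_measurable borel"
 unfolding relu2_def[abs_def] borel_prod[symmetric] by measurable
lemma step2_measurable [measurable]: "step2 \<in> borel_measurable borel"
 unfolding step2_def[abs_def] borel_prod[symmetric] by measurable

lemma zb_measurable: "(\<lambda>z. z b) \<in> borel_measurable (gauss (UNIV::bool set))"
 by (rule gauss_component) simp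

lemma zb_moments:
 "integrable (gauss (UNIV::bool set)) (\<lambda>z. (z b)\<^sup>2)" "(\<integral>z. (z b)\<^sup>2 \<partial>gauss (UNIV::bool set)) = 1"
 "integrable (gauss (UNIV::bool set)) (\<lambda>z. z b ^ 4)" "(\<integral>z. z b ^ 4 \<partial>gauss (UNIV::bool set)) = 3"
 using gauss_mom2[of "UNIV::bool set" b b] gauss_mom4[of "UNIV::bool set" b b b b]
 by (simp_all add: power2_eq_square power4_eq_xxxx)

lemma relu_abs: "\<bar>relu u\<bar> \<le> \<bar>u\<bar>" "0 \<le> relu u"
 by (auto simp: relu_def)

lemma heaviside_01: "0 \<le> heaviside u" "heaviside u \<le> 1"
 by (auto simp: heaviside_def)

lemma step2_bound: "\<bar>step2 p\<bar> \<le> 2"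
 using mult_mono[OF heaviside_01(2)[of "fst p"] heaviside_01(2)[of "snd p"]] heaviside_01
 by (simp add: step2_def abs_mult)

lemma relu2_bound: "\<bar>relu2 p\<bar> \<le> (fst p)\<^sup>2 + (snd p)\<^sup>2"
proof -
 have "\<bar>relu2 p\<bar> \<le> 2 * (\<bar>fst p\<bar> * \<bar>snd p\<bar>)"
  using mult_mono[OF relu_abs(1)[of "fst p"] relu_abs(1)[of "snd p"]] by (simp add: relu2_def abs_mult)
 also have "\<dots> \<le> (fst p)\<^sup>2 + (snd p)\<^sup>2"
  using sum_squares_bound[of "\<bar>fst p\<bar>" "\<bar>snd p\<bar>"] by simp
 finally show ?thesis .
qed

lemma sq_add_le: "(x + y)\<^sup>2 \<le> 2 * x\<^sup>2 + 2 * (y::real)\<^sup>2"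
 using sum_squares_bound[of x y] by (simp add: power2_sum)

text \<open>Crude constants: \<open>relu2\<close> is at most the sum of the two squared components,
  the square of the second component is at most \<open>2 * b\<close> times the sum of two squared
  normals, and the fourth moment of a normal is 3.\<close>

lemma relu2_second_moment:
 assumes "a \<ge> 0" "b \<ge> 0" "c\<^sup>2 \<le> a * b"
 shows "integrable (gauss UNIV) (\<lambda>z. (relu2 (gpair a b c z))\<^sup>2)"
  "(\<integral>z. (relu2 (gpair a b c z))\<^sup>2 \<partial>gauss (UNIV::bool set)) \<le> 6 * a\<^sup>2 + 96 * b\<^sup>2"
proof -
 let ?D = "\<lambda>z::bool=>real. (2 * a\<^sup>2 + 16 * b\<^sup>2) * z True ^ 4 + 16 * b\<^sup>2 * z False ^ 4"
 have ca: "0 \<le> c\<^sup>2 / a" "c\<^sup>2 / a \<le> b" using assms by (cases "a = 0"; simp add: field_simps)+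
 have le: "(relu2 (gpair a b c z))\<^sup>2 \<le> ?D z" for z
 proof -
  define x y where "x = fst (gpair a b c z)" and "y = snd (gpair a b c z)"
  have "(relu2 (gpair a b c z))\<^sup>2 \<le> (x\<^sup>2 + y\<^sup>2)\<^sup>2"
   using relu2_bound[of "gpair a b c z"] unfolding x_def y_def by (rule abs_le_square_iff[THEN iffD1, OF order_trans]) simp
  also have "\<dots> \<le> 2 * (x\<^sup>2)\<^sup>2 + 2 * (y\<^sup>2)\<^sup>2" by (rule sq_add_le)
  also have "(x\<^sup>2)\<^sup>2 = a\<^sup>2 * z True ^ 4"
   using assms by (simp add: x_def gpair_def power_mult_distrib power4_eq_xxxx power2_eq_square)
  also have "(y\<^sup>2)\<^sup>2 \<le> 8 * b\<^sup>2 * z True ^ 4 + 8 * b\<^sup>2 * z False ^ 4"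
  proof -
   have "y\<^sup>2 \<le> 2 * (c / sqrt a * z True)\<^sup>2 + 2 * (sqrt (b - c\<^sup>2 / a) * z False)\<^sup>2"
    unfolding y_def gpair_def snd_conv by (rule sq_add_le)
   also have "\<dots> = 2 * (c\<^sup>2 / a * (z True)\<^sup>2) + 2 * ((b - c\<^sup>2 / a) * (z False)\<^sup>2)"
    using assms ca by (simp add: power_mult_distrib power_divide)
   also have "\<dots> \<le> 2 * (b * (z True)\<^sup>2) + 2 * (b * (z False)\<^sup>2)"
    using ca by (intro add_mono mult_left_mono mult_right_mono) auto
   finally have "(y\<^sup>2)\<^sup>2 \<le> (2 * (b * (z True)\<^sup>2) + 2 * (b * (z False)\<^sup>2))\<^sup>2" by (intro power_mono) auto
   also have "\<dots> \<le> 2 * (2 * (b * (z True)\<^sup>2))\<^sup>2 + 2 * (2 * (b * (z False)\<^sup>2))\<^sup>2" by (rule sq_add_le)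
   also have "\<dots> = 8 * b\<^sup>2 * z True ^ 4 + 8 * b\<^sup>2 * z False ^ 4"
    by (simp add: power_mult_distrib power2_eq_square power4_eq_xxxx)
   finally show ?thesis .
  qed
  finally show ?thesis by (simp add: algebra_simps)
 qed
 have iD: "integrable (gauss UNIV) ?D"
  by (intro Bochner_Integration.integrable_add integrable_mult_right zb_moments)
 have m: "(\<lambda>z. (relu2 (gpair a b c z))\<^sup>2) \<in> borel_measurable (gauss UNIV)" by measurable
 show i: "integrable (gauss UNIV) (\<lambda>z. (relu2 (gpair a b c z))\<^sup>2)"
  by (rule Bochner_Integration.integrable_bound[OF iD m]) (use le in \<open>auto intro: order_trans[OF le]\<close>)
 have "(\<integral>z. (relu2 (gpair a b c z))\<^sup>2 \<partial>gauss (UNIV::bool set)) \<le> (\<integral>z. ?D z \<partial>gauss (UNIV::bool set))"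
  by (rule integral_mono[OF i iD le])
 also have "\<dots> = (2 * a\<^sup>2 + 16 * b\<^sup>2) * 3 + 16 * b\<^sup>2 * 3"
  by (subst Bochner_Integration.integral_add) (simp_all add: zb_moments)
 finally show "(\<integral>z. (relu2 (gpair a b c z))\<^sup>2 \<partial>gauss (UNIV::bool set)) \<le> 6 * a\<^sup>2 + 96 * b\<^sup>2" by simp
qed

lemma step2_second_moment:
 shows "integrable (gauss UNIV) (\<lambda>z. (step2 (gpair a b c z))\<^sup>2)"
  "(\<integral>z. (step2 (gpair a b c z))\<^sup>2 \<partial>gauss (UNIV::bool set)) \<le> 4"
proof -
 interpret G: prob_space "gauss (UNIV::bool set)" by (rule prob_space_gauss)
 have le: "(step2 p)\<^sup>2 \<le> 4" for p
  using abs_le_square_iff[THEN iffD1, of "step2 p" 2] step2_bound[of p] by simp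
 show i: "integrable (gauss UNIV) (\<lambda>z. (step2 (gpair a b c z))\<^sup>2)"
  by (rule G.integrable_const_bound[of _ 4]) (use le in auto)
 have "(\<integral>z. (step2 (gpair a b c z))\<^sup>2 \<partial>gauss (UNIV::bool set)) \<le> (\<integral>z. 4 \<partial>gauss (UNIV::bool set))"
  by (intro integral_mono i le) simp
 then show "(\<integral>z. (step2 (gpair a b c z))\<^sup>2 \<partial>gauss (UNIV::bool set)) \<le> 4" by (simp add: G.prob_space)
qed

lemma gpair_tendsto:
 assumes "A \<longlonglongrightarrow> 1" "B \<longlonglongrightarrow> 1" "C \<longlonglongrightarrow> c"
 shows "(\<lambda>n. gpair (A n) (B n) (C n) z) \<longlonglongrightarrow> gpair 1 1 c z"
 unfolding gpair_def using assms by (intro tendsto_intros) auto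

text \<open>Dominated convergence. A triple near \<open>(1, 1, c)\<close> need not be a covariance
  matrix, for instance if \<open>c = 1\<close>; but \<open>sqrt\<close> is continuous on the whole
  real line, so \<open>gpair\<close> converges pointwise anyway, and its coefficients are bounded
  along the sequence. Continuity of \<open>f\<close> is required only almost everywhere at the
  limit, which admits the step function.\<close>

lemma isCont_psi:
 assumes f[measurable]: "f \<in> borel_measurable borel"
  and cont: "AE z in gauss UNIV. isCont f (gpair 1 1 c z)"
  and bd: "\<And>p. \<bar>f p\<bar> \<le> 2 + (fst p)\<^sup>2 + (snd p)\<^sup>2"
 shows "isCont (\<lambda>(a, b, c). psi f a b c) (1, 1, c)"
proof (rule continuous_at_sequentiallyI)
 fix s :: "nat => real \<times> real \<times> real" assume s: "s \<longlonglongrightarrow> (1, 1, c)"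
 define A B C where "A n = fst (s n)" and "B n = fst (snd (s n))" and "C n = snd (snd (s n))" for n
 have lim: "A \<longlonglongrightarrow> 1" "B \<longlonglongrightarrow> 1" "C \<longlonglongrightarrow> c"
  unfolding A_def B_def C_def
  using tendsto_fst[OF s] tendsto_fst[OF tendsto_snd[OF s]] tendsto_snd[OF tendsto_snd[OF s]] by simp_all
 have "(\<lambda>n. \<bar>A n\<bar>) \<longlonglongrightarrow> \<bar>1\<bar>" "(\<lambda>n. (C n / sqrt (A n))\<^sup>2) \<longlonglongrightarrow> (c / sqrt 1)\<^sup>2" "(\<lambda>n. (sqrt (B n - (C n)\<^sup>2 / A n))\<^sup>2) \<longlonglongrightarrow> (sqrt (1 - c\<^sup>2 / 1))\<^sup>2"
  using lim by (intro tendsto_intros; simp)+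
 then have "Bseq (\<lambda>n. \<bar>A n\<bar>)" "Bseq (\<lambda>n. (C n / sqrt (A n))\<^sup>2)" "Bseq (\<lambda>n. (sqrt (B n - (C n)\<^sup>2 / A n))\<^sup>2)"
  by (blast intro: convergent_imp_Bseq convergentI)+
 then obtain K1 K2 K3 where K: "\<And>n. \<bar>A n\<bar> \<le> K1" "\<And>n. (C n / sqrt (A n))\<^sup>2 \<le> K2" "\<And>n. (sqrt (B n - (C n)\<^sup>2 / A n))\<^sup>2 \<le> K3"
  unfolding Bseq_def by fastforce
 have "(\<lambda>n. psi f (A n) (B n) (C n)) \<longlonglongrightarrow> psi f 1 1 c"
  unfolding psi_def
 proof (rule integral_dominated_convergence)
  let ?D = "\<lambda>z::bool=>real. 2 + K1 * (z True)\<^sup>2 + (2 * K2 * (z True)\<^sup>2 + 2 * K3 * (z False)\<^sup>2)"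
  interpret G: prob_space "gauss (UNIV::bool set)" by (rule prob_space_gauss)
  show "integrable (gauss UNIV) ?D"
   by (intro Bochner_Integration.integrable_add integrable_mult_right zb_moments) simp
  show "AE z in gauss UNIV. (\<lambda>n. f (gpair (A n) (B n) (C n) z)) \<longlonglongrightarrow> f (gpair 1 1 c z)"
   using cont by eventually_elim (rule isCont_tendsto_compose[OF _ gpair_tendsto[OF lim]])
  show "AE z in gauss UNIV. norm (f (gpair (A n) (B n) (C n) z)) \<le> ?D z" for n
  proof (rule AE_I2)
   fix z :: "bool => real"
   have "\<bar>f (gpair (A n) (B n) (C n) z)\<bar> \<le> 2 + (sqrt (A n) * z True)\<^sup>2 + (C n / sqrt (A n) * z True + sqrt (B n - (C n)\<^sup>2 / A n) * z False)\<^sup>2"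
    using bd[of "gpair (A n) (B n) (C n) z"] by (simp add: gpair_def)
   also have "(sqrt (A n) * z True)\<^sup>2 \<le> K1 * (z True)\<^sup>2"
   proof -
    have "(sqrt (A n))\<^sup>2 = \<bar>A n\<bar>" by (cases "A n \<ge> 0") (auto simp: real_sqrt_minus[symmetric] power2_eq_square)
    then show ?thesis using K(1)[of n] by (simp add: power_mult_distrib mult_right_mono)
   qed
   also have "(C n / sqrt (A n) * z True + sqrt (B n - (C n)\<^sup>2 / A n) * z False)\<^sup>2 \<le>
    2 * ((C n / sqrt (A n))\<^sup>2 * (z True)\<^sup>2) + 2 * ((sqrt (B n - (C n)\<^sup>2 / A n))\<^sup>2 * (z False)\<^sup>2)"
    using sq_add_le[of "C n / sqrt (A n) * z True" "sqrt (B n - (C n)\<^sup>2 / A n) * z False"] unfolding power_mult_distrib .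
   also have "\<dots> \<le> 2 * (K2 * (z True)\<^sup>2) + 2 * (K3 * (z False)\<^sup>2)"
    using K(2,3)[of n] by (intro add_mono mult_left_mono mult_right_mono) auto
   finally show "norm (f (gpair (A n) (B n) (C n) z)) \<le> ?D z" by (simp add: mult.assoc)
  qed
 qed measurable
 then show "(\<lambda>n. case s n of (a, b, c) => psi f a b c) \<longlonglongrightarrow> (case (1, 1, c) of (a, b, c) => psi f a b c)"
  by (simp add: A_def B_def C_def case_prod_beta)
qed

lemma isCont_psi_relu2: "isCont (\<lambda>(a, b, c). psi relu2 a b c) (1, 1, c)"
proof (rule isCont_psi)
 have "isCont relu2 p" for p
  unfolding relu2_def[abs_def] relu_def[abs_def] by (intro continuous_intros)
 then show "AE z in gauss UNIV. isCont relu2 (gpair 1 1 c z)" by simp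
 show "\<bar>relu2 p\<bar> \<le> 2 + (fst p)\<^sup>2 + (snd p)\<^sup>2" for p using relu2_bound[of p] by simp
qed simp

lemma isCont_heaviside: "u \<noteq> 0 ==> isCont heaviside u"
proof -
 assume "u \<noteq> 0"
 then have "eventually (\<lambda>v. heaviside v = heaviside u) (nhds u)"
 proof (cases "u > 0")
  case True
  then have "eventually (\<lambda>v. v > 0) (nhds u)" by (simp add: eventually_nhds_in_open[of "{0<..}" u, simplified])
  then show ?thesis by eventually_elim (use True in \<open>simp add: heaviside_def\<close>)
 next
  case False
  with \<open>u \<noteq> 0\<close> have "eventually (\<lambda>v. v < 0) (nhds u)" by (simp add: eventually_nhds_in_open[of "{..<0}" u, simplified])
  then show ?thesis by eventually_elim (use False in \<open>simp add: heaviside_def\<close>)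
 qed
 then show ?thesis by (subst isCont_cong[where g="\<lambda>_. heaviside u"]) auto
qed

lemma AE_gpair_nz:
 assumes "c\<^sup>2 \<le> 1"
 shows "AE z in gauss UNIV. fst (gpair 1 1 c z) \<noteq> 0 \<and> snd (gpair 1 1 c z) \<noteq> 0"
proof -
 have "AE z in gauss UNIV. (\<Sum>i\<in>(UNIV::bool set). (if i then c else sqrt (1 - c\<^sup>2)) * z (id i)) \<noteq> 0"
  by (rule AE_gauss_linear_nz) (use assms in \<open>auto simp: UNIV_bool\<close>)
 then show ?thesis using AE_gauss_component_nz[OF UNIV_I[of True]]
  by eventually_elim (simp add: gpair_def UNIV_bool add.commute)
qed

lemma isCont_psi_step2:
 assumes "c\<^sup>2 \<le> 1"
 shows "isCont (\<lambda>(a, b, c). psi step2 a b c) (1, 1, c)"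
proof (rule isCont_psi)
 show "AE z in gauss UNIV. isCont step2 (gpair 1 1 c z)"
  using AE_gpair_nz[OF assms]
 proof eventually_elim
  case (elim z)
  then have "isCont (\<lambda>p. heaviside (fst p)) (gpair 1 1 c z)" "isCont (\<lambda>p. heaviside (snd p)) (gpair 1 1 c z)"
   by (auto intro!: isCont_o2[OF _ isCont_heaviside] continuous_intros)
  then show ?case unfolding step2_def[abs_def] by (intro continuous_intros)
 qed
 show "\<bar>step2 p\<bar> \<le> 2 + (fst p)\<^sup>2 + (snd p)\<^sup>2" for p
  using step2_bound[of p] zero_le_power2[of "fst p"] zero_le_power2[of "snd p"] by linarith
qed simp

text \<open>The normalised arc-cosine kernels of order 1 and 0, as functions of the cosine of the
  angle. The bounds below come from their form as Gaussian expectations and not from the closed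
  formulas in the angle.\<close>

definition kap1 :: "real => real" where "kap1 c = psi relu2 1 1 c"
definition kap0 :: "real => real" where "kap0 c = psi step2 1 1 c"

lemma expectation_unit_combination:
 assumes "\<alpha>\<^sup>2 + \<beta>\<^sup>2 = 1" and g[measurable]: "g \<in> borel_measurable borel"
 shows "integrable (gauss UNIV) (\<lambda>z. g (\<alpha> * z True + \<beta> * z False)) \<longleftrightarrow> integrable (gauss UNIV) (\<lambda>z::bool=>real. g (z True) :: real)"
  "(\<integral>z. g (\<alpha> * z True + \<beta> * z False) \<partial>gauss (UNIV::bool set)) = (\<integral>z. g (z True) \<partial>gauss (UNIV::bool set))"
proof -
 have m: "(\<lambda>z. \<alpha> * z True + \<beta> * z False) \<in> borel_measurable (gauss UNIV)"
  by (intro borel_measurable_add borel_measurable_times borel_measurable_const zb_measurable)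
 have "distr (gauss UNIV) borel (\<lambda>z. \<Sum>i\<in>(UNIV::bool set). (if i then \<alpha> else \<beta>) * z (id i)) = distr (gauss UNIV) borel (\<lambda>z. sqrt (\<Sum>i\<in>(UNIV::bool set). (if i then \<alpha> else \<beta>)\<^sup>2) * z True)"
  by (rule law_linear) auto
 then have eq: "distr (gauss UNIV) borel (\<lambda>z. \<alpha> * z True + \<beta> * z False) = distr (gauss UNIV) borel (\<lambda>z::bool=>real. z True)"
  using assms(1) by (simp add: UNIV_bool add.commute)
 show "integrable (gauss UNIV) (\<lambda>z. g (\<alpha> * z True + \<beta> * z False)) \<longleftrightarrow> integrable (gauss UNIV) (\<lambda>z::bool=>real. g (z True) :: real)"
  using integrable_distr_eq[OF m g] integrable_distr_eq[OF zb_measurable[of True] g] by (simp add: eq)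
 show "(\<integral>z. g (\<alpha> * z True + \<beta> * z False) \<partial>gauss (UNIV::bool set)) = (\<integral>z. g (z True) \<partial>gauss (UNIV::bool set))"
  using integral_distr[OF m g] integral_distr[OF zb_measurable[of True] g] by (simp add: eq)
qed

text \<open>By symmetry \<open>relu\<close> has the same second moment at a normal and at its
  negative, and the two squares add up to the square of the normal.\<close>

lemma expectation_relu_sq:
 "integrable (gauss UNIV) (\<lambda>z::bool=>real. (relu (z True))\<^sup>2)" "(\<integral>z. (relu (z True))\<^sup>2 \<partial>gauss (UNIV::bool set)) = 1 / 2"
proof -
 have m: "(\<lambda>z::bool=>real. (relu (z True))\<^sup>2) \<in> borel_measurable (gauss UNIV)"
  using zb_measurable[of True] by measurable
 have b: "(relu u)\<^sup>2 \<le> u\<^sup>2" for u using relu_abs(1)[of u] by (simp add: abs_le_square_iff)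
 show i: "integrable (gauss UNIV) (\<lambda>z::bool=>real. (relu (z True))\<^sup>2)"
  by (rule Bochner_Integration.integrable_bound[OF zb_moments(1)[of True] m]) (simp add: b)
 have s: "(\<lambda>z. (relu ((-1) * z True + 0 * z False))\<^sup>2) = (\<lambda>z. (relu (- z True))\<^sup>2)" by simp
 have i': "integrable (gauss UNIV) (\<lambda>z::bool=>real. (relu (- z True))\<^sup>2)"
  and e: "(\<integral>z. (relu (- z True))\<^sup>2 \<partial>gauss (UNIV::bool set)) = (\<integral>z. (relu (z True))\<^sup>2 \<partial>gauss (UNIV::bool set))"
  using expectation_unit_combination[of "-1" 0 "\<lambda>u. (relu u)\<^sup>2"] i unfolding s by auto
 have "(\<integral>z. (relu (z True))\<^sup>2 + (relu (- z True))\<^sup>2 \<partial>gauss (UNIV::bool set)) = (\<integral>z. (z True)\<^sup>2 \<partial>gauss (UNIV::bool set))"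
  by (intro Bochner_Integration.integral_cong refl) (simp add: relu_def max_def)
 then show "(\<integral>z. (relu (z True))\<^sup>2 \<partial>gauss (UNIV::bool set)) = 1 / 2"
  using i i' e zb_moments(2)[of True] by simp
qed

text \<open>\<open>1 - kap1 c\<close> is the mean square distance of \<open>relu\<close> at two
  normals of correlation \<open>c\<close>; \<open>relu\<close> is 1-Lipschitz, and the normals
  themselves have mean square distance \<open>2 * (1 - c)\<close>.\<close>

lemma kap1_bounds:
 assumes "c\<^sup>2 \<le> 1"
 shows "0 \<le> kap1 c" "kap1 c \<le> 1" "1 - kap1 c \<le> 2 * (1 - c)"
proof -
 define s where "s = sqrt (1 - c\<^sup>2)"
 have s2: "s\<^sup>2 = 1 - c\<^sup>2" using assms by (simp add: s_def)
 let ?u = "\<lambda>z::bool=>real. z True" and ?v = "\<lambda>z::bool=>real. c * z True + s * z False"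
 have g: "gpair 1 1 c z = (?u z, ?v z)" for z by (simp add: gpair_def s_def)
 have vm: "?v \<in> borel_measurable (gauss UNIV)"
  by (intro borel_measurable_add borel_measurable_times borel_measurable_const zb_measurable)
 note um = zb_measurable[of True]
 have iu: "integrable (gauss UNIV) (\<lambda>z. (relu (?u z))\<^sup>2)" "(\<integral>z. (relu (?u z))\<^sup>2 \<partial>gauss (UNIV::bool set)) = 1/2" by (rule expectation_relu_sq)+
 have iv: "integrable (gauss UNIV) (\<lambda>z. (relu (?v z))\<^sup>2)" "(\<integral>z. (relu (?v z))\<^sup>2 \<partial>gauss (UNIV::bool set)) = 1/2"
  using expectation_unit_combination[of c s "\<lambda>u. (relu u)\<^sup>2"] s2 expectation_relu_sq by simp_all
 have muv: "(\<lambda>z. 2 * relu (?u z) * relu (?v z)) \<in> borel_measurable (gauss UNIV)"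
  using um vm by measurable
 have le: "\<bar>2 * relu (?u z) * relu (?v z)\<bar> \<le> (relu (?u z))\<^sup>2 + (relu (?v z))\<^sup>2" for z
  using sum_squares_bound[of "relu (?u z)" "relu (?v z)"] relu_abs(2) by simp
 have iuv: "integrable (gauss UNIV) (\<lambda>z. 2 * relu (?u z) * relu (?v z))"
  by (rule Bochner_Integration.integrable_bound[OF Bochner_Integration.integrable_add[OF iu(1) iv(1)] muv]) (use le in simp)
 have k: "kap1 c = (\<integral>z. 2 * relu (?u z) * relu (?v z) \<partial>gauss (UNIV::bool set))"
  unfolding kap1_def psi_def relu2_def g by simp
 show "0 \<le> kap1 c" unfolding k by (intro integral_nonneg_AE AE_I2) (simp add: relu_abs)
 have "kap1 c \<le> (\<integral>z. (relu (?u z))\<^sup>2 + (relu (?v z))\<^sup>2 \<partial>gauss (UNIV::bool set))"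
  unfolding k using le by (intro integral_mono iuv Bochner_Integration.integrable_add iu iv) (meson abs_le_D1)
 then show "kap1 c \<le> 1" using iu iv by simp
 have lip: "(relu x - relu y)\<^sup>2 \<le> (x - y)\<^sup>2" for x y
  by (simp add: abs_le_square_iff[symmetric] relu_def)
 have sqi: "(\<integral>z. (?u z - ?v z)\<^sup>2 \<partial>gauss (UNIV::bool set)) = 2 * (1 - c)" "integrable (gauss UNIV) (\<lambda>z. (?u z - ?v z)\<^sup>2)"
 proof -
  have e: "(?u z - ?v z)\<^sup>2 = (1 - c)\<^sup>2 * (z True * z True) + (s\<^sup>2 * (z False * z False) - 2 * (1 - c) * s * (z True * z False))" for z
   by (simp add: power2_eq_square algebra_simps)
  note m = gauss_mom2[of "UNIV :: bool set" True True] gauss_mom2[of "UNIV :: bool set" False False] gauss_mom2[of "UNIV :: bool set" True False]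
  show "integrable (gauss UNIV) (\<lambda>z. (?u z - ?v z)\<^sup>2)" unfolding e
   by (intro Bochner_Integration.integrable_add Bochner_Integration.integrable_diff integrable_mult_right m) simp_all
  have "(\<integral>z. (?u z - ?v z)\<^sup>2 \<partial>gauss (UNIV::bool set)) = (1 - c)\<^sup>2 + s\<^sup>2"
   unfolding e using m by simp
  then show "(\<integral>z. (?u z - ?v z)\<^sup>2 \<partial>gauss (UNIV::bool set)) = 2 * (1 - c)" unfolding s2 by (simp add: power2_eq_square algebra_simps)
 qed
 have d: "(relu (?u z) - relu (?v z))\<^sup>2 = (relu (?u z))\<^sup>2 + (relu (?v z))\<^sup>2 - 2 * relu (?u z) * relu (?v z)" for z
  by (simp add: power2_diff)
 have "1 - kap1 c = (\<integral>z. (relu (?u z) - relu (?v z))\<^sup>2 \<partial>gauss (UNIV::bool set))"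
  unfolding d k using iu iv iuv by simp
 also have "\<dots> \<le> (\<integral>z. (?u z - ?v z)\<^sup>2 \<partial>gauss (UNIV::bool set))"
  by (intro integral_mono sqi lip) (unfold d, intro Bochner_Integration.integrable_diff Bochner_Integration.integrable_add iu iv iuv)
 finally show "1 - kap1 c \<le> 2 * (1 - c)" unfolding sqi .
qed

lemma std_normal_interval_le:
 assumes "y \<ge> 0" shows "emeasure std_normal_distribution {0<..y} \<le> ennreal y"
proof -
 have d: "std_normal_density x \<le> 1" for x
 proof -
  have "1 / sqrt (2 * pi) \<le> 1" using pi_gt3 by simp
  moreover have "exp (- x\<^sup>2 / 2) \<le> 1" by simp
  ultimately show ?thesis unfolding std_normal_density_def using mult_mono[of "1 / sqrt (2 * pi)" 1 "exp (- x\<^sup>2 / 2)" 1] by simp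
 qed
 have "emeasure std_normal_distribution {0<..y} = (\<integral>\<^sup>+x. ennreal (std_normal_density x) * indicator {0<..y} x \<partial>lborel)"
  by (subst emeasure_density) auto
 also have "\<dots> \<le> (\<integral>\<^sup>+x. indicator {0<..y} x \<partial>lborel)"
  by (intro nn_integral_mono) (use d in \<open>auto simp: indicator_def\<close>)
 also have "\<dots> = ennreal y" using assms by simp
 finally show ?thesis .
qed

lemma wedge_sets: "{z \<in> space (gauss (UNIV::bool set)). 0 < z True \<and> z True \<le> r * \<bar>z False\<bar>} \<in> sets (gauss UNIV)"
 by (intro sets.sets_Collect_conj borel_measurable_less borel_measurable_le borel_measurable_const
   borel_measurable_times borel_measurable_abs zb_measurable)

text \<open>Given \<open>z False\<close>, the event is an interval of length
  \<open>r * \<bar>z False\<bar>\<close>, on which the density is at most 1; and a normal has mean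
  absolute value at most 1, since twice the absolute value is at most 1 plus the square.\<close>

lemma gauss_wedge:
 assumes "r \<ge> 0"
 shows "measure (gauss UNIV) {z \<in> space (gauss (UNIV::bool set)). 0 < z True \<and> z True \<le> r * \<bar>z False\<bar>} \<le> r"
proof -
 interpret G: prob_space "gauss (UNIV::bool set)" by (rule prob_space_gauss)
 let ?S = "{z \<in> space (gauss (UNIV::bool set)). 0 < z True \<and> z True \<le> r * \<bar>z False\<bar>}"
 have S: "?S \<in> sets (gauss UNIV)" by (rule wedge_sets)
 have "emeasure (gauss UNIV) ?S = (\<integral>\<^sup>+z. indicator ?S z \<partial>gauss (UNIV::bool set))" using S by simp
 also have "\<dots> = (\<integral>\<^sup>+W. (\<integral>\<^sup>+w. indicator ?S (override {True} W w) \<partial>gauss {True}) \<partial>gauss (UNIV::bool set))"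
  by (rule nn_integral_gauss_resample) (use S in auto)
 also have "\<dots> \<le> (\<integral>\<^sup>+W. ennreal (r * \<bar>W False\<bar>) \<partial>gauss (UNIV::bool set))"
 proof (rule nn_integral_mono)
  fix W :: "bool => real"
  have "(\<integral>\<^sup>+w. indicator ?S (override {True} W w) \<partial>gauss {True}) = (\<integral>\<^sup>+w. indicator {0<..r * \<bar>W False\<bar>} (w True) \<partial>gauss {True})"
   by (intro nn_integral_cong) (auto simp: override_def indicator_def space_gauss)
  also have "\<dots> = (\<integral>\<^sup>+x. indicator {0<..r * \<bar>W False\<bar>} x \<partial>distr (gauss {True}) std_normal_distribution (\<lambda>w. w True))"
   by (subst nn_integral_distr) (auto intro: gauss_component)
  also have "distr (gauss {True}) std_normal_distribution (\<lambda>w. w True) = std_normal_distribution"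
   by (rule distr_PiM_component) (auto simp: prob_space_normal_density)
  also have "(\<integral>\<^sup>+x. indicator {0<..r * \<bar>W False\<bar>} x \<partial>std_normal_distribution) = emeasure std_normal_distribution {0<..r * \<bar>W False\<bar>}"
   by (subst nn_integral_indicator) auto
  also have "\<dots> \<le> ennreal (r * \<bar>W False\<bar>)" using assms by (intro std_normal_interval_le) simp
  finally show "(\<integral>\<^sup>+w. indicator ?S (override {True} W w) \<partial>gauss {True}) \<le> ennreal (r * \<bar>W False\<bar>)" .
 qed
 also have "\<dots> \<le> (\<integral>\<^sup>+W. ennreal (r / 2 + r / 2 * (W False)\<^sup>2) \<partial>gauss (UNIV::bool set))"
 proof (intro nn_integral_mono ennreal_leI)
  fix W :: "bool => real"
  have "2 * \<bar>W False\<bar> \<le> 1 + (W False)\<^sup>2" using sum_squares_bound[of 1 "\<bar>W False\<bar>"] by simp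
  from mult_left_mono[OF this assms] show "r * \<bar>W False\<bar> \<le> r / 2 + r / 2 * (W False)\<^sup>2" by (simp add: algebra_simps)
 qed
 also have "\<dots> = ennreal (\<integral>W. r / 2 + r / 2 * (W False)\<^sup>2 \<partial>gauss (UNIV::bool set))"
  using assms by (intro nn_integral_eq_integral Bochner_Integration.integrable_add integrable_mult_right zb_moments) auto
 also have "(\<integral>W. r / 2 + r / 2 * (W False)\<^sup>2 \<partial>gauss (UNIV::bool set)) = r"
  using zb_moments(1,2)[of False] by (simp add: G.prob_space)
 finally show ?thesis using assms by (simp add: G.emeasure_eq_measure)
qed

text \<open>The product of the two step functions differs from the first one only where
  \<open>u\<close> is positive and \<open>v\<close> is not. This is a wedge whose angle is of order
  \<open>sqrt (1 - c)\<close>, the source of the square root in the modulus of continuity of the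
  kernel.\<close>

lemma kap0_bounds:
 assumes "c\<^sup>2 \<le> 1"
 shows "0 \<le> kap0 c" "kap0 c \<le> 1" "1 - kap0 c \<le> 8 * sqrt (1 - c)"
proof -
 interpret G: prob_space "gauss (UNIV::bool set)" by (rule prob_space_gauss)
 define s where "s = sqrt (1 - c\<^sup>2)"
 have c1: "\<bar>c\<bar> \<le> 1" using assms by (simp add: abs_square_le_1)
 let ?u = "\<lambda>z::bool=>real. z True" and ?v = "\<lambda>z::bool=>real. c * z True + s * z False"
 have g: "gpair 1 1 c z = (?u z, ?v z)" for z by (simp add: gpair_def s_def)
 have vm: "?v \<in> borel_measurable (gauss UNIV)"
  by (intro borel_measurable_add borel_measurable_times borel_measurable_const zb_measurable)
 note um = zb_measurable[of True]
 have mh: "(\<lambda>z. heaviside (?u z)) \<in> borel_measurable (gauss UNIV)" "(\<lambda>z. heaviside (?v z)) \<in> borel_measurable (gauss UNIV)"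
  using um vm by measurable
 have iu: "integrable (gauss UNIV) (\<lambda>z. heaviside (?u z))"
  by (rule G.integrable_const_bound[of _ 1]) (use mh heaviside_01 in auto)
 have iuv: "integrable (gauss UNIV) (\<lambda>z. heaviside (?u z) * heaviside (?v z))"
 proof (rule G.integrable_const_bound[of _ 1])
  show "AE z in gauss UNIV. norm (heaviside (?u z) * heaviside (?v z)) \<le> 1"
   using mult_mono[OF heaviside_01(2) heaviside_01(2)] heaviside_01(1) by (simp add: abs_mult)
 qed (use mh in measurable)
 have half: "(\<integral>z. heaviside (?u z) \<partial>gauss (UNIV::bool set)) = 1 / 2"
 proof -
  have e: "(\<integral>z. heaviside ((-1) * z True + 0 * z False) \<partial>gauss (UNIV::bool set)) = (\<integral>z. heaviside (?u z) \<partial>gauss (UNIV::bool set))"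
   and i: "integrable (gauss UNIV) (\<lambda>z. heaviside ((-1) * z True + 0 * z False))"
   using expectation_unit_combination[of "-1" 0 heaviside] iu by auto
  have "(\<integral>z. heaviside (?u z) + heaviside ((-1) * z True + 0 * z False) \<partial>gauss (UNIV::bool set)) = (\<integral>z. 1 \<partial>gauss (UNIV::bool set))"
  proof (rule integral_cong_AE)
   show "AE z in gauss (UNIV::bool set). heaviside (?u z) + heaviside ((-1) * z True + 0 * z False) = 1"
    using AE_gauss_component_nz[OF UNIV_I[of True]] by eventually_elim (auto simp: heaviside_def)
  qed (use iu i in \<open>auto intro!: borel_measurable_add borel_measurable_integrable\<close>)
  then show ?thesis using e i iu by (simp add: G.prob_space)
 qed
 have k: "kap0 c = 2 * (\<integral>z. heaviside (?u z) * heaviside (?v z) \<partial>gauss (UNIV::bool set))"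
  unfolding kap0_def psi_def step2_def g by (simp add: mult.assoc)
 show "0 \<le> kap0 c" unfolding k by (intro mult_nonneg_nonneg integral_nonneg_AE AE_I2) (auto simp: heaviside_01)
 have "(\<integral>z. heaviside (?u z) * heaviside (?v z) \<partial>gauss (UNIV::bool set)) \<le> (\<integral>z. heaviside (?u z) \<partial>gauss (UNIV::bool set))"
  by (intro integral_mono iuv iu) (simp add: mult_left_le heaviside_01)
 then show k1: "kap0 c \<le> 1" unfolding k half by simp
 show "1 - kap0 c \<le> 8 * sqrt (1 - c)"
 \<comment> \<open>Below \<open>1 / 2\<close> the right hand side is at least 4 and there is nothing
   to show. Otherwise \<open>c * z True\<close> is at least half of \<open>z True\<close>, which
   gives the slope \<open>2 * s\<close> of the wedge.\<close>
 proof (cases "c \<ge> 1 / 2")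
  case False
  then have "sqrt (1 / 4) \<le> sqrt (1 - c)" by (intro real_sqrt_le_mono) auto
  moreover have "sqrt (1 / 4) = (1 / 2 :: real)" by (simp add: real_sqrt_divide)
  ultimately show ?thesis using \<open>0 \<le> kap0 c\<close> by simp
 next
  case True
  let ?S = "{z \<in> space (gauss (UNIV::bool set)). 0 < z True \<and> z True \<le> (2 * s) * \<bar>z False\<bar>}"
  have S: "?S \<in> sets (gauss UNIV)" by (rule wedge_sets)
  have s0: "s \<ge> 0" using assms by (simp add: s_def)
  have e1: "1 - kap0 c = 2 * (\<integral>z. heaviside (?u z) - heaviside (?u z) * heaviside (?v z) \<partial>gauss (UNIV::bool set))"
   unfolding k using iu iuv half by simp
  have e2: "(\<integral>z. heaviside (?u z) - heaviside (?u z) * heaviside (?v z) \<partial>gauss (UNIV::bool set)) \<le> (\<integral>z. indicator ?S z \<partial>gauss (UNIV::bool set))"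
  proof (rule integral_mono)
   show "integrable (gauss UNIV) (indicator ?S :: _ => real)"
    by (rule integrable_real_indicator[OF S]) (simp add: G.emeasure_eq_measure)
   fix z assume z: "z \<in> space (gauss (UNIV::bool set))"
   show "heaviside (?u z) - heaviside (?u z) * heaviside (?v z) \<le> indicator ?S z"
   proof (cases "z True > 0 \<and> ?v z \<le> 0")
    case True
    have "z True / 2 \<le> c * z True" using True \<open>c \<ge> 1/2\<close> by simp
    also have "\<dots> \<le> - (s * z False)" using True by simp
    also have "\<dots> \<le> s * \<bar>z False\<bar>" using s0 by (metis abs_ge_minus_self mult_left_mono mult_minus_right)
    finally have "z \<in> ?S" using True z by simp
    then show ?thesis by (simp add: heaviside_def)
   next
    case False
    then show ?thesis by (auto simp: heaviside_def indicator_def)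
   qed
  qed (intro Bochner_Integration.integrable_diff iu iuv)
  have "(\<integral>z. indicator ?S z \<partial>gauss (UNIV::bool set)) = measure (gauss UNIV) ?S"
   unfolding Bochner_Integration.integral_indicator sets.Int_space_eq2[OF S] ..
  moreover have "measure (gauss UNIV) ?S \<le> 2 * s" using s0 by (intro gauss_wedge) simp
  ultimately have "1 - kap0 c \<le> 4 * s" using e1 e2 by linarith
  also have "s \<le> 2 * sqrt (1 - c)"
  proof -
   have "s = sqrt ((1 - c) * (1 + c))" by (simp add: s_def power2_eq_square algebra_simps)
   also have "\<dots> \<le> sqrt ((1 - c) * 4)" using c1 by (intro real_sqrt_le_mono mult_left_mono) auto
   also have "\<dots> = 2 * sqrt (1 - c)" by (simp only: real_sqrt_mult real_sqrt_four mult.commute)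
   finally show ?thesis .
  qed
  finally show ?thesis by simp
 qed
qed

section \<open>The limit kernel as a function of the cosine\<close>

fun krho :: "real => nat => real" where
 "krho u 0 = u"
| "krho u (Suc l) = kap1 (krho u l)"

text \<open>\<open>krho u l\<close> is the limit of \<open>gram\<close> at layer
  \<open>Suc l\<close>, and \<open>kth u l\<close> that of the diagonal of \<open>tangent\<close> at
  layer \<open>l\<close>; hence the shifted index. At \<open>l = 0\<close> the truncated subtraction
  is harmless since \<open>kth u 0 = 0\<close>.\<close>

fun kth :: "real => nat => real" where
 "kth u 0 = 0"
| "kth u (Suc l) = krho u l + kap0 (krho u (l - 1)) * kth u l"

lemma krho_bounds:
 assumes "\<bar>u\<bar> \<le> 1"
 shows "\<bar>krho u l\<bar> \<le> 1" "(krho u l)\<^sup>2 \<le> 1" "1 - krho u l \<le> 2 ^ l * (1 - u)"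
proof -
 have "\<bar>krho u l\<bar> \<le> 1 \<and> 1 - krho u l \<le> 2 ^ l * (1 - u)"
 proof (induction l)
  case 0
  then show ?case using assms by simp
 next
  case (Suc l)
  then have "(krho u l)\<^sup>2 \<le> 1" by (simp add: abs_square_le_1)
  from kap1_bounds[OF this] Suc show ?case by simp
 qed
 then show "\<bar>krho u l\<bar> \<le> 1" "1 - krho u l \<le> 2 ^ l * (1 - u)" by auto
 then show "(krho u l)\<^sup>2 \<le> 1" by (simp add: abs_square_le_1)
qed

lemma kth_abs_le:
 assumes "\<bar>u\<bar> \<le> 1"
 shows "\<bar>kth u l\<bar> \<le> l"
proof (induction l)
 case (Suc l)
 note k = kap0_bounds[OF krho_bounds(2)[OF assms, of "l - 1"]]
 have "\<bar>kap0 (krho u (l - 1)) * kth u l\<bar> \<le> 1 * real l"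
  unfolding abs_mult using Suc k by (intro mult_mono) auto
 then show ?case using krho_bounds(1)[OF assms, of l] by simp
qed simp

text \<open>Errors add up over the layers. \<open>krho\<close> contributes a multiple of
  \<open>1 - u\<close>, which is at most \<open>2 * sqrt (1 - u)\<close>; \<open>kap0\<close>
  contributes a multiple of \<open>sqrt (1 - u)\<close>, multiplied by \<open>kth u l\<close>, which
  is at most \<open>l\<close>; the rest is the previous layer. These are the three summands of
  \<open>C'\<close>.\<close>

lemma kth_defect:
 "\<exists>C\<ge>0. \<forall>u. \<bar>u\<bar> \<le> 1 \<longrightarrow> l - kth u l \<le> C * sqrt (1 - u)"
proof (induction l)
 case 0
 then show ?case by (intro exI[of _ 0]) simp
next
 case (Suc l)
 then obtain C where C: "C \<ge> 0" "\<And>u. \<bar>u\<bar> \<le> 1 ==> l - kth u l \<le> C * sqrt (1 - u)" by auto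
 define C' where "C' = 2 ^ l * 2 + 8 * 2 ^ l * l + C"
 have "Suc l - kth u (Suc l) \<le> C' * sqrt (1 - u)" if u: "\<bar>u\<bar> \<le> 1" for u
 proof -
  note k = kap0_bounds[OF krho_bounds(2)[OF u, of "l - 1"]]
  define q where "q = sqrt (1 - u)"
  have q0: "q \<ge> 0" and q2: "1 - u = q * q" using u by (auto simp: q_def)
  have "q \<le> sqrt 4" unfolding q_def using u by (intro real_sqrt_le_mono) auto
  then have q2': "q \<le> 2" by simp
  have 1: "1 - krho u l \<le> 2 ^ l * 2 * q"
  proof -
   have "1 - krho u l \<le> 2 ^ l * (q * q)" using krho_bounds(3)[OF u, of l] q2 by simp
   also have "\<dots> \<le> 2 ^ l * (2 * q)" using q2' q0 by (intro mult_left_mono mult_right_mono) auto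
   finally show ?thesis by simp
  qed
  have 2: "1 - kap0 (krho u (l - 1)) \<le> 8 * 2 ^ l * q"
  proof -
   have "1 - kap0 (krho u (l - 1)) \<le> 8 * sqrt (1 - krho u (l - 1))" by (rule k(3))
   also have "sqrt (1 - krho u (l - 1)) \<le> sqrt ((2 ^ l)\<^sup>2 * (1 - u))"
   proof (rule real_sqrt_le_mono)
    have "1 - krho u (l - 1) \<le> 2 ^ (l - 1) * (1 - u)" by (rule krho_bounds(3)[OF u])
    also have "\<dots> \<le> (2 ^ l)\<^sup>2 * (1 - u)"
     using u by (intro mult_right_mono) (auto simp: power_mult[symmetric] intro!: power_increasing)
    finally show "1 - krho u (l - 1) \<le> (2 ^ l)\<^sup>2 * (1 - u)" .
   qed
   also have "\<dots> = 2 ^ l * q" by (simp add: real_sqrt_mult q_def)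
   finally show ?thesis by simp
  qed
  have "Suc l - kth u (Suc l) = (1 - krho u l) + (1 - kap0 (krho u (l - 1))) * kth u l + (l - kth u l)"
   by (simp add: algebra_simps)
  also have "(1 - kap0 (krho u (l - 1))) * kth u l \<le> (8 * 2 ^ l * q) * l"
  proof -
   have "(1 - kap0 (krho u (l - 1))) * kth u l \<le> (1 - kap0 (krho u (l - 1))) * l"
    using k(2) kth_abs_le[OF u, of l] by (intro mult_left_mono) auto
   also have "\<dots> \<le> (8 * 2 ^ l * q) * l" using 2 by (intro mult_right_mono) auto
   finally show ?thesis .
  qed
  also have "l - kth u l \<le> C * q" using C(2)[OF u] by (simp add: q_def)
  also note 1
  finally show ?thesis by (simp add: C'_def q_def algebra_simps)
 qed
 moreover have "C' \<ge> 0" using C(1) by (simp add: C'_def)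
 ultimately show ?case by blast
qed

text \<open>At \<open>u = 1\<close> the bound on the defect is 0, so the value follows without
  evaluating \<open>kap0\<close> or \<open>kap1\<close> anywhere.\<close>

lemma kth_1: "kth 1 l = l"
proof -
 obtain C where "\<forall>u. \<bar>u\<bar> \<le> 1 \<longrightarrow> l - kth u l \<le> C * sqrt (1 - u)" using kth_defect[of l] by blast
 from this[rule_format, of 1] have "l \<le> kth 1 l" by simp
 moreover have "kth 1 l \<le> l" using kth_abs_le[of 1 l] by simp
 ultimately show ?thesis by simp
qed

section \<open>The infinite-width limit\<close>

lemma inp_cong: "(\<And>p. fst p < l ==> W p = W' p) ==> inp d m W x l j = inp d m W' x l j"
proof (induction l arbitrary: j)
 case (Suc l)
 then show ?case by (cases l) (auto intro!: arg_cong[where f=relu] sum.cong arg_cong2[where f="(*)"])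
qed simp

lemma pre_cong: "(\<And>p. fst p \<le> l ==> W p = W' p) ==> pre d m W x l i = pre d m W' x l i"
 unfolding pre_def by (intro sum.cong refl arg_cong2[where f="(*)"] inp_cong) auto

lemma gram_cong: "(\<And>p. fst p < l ==> W p = W' p) ==> gram d m W x x' l = gram d m W' x x' l"
 unfolding gram_def by (intro sum.cong refl arg_cong2[where f="(*)"] inp_cong) auto

lemma tangent_cong: "(\<And>p. fst p \<le> l ==> W p = W' p) ==> tangent d m W x x' l k k' = tangent d m W' x x' l k k'"
proof (induction l arbitrary: k k')
 case (Suc l)
 then have t: "tangent d m W x x' l i j = tangent d m W' x x' l i j" for i j by simp
 have g: "gram d m W x x' (Suc l) = gram d m W' x x' (Suc l)" using Suc.prems by (intro gram_cong) auto
 have p: "pre d m W y l i = pre d m W' y l i" for y i using Suc.prems by (intro pre_cong) auto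
 have w: "W (Suc l, i, j) = W' (Suc l, i, j)" for i j using Suc.prems by simp
 show ?case unfolding tangent.simps t g p w ..
qed simp

definition layer :: "nat => nat => nat => nat => (nat \<times> nat \<times> nat) set" where
 "layer d L m l = {l} \<times> ({..<layer_rows L m l} \<times> {..<layer_cols d m l})"

lemma finite_params: "finite (params d L m)" by (simp add: params_def)
lemma finite_layer: "finite (layer d L m l)" by (simp add: layer_def)
lemma layer_subset: "1 \<le> l ==> l \<le> Suc L ==> layer d L m l \<subseteq> params d L m"
 by (auto simp: layer_def params_def)

lemma override_layer_neq: "fst p \<noteq> l ==> override (layer d L m l) W w p = W p"
 by (auto simp: override_def layer_def)
lemma override_layer_eq: "i < layer_rows L m l ==> j < layer_cols d m l ==> override (layer d L m l) W w (l, i, j) = w (l, i, j)"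
 by (auto simp: override_def layer_def)

lemma inp_override: "k \<le> l ==> inp d m (override (layer d L m l) W w) x k j = inp d m W x k j"
 by (rule inp_cong) (auto intro: override_layer_neq)
lemma gram_override: "k \<le> l ==> gram d m (override (layer d L m l) W w) x x' k = gram d m W x x' k"
 by (rule gram_cong) (auto intro: override_layer_neq)
lemma pre_override_less: "k < l ==> pre d m (override (layer d L m l) W w) x k i = pre d m W x k i"
 by (rule pre_cong) (auto intro: override_layer_neq)
lemma tangent_override: "k < l ==> tangent d m (override (layer d L m l) W w) x x' k i j = tangent d m W x x' k i j"
 by (rule tangent_cong) (auto intro: override_layer_neq)
lemma pre_override: "i < layer_rows L m l ==>
 pre d m (override (layer d L m l) W w) x l i = (\<Sum>j<layer_cols d m l. inp d m W x l j * w (l, i, j))"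
 unfolding pre_def by (intro sum.cong) (auto simp: inp_override override_layer_eq)

lemma weight_measurable:
 "1 \<le> l ==> l \<le> Suc L ==> i < layer_rows L m l ==> j < layer_cols d m l ==> (\<lambda>W. W (l, i, j)) \<in> borel_measurable (gauss (params d L m))"
 by (rule gauss_component) (auto simp: params_def)

lemma inp_measurable:
 "l \<le> Suc L ==> j < layer_cols d m l ==> (\<lambda>W. inp d m W x l j) \<in> borel_measurable (gauss (params d L m))"
proof (induction l arbitrary: j)
 case (Suc l)
 show ?case
 proof (cases l)
  case (Suc k)
  have "j < layer_rows L m l" using Suc Suc.prems by (simp add: layer_cols_def layer_rows_def split: if_splits)
  then show ?thesis
   using Suc Suc.prems Suc.IH
   by (auto intro!: borel_measurable_times borel_measurable_sum measurable_compose[OF _ relu_measurable] weight_measurable simp del: One_nat_def)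
 qed simp
qed simp

lemma pre_measurable:
 assumes "l \<le> Suc L" "i < layer_rows L m l"
 shows "(\<lambda>W. pre d m W x l i) \<in> borel_measurable (gauss (params d L m))"
proof (cases "l = 0")
 case True
 then show ?thesis by (simp add: pre_def)
next
 case False
 then show ?thesis unfolding pre_def using assms
  by (intro borel_measurable_times borel_measurable_sum weight_measurable inp_measurable) auto
qed

lemma gram_measurable:
 "l \<le> Suc L ==> (\<lambda>W. gram d m W x x' l) \<in> borel_measurable (gauss (params d L m))"
 unfolding gram_def by (intro borel_measurable_times borel_measurable_sum inp_measurable) auto

lemma heaviside_pre_measurable:
 "l \<le> L ==> i < m ==> (\<lambda>W. heaviside (pre d m W x l i)) \<in> borel_measurable (gauss (params d L m))"
 by (intro measurable_compose[OF _ heaviside_measurable] pre_measurable) (auto simp: layer_rows_def)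

lemma tangent_measurable:
 "l \<le> Suc L ==> k < layer_rows L m l ==> k' < layer_rows L m l ==>
 (\<lambda>W. tangent d m W x x' l k k') \<in> borel_measurable (gauss (params d L m))"
proof (induction l arbitrary: k k')
 case (Suc l)
 show ?case
 proof (cases "l = 0")
  case True
  then show ?thesis using gram_measurable[of "Suc 0" L d m x x'] by (auto intro!: borel_measurable_times)
 next
  case False
  then have "layer_cols d m (Suc l) = m" "layer_rows L m l = m" using Suc.prems by (auto simp: layer_cols_def layer_rows_def)
  then show ?thesis unfolding tangent.simps using Suc False
   by (intro borel_measurable_add borel_measurable_times borel_measurable_sum borel_measurable_const gram_measurable heaviside_pre_measurable weight_measurable) auto
 qed
qed simp

lemma psi_measurable:
 assumes f: "f \<in> borel_measurable borel"
  and A: "A \<in> borel_measurable M" and B: "B \<in> borel_measurable M" and C: "C \<in> borel_measurable M"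
 shows "(\<lambda>W. psi f (A W) (B W) (C W)) \<in> borel_measurable M"
proof -
 interpret G: prob_space "gauss (UNIV::bool set)" by (rule prob_space_gauss)
 have Z: "(\<lambda>p. snd p b) \<in> borel_measurable (M \<Otimes>\<^sub>M gauss (UNIV::bool set))" for b
  by (rule measurable_compose[OF measurable_snd zb_measurable])
 have q: "(\<lambda>p. sqrt (h p)) \<in> borel_measurable (M \<Otimes>\<^sub>M gauss (UNIV::bool set))" if "h \<in> borel_measurable (M \<Otimes>\<^sub>M gauss (UNIV::bool set))" for h
  by (rule measurable_compose[OF that]) measurable
 have F: "(\<lambda>p. h (fst p)) \<in> borel_measurable (M \<Otimes>\<^sub>M gauss (UNIV::bool set))" if "h \<in> borel_measurable M" for h :: "_ => real"
  by (rule measurable_compose[OF measurable_fst that])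
 have "(\<lambda>p. gpair (A (fst p)) (B (fst p)) (C (fst p)) (snd p)) \<in> borel_measurable (M \<Otimes>\<^sub>M gauss UNIV)"
  unfolding gpair_def
  by (intro borel_measurable_Pair borel_measurable_add borel_measurable_times borel_measurable_divide borel_measurable_diff
    borel_measurable_power q Z F A B C)
 then have "(\<lambda>(W, z). f (gpair (A W) (B W) (C W) z)) \<in> borel_measurable (M \<Otimes>\<^sub>M gauss UNIV)"
  using f by (simp add: case_prod_beta' measurable_compose)
 then show ?thesis unfolding psi_def by (rule G.borel_measurable_lebesgue_integral)
qed

lemma scalar_prod_sum: "x' \<in> carrier_vec d ==> scalar_prod x x' = (\<Sum>j<d. vec_index x j * vec_index x' j)"
 by (auto simp: scalar_prod_def atLeast0LessThan)

lemma unit_sphere_abs_le: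
 assumes "x \<in> unit_sphere d" "x' \<in> unit_sphere d"
 shows "\<bar>scalar_prod x x'\<bar> \<le> 1"
proof -
 have c: "x \<in> carrier_vec d" "x' \<in> carrier_vec d" and 1: "scalar_prod x x = 1" "scalar_prod x' x' = 1"
  using assms by (auto simp: unit_sphere_def)
 have "(\<Sum>j<d. vec_index x j * vec_index x' j)\<^sup>2 \<le> (\<Sum>j<d. (vec_index x j)\<^sup>2) * (\<Sum>j<d. (vec_index x' j)\<^sup>2)"
  by (rule Cauchy_Schwarz_ineq_sum)
 also have "\<dots> = 1" using 1 unfolding scalar_prod_sum[OF c(1)] scalar_prod_sum[OF c(2)] by (simp add: power2_eq_square)
 finally show ?thesis unfolding scalar_prod_sum[OF c(2)] by (simp add: abs_square_le_1)
qed

lemma gram_cauchy_schwarz: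
 "0 \<le> gram d m W x x l" "(gram d m W x x' l)\<^sup>2 \<le> gram d m W x x l * gram d m W x' x' l"
proof -
 show "0 \<le> gram d m W x x l" unfolding gram_def by (intro sum_nonneg) simp
 show "(gram d m W x x' l)\<^sup>2 \<le> gram d m W x x l * gram d m W x' x' l"
  using Cauchy_Schwarz_ineq_sum[of "inp d m W x l" "inp d m W x' l" "{..<layer_cols d m l}"]
  unfolding gram_def by (simp add: power2_eq_square)
qed

lemma prob_seq_init: "prob_seq (\<lambda>m. gauss (params d L m))"
 by (rule prob_seq.intro) (rule prob_space_gauss)

abbreviation init_plim :: "nat => nat => (nat => (nat \<times> nat \<times> nat => real) => real) => real => bool" where
 "init_plim d L \<equiv> plim (\<lambda>m. gauss (params d L m))"

text \<open>Given the lower layers, the average over the units has mean \<open>psi f\<close> at the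
  actual Gram matrix and variance of order 1 / m. The Gram matrix converges, and
  \<open>psi f\<close> is continuous at its limit. The moment bound is shaped to cover both
  \<open>relu2\<close>, which yields the next Gram entry, and \<open>step2\<close>, which yields the
  factor \<open>kap0\<close>.\<close>

lemma layer_lln:
 assumes k: "1 \<le> k" "k \<le> L" and f: "f \<in> borel_measurable borel"
  and cont: "isCont (\<lambda>(a, b, c). psi f a b c) (1, 1, \<rho>)"
  and mom: "\<And>a b c. 0 \<le> a ==> 0 \<le> b ==> c\<^sup>2 \<le> a * b ==> integrable (gauss UNIV) (\<lambda>z. (f (gpair a b c z))\<^sup>2) \<and>
    (\<integral>z. (f (gpair a b c z))\<^sup>2 \<partial>gauss (UNIV::bool set)) \<le> 6 * a\<^sup>2 + 96 * b\<^sup>2 + 4"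
  and g1: "init_plim d L (\<lambda>m W. gram d m W x x k) 1"
  and g2: "init_plim d L (\<lambda>m W. gram d m W x' x' k) 1"
  and g3: "init_plim d L (\<lambda>m W. gram d m W x x' k) \<rho>"
 shows "init_plim d L (\<lambda>m W. (\<Sum>i<m. f (pre d m W x k i, pre d m W x' k i)) / m) (psi f 1 1 \<rho>)"
proof -
 interpret prob_seq "\<lambda>m. gauss (params d L m)" by (rule prob_seq_init)
 let ?a = "\<lambda>m W. gram d m W x x k" and ?b = "\<lambda>m W. gram d m W x' x' k" and ?c = "\<lambda>m W. gram d m W x x' k"
 define avg where "avg m W = (\<Sum>i<m. f (pre d m W x k i, pre d m W x' k i)) / m" for m W
 define X where "X m W = (avg m W - psi f (?a m W) (?b m W) (?c m W))\<^sup>2" for m W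
 \<comment> \<open>A bound on the conditional variance. It depends on the lower layers only and
   tends to 0 in probability because the Gram entries converge.\<close>
 define g where "g m W = (6 * (?a m W)\<^sup>2 + 96 * (?b m W)\<^sup>2 + 4) / real m" for m W
 have rows: "layer_rows L m k = m" for m using k by (simp add: layer_rows_def)
 have mG: "(\<lambda>W. gram d m W y y' k) \<in> borel_measurable (gauss (params d L m))" for m y y'
  using k by (intro gram_measurable) simp
 have mp: "(\<lambda>W. psi f (?a m W) (?b m W) (?c m W)) \<in> borel_measurable (gauss (params d L m))" for m
  by (intro psi_measurable f mG)
 have mavg: "avg m \<in> borel_measurable (gauss (params d L m))" for m
  unfolding avg_def[abs_def] using k
  by (intro borel_measurable_divide borel_measurable_sum borel_measurable_const measurable_compose[OF _ f] borel_measurable_Pair pre_measurable)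
   (auto simp: layer_rows_def)
 have mX: "X m \<in> borel_measurable (gauss (params d L m))" for m
  unfolding X_def[abs_def] by (intro borel_measurable_power borel_measurable_diff mavg mp)
 have mg: "g m \<in> borel_measurable (gauss (params d L m))" for m
  unfolding g_def[abs_def] by (intro borel_measurable_divide borel_measurable_add borel_measurable_times borel_measurable_power borel_measurable_const mG)
 have "isCont (\<lambda>p. (6 * (fst p)\<^sup>2 + 96 * (fst (snd p))\<^sup>2 + 4) * snd (snd p)) (1::real, 1::real, 0::real)"
  by (intro continuous_intros)
 from plim_cont[OF g1 g2 plim_seq[OF lim_inverse_n] mG mG borel_measurable_const this]
 have g0: "plim (\<lambda>m. gauss (params d L m)) g 0" by (simp add: g_def[abs_def] divide_inverse)
 have X0: "init_plim d L X 0"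
 proof (rule plim_markov[OF g0 mg mX])
  show "0 \<le> X m W" for m W by (simp add: X_def)
  fix m :: nat and c :: real assume m: "1 \<le> m" and "c > 0"
  show "(\<integral>\<^sup>+W. ennreal (X m W) * indicator {W. g m W \<le> c} W \<partial>gauss (params d L m)) \<le> ennreal c"
  proof (rule resample_cond[OF finite_params layer_subset[OF k(1), of L d m] mX mg])
   show "k \<le> Suc L" using k by simp
   show "g m (override (layer d L m k) W w) = g m W" for W w
    by (simp add: g_def gram_override)
   fix W
   let ?g = "gpair (\<Sum>j<layer_cols d m k. (inp d m W x k j)\<^sup>2) (\<Sum>j<layer_cols d m k. (inp d m W x' k j)\<^sup>2) (\<Sum>j<layer_cols d m k. inp d m W x k j * inp d m W x' k j)"
   have ge: "?g = gpair (?a m W) (?b m W) (?c m W)" by (simp add: gram_def power2_eq_square)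
   note M = mom[OF gram_cauchy_schwarz(1,1,2), of d m W x k x']
   have "(\<integral>\<^sup>+w. ennreal (X m (override (layer d L m k) W w)) \<partial>gauss (layer d L m k)) =
    (\<integral>\<^sup>+w. ennreal (((\<Sum>i<m. f (\<Sum>j<layer_cols d m k. inp d m W x k j * w (k, i, j), \<Sum>j<layer_cols d m k. inp d m W x' k j * w (k, i, j))) / m -
     (\<integral>z. f (?g z) \<partial>gauss (UNIV::bool set)))\<^sup>2) \<partial>gauss (layer d L m k))"
   proof -
    have po: "pre d m (override (layer d L m k) W w) y k i = (\<Sum>j<layer_cols d m k. inp d m W y k j * w (k, i, j))" if "i < m" for y i w
     using that by (intro pre_override) (simp add: rows)
    have "(\<Sum>i<m. f (pre d m (override (layer d L m k) W w) x k i, pre d m (override (layer d L m k) W w) x' k i)) =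
     (\<Sum>i<m. f (\<Sum>j<layer_cols d m k. inp d m W x k j * w (k, i, j), \<Sum>j<layer_cols d m k. inp d m W x' k j * w (k, i, j)))" for w
     by (intro sum.cong refl) (simp add: po)
    then show ?thesis unfolding X_def avg_def ge by (simp add: gram_override psi_def)
   qed
   also have "\<dots> \<le> ennreal ((\<integral>z. (f (?g z))\<^sup>2 \<partial>gauss (UNIV::bool set)) / m)"
    by (rule gauss_rows_lln[OF finite_layer]) (use m M f ge in \<open>auto simp: layer_def rows inj_on_def\<close>)
   also have "\<dots> \<le> ennreal (g m W)" unfolding ge g_def using M by (intro ennreal_leI divide_right_mono) auto
   finally show "(\<integral>\<^sup>+w. ennreal (X m (override (layer d L m k) W w)) \<partial>gauss (layer d L m k)) \<le> ennreal (g m W)" .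
  qed
 qed
 have "init_plim d L (\<lambda>m W. sqrt (X m W)) (sqrt 0)"
  by (rule plim_cont1[OF X0 mX]) (intro continuous_intros)
 then have s: "init_plim d L (\<lambda>m W. sqrt (X m W)) 0" by simp
 have diff: "init_plim d L (\<lambda>m W. avg m W - psi f (?a m W) (?b m W) (?c m W)) 0"
 proof (rule plim_bound[OF s])
  show "(\<lambda>W. sqrt (X m W)) \<in> borel_measurable (gauss (params d L m))" for m
   by (rule measurable_compose[OF mX]) measurable
 qed (simp add: X_def)
 have "init_plim d L (\<lambda>m W. psi f (?a m W) (?b m W) (?c m W)) (psi f 1 1 \<rho>)"
  using plim_cont[OF g1 g2 g3 mG mG mG cont] by simp
 from plim_add[OF diff this borel_measurable_diff[OF mavg mp] mp]
 show ?thesis by (simp add: avg_def)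
qed

lemma relu2_mom: "0 \<le> a ==> 0 \<le> b ==> c\<^sup>2 \<le> a * b ==> integrable (gauss UNIV) (\<lambda>z. (relu2 (gpair a b c z))\<^sup>2) \<and>
    (\<integral>z. (relu2 (gpair a b c z))\<^sup>2 \<partial>gauss (UNIV::bool set)) \<le> 6 * a\<^sup>2 + 96 * b\<^sup>2 + 4"
 using relu2_second_moment[of a b c] by auto

lemma step2_mom: "0 \<le> a ==> 0 \<le> b ==> c\<^sup>2 \<le> a * b ==> integrable (gauss UNIV) (\<lambda>z. (step2 (gpair a b c z))\<^sup>2) \<and>
    (\<integral>z. (step2 (gpair a b c z))\<^sup>2 \<partial>gauss (UNIV::bool set)) \<le> 6 * a\<^sup>2 + 96 * b\<^sup>2 + 4"
 using step2_second_moment[of a b c] zero_le_power2[of a] zero_le_power2[of b] by (auto intro: order_trans)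

lemma krho_1: "krho 1 l = 1"
 using krho_bounds[of 1 l] by auto

text \<open>The two diagonal pairs belong to the induction hypothesis as well, since the law of
  large numbers for a layer needs the whole Gram matrix of the two inputs.\<close>

lemma gram_plim:
 assumes "x \<in> unit_sphere d" "x' \<in> unit_sphere d" "l \<le> L"
 shows "init_plim d L (\<lambda>m W. gram d m W x x' (Suc l)) (krho (scalar_prod x x') l)"
 using assms
proof (induction l arbitrary: x x')
 case 0
 interpret prob_seq "\<lambda>m. gauss (params d L m)" by (rule prob_seq_init)
 have "gram d m W x x' (Suc 0) = scalar_prod x x'" for m W
  using 0 by (simp add: gram_def layer_cols_def unit_sphere_def scalar_prod_sum[of x' d x])
 then show ?case using plim_seq[OF tendsto_const] by simp
next
 case (Suc l)
 have g: "gram d m W x x' (Suc (Suc l)) = (\<Sum>i<m. relu2 (pre d m W x (Suc l) i, pre d m W x' (Suc l) i)) / m" for m W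
 proof -
  have "inp d m W x (Suc (Suc l)) j * inp d m W x' (Suc (Suc l)) j = (sqrt (2 / m) * sqrt (2 / m)) * (relu (pre d m W x (Suc l) j) * relu (pre d m W x' (Suc l) j))" for j
  proof -
   have i: "inp d m W y (Suc (Suc l)) j = sqrt (2 / m) * relu (pre d m W y (Suc l) j)" for y
    by (rule inp_Suc) simp
   show ?thesis unfolding i by (simp only: mult_ac)
  qed
  then show ?thesis by (simp add: gram_def layer_cols_def relu2_def sum_divide_distrib mult.assoc del: inp.simps)
 qed
 have "krho (scalar_prod x x') (Suc l) = psi relu2 1 1 (krho (scalar_prod x x') l)" by (simp add: kap1_def)
 moreover have "init_plim d L (\<lambda>m W. (\<Sum>i<m. relu2 (pre d m W x (Suc l) i, pre d m W x' (Suc l) i)) / m) (psi relu2 1 1 (krho (scalar_prod x x') l))"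
  by (rule layer_lln[OF _ _ relu2_measurable isCont_psi_relu2 relu2_mom])
   (use Suc.prems Suc.IH[of x x] Suc.IH[of x' x'] Suc.IH[of x x'] in \<open>auto simp: unit_sphere_def krho_1\<close>)
 ultimately show ?case unfolding g by simp
qed

text \<open>The deviation from the conditional mean given the layers up to \<open>l\<close>: a
  product of two weights of layer \<open>Suc l\<close> has mean 1 if they are the same weight and 0
  otherwise.\<close>

definition tangent_dev :: "nat => nat => (nat \<times> nat \<times> nat => real) => real vec => real vec => nat => nat => nat => real" where
 "tangent_dev d m W x x' l k k' = tangent d m W x x' (Suc l) k k' - of_bool (k = k') * (gram d m W x x' (Suc l) +
  (\<Sum>i<m. step2 (pre d m W x l i, pre d m W x' l i) * tangent d m W x x' l i i) / m)"

text \<open>The mean square of all entries, which bounds the conditional variance at the next layer.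
  It tends to 0 although the diagonal need not, since the diagonal makes up only the fraction 1 / m
  of the entries.\<close>

definition tangent_energy :: "nat => nat => (nat \<times> nat \<times> nat => real) => real vec => real vec => nat => real" where
 "tangent_energy d m W x x' l = (\<Sum>i<m. \<Sum>j<m. (tangent d m W x x' l i j)\<^sup>2) / (real m)\<^sup>2"

text \<open>With the lower layers fixed, the deviation is a centred bilinear form in the rows
  \<open>k\<close> and \<open>k'\<close>, with coefficients \<open>2 / m\<close> times the entries
  of \<open>tangent\<close> masked by step functions. The constant 8 is the 2 of the quadratic form
  times the square of this 2.\<close>

lemma tangent_dev_second_moment:
 assumes l: "l \<le> L" and k: "k < layer_rows L m (Suc l)" "k' < layer_rows L m (Suc l)" and m: "m \<ge> 1"
 shows "(\<integral>\<^sup>+w. ennreal ((tangent_dev d m (override (layer d L m (Suc l)) W w) x x' l k k')\<^sup>2) \<partial>gauss (layer d L m (Suc l)))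
  \<le> ennreal (8 * tangent_energy d m W x x' l)"
proof (cases "l = 0")
 case True
 then have "tangent_dev d m W' x x' l k k' = 0" for W' by (simp add: tangent_dev_def)
 then show ?thesis by simp
next
 case False
 let ?J = "layer d L m (Suc l)"
 define B where "B i j = heaviside (pre d m W x l i) * heaviside (pre d m W x' l j) * tangent d m W x x' l i j" for i j
 define C where "C i j = 2 / real m * B i j" for i j
 have cols: "layer_cols d m (Suc l) = m" using False by (simp add: layer_cols_def)
 define u v where "u i = (Suc l, k, i)" and "v j = (Suc l, k', j)" for i j :: nat
 have uv: "inj_on u {..<m}" "u ` {..<m} \<subseteq> ?J" "inj_on v {..<m}" "v ` {..<m} \<subseteq> ?J"
  using k cols by (auto simp: u_def v_def inj_on_def layer_def)
 have dev: "tangent_dev d m (override ?J W w) x x' l k k' = (\<Sum>i<m. \<Sum>j<m. C i j * (w (u i) * w (v j) - of_bool (u i = v j)))" for w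
 proof -
  have ov: "override ?J W w (Suc l, q, i) = w (Suc l, q, i)" if "i < m" "q \<in> {k, k'}" for i q
   using that k cols by (auto intro: override_layer_eq)
  have "2 / real m * (\<Sum>i<m. \<Sum>j<m. B i j * (override ?J W w (Suc l, k, i) * override ?J W w (Suc l, k', j))) = (\<Sum>i<m. \<Sum>j<m. C i j * (w (u i) * w (v j)))"
   unfolding sum_distrib_left C_def u_def v_def by (intro sum.cong refl) (simp add: ov mult.assoc)
  moreover have "of_bool (k = k') * ((\<Sum>i<m. step2 (pre d m W x l i, pre d m W x' l i) * tangent d m W x x' l i i) / m) = (\<Sum>i<m. \<Sum>j<m. C i j * of_bool (u i = v j))"
  proof -
   have "(\<Sum>j<m. C i j * of_bool (u i = v j)) = of_bool (k = k') * (step2 (pre d m W x l i, pre d m W x' l i) * tangent d m W x x' l i i / m)" if "i < m" for i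
   proof -
    have "(\<Sum>j<m. C i j * of_bool (u i = v j)) = (\<Sum>j<m. if j = i then of_bool (k = k') * C i i else 0)"
     by (intro sum.cong refl) (auto simp: u_def v_def)
    also have "\<dots> = of_bool (k = k') * C i i" using that by simp
    finally show ?thesis by (simp add: C_def B_def step2_def)
   qed
   then show ?thesis by (simp add: sum_divide_distrib sum_distrib_left)
  qed
  ultimately show ?thesis
   unfolding tangent_dev_def tangent.simps using l
   by (simp add: pre_override_less tangent_override gram_override B_def[symmetric] right_diff_distrib sum_subtractf distrib_left)
 qed
 note Q = gauss_quadratic_form[OF finite_layer uv, of C]
 have "(\<integral>\<^sup>+w. ennreal ((tangent_dev d m (override ?J W w) x x' l k k')\<^sup>2) \<partial>gauss ?J) =
  ennreal (\<integral>w. (\<Sum>i<m. \<Sum>j<m. C i j * (w (u i) * w (v j) - of_bool (u i = v j)))\<^sup>2 \<partial>gauss ?J)"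
  unfolding dev by (rule nn_integral_eq_integral[OF Q(1)]) simp
 also have "\<dots> \<le> ennreal (2 * (\<Sum>i<m. \<Sum>j<m. (C i j)\<^sup>2))" by (rule ennreal_leI[OF Q(2)])
 also have "\<dots> \<le> ennreal (8 * tangent_energy d m W x x' l)"
 proof (rule ennreal_leI)
  have "(C i j)\<^sup>2 \<le> 4 / (real m)\<^sup>2 * (tangent d m W x x' l i j)\<^sup>2" for i j
  proof -
   have "(heaviside (pre d m W x l i))\<^sup>2 \<le> 1" "(heaviside (pre d m W x' l j))\<^sup>2 \<le> 1" by (auto simp: heaviside_def)
   then have "(heaviside (pre d m W x l i))\<^sup>2 * (heaviside (pre d m W x' l j))\<^sup>2 \<le> 1 * 1" by (intro mult_mono) auto
   then have "((heaviside (pre d m W x l i))\<^sup>2 * (heaviside (pre d m W x' l j))\<^sup>2) * (tangent d m W x x' l i j)\<^sup>2 \<le> 1 * (tangent d m W x x' l i j)\<^sup>2"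
    by (intro mult_right_mono) auto
   from mult_left_mono[OF this, of "4 / (real m)\<^sup>2"] show ?thesis by (simp add: C_def B_def power_mult_distrib power_divide)
  qed
  then have "(\<Sum>i<m. \<Sum>j<m. (C i j)\<^sup>2) \<le> (\<Sum>i<m. \<Sum>j<m. 4 / (real m)\<^sup>2 * (tangent d m W x x' l i j)\<^sup>2)"
   by (intro sum_mono)
  also have "\<dots> = 4 / (real m)\<^sup>2 * (\<Sum>i<m. \<Sum>j<m. (tangent d m W x x' l i j)\<^sup>2)"
   by (simp only: sum_distrib_left)
  finally show "2 * (\<Sum>i<m. \<Sum>j<m. (C i j)\<^sup>2) \<le> 8 * tangent_energy d m W x x' l"
   by (simp add: tangent_energy_def)
 qed
 finally show ?thesis .
qed

lemma tangent_energy_measurable: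
 "l \<le> L ==> (\<lambda>W. tangent_energy d m W x x' l) \<in> borel_measurable (gauss (params d L m))"
 unfolding tangent_energy_def
 by (intro borel_measurable_divide borel_measurable_sum borel_measurable_power borel_measurable_const tangent_measurable) (auto simp: layer_rows_def)

definition tangent_mean :: "nat => nat => (nat \<times> nat \<times> nat => real) => real vec => real vec => nat => real" where
 "tangent_mean d m W x x' l = gram d m W x x' (Suc l) +
  (\<Sum>i<m. step2 (pre d m W x l i, pre d m W x' l i) * tangent d m W x x' l i i) / m"

lemma trace_measurable:
 "l \<le> L ==> (\<lambda>W. (\<Sum>i<m. step2 (pre d m W x l i, pre d m W x' l i) * tangent d m W x x' l i i) / m) \<in> borel_measurable (gauss (params d L m))"
 by (intro borel_measurable_divide borel_measurable_sum borel_measurable_times borel_measurable_const tangent_measurable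
   measurable_compose[OF _ step2_measurable] borel_measurable_Pair pre_measurable) (auto simp: layer_rows_def)

lemma tangent_mean_measurable:
 "l \<le> L ==> (\<lambda>W. tangent_mean d m W x x' l) \<in> borel_measurable (gauss (params d L m))"
 unfolding tangent_mean_def by (intro borel_measurable_add gram_measurable trace_measurable) auto

lemma tangent_dev_measurable:
 "l \<le> L ==> k < layer_rows L m (Suc l) ==> k' < layer_rows L m (Suc l) ==>
  (\<lambda>W. tangent_dev d m W x x' l k k') \<in> borel_measurable (gauss (params d L m))"
 unfolding tangent_dev_def tangent_mean_def[symmetric]
 by (intro borel_measurable_diff borel_measurable_times borel_measurable_const tangent_mean_measurable tangent_measurable) auto

text \<open>What is controlled is an average over a set \<open>S m\<close> of index pairs, not each
  unit of a wide layer. The sets used are the diagonal, the full square and the single output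
  unit.\<close>

lemma tangent_dev_plim:
 assumes l: "l \<le> L" and E: "init_plim d L (\<lambda>m W. tangent_energy d m W x x' l) 0"
  and S: "\<And>m. m \<ge> 1 ==> finite (S m) \<and> S m \<noteq> {}" "\<And>m. S m \<subseteq> {..<layer_rows L m (Suc l)} \<times> {..<layer_rows L m (Suc l)}"
 shows "init_plim d L (\<lambda>m W. (\<Sum>(k, k')\<in>S m. (tangent_dev d m W x x' l k k')\<^sup>2) / card (S m)) 0"
proof -
 interpret prob_seq "\<lambda>m. gauss (params d L m)" by (rule prob_seq_init)
 note mE = tangent_energy_measurable[OF l]
 let ?X = "\<lambda>m W. (\<Sum>(k, k')\<in>S m. (tangent_dev d m W x x' l k k')\<^sup>2) / card (S m)"
 have mD: "(\<lambda>W. (case p of (k, k') => (tangent_dev d m W x x' l k k')\<^sup>2)) \<in> borel_measurable (gauss (params d L m))" if "p \<in> S m" for m p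
  using that S(2)[of m] l by (auto intro!: borel_measurable_power tangent_dev_measurable split: prod.split)
 have mX: "?X m \<in> borel_measurable (gauss (params d L m))" for m
  by (intro borel_measurable_divide borel_measurable_sum mD borel_measurable_const)
 have E8: "init_plim d L (\<lambda>m W. 8 * tangent_energy d m W x x' l) 0"
  using plim_cont1[OF E mE, of "\<lambda>x. 8 * x"] by simp
 show ?thesis
 proof (rule plim_markov[OF E8 _ mX])
  show "(\<lambda>W. 8 * tangent_energy d m W x x' l) \<in> borel_measurable (gauss (params d L m))" for m
   by (intro borel_measurable_times borel_measurable_const mE)
  show "0 \<le> ?X m W" for m W by (intro divide_nonneg_nonneg sum_nonneg) auto
  fix m :: nat and c :: real assume m: "1 \<le> m" and "c > 0"
  show "(\<integral>\<^sup>+W. ennreal (?X m W) * indicator {W. 8 * tangent_energy d m W x x' l \<le> c} W \<partial>gauss (params d L m)) \<le> ennreal c"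
  proof (rule resample_cond[OF finite_params layer_subset[of "Suc l" L d m] mX])
   show "1 \<le> Suc l" "Suc l \<le> Suc L" using l by auto
   show "(\<lambda>W. 8 * tangent_energy d m W x x' l) \<in> borel_measurable (gauss (params d L m))"
    by (intro borel_measurable_times borel_measurable_const mE)
   show "8 * tangent_energy d m (override (layer d L m (Suc l)) W w) x x' l = 8 * tangent_energy d m W x x' l" for W w
    by (simp add: tangent_energy_def tangent_override)
   fix W assume W: "W \<in> space (gauss (params d L m))"
   let ?J = "layer d L m (Suc l)"
   have cp: "real (card (S m)) > 0" using S(1)[OF m] by (simp add: card_gt_0_iff)
   have mJ: "(\<lambda>w. override ?J W w) \<in> measurable (gauss ?J) (gauss (params d L m))"
   proof -
    have "(\<lambda>w. \<lambda>p\<in>params d L m. if p \<in> ?J then w p else W p) \<in> measurable (gauss ?J) (gauss (params d L m))"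
    proof (rule measurable_restrict)
     show "(\<lambda>w. if p \<in> ?J then w p else W p) \<in> measurable (gauss ?J) std_normal_distribution" for p
      by (cases "p \<in> ?J") (simp_all add: gauss_component)
    qed
    moreover have "(\<lambda>p\<in>params d L m. if p \<in> ?J then w p else W p) = override ?J W w" for w
     using W layer_subset[of "Suc l" L d m] l by (auto simp: override_def space_gauss PiE_iff extensional_def restrict_def fun_eq_iff)
    ultimately show ?thesis by simp
   qed
   have mDJ: "(\<lambda>w. ennreal ((tangent_dev d m (override ?J W w) x x' l k k')\<^sup>2)) \<in> borel_measurable (gauss ?J)" if "(k, k') \<in> S m" for k k'
    using measurable_compose[OF mJ mD[OF that]] by simp
   have "(\<integral>\<^sup>+w. ennreal (?X m (override ?J W w)) \<partial>gauss ?J) =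
    (\<integral>\<^sup>+w. (\<Sum>(k, k')\<in>S m. ennreal ((tangent_dev d m (override ?J W w) x x' l k k')\<^sup>2)) * ennreal (1 / card (S m)) \<partial>gauss ?J)"
   proof (rule nn_integral_cong)
    fix w
    have "ennreal (?X m (override ?J W w)) = ennreal (\<Sum>(k, k')\<in>S m. (tangent_dev d m (override ?J W w) x x' l k k')\<^sup>2) * ennreal (1 / card (S m))"
     by (subst ennreal_mult[symmetric]) (auto intro!: sum_nonneg)
    also have "ennreal (\<Sum>(k, k')\<in>S m. (tangent_dev d m (override ?J W w) x x' l k k')\<^sup>2) = (\<Sum>(k, k')\<in>S m. ennreal ((tangent_dev d m (override ?J W w) x x' l k k')\<^sup>2))"
     by (subst sum_ennreal[symmetric]) (auto simp: case_prod_beta)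
    finally show "ennreal (?X m (override ?J W w)) = (\<Sum>(k, k')\<in>S m. ennreal ((tangent_dev d m (override ?J W w) x x' l k k')\<^sup>2)) * ennreal (1 / card (S m))" .
   qed
   also have "\<dots> = (\<Sum>(k, k')\<in>S m. \<integral>\<^sup>+w. ennreal ((tangent_dev d m (override ?J W w) x x' l k k')\<^sup>2) \<partial>gauss ?J) * ennreal (1 / card (S m))"
   proof -
    have f: "(\<lambda>w. ennreal ((tangent_dev d m (override ?J W w) x x' l (fst p) (snd p))\<^sup>2)) \<in> borel_measurable (gauss ?J)" if "p \<in> S m" for p
     using mDJ[of "fst p" "snd p"] that by simp
    show ?thesis unfolding case_prod_beta by (simp only: nn_integral_multc[OF borel_measurable_sum[OF f]] nn_integral_sum[OF f])
   qed
   also have "\<dots> \<le> (\<Sum>(k, k')\<in>S m. ennreal (8 * tangent_energy d m W x x' l)) * ennreal (1 / card (S m))"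
    using S(2)[of m] m l by (intro mult_right_mono sum_mono) (auto intro!: tangent_dev_second_moment)
   also have "\<dots> = ennreal (8 * tangent_energy d m W x x' l)"
   proof -
    have e0: "0 \<le> tangent_energy d m W x x' l" unfolding tangent_energy_def by (intro divide_nonneg_nonneg sum_nonneg) auto
    have "(\<Sum>(k, k')\<in>S m. ennreal (8 * tangent_energy d m W x x' l)) = ennreal (card (S m) * (8 * tangent_energy d m W x x' l))"
     using e0 by (simp add: case_prod_beta ennreal_mult ennreal_of_nat_eq_real_of_nat)
    then show ?thesis using cp e0 by (simp add: ennreal_mult[symmetric])
   qed
   finally show "(\<integral>\<^sup>+w. ennreal (?X m (override ?J W w)) \<partial>gauss ?J) \<le> ennreal (8 * tangent_energy d m W x x' l)" .
  qed
 qed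
qed

lemma real_sq_sum_le:
 "(\<Sum>i<m. \<bar>y i\<bar>) / real m \<le> sqrt ((\<Sum>i<m. (y i)\<^sup>2) / real m)"
proof (cases "m = 0")
 case False
 have "(\<Sum>i<m. \<bar>y i\<bar> * 1)\<^sup>2 \<le> (\<Sum>i<m. \<bar>y i\<bar>\<^sup>2) * (\<Sum>i<m. 1\<^sup>2)" by (rule Cauchy_Schwarz_ineq_sum)
 then have "(\<Sum>i<m. \<bar>y i\<bar>)\<^sup>2 \<le> m * (\<Sum>i<m. (y i)\<^sup>2)" by (simp add: mult.commute)
 then have "((\<Sum>i<m. \<bar>y i\<bar>) / real m)\<^sup>2 \<le> (\<Sum>i<m. (y i)\<^sup>2) / real m"
  using False by (simp add: power_divide power2_eq_square[of "real m"] field_simps)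
 then show ?thesis by (rule real_le_rsqrt)
qed simp

definition tangent_defect :: "nat => nat => (nat \<times> nat \<times> nat => real) => real vec => real vec => nat => real" where
 "tangent_defect d m W x x' l = (\<Sum>i<m. (tangent d m W x x' l i i - kth (scalar_prod x x') l)\<^sup>2) / real m"

lemma tangent_defect_measurable:
 "l \<le> L ==> (\<lambda>W. tangent_defect d m W x x' l) \<in> borel_measurable (gauss (params d L m))"
 unfolding tangent_defect_def
 by (intro borel_measurable_divide borel_measurable_sum borel_measurable_power borel_measurable_diff borel_measurable_const tangent_measurable) (auto simp: layer_rows_def)

lemma tangent_mean_plim:
 assumes x: "x \<in> unit_sphere d" "x' \<in> unit_sphere d" and l: "l \<le> L"
  and D: "init_plim d L (\<lambda>m W. tangent_defect d m W x x' l) 0"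
 shows "init_plim d L (\<lambda>m W. tangent_mean d m W x x' l) (kth (scalar_prod x x') (Suc l))"
proof -
 interpret prob_seq "\<lambda>m. gauss (params d L m)" by (rule prob_seq_init)
 let ?u = "scalar_prod x x'"
 let ?T = "\<lambda>m W. (\<Sum>i<m. step2 (pre d m W x l i, pre d m W x' l i) * tangent d m W x x' l i i) / m"
 have T: "init_plim d L ?T (kap0 (krho ?u (l - 1)) * kth ?u l)"
 proof (cases l)
  case 0
  then show ?thesis using plim_seq[OF tendsto_const[of 0]] by simp
 next
  case (Suc k)
  let ?S = "\<lambda>m W. (\<Sum>i<m. step2 (pre d m W x l i, pre d m W x' l i)) / m"
  have mS: "?S m \<in> borel_measurable (gauss (params d L m))" for m
   using l by (intro borel_measurable_divide borel_measurable_sum borel_measurable_const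
    measurable_compose[OF _ step2_measurable] borel_measurable_Pair pre_measurable) (auto simp: layer_rows_def)
  have u: "\<bar>?u\<bar> \<le> 1" by (rule unit_sphere_abs_le[OF x])
  have "init_plim d L ?S (psi step2 1 1 (krho ?u k))"
   by (rule layer_lln[OF _ _ step2_measurable isCont_psi_step2[OF krho_bounds(2)[OF u]] step2_mom])
    (use Suc l gram_plim[OF x(1,1), of k L] gram_plim[OF x(2,2), of k L] gram_plim[OF x, of k L] x in \<open>auto simp: unit_sphere_def krho_1\<close>)
  then have S: "init_plim d L ?S (kap0 (krho ?u k))" by (simp add: kap0_def)
  have SK: "init_plim d L (\<lambda>m W. ?S m W * kth ?u l) (kap0 (krho ?u k) * kth ?u l)"
   by (rule plim_cont1[OF S mS]) (intro continuous_intros)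
  have mD: "(\<lambda>W. tangent_defect d m W x x' l) \<in> borel_measurable (gauss (params d L m))" for m
   by (rule tangent_defect_measurable[OF l])
  have "init_plim d L (\<lambda>m W. 2 * sqrt (tangent_defect d m W x x' l)) (2 * sqrt 0)"
   by (rule plim_cont1[OF D mD]) (intro continuous_intros)
  then have D2: "init_plim d L (\<lambda>m W. 2 * sqrt (tangent_defect d m W x x' l)) 0" by simp
  have mT: "?T m \<in> borel_measurable (gauss (params d L m))" for m by (rule trace_measurable[OF l])
  have mSK: "(\<lambda>W. ?S m W * kth ?u l) \<in> borel_measurable (gauss (params d L m))" for m
   by (intro borel_measurable_times mS borel_measurable_const)
  \<comment> \<open>Replacing the diagonal entries by their limit costs at most twice their mean
    absolute deviation, as \<open>step2\<close> is at most 2; Cauchy-Schwarz turns this into the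
    square root of \<open>tangent_defect\<close>.\<close>
  have "init_plim d L (\<lambda>m W. ?T m W - ?S m W * kth ?u l) 0"
  proof (rule plim_bound[OF D2])
   show "(\<lambda>W. 2 * sqrt (tangent_defect d m W x x' l)) \<in> borel_measurable (gauss (params d L m))" for m
    using measurable_compose[OF mD, of "\<lambda>y. 2 * sqrt y"] by simp
   fix m W
   let ?s = "\<lambda>i. step2 (pre d m W x l i, pre d m W x' l i)"
   let ?y = "\<lambda>i. tangent d m W x x' l i i - kth ?u l"
   have "?T m W - ?S m W * kth ?u l = (\<Sum>i<m. ?s i * ?y i) / m"
    by (simp add: right_diff_distrib sum_subtractf sum_distrib_right diff_divide_distrib)
   also have "\<bar>\<dots>\<bar> \<le> (\<Sum>i<m. 2 * \<bar>?y i\<bar>) / m"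
   proof -
    have "\<bar>\<Sum>i<m. ?s i * ?y i\<bar> \<le> (\<Sum>i<m. \<bar>?s i * ?y i\<bar>)" by (rule sum_abs)
    also have "\<dots> \<le> (\<Sum>i<m. 2 * \<bar>?y i\<bar>)"
     unfolding abs_mult by (intro sum_mono mult_right_mono step2_bound) simp
    finally show ?thesis by (simp add: divide_right_mono)
   qed
   also have "\<dots> = 2 * ((\<Sum>i<m. \<bar>?y i\<bar>) / m)" by (simp add: sum_distrib_left)
   also have "\<dots> \<le> 2 * sqrt (tangent_defect d m W x x' l)"
    unfolding tangent_defect_def by (intro mult_left_mono real_sq_sum_le) simp
   finally show "\<bar>?T m W - ?S m W * kth ?u l - 0\<bar> \<le> 2 * sqrt (tangent_defect d m W x x' l)" by simp
  qed
  from plim_add[OF this SK borel_measurable_diff[OF mT mSK] mSK] show ?thesis by (simp add: Suc)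
 qed
 have l': "Suc l \<le> Suc L" using l by simp
 from plim_add[OF gram_plim[OF x l] T gram_measurable[OF l'] trace_measurable[OF l]]
 show ?thesis by (simp add: tangent_mean_def)
qed

text \<open>The two statements feed each other: the energy controls the fluctuation at the next
  layer, and the defect controls its conditional mean. The next energy is bounded by the fluctuation
  of all entries plus the conditional mean on the diagonal, and the latter is divided by
  \<open>m\<close>.\<close>

lemma tangent_plim_induct:
 assumes x: "x \<in> unit_sphere d" "x' \<in> unit_sphere d" and "l \<le> L"
 shows "init_plim d L (\<lambda>m W. tangent_defect d m W x x' l) 0 \<and> init_plim d L (\<lambda>m W. tangent_energy d m W x x' l) 0"
 using assms(3)
proof (induction l)
 case 0
 interpret prob_seq "\<lambda>m. gauss (params d L m)" by (rule prob_seq_init)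
 show ?case using plim_seq[OF tendsto_const[of 0]] by (simp add: tangent_defect_def tangent_energy_def)
next
 case (Suc l)
 interpret prob_seq "\<lambda>m. gauss (params d L m)" by (rule prob_seq_init)
 from Suc have l: "l \<le> L" and D: "init_plim d L (\<lambda>m W. tangent_defect d m W x x' l) 0"
  and E: "init_plim d L (\<lambda>m W. tangent_energy d m W x x' l) 0" by auto
 have rows: "layer_rows L m (Suc l) = m" for m using Suc.prems by (simp add: layer_rows_def)
 define K where "K = kth (scalar_prod x x') (Suc l)"
 let ?t = "\<lambda>m W. tangent_mean d m W x x' l"
 let ?dev = "\<lambda>m W k k'. tangent_dev d m W x x' l k k'"
 have t: "init_plim d L ?t K" unfolding K_def by (rule tangent_mean_plim[OF x l D])
 have mt: "?t m \<in> borel_measurable (gauss (params d L m))" for m by (rule tangent_mean_measurable[OF l])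
 define E1 where "E1 m W = (\<Sum>(k, k')\<in>(\<lambda>k. (k, k)) ` {..<m}. (?dev m W k k')\<^sup>2) / card ((\<lambda>k. (k, k)) ` {..<m})" for m W
 define E2 where "E2 m W = (\<Sum>(k, k')\<in>{..<m} \<times> {..<m}. (?dev m W k k')\<^sup>2) / card ({..<m} \<times> {..<m})" for m W
 have E1: "init_plim d L E1 0" unfolding E1_def[abs_def]
  by (rule tangent_dev_plim[OF l E]) (auto simp: rows lessThan_empty_iff)
 have E2: "init_plim d L E2 0" unfolding E2_def[abs_def]
  by (rule tangent_dev_plim[OF l E]) (auto simp: rows lessThan_empty_iff)
 have E1e: "E1 m W = (\<Sum>k<m. (?dev m W k k)\<^sup>2) / m" for m W
  unfolding E1_def by (subst sum.reindex; simp add: card_image inj_on_def)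
 have E2e: "E2 m W = (\<Sum>k<m. \<Sum>k'<m. (?dev m W k k')\<^sup>2) / (real m)\<^sup>2" for m W
  unfolding E2_def by (simp add: sum.cartesian_product power2_eq_square)
 have mdev: "(\<lambda>W. ?dev m W k k') \<in> borel_measurable (gauss (params d L m))" if "k < m" "k' < m" for m k k'
  using that by (intro tangent_dev_measurable l) (simp_all add: rows)
 have mE1: "E1 m \<in> borel_measurable (gauss (params d L m))" for m
  unfolding E1e[abs_def] by (intro borel_measurable_divide borel_measurable_sum borel_measurable_power borel_measurable_const mdev) auto
 have mE2: "E2 m \<in> borel_measurable (gauss (params d L m))" for m
  unfolding E2e[abs_def] by (intro borel_measurable_divide borel_measurable_sum borel_measurable_power borel_measurable_const mdev) auto
 have tan: "tangent d m W x x' (Suc l) k k' = ?dev m W k k' + of_bool (k = k') * ?t m W" for m W k k'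
  by (simp add: tangent_dev_def tangent_mean_def del: tangent.simps)
 have c1: "isCont (\<lambda>p. 2 * fst p + 2 * (fst (snd p) - K)\<^sup>2) (0::real, K, 0::real)" by (intro continuous_intros)
 have "init_plim d L (\<lambda>m W. 2 * E1 m W + 2 * (?t m W - K)\<^sup>2) 0"
  using plim_cont[OF E1 t E1 mE1 mt mE1 c1] by simp
 then have 1: "init_plim d L (\<lambda>m W. tangent_defect d m W x x' (Suc l)) 0"
 proof (rule plim_bound)
  show "(\<lambda>W. 2 * E1 m W + 2 * (?t m W - K)\<^sup>2) \<in> borel_measurable (gauss (params d L m))" for m
   by (intro borel_measurable_add borel_measurable_times borel_measurable_power borel_measurable_diff borel_measurable_const mE1 mt)
  fix m :: nat and W assume m: "m \<ge> 1"
  have "(\<Sum>k<m. (tangent d m W x x' (Suc l) k k - K)\<^sup>2) \<le> (\<Sum>k<m. 2 * (?dev m W k k)\<^sup>2 + 2 * (?t m W - K)\<^sup>2)"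
   using sq_add_le[of "?dev m W k k" "?t m W - K" for k] by (intro sum_mono) (simp add: tan add_diff_eq del: tangent.simps)
  also have "\<dots> = 2 * (\<Sum>k<m. (?dev m W k k)\<^sup>2) + m * (2 * (?t m W - K)\<^sup>2)"
   by (simp add: sum.distrib sum_distrib_left)
  finally have "tangent_defect d m W x x' (Suc l) \<le> (2 * (\<Sum>k<m. (?dev m W k k)\<^sup>2) + m * (2 * (?t m W - K)\<^sup>2)) / m"
   unfolding tangent_defect_def K_def by (rule divide_right_mono) simp
  also have "\<dots> = 2 * E1 m W + 2 * (?t m W - K)\<^sup>2" using m by (simp add: E1e add_divide_distrib)
  finally show "\<bar>tangent_defect d m W x x' (Suc l) - 0\<bar> \<le> 2 * E1 m W + 2 * (?t m W - K)\<^sup>2"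
   by (simp add: tangent_defect_def sum_nonneg)
 qed
 have c2: "isCont (\<lambda>p. 2 * fst p + 2 * (fst (snd p))\<^sup>2 * snd (snd p)) (0::real, K, 0::real)" by (intro continuous_intros)
 have "init_plim d L (\<lambda>m W. 2 * E2 m W + 2 * (?t m W)\<^sup>2 * inverse (real m)) 0"
  using plim_cont[OF E2 t plim_seq[OF lim_inverse_n] mE2 mt borel_measurable_const c2] by simp
 then have 2: "init_plim d L (\<lambda>m W. tangent_energy d m W x x' (Suc l)) 0"
 proof (rule plim_bound)
  show "(\<lambda>W. 2 * E2 m W + 2 * (?t m W)\<^sup>2 * inverse (real m)) \<in> borel_measurable (gauss (params d L m))" for m
   by (intro borel_measurable_add borel_measurable_times borel_measurable_power borel_measurable_diff borel_measurable_const mE2 mt)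
  fix m :: nat and W assume m: "m \<ge> 1"
  have "(\<Sum>k<m. \<Sum>k'<m. (tangent d m W x x' (Suc l) k k')\<^sup>2) \<le> (\<Sum>k<m. \<Sum>k'<m. 2 * (?dev m W k k')\<^sup>2 + 2 * (of_bool (k = k') * (?t m W)\<^sup>2))"
  proof (intro sum_mono)
   fix k k'
   show "(tangent d m W x x' (Suc l) k k')\<^sup>2 \<le> 2 * (?dev m W k k')\<^sup>2 + 2 * (of_bool (k = k') * (?t m W)\<^sup>2)"
    using sq_add_le[of "?dev m W k k'" "of_bool (k = k') * ?t m W"] by (cases "k = k'") (simp_all add: tan del: tangent.simps)
  qed
  also have "\<dots> = 2 * (\<Sum>k<m. \<Sum>k'<m. (?dev m W k k')\<^sup>2) + 2 * (\<Sum>k<m. \<Sum>k'<m. of_bool (k = k') * (?t m W)\<^sup>2)"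
   by (simp only: sum.distrib sum_distrib_left)
  also have "(\<Sum>k<m. \<Sum>k'<m. of_bool (k = k') * (?t m W)\<^sup>2) = m * (?t m W)\<^sup>2"
  proof -
   have "(\<Sum>k'<m. of_bool (k = k') * (?t m W)\<^sup>2) = (\<Sum>k'<m. if k' = k then (?t m W)\<^sup>2 else 0)" for k
    by (intro sum.cong) auto
   then show ?thesis by simp
  qed
  finally have "tangent_energy d m W x x' (Suc l) \<le> (2 * (\<Sum>k<m. \<Sum>k'<m. (?dev m W k k')\<^sup>2) + 2 * (m * (?t m W)\<^sup>2)) / (real m)\<^sup>2"
   unfolding tangent_energy_def by (rule divide_right_mono) simp
  also have "\<dots> = 2 * E2 m W + 2 * (?t m W)\<^sup>2 * inverse (real m)"
  proof -
   have "(2 * a + 2 * (r * b)) / r\<^sup>2 = 2 * (a / r\<^sup>2) + 2 * b * inverse r" if "r > 0" for a b r :: real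
    using that by (simp add: divide_inverse power2_eq_square distrib_right)
   from this[of "real m"] show ?thesis using m by (simp add: E2e)
  qed
  finally show "\<bar>tangent_energy d m W x x' (Suc l) - 0\<bar> \<le> 2 * E2 m W + 2 * (?t m W)\<^sup>2 * inverse (real m)"
   by (simp add: tangent_energy_def sum_nonneg)
 qed
 show ?case using 1 2 by blast
qed

lemma tangent_output_plim:
 assumes x: "x \<in> unit_sphere d" "x' \<in> unit_sphere d"
 shows "init_plim d L (\<lambda>m W. tangent d m W x x' (Suc L) 0 0) (kth (scalar_prod x x') (Suc L))"
proof -
 interpret prob_seq "\<lambda>m. gauss (params d L m)" by (rule prob_seq_init)
 from tangent_plim_induct[OF x order_refl]
 have D: "init_plim d L (\<lambda>m W. tangent_defect d m W x x' L) 0" and E: "init_plim d L (\<lambda>m W. tangent_energy d m W x x' L) 0" by auto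
 have "init_plim d L (\<lambda>m W. (\<Sum>(k, k')\<in>{(0, 0)}. (tangent_dev d m W x x' L k k')\<^sup>2) / card {(0::nat, 0::nat)}) 0"
  by (rule tangent_dev_plim[OF order_refl E]) (auto simp: layer_rows_def)
 then have V: "init_plim d L (\<lambda>m W. (tangent_dev d m W x x' L 0 0)\<^sup>2) 0" by simp
 have mV: "(\<lambda>W. tangent_dev d m W x x' L 0 0) \<in> borel_measurable (gauss (params d L m))" for m
  by (rule tangent_dev_measurable) (auto simp: layer_rows_def)
 have mV2: "(\<lambda>W. (tangent_dev d m W x x' L 0 0)\<^sup>2) \<in> borel_measurable (gauss (params d L m))" for m
  by (intro borel_measurable_power mV)
 have "init_plim d L (\<lambda>m W. sqrt ((tangent_dev d m W x x' L 0 0)\<^sup>2)) (sqrt 0)"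
  by (rule plim_cont1[OF V mV2]) (intro continuous_intros)
 then have V1: "init_plim d L (\<lambda>m W. \<bar>tangent_dev d m W x x' L 0 0\<bar>) 0" by simp
 have V0: "init_plim d L (\<lambda>m W. tangent_dev d m W x x' L 0 0) 0"
  by (rule plim_bound[OF V1]) (auto intro: borel_measurable_abs mV)
 from plim_add[OF V0 tangent_mean_plim[OF x order_refl D] mV tangent_mean_measurable[OF order_refl]]
 show ?thesis by (simp add: tangent_dev_def tangent_mean_def del: tangent.simps kth.simps)
qed

section \<open>Differentiability almost everywhere and the value of the kernel\<close>

lemma AE_pre_nz:
 assumes l: "1 \<le> l" "l \<le> L" and i: "i < m"
 shows "AE W in gauss (params d L m). pre d m W x l i \<noteq> 0 \<or> (\<forall>j<layer_cols d m l. inp d m W x l j = 0)"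
proof -
 let ?G = "gauss (params d L m)" and ?J = "layer d L m l"
 let ?N = "{W \<in> space ?G. pre d m W x l i = 0 \<and> (\<exists>j\<in>{..<layer_cols d m l}. inp d m W x l j \<noteq> 0)}"
 have i': "i < layer_rows L m l" using l i by (simp add: layer_rows_def)
 have mp: "(\<lambda>W. pre d m W x l i) \<in> borel_measurable ?G" using l i' by (intro pre_measurable) auto
 have mi: "(\<lambda>W. inp d m W x l j) \<in> borel_measurable ?G" if "j \<in> {..<layer_cols d m l}" for j
  using that l by (intro inp_measurable) auto
 have eq0: "{W \<in> space ?G. h W = 0} \<in> sets ?G" "{W \<in> space ?G. h W \<noteq> 0} \<in> sets ?G" if "h \<in> borel_measurable ?G" for h :: "_ => real"
  using borel_measurable_eq[OF that borel_measurable_const[of 0]] borel_measurable_neq[OF that borel_measurable_const[of 0]] by auto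
 have N: "?N \<in> sets ?G"
  by (intro sets.sets_Collect_conj sets.sets_Collect_finite_Ex eq0 mp mi) auto
 have "emeasure ?G ?N = (\<integral>\<^sup>+W. indicator ?N W \<partial>?G)" using N by (rule nn_integral_indicator[symmetric])
 also have "\<dots> = (\<integral>\<^sup>+W. (\<integral>\<^sup>+w. indicator ?N (override ?J W w) \<partial>gauss ?J) \<partial>?G)"
  by (rule nn_integral_gauss_resample[OF finite_params layer_subset]) (use l N in \<open>auto intro: borel_measurable_indicator\<close>)
 also have "\<dots> = (\<integral>\<^sup>+W. 0 \<partial>?G)"
 proof (rule nn_integral_cong)
  fix W
  have "(\<integral>\<^sup>+w. indicator ?N (override ?J W w) \<partial>gauss ?J) = (\<integral>\<^sup>+w. 0 \<partial>gauss ?J)"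
  proof (cases "\<exists>j\<in>{..<layer_cols d m l}. inp d m W x l j \<noteq> 0")
   case True
   have "AE w in gauss ?J. (\<Sum>j\<in>{..<layer_cols d m l}. inp d m W x l j * w (l, i, j)) \<noteq> 0"
    by (rule AE_gauss_linear_nz[OF finite_layer _ _ _ True]) (use i' in \<open>auto simp: inj_on_def layer_def\<close>)
   then have "AE w in gauss ?J. indicator ?N (override ?J W w) = (0::ennreal)"
    by eventually_elim (simp add: pre_override[OF i'])
   then show ?thesis by (rule nn_integral_cong_AE)
  next
   case False
   then show ?thesis by (intro nn_integral_cong) (simp add: inp_override)
  qed
  then show "(\<integral>\<^sup>+w. indicator ?N (override ?J W w) \<partial>gauss ?J) = 0" by simp
 qed
 finally have "?N \<in> null_sets ?G" using N by (simp add: null_setsI)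
 then show ?thesis by (rule AE_I') auto
qed

text \<open>The extra condition \<open>l > 1\<close> holds because in the first layer the inputs are
  the coordinates of a unit vector and cannot all vanish.\<close>

lemma AE_regular_at:
 assumes x: "x \<in> unit_sphere d"
 shows "AE W in gauss (params d L m). regular_at d L m W x"
proof -
 have x1: "\<exists>j<d. vec_index x j \<noteq> 0"
 proof (rule ccontr)
  assume "\<not> ?thesis"
  then have "scalar_prod x x = 0" using x by (subst scalar_prod_sum[of _ d]) (auto simp: unit_sphere_def)
  then show False using x by (simp add: unit_sphere_def)
 qed
 have "AE W in gauss (params d L m). \<forall>p\<in>{1..L} \<times> {..<m}. pre d m W x (fst p) (snd p) \<noteq> 0 \<or> (\<forall>j<layer_cols d m (fst p). inp d m W x (fst p) j = 0)"
 proof (rule AE_finite_allI)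
  fix p assume "p \<in> {1..L} \<times> {..<m}"
  then show "AE W in gauss (params d L m). pre d m W x (fst p) (snd p) \<noteq> 0 \<or> (\<forall>j<layer_cols d m (fst p). inp d m W x (fst p) j = 0)"
   by (intro AE_pre_nz) auto
 qed simp
 then show ?thesis
 proof eventually_elim
  case (elim W)
  show ?case unfolding regular_at_def
  proof (intro ballI allI impI)
   fix l i assume l: "l \<in> {1..L}" and i: "i < m"
   from elim[rule_format, of "(l, i)"] l i
   have "pre d m W x l i \<noteq> 0 \<or> (\<forall>j<layer_cols d m l. inp d m W x l j = 0)" by simp
   moreover have "\<not> (\<forall>j<layer_cols d m l. inp d m W x l j = 0)" if "l = 1"
    using x1 that by (auto simp: layer_cols_def)
   ultimately show "pre d m W x l i \<noteq> 0 \<or> (\<forall>j<layer_cols d m l. inp d m W x l j = 0) \<and> l > 1"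
    using l by (cases "l = 1") auto
  qed
 qed
qed

text \<open>An event formulated with the actual gradient agrees with a measurable event only almost
  everywhere; in the completion it is measurable and has the same probability.\<close>

lemma completion_AE_cong:
 assumes A: "A \<in> sets M" and B: "B \<subseteq> space M" and AB: "AE x in M. x \<in> A \<longleftrightarrow> x \<in> B"
 shows "B \<in> sets (completion M)" "measure (completion M) B = measure M A"
proof -
 obtain N where N: "N \<in> null_sets M" "{x \<in> space M. \<not> (x \<in> A \<longleftrightarrow> x \<in> B)} \<subseteq> N"
  using AB by (auto elim!: AE_E simp: null_sets_def)
 have AN: "A - N \<in> sets M" using A N by auto
 show Bm: "B \<in> sets (completion M)"
 proof (rule sets_completionI[of _ "A - N" "B \<inter> N" N])
  show "B = A - N \<union> B \<inter> N" using N(2) B sets.sets_into_space[OF A] by blast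
 qed (use N AN in auto)
 have "emeasure (completion M) B = emeasure (completion M) A"
  by (rule emeasure_eq_AE) (use AB Bm A in \<open>auto intro: AE_completion\<close>)
 then show "measure (completion M) B = measure M A"
  using A by (simp add: measure_def)
qed

lemma empirical_ntk_law:
 assumes x: "x \<in> unit_sphere d" "x' \<in> unit_sphere d" and L: "L \<ge> 1" and m: "m \<ge> 1"
 shows "{W \<in> space (init_law d L m). \<bar>empirical_ntk d L m W x x' - c\<bar> > e} \<in> sets (init_law d L m)"
  "measure (init_law d L m) {W \<in> space (init_law d L m). \<bar>empirical_ntk d L m W x x' - c\<bar> > e} =
  measure (gauss (params d L m)) {W \<in> space (gauss (params d L m)). \<bar>tangent d m W x x' (Suc L) 0 0 - c\<bar> > e}"
proof -
 let ?G = "gauss (params d L m)"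
 let ?A = "{W \<in> space ?G. \<bar>tangent d m W x x' (Suc L) 0 0 - c\<bar> > e}" and ?B = "{W \<in> space ?G. \<bar>empirical_ntk d L m W x x' - c\<bar> > e}"
 have mt: "(\<lambda>W. tangent d m W x x' (Suc L) 0 0) \<in> borel_measurable ?G"
  by (rule tangent_measurable) (auto simp: layer_rows_def)
 have A: "?A \<in> sets ?G"
  by (intro borel_measurable_less borel_measurable_const borel_measurable_abs borel_measurable_diff mt)
 have c: "x \<in> carrier_vec d" "x' \<in> carrier_vec d" using x by (auto simp: unit_sphere_def)
 have "AE W in ?G. W \<in> ?A \<longleftrightarrow> W \<in> ?B"
  using AE_regular_at[OF x(1), of L m] AE_regular_at[OF x(2), of L m]
  by eventually_elim (simp add: empirical_ntk_eq_tangent[OF c L m] del: tangent.simps)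
 note C = completion_AE_cong[OF A _ this]
 have sp: "space (init_law d L m) = space ?G" by (simp add: init_law_def)
 show "{W \<in> space (init_law d L m). \<bar>empirical_ntk d L m W x x' - c\<bar> > e} \<in> sets (init_law d L m)"
  unfolding sp unfolding init_law_def by (rule C) auto
 show "measure (init_law d L m) {W \<in> space (init_law d L m). \<bar>empirical_ntk d L m W x x' - c\<bar> > e} = measure ?G ?A"
  unfolding sp unfolding init_law_def by (rule C) auto
qed

lemma prob_space_init_law: "prob_space (init_law d L m)"
proof -
 interpret prob_space "gauss (params d L m)" by (rule prob_space_gauss)
 show ?thesis unfolding init_law_def by (rule prob_space_completion)
qed

lemma empirical_ntk_tendsto:
 assumes x: "x \<in> unit_sphere d" "x' \<in> unit_sphere d" and L: "L \<ge> 1" and e: "e > 0"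
 shows "(\<lambda>m. measure (init_law d L m) {W \<in> space (init_law d L m). \<bar>empirical_ntk d L m W x x' - kth (scalar_prod x x') (Suc L)\<bar> > e}) \<longlonglongrightarrow> 0"
proof -
 have "(\<lambda>m. measure (gauss (params d L m)) {W \<in> space (gauss (params d L m)). \<bar>tangent d m W x x' (Suc L) 0 0 - kth (scalar_prod x x') (Suc L)\<bar> > e}) \<longlonglongrightarrow> 0"
  using tangent_output_plim[OF x, of L] e unfolding plim_def by blast
 then show ?thesis
  by (rule Lim_transform_eventually) (use eventually_ge_at_top[of "1::nat"] in eventually_elim, simp only: empirical_ntk_law(2)[OF x L])
qed

text \<open>For the uniqueness of the limit: if the two candidates have distance
  \<open>3 * e\<close>, no number is within \<open>e\<close> of both, so the two exceptional events
  cover the whole space and cannot both have small probability.\<close>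

theorem ntk_eq_kth:
 assumes x: "x \<in> unit_sphere d" "x' \<in> unit_sphere d" and L: "L \<ge> 1"
 shows "ntk d L x x' = kth (scalar_prod x x') (Suc L)"
 unfolding ntk_def
proof (rule the_equality)
 define c where "c = kth (scalar_prod x x') (Suc L)"
 let ?S = "\<lambda>m c e. {W \<in> space (init_law d L m). \<bar>empirical_ntk d L m W x x' - c\<bar> > e}"
 show "\<forall>e>0. (\<lambda>m. measure (init_law d L m) (?S m (kth (scalar_prod x x') (Suc L)) e)) \<longlonglongrightarrow> 0"
  using empirical_ntk_tendsto[OF x L] by blast
 fix c' assume c': "\<forall>e>0. (\<lambda>m. measure (init_law d L m) (?S m c' e)) \<longlonglongrightarrow> 0"
 show "c' = kth (scalar_prod x x') (Suc L)"
 proof (rule ccontr)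
  assume "c' \<noteq> kth (scalar_prod x x') (Suc L)"
  then have ne: "c' \<noteq> c" by (simp add: c_def)
  define e where "e = \<bar>c - c'\<bar> / 3"
  have e: "e > 0" using ne by (simp add: e_def)
  have "(\<lambda>m. measure (init_law d L m) (?S m c e) + measure (init_law d L m) (?S m c' e)) \<longlonglongrightarrow> 0 + 0"
   using empirical_ntk_tendsto[OF x L e] c' e unfolding c_def by (intro tendsto_add) auto
  then have "eventually (\<lambda>m. measure (init_law d L m) (?S m c e) + measure (init_law d L m) (?S m c' e) < 1) sequentially"
   by (intro order_tendstoD(2)) auto
  moreover have "eventually (\<lambda>m. measure (init_law d L m) (?S m c e) + measure (init_law d L m) (?S m c' e) \<ge> 1) sequentially"
   using eventually_ge_at_top[of "1::nat"]
  proof eventually_elim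
   case (elim m)
   interpret prob_space "init_law d L m" by (rule prob_space_init_law)
   have "space (init_law d L m) = ?S m c e \<union> ?S m c' e"
   proof -
    have "e < \<bar>y - c\<bar> \<or> e < \<bar>y - c'\<bar>" for y
    proof -
     have "\<bar>c - c'\<bar> = 3 * e" by (simp add: e_def)
     then show ?thesis using e by linarith
    qed
    then show ?thesis by auto
   qed
   then have "1 = prob (?S m c e \<union> ?S m c' e)" using prob_space by simp
   also have "\<dots> \<le> prob (?S m c e) + prob (?S m c' e)"
    by (rule measure_Un_le) (rule empirical_ntk_law[OF x L elim])+
   finally show ?case .
  qed
  ultimately have "eventually (\<lambda>m::nat. False) sequentially" by eventually_elim auto
  then show False by simp
 qed
qed

section \<open>Symmetry, positivity and continuity of the limit kernel\<close>

lemma empirical_ntk_psd: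
 fixes c :: "nat => real" and n :: nat
 shows "0 \<le> (\<Sum>i<n. \<Sum>j<n. c i * c j * empirical_ntk d L m W (x i) (x j))"
proof -
 have "(\<Sum>i<n. \<Sum>j<n. c i * c j * empirical_ntk d L m W (x i) (x j)) =
  (\<Sum>i<n. \<Sum>j<n. \<Sum>p\<in>params d L m. c i * network_grad d L m W (x i) p * (c j * network_grad d L m W (x j) p) / m)"
  unfolding empirical_ntk_def by (simp add: sum_distrib_left sum_divide_distrib mult_ac)
 also have "\<dots> = (\<Sum>p\<in>params d L m. \<Sum>i<n. \<Sum>j<n. c i * network_grad d L m W (x i) p * (c j * network_grad d L m W (x j) p) / m)"
 proof -
  have "(\<Sum>i<n. \<Sum>j<n. \<Sum>p\<in>params d L m. F i j p) = (\<Sum>p\<in>params d L m. \<Sum>i<n. \<Sum>j<n. F i j p)" for F :: "nat => nat => _ => real"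
   by (subst (2) sum.swap, subst sum.swap) (rule refl)
  then show ?thesis .
 qed
 also have "\<dots> = (\<Sum>p\<in>params d L m. (\<Sum>i<n. c i * network_grad d L m W (x i) p)\<^sup>2 / m)"
  by (intro sum.cong refl) (simp add: power2_eq_square sum_product sum_divide_distrib)
 also have "\<dots> \<ge> 0" by (intro sum_nonneg divide_nonneg_nonneg) auto
 finally show ?thesis .
qed

text \<open>The empirical kernel is a Gram matrix of gradients at every parameter. For some width
  there is one parameter at which all of the finitely many entries are \<open>e\<close>-close to the
  limit, because the exceptional events have total probability below 1.\<close>

lemma ntk_psd:
 fixes c :: "nat => real" and n :: nat
 assumes x: "\<And>i. i < n ==> x i \<in> unit_sphere d" and L: "L \<ge> 1"
 shows "0 \<le> (\<Sum>i<n. \<Sum>j<n. c i * c j * ntk d L (x i) (x j))"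
proof (rule ccontr)
 assume neg: "\<not> ?thesis"
 define q where "q = - (\<Sum>i<n. \<Sum>j<n. c i * c j * ntk d L (x i) (x j))"
 define s where "s = (\<Sum>i<n. \<Sum>j<n. \<bar>c i * c j\<bar>) + 1"
 have q: "q > 0" using neg by (simp add: q_def)
 have s: "s > 0" unfolding s_def by (intro add_nonneg_pos sum_nonneg) auto
 define e where "e = q / (2 * s)"
 have e: "e > 0" using q s by (simp add: e_def)
 let ?S = "\<lambda>m p. {W \<in> space (init_law d L m). \<bar>empirical_ntk d L m W (x (fst p)) (x (snd p)) - ntk d L (x (fst p)) (x (snd p))\<bar> > e}"
 let ?P = "{..<n} \<times> {..<n}"
 have "(\<lambda>m. \<Sum>p\<in>?P. measure (init_law d L m) (?S m p)) \<longlonglongrightarrow> (\<Sum>p\<in>?P. 0)"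
 proof (intro tendsto_sum)
  fix p assume "p \<in> ?P"
  then have X: "x (fst p) \<in> unit_sphere d" "x (snd p) \<in> unit_sphere d" using x by auto
  show "(\<lambda>m. measure (init_law d L m) (?S m p)) \<longlonglongrightarrow> 0"
   unfolding ntk_eq_kth[OF X L] by (rule empirical_ntk_tendsto[OF X L e])
 qed
 then have "eventually (\<lambda>m. (\<Sum>p\<in>?P. measure (init_law d L m) (?S m p)) < 1) sequentially"
  by (intro order_tendstoD(2)) auto
 then have "eventually (\<lambda>m. m \<ge> 1 \<and> (\<Sum>p\<in>?P. measure (init_law d L m) (?S m p)) < 1) sequentially"
  using eventually_ge_at_top[of "1::nat"] by eventually_elim auto
 then obtain m where m: "m \<ge> 1" and lt: "(\<Sum>p\<in>?P. measure (init_law d L m) (?S m p)) < 1"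
  by (auto simp: eventually_sequentially)
 interpret prob_space "init_law d L m" by (rule prob_space_init_law)
 have sets: "?S m p \<in> events" if "p \<in> ?P" for p
  using that x by (intro empirical_ntk_law(1)[OF _ _ L m]) auto
 have "prob (\<Union>p\<in>?P. ?S m p) \<le> (\<Sum>p\<in>?P. prob (?S m p))"
  by (rule finite_measure_subadditive_finite) (simp, use sets in blast)
 with lt have "prob (\<Union>p\<in>?P. ?S m p) < 1" by simp
 then have "(\<Union>p\<in>?P. ?S m p) \<noteq> space (init_law d L m)" using prob_space by auto
 then obtain W where W: "W \<in> space (init_law d L m)" "\<And>p. p \<in> ?P ==> W \<notin> ?S m p" by blast
 have close: "\<bar>empirical_ntk d L m W (x i) (x j) - ntk d L (x i) (x j)\<bar> \<le> e" if "i < n" "j < n" for i j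
  using W(2)[of "(i, j)"] W(1) that by auto
 have "(\<Sum>i<n. \<Sum>j<n. c i * c j * empirical_ntk d L m W (x i) (x j)) - (\<Sum>i<n. \<Sum>j<n. c i * c j * ntk d L (x i) (x j)) =
  (\<Sum>i<n. \<Sum>j<n. c i * c j * (empirical_ntk d L m W (x i) (x j) - ntk d L (x i) (x j)))"
  by (simp add: right_diff_distrib sum_subtractf)
 also have "\<dots> \<le> (\<Sum>i<n. \<Sum>j<n. \<bar>c i * c j\<bar> * e)"
 proof (intro sum_mono)
  fix i j assume "i \<in> {..<n}" "j \<in> {..<n}"
  then have "\<bar>c i * c j * (empirical_ntk d L m W (x i) (x j) - ntk d L (x i) (x j))\<bar> \<le> \<bar>c i * c j\<bar> * e"
   unfolding abs_mult[of "c i * c j"] using close by (intro mult_left_mono) auto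
  then show "c i * c j * (empirical_ntk d L m W (x i) (x j) - ntk d L (x i) (x j)) \<le> \<bar>c i * c j\<bar> * e" by simp
 qed
 also have "\<dots> = (s - 1) * e" by (simp add: s_def sum_distrib_right)
 also have "\<dots> < q" using q s by (simp add: e_def field_simps add_pos_pos)
 finally show False using empirical_ntk_psd[of c d L m W x n] by (simp add: q_def)
qed

lemma ntk_sym:
 assumes "x \<in> unit_sphere d" "x' \<in> unit_sphere d" "L \<ge> 1"
 shows "ntk d L x x' = ntk d L x' x"
 using assms comm_scalar_prod[of x d x'] by (simp add: ntk_eq_kth unit_sphere_def del: kth.simps)

lemma ntk_diag:
 assumes "x \<in> unit_sphere d" "L \<ge> 1"
 shows "ntk d L x x = real L + 1"
 using assms kth_1[of "Suc L"] by (simp add: ntk_eq_kth unit_sphere_def del: kth.simps)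

text \<open>The left hand side is the squared distance of the two kernel functions. On the sphere
  \<open>sqrt (1 - scalar_prod x x')\<close> is a multiple of the Euclidean distance, so the bound
  is linear in that distance; its constant does not involve \<open>d\<close>.\<close>

lemma ntk_Hoelder:
 "\<exists>C\<ge>0. \<forall>d. \<forall>x\<in>unit_sphere d. \<forall>x'\<in>unit_sphere d. L \<ge> 1 \<longrightarrow>
  ntk d L x x + ntk d L x' x' - 2 * ntk d L x x' \<le> C * sqrt (1 - scalar_prod x x')"
proof -
 obtain C where C: "C \<ge> 0" "\<And>u. \<bar>u\<bar> \<le> 1 ==> Suc L - kth u (Suc L) \<le> C * sqrt (1 - u)"
  using kth_defect[of "Suc L"] by auto
 show ?thesis
 proof (intro exI[of _ "2 * C"] conjI allI ballI impI)
  fix d x x' assume x: "x \<in> unit_sphere d" "x' \<in> unit_sphere d" and L: "L \<ge> 1"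
  have "ntk d L x x + ntk d L x' x' - 2 * ntk d L x x' = 2 * (Suc L - kth (scalar_prod x x') (Suc L))"
   using x L by (simp add: ntk_diag ntk_eq_kth algebra_simps del: kth.simps)
  also have "\<dots> \<le> 2 * (C * sqrt (1 - scalar_prod x x'))"
   by (intro mult_left_mono C unit_sphere_abs_le[OF x]) simp
  finally show "ntk d L x x + ntk d L x' x' - 2 * ntk d L x x' \<le> 2 * C * sqrt (1 - scalar_prod x x')" by simp
 qed (use C in simp)
qed

section \<open>Posterior variances\<close>

definition psd_kernel :: "'x set => ('x => 'x => real) => bool" where
 "psd_kernel X k \<longleftrightarrow> (\<forall>x\<in>X. \<forall>y\<in>X. k x y = k y x) \<and>
  (\<forall>n c (x :: nat => 'x). (\<forall>i<n. x i \<in> X) \<longrightarrow> 0 \<le> (\<Sum>i<(n::nat). \<Sum>j<n. c i * c j * k (x i) (x j)))"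

lemma psd_kernel_sym: "psd_kernel X k ==> x \<in> X ==> y \<in> X ==> k x y = k y x"
 by (auto simp: psd_kernel_def)

lemma psd_kernelD: "psd_kernel X k ==> (\<And>i. i < n ==> x i \<in> X) ==> 0 \<le> (\<Sum>i<(n::nat). \<Sum>j<n. c i * c j * k (x i) (x j))"
 by (simp add: psd_kernel_def)

lemma psd_kernel_mono:
 assumes k: "psd_kernel X k" and Y: "Y \<subseteq> X"
 shows "psd_kernel Y k"
 unfolding psd_kernel_def
proof (intro conjI ballI allI impI)
 show "k x y = k y x" if "x \<in> Y" "y \<in> Y" for x y using psd_kernel_sym[OF k] Y that by blast
 show "0 \<le> (\<Sum>i<n. \<Sum>j<n. c i * c j * k (x i) (x j))" if "\<forall>i<n. x i \<in> Y" for n c and x :: "nat => _"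
  by (rule psd_kernelD[OF k]) (use that Y in blast)
qed

text \<open>The squared norm, in the reproducing kernel Hilbert space, of the kernel function at
  \<open>x'\<close> minus the combination with coefficients \<open>c\<close> of the kernel functions
  at the inputs, expanded into kernel values.\<close>

definition kdist :: "('x => 'x => real) => nat set => (nat => 'x) => 'x => (nat => real) => real" where
 "kdist k \<Psi> x x' c = k x' x' - 2 * (\<Sum>i\<in>\<Psi>. c i * k (x i) x') + (\<Sum>i\<in>\<Psi>. \<Sum>j\<in>\<Psi>. c i * c j * k (x i) (x j))"

lemma ex_enum:
 assumes "finite (\<Psi> :: nat set)"
 obtains e :: "nat => nat" where "bij_betw e {..<card \<Psi>} \<Psi>"
 using ex_bij_betw_nat_finite[OF assms] by (auto simp: atLeast0LessThan)

lemma psd_kernel_sum: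
 fixes \<Psi> :: "nat set" and c :: "nat => real"
 assumes k: "psd_kernel X k" and fin: "finite \<Psi>" and x: "\<forall>i\<in>\<Psi>. x i \<in> X"
 shows "0 \<le> (\<Sum>i\<in>\<Psi>. \<Sum>j\<in>\<Psi>. c i * c j * k (x i) (x j))"
proof -
 obtain e where e: "bij_betw e {..<card \<Psi>} \<Psi>" using ex_enum[OF fin] .
 have s: "(\<Sum>i\<in>\<Psi>. g i) = (\<Sum>i<card \<Psi>. g (e i))" for g :: "nat => real"
  by (rule sum.reindex_bij_betw[OF e, symmetric])
 have "\<forall>i<card \<Psi>. x (e i) \<in> X" using x bij_betwE[OF e] by auto
 then show ?thesis unfolding s by (intro psd_kernelD[OF k]) simp
qed

lemma kdist_nonneg:
 assumes k: "psd_kernel X k" and fin: "finite \<Psi>" and x: "\<forall>i\<in>\<Psi>. x i \<in> X" and x': "x' \<in> X"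
 shows "0 \<le> kdist k \<Psi> x x' c"
proof -
 \<comment> \<open>A fresh index stands for \<open>x'\<close>, with coefficient 1 against
   \<open>- c i\<close> for the inputs.\<close>
 obtain b where b: "b \<notin> \<Psi>" using fin ex_new_if_finite[OF infinite_UNIV_nat] by blast
 define y where "y i = (if i = b then x' else x i)" for i
 define a where "a i = (if i = b then 1 else - c i)" for i
 have "0 \<le> (\<Sum>i\<in>insert b \<Psi>. \<Sum>j\<in>insert b \<Psi>. a i * a j * k (y i) (y j))"
  by (rule psd_kernel_sum[OF k]) (use fin x x' in \<open>auto simp: y_def\<close>)
 also have "\<dots> = k x' x' + (\<Sum>j\<in>\<Psi>. - c j * k x' (x j)) + (\<Sum>i\<in>\<Psi>. - c i * k (x i) x' + (\<Sum>j\<in>\<Psi>. c i * c j * k (x i) (x j)))"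
 proof -
  have i: "(\<Sum>j\<in>insert b \<Psi>. a i * a j * k (y i) (y j)) = a i * k (y i) x' + (\<Sum>j\<in>\<Psi>. a i * (- c j) * k (y i) (x j))" for i
   using fin b by (subst sum.insert) (auto simp: a_def y_def intro!: sum.cong)
  show ?thesis unfolding i using fin b
   by (subst sum.insert) (auto simp: a_def y_def intro!: sum.cong arg_cong2[where f="(+)"])
 qed
 also have "(\<Sum>j\<in>\<Psi>. - c j * k x' (x j)) = (\<Sum>j\<in>\<Psi>. - c j * k (x j) x')"
  by (intro sum.cong refl) (use psd_kernel_sym[OF k x'] x in simp)
 finally show ?thesis by (simp add: kdist_def sum.distrib sum_negf sum_subtractf)
qed

text \<open>Translates the matrix formulas, which order the index set by a sorted list, into sums
  over \<open>\<Psi>\<close>. The matrix to be inverted is positive definite since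
  \<open>\<sigma> > 0\<close>, even for repeated inputs, so the inverse exists. Being symmetric, it
  can be moved from the rewards to \<open>kernel_col\<close>, which makes the posterior mean a
  linear form with the coefficients \<open>\<alpha>\<close>.\<close>

lemma posterior_solution:
 fixes k :: "real vec => real vec => real"
 assumes k: "psd_kernel X k" and \<sigma>: "\<sigma> > 0" and fin: "finite \<Psi>" and x: "\<forall>i\<in>\<Psi>. x i \<in> X"
 shows "\<exists>\<alpha>. (\<forall>i\<in>\<Psi>. (\<Sum>j\<in>\<Psi>. k (x i) (x j) * \<alpha> j) + \<sigma>\<^sup>2 * \<alpha> i = k (x i) x') \<and>
  (\<forall>y. post_mean k \<sigma> \<Psi> x y x' = (\<Sum>i\<in>\<Psi>. \<alpha> i * y i)) \<and>
  post_sd k \<sigma> \<Psi> x x' = sqrt (k x' x' - (\<Sum>i\<in>\<Psi>. \<alpha> i * k (x i) x'))"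
proof -
 define r where "r = sorted_list_of_set \<Psi>"
 define n where "n = card \<Psi>"
 have bij: "bij_betw ((!) r) {..<n} \<Psi>"
  unfolding r_def n_def using fin by (intro bij_betw_nth) auto
 have s: "(\<Sum>i\<in>\<Psi>. g i) = (\<Sum>i<n. g (r ! i))" for g :: "nat => real"
  by (rule sum.reindex_bij_betw[OF bij, symmetric])
 have rX: "x (r ! i) \<in> X" if "i < n" for i using bij_betwE[OF bij] that x by auto
 define K where "K i j = k (x (r ! i)) (x (r ! j))" for i j
 have Ksym: "K i j = K j i" if "i < n" "j < n" for i j
  unfolding K_def using that rX psd_kernel_sym[OF k] by blast
 define A where "A = Matrix.mat n n (\<lambda>(i, j). K i j) + \<sigma>\<^sup>2 \<cdot>\<^sub>m 1\<^sub>m n"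
 have A: "A \<in> carrier_mat n n" by (simp add: A_def)
 have Av: "vec_index (A *\<^sub>v v) i = (\<Sum>j<n. K i j * vec_index v j) + \<sigma>\<^sup>2 * vec_index v i" if "v \<in> carrier_vec n" "i < n" for v i
 proof -
  have "vec_index (A *\<^sub>v v) i = (\<Sum>j<n. (K i j + \<sigma>\<^sup>2 * of_bool (i = j)) * vec_index v j)"
   using that A by (auto simp: A_def scalar_prod_def atLeast0LessThan intro!: sum.cong)
  also have "\<dots> = (\<Sum>j<n. K i j * vec_index v j) + (\<Sum>j<n. if j = i then \<sigma>\<^sup>2 * vec_index v i else 0)"
   unfolding sum.distrib[symmetric] by (intro sum.cong) (auto simp: distrib_right)
  finally show ?thesis using that by simp
 qed
 have sp: "scalar_prod u v = (\<Sum>i<n. vec_index u i * vec_index v i)" if "v \<in> carrier_vec n" for u v :: "real vec"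
  using that by (auto simp: scalar_prod_def atLeast0LessThan)
 have Kpsd: "0 \<le> (\<Sum>i<n. \<Sum>j<n. c i * c j * K i j)" for c
  unfolding K_def by (rule psd_kernelD[OF k rX])
 have "det A \<noteq> 0"
 proof
  assume "det A = 0"
  then obtain v where v: "v \<in> carrier_vec n" "v \<noteq> 0\<^sub>v n" "A *\<^sub>v v = 0\<^sub>v n"
   using det_0_iff_vec_prod_zero[OF A] by blast
  have "0 = (\<Sum>i<n. vec_index v i * vec_index (A *\<^sub>v v) i)" using v by simp
  also have "\<dots> = (\<Sum>i<n. \<Sum>j<n. vec_index v i * vec_index v j * K i j) + \<sigma>\<^sup>2 * (\<Sum>i<n. (vec_index v i)\<^sup>2)"
   unfolding sum_distrib_left sum.distrib[symmetric] using v(1)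
   by (intro sum.cong refl) (simp add: Av sum_distrib_left algebra_simps power2_eq_square del: index_mult_mat_vec)
  finally have "\<sigma>\<^sup>2 * (\<Sum>i<n. (vec_index v i)\<^sup>2) \<le> 0" using Kpsd[of "vec_index v"] by linarith
  then have "(\<Sum>i<n. (vec_index v i)\<^sup>2) \<le> 0" using \<sigma> by (simp add: mult_le_0_iff)
  then have "(\<Sum>i<n. (vec_index v i)\<^sup>2) = 0" by (simp add: sum_nonneg antisym)
  then have "\<forall>i<n. vec_index v i = 0" by (subst (asm) sum_nonneg_eq_0_iff) auto
  then have "v = 0\<^sub>v n" using v(1) by (intro eq_vecI) auto
  with v(2) show False by simp
 qed
 from det_non_zero_imp_unit[OF A this, of "()"] mat_inverse(1)[OF A, where b="()"]
 obtain B where Bs: "mat_inverse A = Some B" by (cases "mat_inverse A") auto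
 from mat_inverse(2)[OF A Bs] have AB: "A * B = 1\<^sub>m n" and B: "B \<in> carrier_mat n n" by auto
 have inv: "kernel_inv k \<sigma> \<Psi> x = B"
  using Bs by (simp add: kernel_inv_def Let_def A_def K_def r_def[symmetric] n_def[symmetric])
 define b where "b = kernel_col k \<Psi> x x'"
 have b: "b \<in> carrier_vec n" "\<And>i. i < n ==> vec_index b i = k (x (r ! i)) x'"
  by (auto simp: b_def kernel_col_def r_def n_def)
 define a where "a = B *\<^sub>v b"
 have a: "a \<in> carrier_vec n" unfolding a_def by (rule mult_mat_vec_carrier[OF B b(1)])
 have ABv: "A *\<^sub>v (B *\<^sub>v v) = v" if "v \<in> carrier_vec n" for v
  using assoc_mult_mat_vec[OF A B that] AB that by simp
 define \<alpha> where "\<alpha> i = vec_index a (the_inv_into {..<n} ((!) r) i)" for i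
 have \<alpha>: "\<alpha> (r ! i) = vec_index a i" if "i < n" for i
  unfolding \<alpha>_def using bij that by (subst the_inv_into_f_f) (auto simp: bij_betw_def)
 have eq: "(\<Sum>j<n. K i j * vec_index a j) + \<sigma>\<^sup>2 * vec_index a i = k (x (r ! i)) x'" if "i < n" for i
  using Av[OF a that] ABv[OF b(1)] b(2)[OF that] unfolding a_def by simp
 have "(\<Sum>j\<in>\<Psi>. k (x i) (x j) * \<alpha> j) + \<sigma>\<^sup>2 * \<alpha> i = k (x i) x'" if i: "i \<in> \<Psi>" for i
 proof -
  obtain q where q: "q < n" "i = r ! q" using bij i by (auto simp: bij_betw_def)
  have "(\<Sum>j\<in>\<Psi>. k (x i) (x j) * \<alpha> j) = (\<Sum>j<n. K q j * vec_index a j)"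
   unfolding s q(2) by (intro sum.cong refl) (simp add: \<alpha> K_def)
  then show ?thesis using eq[OF q(1)] q by (simp add: \<alpha>)
 qed
 moreover have "post_mean k \<sigma> \<Psi> x y x' = (\<Sum>i\<in>\<Psi>. \<alpha> i * y i)" for y
 proof -
  define w where "w = Matrix.vec n (\<lambda>i. y (r ! i))"
  define \<eta> where "\<eta> = B *\<^sub>v w"
  have w: "w \<in> carrier_vec n" by (simp add: w_def)
  have \<eta>: "\<eta> \<in> carrier_vec n" unfolding \<eta>_def by (rule mult_mat_vec_carrier[OF B w])
  have A\<eta>: "(\<Sum>j<n. K i j * vec_index \<eta> j) + \<sigma>\<^sup>2 * vec_index \<eta> i = y (r ! i)" if "i < n" for i
   using Av[OF \<eta> that] ABv[OF w] that unfolding \<eta>_def by (simp add: w_def)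
  have "post_mean k \<sigma> \<Psi> x y x' = (\<Sum>i<n. k (x (r ! i)) x' * vec_index \<eta> i)"
   unfolding post_mean_def inv b_def[symmetric] r_def[symmetric] n_def[symmetric] w_def[symmetric] \<eta>_def[symmetric]
   unfolding sp[OF \<eta>] by (intro sum.cong refl) (simp add: b(2))
  also have "\<dots> = (\<Sum>i<n. ((\<Sum>j<n. K i j * vec_index a j) + \<sigma>\<^sup>2 * vec_index a i) * vec_index \<eta> i)"
   by (intro sum.cong refl) (simp add: eq)
  also have "\<dots> = (\<Sum>i<n. \<Sum>j<n. K i j * vec_index a j * vec_index \<eta> i) + (\<Sum>i<n. \<sigma>\<^sup>2 * vec_index a i * vec_index \<eta> i)"
   by (simp add: distrib_right sum.distrib sum_distrib_right)
  also have "(\<Sum>i<n. \<Sum>j<n. K i j * vec_index a j * vec_index \<eta> i) = (\<Sum>j<n. \<Sum>i<n. K i j * vec_index a j * vec_index \<eta> i)"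
   by (rule sum.swap)
  also have "\<dots> = (\<Sum>j<n. vec_index a j * (\<Sum>i<n. K j i * vec_index \<eta> i))"
  proof (intro sum.cong refl)
   fix j assume j: "j \<in> {..<n}"
   have "(\<Sum>i<n. K i j * vec_index a j * vec_index \<eta> i) = (\<Sum>i<n. vec_index a j * (K j i * vec_index \<eta> i))"
   proof (intro sum.cong refl)
    fix i assume "i \<in> {..<n}"
    then have "K i j = K j i" using j by (intro Ksym) auto
    then show "K i j * vec_index a j * vec_index \<eta> i = vec_index a j * (K j i * vec_index \<eta> i)" by simp
   qed
   then show "(\<Sum>i<n. K i j * vec_index a j * vec_index \<eta> i) = vec_index a j * (\<Sum>i<n. K j i * vec_index \<eta> i)"
    by (simp only: sum_distrib_left)
  qed
  also have "\<dots> + (\<Sum>i<n. \<sigma>\<^sup>2 * vec_index a i * vec_index \<eta> i) = (\<Sum>i<n. vec_index a i * ((\<Sum>j<n. K i j * vec_index \<eta> j) + \<sigma>\<^sup>2 * vec_index \<eta> i))"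
   by (simp add: distrib_left sum.distrib mult_ac)
  also have "\<dots> = (\<Sum>i\<in>\<Psi>. \<alpha> i * y i)" unfolding s by (intro sum.cong refl) (simp add: A\<eta> \<alpha>)
  finally show ?thesis .
 qed
 moreover have "post_sd k \<sigma> \<Psi> x x' = sqrt (k x' x' - (\<Sum>i\<in>\<Psi>. \<alpha> i * k (x i) x'))"
  unfolding post_sd_def inv b_def[symmetric] a_def[symmetric] s sp[OF a]
  by (intro arg_cong[where f=sqrt] arg_cong2[where f="(-)"] sum.cong refl) (simp add: b(2) \<alpha>)
 ultimately show ?thesis by blast
qed

text \<open>Kernel ridge regression: the posterior variance is the minimum over \<open>c\<close> of
  \<open>kdist\<close> plus the ridge term, attained at \<open>\<alpha>\<close>. Hence any trial
  coefficients bound the variance from above, and at \<open>\<alpha>\<close> it splits into a part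
  for the bias and a part for the noise.\<close>

lemma posterior:
 fixes k :: "real vec => real vec => real"
 assumes k: "psd_kernel X k" and \<sigma>: "\<sigma> > 0" and fin: "finite \<Psi>" and x: "\<forall>i\<in>\<Psi>. x i \<in> X" and x': "x' \<in> X"
 shows "\<exists>\<alpha>. (\<forall>i\<in>\<Psi>. (\<Sum>j\<in>\<Psi>. k (x i) (x j) * \<alpha> j) + \<sigma>\<^sup>2 * \<alpha> i = k (x i) x') \<and>
  (\<forall>y. post_mean k \<sigma> \<Psi> x y x' = (\<Sum>i\<in>\<Psi>. \<alpha> i * y i)) \<and>
  0 \<le> post_sd k \<sigma> \<Psi> x x' \<and>
  (post_sd k \<sigma> \<Psi> x x')\<^sup>2 = kdist k \<Psi> x x' \<alpha> + \<sigma>\<^sup>2 * (\<Sum>i\<in>\<Psi>. (\<alpha> i)\<^sup>2) \<and>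
  (\<forall>c. (post_sd k \<sigma> \<Psi> x x')\<^sup>2 \<le> kdist k \<Psi> x x' c + \<sigma>\<^sup>2 * (\<Sum>i\<in>\<Psi>. (c i)\<^sup>2))"
proof -
 obtain \<alpha> where eq: "\<And>i. i \<in> \<Psi> ==> (\<Sum>j\<in>\<Psi>. k (x i) (x j) * \<alpha> j) + \<sigma>\<^sup>2 * \<alpha> i = k (x i) x'"
  and mean: "\<And>y. post_mean k \<sigma> \<Psi> x y x' = (\<Sum>i\<in>\<Psi>. \<alpha> i * y i)"
  and sd: "post_sd k \<sigma> \<Psi> x x' = sqrt (k x' x' - (\<Sum>i\<in>\<Psi>. \<alpha> i * k (x i) x'))"
  using posterior_solution[OF k \<sigma> fin x, of x'] by blast
 define bil :: "(nat => real) => (nat => real) => real" where "bil u w = (\<Sum>i\<in>\<Psi>. \<Sum>j\<in>\<Psi>. u i * w j * k (x i) (x j)) + \<sigma>\<^sup>2 * (\<Sum>i\<in>\<Psi>. u i * w i)" for u w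
 have bil_sym: "bil u w = bil w u" for u w
 proof -
  have "(\<Sum>i\<in>\<Psi>. \<Sum>j\<in>\<Psi>. u i * w j * k (x i) (x j)) = (\<Sum>j\<in>\<Psi>. \<Sum>i\<in>\<Psi>. u i * w j * k (x i) (x j))" by (rule sum.swap)
  also have "\<dots> = (\<Sum>i\<in>\<Psi>. \<Sum>j\<in>\<Psi>. w i * u j * k (x i) (x j))"
   using psd_kernel_sym[OF k] x by (intro sum.cong refl) (simp add: mult_ac)
  finally show ?thesis unfolding bil_def by (simp add: mult.commute)
 qed
 have bil_diff: "bil (\<lambda>i. u i - v i) w = bil u w - bil v w" for u v w
  unfolding bil_def by (simp add: left_diff_distrib sum_subtractf right_diff_distrib)
 have bil_nonneg: "0 \<le> bil u u" for u
  unfolding bil_def using psd_kernel_sum[OF k fin x, of u] by (simp add: sum_nonneg)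
 have bil_\<alpha>: "bil c \<alpha> = (\<Sum>i\<in>\<Psi>. c i * k (x i) x')" for c
 proof -
  have "bil c \<alpha> = (\<Sum>i\<in>\<Psi>. c i * ((\<Sum>j\<in>\<Psi>. k (x i) (x j) * \<alpha> j) + \<sigma>\<^sup>2 * \<alpha> i))"
   unfolding bil_def by (simp add: distrib_left sum.distrib sum_distrib_left mult_ac)
  then show ?thesis by (simp add: eq)
 qed
 define Q where "Q c = kdist k \<Psi> x x' c + \<sigma>\<^sup>2 * (\<Sum>i\<in>\<Psi>. (c i)\<^sup>2)" for c
 have Q: "Q c = k x' x' - 2 * bil c \<alpha> + bil c c" for c
  unfolding Q_def kdist_def bil_\<alpha> by (simp add: bil_def power2_eq_square)
 have Qmin: "Q \<alpha> \<le> Q c" for c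
 proof -
  have "bil (\<lambda>i. c i - \<alpha> i) (\<lambda>i. c i - \<alpha> i) = bil c c - 2 * bil c \<alpha> + bil \<alpha> \<alpha>"
   unfolding bil_diff bil_sym[of _ "\<lambda>i. c i - \<alpha> i"] by (simp add: bil_sym[of \<alpha> c])
  with bil_nonneg[of "\<lambda>i. c i - \<alpha> i"] show ?thesis unfolding Q by simp
 qed
 have Q\<alpha>: "Q \<alpha> = k x' x' - (\<Sum>i\<in>\<Psi>. \<alpha> i * k (x i) x')" unfolding Q bil_\<alpha> by simp
 have Q0: "0 \<le> Q \<alpha>" unfolding Q_def using kdist_nonneg[OF k fin x x', of \<alpha>] by (simp add: sum_nonneg)
 have sd2: "(post_sd k \<sigma> \<Psi> x x')\<^sup>2 = Q \<alpha>" unfolding sd Q\<alpha>[symmetric] using Q0 by simp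
 have "0 \<le> post_sd k \<sigma> \<Psi> x x'" unfolding sd Q\<alpha>[symmetric] using Q0 by simp
 then show ?thesis using eq mean sd2 Qmin unfolding Q_def by (intro exI[of _ \<alpha>]) auto
qed

lemma post_sd_nonneg:
 fixes k :: "real vec => real vec => real"
 assumes "psd_kernel X k" "\<sigma> > 0" "finite \<Psi>" "\<forall>i\<in>\<Psi>. x i \<in> X" "x' \<in> X"
 shows "0 \<le> post_sd k \<sigma> \<Psi> x x'"
 using posterior[OF assms] by blast

lemma post_var_le_prior:
 fixes k :: "real vec => real vec => real"
 assumes "psd_kernel X k" "\<sigma> > 0" "finite \<Psi>" "\<forall>i\<in>\<Psi>. x i \<in> X" "x' \<in> X"
 shows "(post_sd k \<sigma> \<Psi> x x')\<^sup>2 \<le> k x' x'"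
proof -
 have "(post_sd k \<sigma> \<Psi> x x')\<^sup>2 \<le> kdist k \<Psi> x x' (\<lambda>_. 0) + \<sigma>\<^sup>2 * (\<Sum>i\<in>\<Psi>. 0\<^sup>2)"
  using posterior[OF assms] by blast
 then show ?thesis by (simp add: kdist_def)
qed

text \<open>The trial coefficients average over \<open>J\<close>. An average of kernel functions has
  a squared distance from the one at \<open>x'\<close> of at most the mean squared distance, and
  averaging reduces the ridge term to \<open>\<sigma>\<^sup>2 / card J\<close>.\<close>

lemma post_var_le_cell:
 fixes k :: "real vec => real vec => real"
 assumes k: "psd_kernel X k" and \<sigma>: "\<sigma> > 0" and fin: "finite \<Psi>" and x: "\<forall>i\<in>\<Psi>. x i \<in> X" and x': "x' \<in> X"
  and J: "J \<subseteq> \<Psi>" "J \<noteq> {}" and D: "\<And>i. i \<in> J ==> k x' x' + k (x i) (x i) - 2 * k (x i) x' \<le> D"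
 shows "(post_sd k \<sigma> \<Psi> x x')\<^sup>2 \<le> D + \<sigma>\<^sup>2 / card J"
proof -
 have finJ: "finite J" using J fin finite_subset by blast
 define n where "n = real (card J)"
 have n: "n > 0" using J finJ by (simp add: n_def card_gt_0_iff)
 define c where "c i = (if i \<in> J then 1 / n else 0)" for i
 have sc: "(\<Sum>i\<in>\<Psi>. c i * g i) = (\<Sum>i\<in>J. g i) / n" for g :: "nat => real"
 proof -
  have "(\<Sum>i\<in>\<Psi>. c i * g i) = (\<Sum>i\<in>J. c i * g i)"
   using J fin by (intro sum.mono_neutral_right) (auto simp: c_def)
  also have "\<dots> = (\<Sum>i\<in>J. g i / n)" by (intro sum.cong) (auto simp: c_def)
  finally show ?thesis by (simp add: sum_divide_distrib)
 qed
 have scc: "(\<Sum>i\<in>\<Psi>. \<Sum>j\<in>\<Psi>. c i * c j * h i j) = (\<Sum>i\<in>J. \<Sum>j\<in>J. h i j) / n\<^sup>2" for h :: "nat => nat => real"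
  unfolding mult.assoc sum_distrib_left[symmetric] sc by (simp add: sum_divide_distrib[symmetric] power2_eq_square)
 have c2: "(\<Sum>i\<in>\<Psi>. (c i)\<^sup>2) = 1 / n"
 proof -
  have "(\<Sum>i\<in>\<Psi>. c i * c i) = (\<Sum>i\<in>J. c i) / n" by (rule sc)
  also have "(\<Sum>i\<in>J. c i) = 1" using n by (simp add: c_def n_def)
  finally show ?thesis by (simp add: power2_eq_square)
 qed
 have pair: "0 \<le> k (x i) (x i) + k (x j) (x j) - 2 * k (x i) (x j)" if "i \<in> J" "j \<in> J" for i j
 proof -
  have "0 \<le> kdist k {i} x (x j) (\<lambda>_. 1)" by (rule kdist_nonneg[OF k]) (use that J x in auto)
  then show ?thesis by (simp add: kdist_def)
 qed
 have "kdist k \<Psi> x x' c = k x' x' - 2 * ((\<Sum>i\<in>J. k (x i) x') / n) + (\<Sum>i\<in>J. \<Sum>j\<in>J. k (x i) (x j)) / n\<^sup>2"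
  unfolding kdist_def sc scc ..
 \<comment> \<open>The squared distance to a mean is the mean squared distance minus half the mean
   squared distance of pairs.\<close>
 also have "\<dots> = (\<Sum>i\<in>J. k x' x' + k (x i) (x i) - 2 * k (x i) x') / n
   - (\<Sum>i\<in>J. \<Sum>j\<in>J. k (x i) (x i) + k (x j) (x j) - 2 * k (x i) (x j)) / (2 * n\<^sup>2)"
 proof -
  have 1: "(\<Sum>i\<in>J. k x' x' + k (x i) (x i) - 2 * k (x i) x') = n * k x' x' + (\<Sum>i\<in>J. k (x i) (x i)) - 2 * (\<Sum>i\<in>J. k (x i) x')"
   by (simp add: sum.distrib sum_subtractf sum_distrib_left n_def)
  have 2: "(\<Sum>i\<in>J. \<Sum>j\<in>J. k (x i) (x i) + k (x j) (x j) - 2 * k (x i) (x j)) = 2 * n * (\<Sum>i\<in>J. k (x i) (x i)) - 2 * (\<Sum>i\<in>J. \<Sum>j\<in>J. k (x i) (x j))"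
   by (simp add: sum.distrib sum_subtractf sum_distrib_left[symmetric] n_def)
  show ?thesis unfolding 1 2 using n by (simp add: field_simps power2_eq_square)
 qed
 also have "\<dots> \<le> (\<Sum>i\<in>J. D) / n - 0"
  using n pair D by (intro diff_mono divide_right_mono sum_mono divide_nonneg_nonneg sum_nonneg) auto
 also have "\<dots> = D" using n by (simp add: n_def)
 finally have "kdist k \<Psi> x x' c \<le> D" .
 moreover have "(post_sd k \<sigma> \<Psi> x x')\<^sup>2 \<le> kdist k \<Psi> x x' c + \<sigma>\<^sup>2 * (\<Sum>i\<in>\<Psi>. (c i)\<^sup>2)"
  using posterior[OF k \<sigma> fin x x'] by blast
 ultimately show ?thesis unfolding c2 by (simp add: n_def)
qed

section \<open>Summing variances cell by cell\<close>

lemma sum_rank: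
 fixes g :: "nat => real"
 assumes "finite (S :: nat set)"
 shows "(\<Sum>t\<in>S. g (card {i \<in> S. i < t})) = (\<Sum>n<card S. g n)"
 using assms
proof (induction S rule: finite_linorder_max_induct)
 case (insert b A)
 have "(\<Sum>t\<in>insert b A. g (card {i \<in> insert b A. i < t})) = g (card {i \<in> insert b A. i < b}) + (\<Sum>t\<in>A. g (card {i \<in> insert b A. i < t}))"
  using insert by (subst sum.insert) auto
 also have "{i \<in> insert b A. i < b} = A" using insert by auto
 also have "(\<Sum>t\<in>A. g (card {i \<in> insert b A. i < t})) = (\<Sum>t\<in>A. g (card {i \<in> A. i < t}))"
  using insert by (intro sum.cong refl arg_cong[where f=g] arg_cong[where f=card]) (auto dest: less_asym)
 also have "card (insert b A) = Suc (card A)" using insert by auto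
 ultimately show ?case using insert by (simp add: add.commute)
qed simp

lemma harmonic_sum_le: "n > 0 ==> (\<Sum>i<n. 1 / real (Suc i)) \<le> 1 + ln (real n)"
proof (induction n)
 case (Suc n)
 show ?case
 proof (cases "n = 0")
  case False
  have "ln (real n / real (Suc n)) \<le> real n / real (Suc n) - 1" using False by (intro ln_le_minus_one) simp
  also have "\<dots> = - (1 / real (Suc n))" by (simp add: field_simps)
  finally have "1 / real (Suc n) \<le> ln (real (Suc n)) - ln (real n)" using False by (simp add: ln_div)
  then show ?thesis using Suc.IH False by simp
 qed simp
qed simp

text \<open>In the order of time, the visits to one cell see 0, 1, 2, ... earlier visits. The first
  costs \<open>\<kappa>\<close> and a later one \<open>\<sigma>\<^sup>2 / n\<close>, which gives a
  harmonic sum per cell; \<open>D\<close> is charged at every visit.\<close>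

lemma sum_variance_cells:
 fixes v :: "nat => real" and cell :: "nat => 'c" and D \<kappa> :: real
 assumes S: "finite S" "S \<noteq> {}" and C: "finite C" "cell ` S \<subseteq> C" and \<kappa>: "\<kappa> \<ge> 0"
  and v0: "\<And>t. t \<in> S ==> v t \<le> \<kappa>" and D0: "D \<ge> 0"
  and vD: "\<And>t. t \<in> S ==> {i \<in> S. i < t \<and> cell i = cell t} \<noteq> {} ==> v t \<le> D + \<sigma>\<^sup>2 / card {i \<in> S. i < t \<and> cell i = cell t}"
 shows "(\<Sum>t\<in>S. v t) \<le> card S * D + card C * (\<kappa> + \<sigma>\<^sup>2 * (1 + ln (card S)))"
proof -
 define g where "g n = (if n = 0 then \<kappa> else \<sigma>\<^sup>2 / real n)" for n :: nat
 define N where "N t = card {i \<in> S. i < t \<and> cell i = cell t}" for t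
 have vg: "v t \<le> D + g (N t)" if t: "t \<in> S" for t
 proof (cases "{i \<in> S. i < t \<and> cell i = cell t} = {}")
  case True
  then show ?thesis using v0[OF t] D0 by (simp add: g_def N_def)
 next
  case False
  then have "N t \<noteq> 0" using S unfolding N_def by (simp only: card_eq_0_iff) simp
  then have "g (N t) = \<sigma>\<^sup>2 / N t" by (simp add: g_def)
  then show ?thesis using vD[OF t False] unfolding N_def by simp
 qed
 have gsum: "(\<Sum>n<M. g n) \<le> \<kappa> + \<sigma>\<^sup>2 * (1 + ln (card S))" if M: "M \<le> card S" for M
 proof -
  have cS: "card S > 0" using S by (simp add: card_gt_0_iff)
  have "(\<Sum>n<M. g n) \<le> (\<Sum>n<Suc (card S). g n)"
   using M \<kappa> by (intro sum_mono2) (auto simp: g_def)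
  also have "\<dots> = \<kappa> + (\<Sum>n<card S. \<sigma>\<^sup>2 / real (Suc n))" by (subst sum.lessThan_Suc_shift) (simp add: g_def)
  also have "(\<Sum>n<card S. \<sigma>\<^sup>2 / real (Suc n)) = \<sigma>\<^sup>2 * (\<Sum>n<card S. 1 / real (Suc n))"
   by (simp add: sum_distrib_left)
  also have "\<dots> \<le> \<sigma>\<^sup>2 * (1 + ln (card S))"
   using harmonic_sum_le[OF cS] by (intro mult_left_mono) auto
  finally show ?thesis by simp
 qed
 have "(\<Sum>t\<in>S. v t) \<le> (\<Sum>t\<in>S. D + g (N t))" by (intro sum_mono vg)
 also have "\<dots> = card S * D + (\<Sum>t\<in>S. g (N t))" by (simp add: sum.distrib)
 also have "(\<Sum>t\<in>S. g (N t)) = (\<Sum>c\<in>C. \<Sum>t\<in>{t \<in> S. cell t = c}. g (N t))"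
  by (rule sum.group[symmetric]) (use S C in auto)
 also have "\<dots> = (\<Sum>c\<in>C. \<Sum>t\<in>{t \<in> S. cell t = c}. g (card {i \<in> {t \<in> S. cell t = c}. i < t}))"
  unfolding N_def by (intro sum.cong refl arg_cong[where f=g] arg_cong[where f=card]) auto
 also have "\<dots> = (\<Sum>c\<in>C. \<Sum>n<card {t \<in> S. cell t = c}. g n)"
  using S by (intro sum.cong refl sum_rank) auto
 also have "\<dots> \<le> (\<Sum>c\<in>C. \<kappa> + \<sigma>\<^sup>2 * (1 + ln (card S)))"
  using S by (intro sum_mono gsum card_mono) auto
 also have "\<dots> = card C * (\<kappa> + \<sigma>\<^sup>2 * (1 + ln (card S)))" by simp
 finally show ?thesis by simp
qed

section \<open>A partition of the sphere into cells\<close>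

lemma scalar_prod_defect:
 assumes "x \<in> unit_sphere d" "x' \<in> unit_sphere d"
 shows "2 * (1 - scalar_prod x x') = (\<Sum>i<d. (vec_index x i - vec_index x' i)\<^sup>2)"
proof -
 have c: "x \<in> carrier_vec d" "x' \<in> carrier_vec d" and 1: "scalar_prod x x = 1" "scalar_prod x' x' = 1"
  using assms by (auto simp: unit_sphere_def)
 have "(\<Sum>i<d. (vec_index x i - vec_index x' i)\<^sup>2) = scalar_prod x x + scalar_prod x' x' - 2 * scalar_prod x x'"
  unfolding scalar_prod_sum[OF c(1)] scalar_prod_sum[OF c(2)]
  by (simp add: power2_eq_square algebra_simps sum.distrib sum_subtractf sum_distrib_left)
 then show ?thesis using 1 by simp
qed

definition pivot :: "nat => real vec => nat" where
 "pivot d x = (SOME j. j < d \<and> 1 / d \<le> (vec_index x j)\<^sup>2)"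

text \<open>Only \<open>d - 1\<close> coordinates are rounded. The remaining one, the pivot, is
  large, and the unit norm determines it up to its sign, which is recorded; rounding it as well
  would give the exponent \<open>d\<close> in the number of cells.\<close>

definition sphere_cell :: "nat => real => real vec => nat \<times> bool \<times> (nat => int)" where
 "sphere_cell d \<rho> x = (pivot d x, vec_index x (pivot d x) > 0, \<lambda>i\<in>{..<d} - {pivot d x}. \<lfloor>vec_index x i / \<rho>\<rfloor>)"

lemma pivot:
 assumes x: "x \<in> unit_sphere d"
 shows "pivot d x < d" "1 / d \<le> (vec_index x (pivot d x))\<^sup>2"
proof -
 have s: "(\<Sum>j<d. (vec_index x j)\<^sup>2) = 1"
  using x scalar_prod_sum[of x d x] by (simp add: unit_sphere_def power2_eq_square)
 have "\<exists>j. j < d \<and> 1 / d \<le> (vec_index x j)\<^sup>2"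
 proof (rule ccontr)
  assume "\<not> ?thesis"
  then have lt: "(vec_index x j)\<^sup>2 < 1 / d" if "j < d" for j using that by (meson not_le)
  have d: "d > 0" using s by (cases d) auto
  have "(\<Sum>j<d. (vec_index x j)\<^sup>2) < (\<Sum>j<d. 1 / d)" using lt d by (intro sum_strict_mono) auto
  with s d show False by simp
 qed
 from someI_ex[OF this] show "pivot d x < d" "1 / d \<le> (vec_index x (pivot d x))\<^sup>2" unfolding pivot_def by auto
qed

lemma unit_sphere_coord:
 assumes x: "x \<in> unit_sphere d" and i: "i < d"
 shows "\<bar>vec_index x i\<bar> \<le> 1"
proof -
 have "(vec_index x i)\<^sup>2 \<le> (\<Sum>j<d. (vec_index x j)\<^sup>2)" using i by (intro member_le_sum) auto
 also have "\<dots> = 1" using x scalar_prod_sum[of x d x] by (simp add: unit_sphere_def power2_eq_square)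
 finally show ?thesis by (simp add: abs_square_le_1)
qed

text \<open>For the pivot coordinates \<open>a\<close> and \<open>a'\<close> the unit norm bounds
  the difference of the squares by \<open>2 * d * \<rho>\<close>, while
  \<open>\<bar>a + a'\<bar>\<close> is at least \<open>2 / d\<close>, as both have the same sign and
  a square of at least \<open>1 / d\<close>. Dividing bounds \<open>\<bar>a - a'\<bar>\<close>; the
  other coordinates differ by at most \<open>\<rho>\<close>.\<close>

lemma sphere_cell_defect:
 assumes x: "x \<in> unit_sphere d" "x' \<in> unit_sphere d" and \<rho>: "\<rho> > 0"
  and eq: "sphere_cell d \<rho> x = sphere_cell d \<rho> x'"
 shows "1 - scalar_prod x x' \<le> (real d ^ 2 * \<rho>)\<^sup>2"
proof -
 define j where "j = pivot d x"
 have j': "pivot d x' = j" and sg: "(vec_index x j > 0) = (vec_index x' j > 0)"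
  and fl: "(\<lambda>i\<in>{..<d} - {j}. \<lfloor>vec_index x i / \<rho>\<rfloor>) = (\<lambda>i\<in>{..<d} - {j}. \<lfloor>vec_index x' i / \<rho>\<rfloor>)"
  using eq by (auto simp: sphere_cell_def j_def)
 have jd: "j < d" using pivot(1)[OF x(1)] by (simp add: j_def)
 have d1: "real d \<ge> 1" using jd by simp
 define a a' where "a = vec_index x j" and "a' = vec_index x' j"
 have a2: "1 / d \<le> a\<^sup>2" "1 / d \<le> a'\<^sup>2" using pivot(2)[OF x(1)] pivot(2)[OF x(2)] j' by (auto simp: a_def a'_def j_def)
 have close: "\<bar>vec_index x i - vec_index x' i\<bar> \<le> \<rho>" if "i < d" "i \<noteq> j" for i
 proof -
  have "\<lfloor>vec_index x i / \<rho>\<rfloor> = \<lfloor>vec_index x' i / \<rho>\<rfloor>"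
   using fun_cong[OF fl, of i] that by simp
  then have "\<bar>vec_index x i / \<rho> - vec_index x' i / \<rho>\<bar> \<le> 1" by linarith
  then show ?thesis using \<rho> by (simp add: diff_divide_distrib[symmetric] abs_divide)
 qed
 have sq1: "(\<Sum>i<d. (vec_index y i)\<^sup>2) = 1" if "y \<in> unit_sphere d" for y
  using that scalar_prod_sum[of y d y] by (simp add: unit_sphere_def power2_eq_square)
 have split: "(\<Sum>i<d. g i) = g j + (\<Sum>i\<in>{..<d} - {j}. g i)" for g :: "nat => real"
  using jd by (subst sum.remove[of _ j]) auto
 have "\<bar>a\<^sup>2 - a'\<^sup>2\<bar> \<le> 2 * d * \<rho>"
 proof -
  have "a\<^sup>2 - a'\<^sup>2 = (\<Sum>i\<in>{..<d} - {j}. (vec_index x' i)\<^sup>2 - (vec_index x i)\<^sup>2)"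
   using sq1[OF x(1)] sq1[OF x(2)] unfolding split by (simp add: a_def a'_def sum_subtractf)
  also have "\<bar>\<dots>\<bar> \<le> (\<Sum>i\<in>{..<d} - {j}. 2 * \<rho>)"
  proof (rule order_trans[OF sum_abs], rule sum_mono)
   fix i assume i: "i \<in> {..<d} - {j}"
   have "\<bar>(vec_index x' i)\<^sup>2 - (vec_index x i)\<^sup>2\<bar> = \<bar>vec_index x i - vec_index x' i\<bar> * \<bar>vec_index x i + vec_index x' i\<bar>"
    unfolding abs_mult[symmetric] by (subst abs_minus_commute) (simp add: power2_eq_square algebra_simps)
   also have "\<dots> \<le> \<rho> * 2"
    using close i unit_sphere_coord[OF x(1), of i] unit_sphere_coord[OF x(2), of i] \<rho> by (intro mult_mono) auto
   finally show "\<bar>(vec_index x' i)\<^sup>2 - (vec_index x i)\<^sup>2\<bar> \<le> 2 * \<rho>" by simp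
  qed
  also have "\<dots> \<le> 2 * d * \<rho>" using \<rho> jd by (simp add: of_nat_diff)
  finally show ?thesis .
 qed
 have aa: "\<bar>a + a'\<bar> \<ge> 2 / d"
 proof -
  have "1 / real d \<le> \<bar>y\<bar>" if "1 / real d \<le> y\<^sup>2" for y :: real
  proof -
   have "(1 / real d)\<^sup>2 \<le> 1 / d" using d1 by (simp add: power2_eq_square field_simps)
   then have "(1 / real d)\<^sup>2 \<le> \<bar>y\<bar>\<^sup>2" using that by simp
   then show ?thesis by (rule power2_le_imp_le) simp
  qed
  from this[OF a2(1)] this[OF a2(2)] sg show ?thesis unfolding a_def a'_def by (auto simp: abs_if split: if_splits)
 qed
 have "\<bar>a - a'\<bar> * (2 / d) \<le> \<bar>a - a'\<bar> * \<bar>a + a'\<bar>" using aa by (intro mult_left_mono) auto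
 also have "\<dots> = \<bar>a\<^sup>2 - a'\<^sup>2\<bar>" unfolding abs_mult[symmetric] by (simp add: power2_eq_square algebra_simps)
 also have "\<dots> \<le> 2 * d * \<rho>" by fact
 finally have aj: "\<bar>a - a'\<bar> \<le> real d ^ 2 * \<rho>" using d1 by (simp add: field_simps power2_eq_square)
 have le: "(vec_index x i - vec_index x' i)\<^sup>2 \<le> (if i = j then (real d ^ 2 * \<rho>)\<^sup>2 else \<rho>\<^sup>2)" if "i < d" for i
  using aj close[OF that] \<rho> by (auto simp: a_def a'_def abs_le_square_iff[symmetric] abs_mult)
 have "2 * (1 - scalar_prod x x') = (\<Sum>i<d. (vec_index x i - vec_index x' i)\<^sup>2)" by (rule scalar_prod_defect[OF x])
 also have "\<dots> \<le> (\<Sum>i<d. if i = j then (real d ^ 2 * \<rho>)\<^sup>2 else \<rho>\<^sup>2)" using le by (intro sum_mono) auto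
 also have "\<dots> = (real d ^ 2 * \<rho>)\<^sup>2 + (real d - 1) * \<rho>\<^sup>2" unfolding split using jd by (simp add: of_nat_diff)
 also have "(real d - 1) * \<rho>\<^sup>2 \<le> (real d ^ 2 * \<rho>)\<^sup>2"
 proof -
  have "real d - 1 \<le> real d ^ 1" by simp
  also have "\<dots> \<le> real d ^ 4" using d1 by (intro power_increasing) auto
  finally show ?thesis by (simp add: power_mult_distrib power_mult[symmetric] mult_right_mono)
 qed
 finally show ?thesis by simp
qed

lemma sphere_cells_card:
 assumes d: "d \<ge> 1" and \<rho>: "0 < \<rho>" "\<rho> \<le> 1"
 shows "\<exists>C. finite C \<and> sphere_cell d \<rho> ` unit_sphere d \<subseteq> C \<and> real (card C) \<le> 2 * real d * (5 / \<rho>) ^ (d - 1)"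
proof -
 define K where "K = \<lceil>1 / \<rho>\<rceil>"
 have K0: "K \<ge> 1" using \<rho> by (simp add: K_def one_le_ceiling)
 define C where "C = (SIGMA j:{..<d}. (UNIV :: bool set) \<times> (\<Pi>\<^sub>E i\<in>{..<d} - {j}. {-K..K}))"
 have fin: "finite C" unfolding C_def by (intro finite_SigmaI finite_cartesian_product finite_PiE) auto
 have sub: "sphere_cell d \<rho> x \<in> C" if x: "x \<in> unit_sphere d" for x
 proof -
  have "\<lfloor>vec_index x i / \<rho>\<rfloor> \<in> {-K..K}" if "i < d" for i
  proof -
   have "\<bar>vec_index x i / \<rho>\<bar> \<le> 1 / \<rho>" using unit_sphere_coord[OF x that] \<rho> by (simp add: abs_divide divide_right_mono)
   then have "vec_index x i / \<rho> \<le> of_int K" "- of_int K \<le> vec_index x i / \<rho>" unfolding K_def by linarith+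
   then show ?thesis by (auto simp: le_floor_iff floor_le_iff)
  qed
  then show ?thesis using pivot(1)[OF x] by (auto simp: sphere_cell_def C_def)
 qed
 have "card C = (\<Sum>j<d. 2 * card (\<Pi>\<^sub>E i\<in>{..<d} - {j}. {-K..K}))"
  unfolding C_def by (subst card_SigmaI) (auto simp: card_cartesian_product finite_PiE)
 also have "\<dots> = (\<Sum>j<d. 2 * nat (2 * K + 1) ^ (d - 1))"
  by (intro sum.cong refl) (auto simp: card_PiE)
 finally have "real (card C) = 2 * real d * real (nat (2 * K + 1)) ^ (d - 1)" by simp
 also have "\<dots> \<le> 2 * real d * (5 / \<rho>) ^ (d - 1)"
 \<comment> \<open>\<open>2 * K + 1\<close> is at most \<open>2 / \<rho> + 3\<close>, and 1 is at
   most \<open>1 / \<rho>\<close>; hence the 5.\<close>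
 proof (intro mult_left_mono power_mono)
  have "real_of_int K \<le> 1 / \<rho> + 1" unfolding K_def by linarith
  moreover have "1 \<le> 1 / \<rho>" using \<rho> by simp
  ultimately have "2 * real_of_int K + 1 \<le> 5 / \<rho>" by simp
  then show "real (nat (2 * K + 1)) \<le> 5 / \<rho>" using K0 by simp
 qed auto
 finally show ?thesis using fin sub by (intro exI[of _ C]) auto
qed

lemma psd_kernel_ntk:
 assumes "L \<ge> 1"
 shows "psd_kernel (unit_sphere d) (ntk d L)"
 unfolding psd_kernel_def using ntk_sym[OF _ _ assms] ntk_psd[OF _ assms] by blast

text \<open>Stated for an arbitrary set \<open>S\<close> of rounds, each of which sees the earlier
  rounds of \<open>S\<close>: this is the posterior used at one level of the elimination algorithm,
  and with all rounds in \<open>S\<close> the one of NTK-UCB. The second lower bound on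
  \<open>C\<close> lets it dominate the diagonal of the kernel later.\<close>

theorem ntk_variance_sum:
 "\<exists>C :: nat => nat => real. (\<forall>d L. C d L \<ge> 1 \<and> C d L \<ge> real L + 1) \<and>
  (\<forall>d L \<sigma> T S x. d \<ge> 1 \<and> L \<ge> 1 \<and> \<sigma> > 0 \<and> T \<ge> 3 \<and> S \<subseteq> {1..T} \<and> (\<forall>t\<in>S. x t \<in> unit_sphere d) \<longrightarrow>
   (\<Sum>t\<in>S. (post_sd (ntk d L) \<sigma> {i \<in> S. i < t} x (x t))\<^sup>2) \<le>
    C d L * (1 + \<sigma>\<^sup>2) * real T powr ((real d - 1) / real d) * ln (real T))"
proof -
 obtain H where H: "\<And>L. H L \<ge> 0" "\<And>L d x x'. x \<in> unit_sphere d ==> x' \<in> unit_sphere d ==> L \<ge> 1 ==>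
  ntk d L x x + ntk d L x' x' - 2 * ntk d L x x' \<le> H L * sqrt (1 - scalar_prod x x')"
  using ntk_Hoelder by metis
 \<comment> \<open>The first summand comes from the diameter of the cells, the second is their
   number times the variance collected in each, and the last one provides
   \<open>C d L \<ge> real L + 1\<close>.\<close>
 define C where "C d L = H L * real d ^ 2 + 2 * real d * 5 ^ (d - 1) * (real L + 3) + real L + 1" for d L :: nat
 have C: "C d L \<ge> 1 \<and> C d L \<ge> real L + 1" for d L unfolding C_def using H(1)[of L] by simp
 have "(\<Sum>t\<in>S. (post_sd (ntk d L) \<sigma> {i \<in> S. i < t} x (x t))\<^sup>2) \<le>
    C d L * (1 + \<sigma>\<^sup>2) * real T powr ((real d - 1) / real d) * ln (real T)"
  if d: "d \<ge> 1" and L: "L \<ge> 1" and \<sigma>: "\<sigma> > 0" and T: "T \<ge> 3" and S: "S \<subseteq> {1..T}" and x: "\<And>t. t \<in> S ==> x t \<in> unit_sphere d"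
  for d L T :: nat and \<sigma> :: real and S :: "nat set" and x
 proof (cases "S = {}")
  case True
  have "ln (real T) \<ge> 0" using T by simp
  then show ?thesis using True C[of d L] by simp
 next
  case False
  have lnT: "ln (real T) \<ge> 1"
  proof -
   have "exp 1 \<le> (3::real)" using e_less_272 by simp
   then have "exp 1 \<le> real T" using T by linarith
   then show ?thesis using T by (subst ln_ge_iff) auto
  qed
  have finS: "finite S" using S finite_subset by blast
  \<comment> \<open>Chosen so that the cost of the diameter, \<open>T * \<rho>\<close>, and the
    number of cells, of order \<open>(1 / \<rho>) ^ (d - 1)\<close>, are both governed by
    \<open>\<tau>\<close>.\<close>
  define \<rho> where "\<rho> = real T powr (- 1 / real d)"
  define \<tau> where "\<tau> = real T powr ((real d - 1) / real d)"
  have \<rho>: "0 < \<rho>" "\<rho> \<le> 1"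
  proof -
   show "0 < \<rho>" using T by (simp add: \<rho>_def)
   have "real T powr (- 1 / real d) \<le> real T powr 0" using T by (intro powr_mono) auto
   then show "\<rho> \<le> 1" using T by (simp add: \<rho>_def)
  qed
  have T\<rho>: "real T * \<rho> = \<tau>"
  proof -
   have "(real d - 1) / real d = 1 + - 1 / real d" using d by (simp add: field_simps)
   then have "\<tau> = real T powr 1 * real T powr (- 1 / real d)" unfolding \<tau>_def by (simp only: powr_add)
   then show ?thesis using T by (simp only: \<rho>_def powr_one of_nat_0_le_iff)
  qed
  have inv\<rho>: "(1 / \<rho>) ^ (d - 1) = \<tau>"
  proof -
   have T0: "real T > 0" using T by simp
   have "1 / \<rho> = real T powr (1 / real d)"
    unfolding \<rho>_def minus_divide_left[symmetric] powr_minus by (simp add: inverse_eq_divide)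
   then have "(1 / \<rho>) ^ (d - 1) = (real T powr (1 / real d)) powr (real (d - 1))"
    using T0 by (simp only: powr_realpow powr_gt_zero)
   also have "\<dots> = real T powr (1 / real d * real (d - 1))" by (rule powr_powr)
   also have "1 / real d * real (d - 1) = (real d - 1) / real d" using d by (simp add: of_nat_diff)
   finally show ?thesis by (simp only: \<tau>_def)
  qed
  have \<tau>0: "\<tau> \<ge> 0" by (simp add: \<tau>_def)
  obtain Ce where Ce: "finite Ce" "sphere_cell d \<rho> ` unit_sphere d \<subseteq> Ce" "real (card Ce) \<le> 2 * real d * (5 / \<rho>) ^ (d - 1)"
   using sphere_cells_card[OF d \<rho>] by (elim exE conjE) (rule that)
  have cardCe: "real (card Ce) \<le> 2 * real d * 5 ^ (d - 1) * \<tau>"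
  proof -
   have "(5 / \<rho>) ^ (d - 1) = 5 ^ (d - 1) * \<tau>" unfolding inv\<rho>[symmetric] by (simp add: power_divide)
   then show ?thesis using Ce(3) by (simp only: mult.assoc)
  qed
  define D where "D = H L * (real d ^ 2 * \<rho>)"
  have D0: "D \<ge> 0" using H(1) \<rho> by (simp add: D_def)
  note K = psd_kernel_ntk[OF L, of d]
  define v where "v t = (post_sd (ntk d L) \<sigma> {i \<in> S. i < t} x (x t))\<^sup>2" for t
  have "(\<Sum>t\<in>S. v t) \<le> card S * D + card Ce * ((real L + 1) + \<sigma>\<^sup>2 * (1 + ln (card S)))"
  proof (rule sum_variance_cells[where cell="\<lambda>t. sphere_cell d \<rho> (x t)"])
   show "(\<lambda>t. sphere_cell d \<rho> (x t)) ` S \<subseteq> Ce" using Ce(2) x by auto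
   show "v t \<le> real L + 1" if "t \<in> S" for t
    unfolding v_def ntk_diag[OF x[OF that] L, symmetric]
    by (rule post_var_le_prior[OF K \<sigma>]) (use finS x that in auto)
   fix t assume t: "t \<in> S" and ne: "{i \<in> S. i < t \<and> sphere_cell d \<rho> (x i) = sphere_cell d \<rho> (x t)} \<noteq> {}"
   show "v t \<le> D + \<sigma>\<^sup>2 / card {i \<in> S. i < t \<and> sphere_cell d \<rho> (x i) = sphere_cell d \<rho> (x t)}"
    unfolding v_def
   proof (rule post_var_le_cell[OF K \<sigma> _ _ _ _ ne])
    fix i assume i: "i \<in> {i \<in> S. i < t \<and> sphere_cell d \<rho> (x i) = sphere_cell d \<rho> (x t)}"
    then have xi: "x i \<in> unit_sphere d" "x t \<in> unit_sphere d" using x t by auto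
    have "1 - scalar_prod (x i) (x t) \<le> (real d ^ 2 * \<rho>)\<^sup>2"
     using i by (intro sphere_cell_defect[OF xi \<rho>(1)]) auto
    then have "sqrt (1 - scalar_prod (x i) (x t)) \<le> real d ^ 2 * \<rho>"
     using \<rho> by (intro real_le_lsqrt) auto
    then have "H L * sqrt (1 - scalar_prod (x i) (x t)) \<le> D" unfolding D_def using H(1) by (intro mult_left_mono) auto
    with H(2)[OF xi L] show "ntk d L (x t) (x t) + ntk d L (x i) (x i) - 2 * ntk d L (x i) (x t) \<le> D" by linarith
   qed (use finS x t in auto)
  qed (use finS False Ce D0 in auto)
  also have "\<dots> \<le> T * D + (2 * real d * 5 ^ (d - 1) * \<tau>) * ((real L + 1) + \<sigma>\<^sup>2 * (1 + ln T))"
  proof (intro add_mono mult_mono mult_left_mono add_left_mono)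
   have "real (card S) \<ge> 1" using False finS by (simp add: Suc_le_eq card_gt_0_iff)
   then have "0 \<le> ln (real (card S))" by (rule ln_ge_zero)
   then show "0 \<le> 1 + ln (real (card S))" by simp
   have cS: "card S \<le> T" using card_mono[OF _ S] by simp
   then show "real (card S) \<le> real T" by simp
   have "card S > 0" using False finS by (simp add: card_gt_0_iff)
   then show "ln (real (card S)) \<le> ln (real T)" using cS by simp
   show "0 \<le> (real L + 1) + \<sigma>\<^sup>2 * (1 + ln (card S))" using \<open>card S > 0\<close> by (intro add_nonneg_nonneg mult_nonneg_nonneg) auto
  qed (use D0 cardCe \<tau>0 in auto)
  also have "real T * D = H L * real d ^ 2 * \<tau>" unfolding D_def T\<rho>[symmetric] by simp
  also have "H L * real d ^ 2 * \<tau> + (2 * real d * 5 ^ (d - 1) * \<tau>) * ((real L + 1) + \<sigma>\<^sup>2 * (1 + ln T)) \<le>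
    (H L * real d ^ 2 + 2 * real d * 5 ^ (d - 1) * (real L + 3)) * ((1 + \<sigma>\<^sup>2) * ln T) * \<tau>"
  proof -
   have one: "1 \<le> (1 + \<sigma>\<^sup>2) * ln T" using mult_mono[of 1 "1 + \<sigma>\<^sup>2" 1 "ln T"] lnT by simp
   have "H L * real d ^ 2 * 1 \<le> H L * real d ^ 2 * ((1 + \<sigma>\<^sup>2) * ln T)" using one H(1) by (intro mult_left_mono) auto
   moreover have "(real L + 1) + \<sigma>\<^sup>2 * (1 + ln T) \<le> (real L + 3) * ((1 + \<sigma>\<^sup>2) * ln T)"
   proof -
    have "(real L + 1) * 1 \<le> (real L + 1) * ((1 + \<sigma>\<^sup>2) * ln T)" using one by (intro mult_left_mono) auto
    moreover have "\<sigma>\<^sup>2 * (1 + ln T) \<le> (1 + \<sigma>\<^sup>2) * (2 * ln T)" using lnT by (intro mult_mono) auto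
    ultimately show ?thesis by (simp add: algebra_simps)
   qed
   then have "2 * real d * 5 ^ (d - 1) * ((real L + 1) + \<sigma>\<^sup>2 * (1 + ln T)) \<le> 2 * real d * 5 ^ (d - 1) * ((real L + 3) * ((1 + \<sigma>\<^sup>2) * ln T))"
    by (intro mult_left_mono) auto
   ultimately have "(H L * real d ^ 2 * 1 + 2 * real d * 5 ^ (d - 1) * ((real L + 1) + \<sigma>\<^sup>2 * (1 + ln T))) * \<tau> \<le>
    (H L * real d ^ 2 * ((1 + \<sigma>\<^sup>2) * ln T) + 2 * real d * 5 ^ (d - 1) * ((real L + 3) * ((1 + \<sigma>\<^sup>2) * ln T))) * \<tau>"
    using \<tau>0 by (intro mult_right_mono add_mono) auto
   then show ?thesis by (simp add: algebra_simps)
  qed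
  also have "\<dots> \<le> C d L * ((1 + \<sigma>\<^sup>2) * ln T) * \<tau>"
   using lnT \<tau>0 by (intro mult_right_mono) (auto simp: C_def)
  finally show ?thesis by (simp add: v_def \<tau>_def mult_ac)
 qed
 then show ?thesis using C by (intro exI[of _ C]) blast
qed

section \<open>Optimism under the Gaussian process assumption\<close>

definition gtail :: "real => real" where
 "gtail r = measure std_normal_distribution {z. \<bar>z\<bar> > r}"

text \<open>Beyond \<open>r\<close> the density is at most \<open>x / r\<close> times itself, and
  this has an explicit primitive. The factor in front of the exponential is what will make the total
  failure probability strictly smaller than \<open>\<delta>\<close>.\<close>

lemma gtail_le:
 assumes r: "r > 0"
 shows "gtail r \<le> sqrt (2 / pi) / r * exp (- r\<^sup>2 / 2)"
proof -
 interpret prob_space std_normal_distribution by (rule prob_space_normal_density) simp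
 define F where "F x = - (std_normal_density x / r)" for x
 have lim: "(F \<longlongrightarrow> 0) at_top"
 proof -
  have "((\<lambda>x::real. exp (- (x\<^sup>2 / 2))) \<longlongrightarrow> 0) at_top"
   by (intro filterlim_compose[OF exp_at_bot] filterlim_compose[OF filterlim_uminus_at_bot_at_top]
     filterlim_at_top_mult_tendsto_pos[OF tendsto_const, of "1/2", simplified] filterlim_pow_at_top filterlim_ident) auto
  then have "((\<lambda>x::real. - (1 / sqrt (2 * pi) * exp (- (x\<^sup>2 / 2)) / r)) \<longlongrightarrow> - (1 / sqrt (2 * pi) * 0 / r)) at_top"
   using r by (intro tendsto_intros) auto
  then show ?thesis by (simp add: F_def[abs_def] std_normal_density_def)
 qed
 have der: "DERIV F x :> x * std_normal_density x / r" for x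
  unfolding F_def std_normal_density_def using r
  by (auto intro!: derivative_eq_intros simp: field_simps)
 have half: "(\<integral>\<^sup>+x. ennreal (x * std_normal_density x / r) * indicator {r..} x \<partial>lborel) = ennreal (std_normal_density r / r)"
  using nn_integral_FTC_atLeast[of "\<lambda>x. x * std_normal_density x / r" r F 0] der lim r
  by (simp add: F_def)
 have pos: "emeasure std_normal_distribution {r<..} \<le> ennreal (std_normal_density r / r)"
 proof -
  have "emeasure std_normal_distribution {r<..} = (\<integral>\<^sup>+x. ennreal (std_normal_density x) * indicator {r<..} x \<partial>lborel)"
   by (subst emeasure_density) auto
  also have "\<dots> \<le> (\<integral>\<^sup>+x. ennreal (x * std_normal_density x / r) * indicator {r..} x \<partial>lborel)"
  proof (rule nn_integral_mono)
   fix x :: real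
   have "std_normal_density x \<le> x * std_normal_density x / r" if "x > r"
    using that r mult_right_mono[of r x "std_normal_density x"] by (simp add: field_simps)
   then show "ennreal (std_normal_density x) * indicator {r<..} x \<le> ennreal (x * std_normal_density x / r) * indicator {r..} x"
    by (auto simp: indicator_def intro: ennreal_leI)
  qed
  finally show ?thesis unfolding half .
 qed
 have neg: "emeasure std_normal_distribution {..<- r} = emeasure std_normal_distribution {r<..}"
 proof -
  have "emeasure std_normal_distribution {..<- r} = (\<integral>\<^sup>+x. ennreal (std_normal_density x) * indicator {..<- r} x \<partial>lborel)"
   by (subst emeasure_density) auto
  also have "\<dots> = (\<integral>\<^sup>+x. ennreal (std_normal_density (- x)) * indicator {..<- r} (- x) \<partial>lborel)"
   using nn_integral_real_affine[of "\<lambda>x. ennreal (std_normal_density x) * indicator {..<- r} x" "-1" 0] by simp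
  also have "\<dots> = (\<integral>\<^sup>+x. ennreal (std_normal_density x) * indicator {r<..} x \<partial>lborel)"
   by (intro nn_integral_cong) (auto simp: indicator_def std_normal_density_def)
  also have "\<dots> = emeasure std_normal_distribution {r<..}" by (subst emeasure_density) auto
  finally show ?thesis .
 qed
 have "{z::real. \<bar>z\<bar> > r} = {r<..} \<union> {..<- r}" by auto
 then have "gtail r \<le> prob {r<..} + prob {..<- r}"
  unfolding gtail_def by (simp add: measure_Un_le)
 also have "\<dots> \<le> 2 * (std_normal_density r / r)"
  using pos neg r by (simp add: emeasure_eq_measure)
 also have "\<dots> = sqrt (2 / pi) / r * exp (- r\<^sup>2 / 2)"
 proof -
  have "2 * (1 / sqrt (2 * pi)) = sqrt (2 / pi)"
   by (simp add: real_sqrt_mult real_sqrt_divide field_simps)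
  then have "2 * (1 / sqrt (2 * pi)) * exp (- r\<^sup>2 / 2) / r = sqrt (2 / pi) * exp (- r\<^sup>2 / 2) / r"
   by (simp only:)
  then show ?thesis by (simp add: std_normal_density_def mult.commute mult.left_commute)
 qed
 finally show ?thesis .
qed

lemma char_std_normal: "(CLINT x|std_normal_distribution. iexp (t * x)) = exp (- (t\<^sup>2 / 2))"
 using char_std_normal_distribution by (simp add: char_def fun_eq_iff)

lemma char_centred_normal:
 assumes "v \<ge> 0"
 shows "char (centred_normal v) t = exp (- (v * t\<^sup>2 / 2))"
proof -
 have "char (centred_normal v) t = (CLINT x|std_normal_distribution. iexp (t * (sqrt v * x)))"
  unfolding char_def centred_normal_def by (subst integral_distr) auto
 also have "\<dots> = (CLINT x|std_normal_distribution. iexp ((t * sqrt v) * x))" by (simp add: mult.assoc)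
 also have "\<dots> = exp (- (v * t\<^sup>2 / 2))" unfolding char_std_normal using assms by (simp add: power_mult_distrib mult.commute)
 finally show ?thesis .
qed

lemma generated_by_vimage:
 assumes V: "\<And>\<omega>. \<omega> \<in> space M ==> V \<omega> \<in> space S" and h: "h \<in> borel_measurable S" and A: "A \<in> sets borel"
 shows "(\<lambda>\<omega>. h (V \<omega>)) -` A \<inter> space M \<in> generated_by M S V"
proof -
 have "V \<in> measurable (vimage_algebra (space M) V S) S"
  by (rule measurable_vimage_algebra1) (use V in auto)
 from measurable_sets[OF measurable_compose[OF this h] A] show ?thesis by (simp add: generated_by_def)
qed

lemma post_mean_cong:
 assumes "finite \<Psi>" "\<And>i. i \<in> \<Psi> ==> x i = x2 i" "\<And>i. i \<in> \<Psi> ==> y i = y2 i"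
 shows "post_mean k \<sigma> \<Psi> x y x' = post_mean k \<sigma> \<Psi> x2 y2 x'"
  and "post_sd k \<sigma> \<Psi> x x' = post_sd k \<sigma> \<Psi> x2 x'"
proof -
 have r: "sorted_list_of_set \<Psi> ! i \<in> \<Psi>" if "i < card \<Psi>" for i
  using that assms(1) nth_mem[of i "sorted_list_of_set \<Psi>"] by simp
 have c: "kernel_col k \<Psi> x x' = kernel_col k \<Psi> x2 x'"
  unfolding kernel_col_def using r assms(2) by (intro eq_vecI) auto
 have m: "Matrix.mat (card \<Psi>) (card \<Psi>) (\<lambda>(i, j). k (x (sorted_list_of_set \<Psi> ! i)) (x (sorted_list_of_set \<Psi> ! j))) =
  Matrix.mat (card \<Psi>) (card \<Psi>) (\<lambda>(i, j). k (x2 (sorted_list_of_set \<Psi> ! i)) (x2 (sorted_list_of_set \<Psi> ! j)))"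
  using r assms(2) by (intro eq_matI) auto
 have i: "kernel_inv k \<sigma> \<Psi> x = kernel_inv k \<sigma> \<Psi> x2" unfolding kernel_inv_def Let_def m ..
 have y: "Matrix.vec (card \<Psi>) (\<lambda>i. y (sorted_list_of_set \<Psi> ! i)) = Matrix.vec (card \<Psi>) (\<lambda>i. y2 (sorted_list_of_set \<Psi> ! i))"
  using r assms(3) by (intro eq_vecI) auto
 show "post_mean k \<sigma> \<Psi> x y x' = post_mean k \<sigma> \<Psi> x2 y2 x'" unfolding post_mean_def c i y ..
 show "post_sd k \<sigma> \<Psi> x x' = post_sd k \<sigma> \<Psi> x2 x'" unfolding post_sd_def c i ..
qed

locale gp_model = prob_space M
 for M :: "'w measure" +
 fixes X :: "real vec set" and k :: "real vec => real vec => real" and f :: "'w => real vec => real"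
  and \<epsilon> :: "'w => nat => real" and U :: "'w => real" and \<sigma> :: real
 assumes k: "psd_kernel X k" and \<sigma>: "\<sigma> > 0"
  and gp: "gaussian_process M X k f" and noise: "iid_gaussian_noise M {1..} \<sigma> \<epsilon>"
  and U: "U \<in> borel_measurable M"
  and ind: "indep_sets ((!) [generated_by M (PiM X (\<lambda>_. borel)) (\<lambda>\<omega>. restrict (f \<omega>) X),
         generated_by M (PiM {1..} (\<lambda>_. borel)) (\<lambda>\<omega>. restrict (\<epsilon> \<omega>) {1..}),
         generated_by M borel U]) {..<3}"
begin

lemma f_measurable: "x \<in> X ==> (\<lambda>\<omega>. f \<omega> x) \<in> borel_measurable M"
 using gp by (auto simp: gaussian_process_def)

lemma eps_measurable: "t \<ge> 1 ==> (\<lambda>\<omega>. \<epsilon> \<omega> t) \<in> borel_measurable M"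
 using noise unfolding iid_gaussian_noise_def indep_vars_def by auto

lemma char_noise:
 assumes I: "finite I" "I \<subseteq> {1..}"
 shows "(CLINT \<omega>|M. iexp (\<Sum>t\<in>I. b t * \<epsilon> \<omega> t)) = exp (- (\<sigma>\<^sup>2 * (\<Sum>t\<in>I. (b t)\<^sup>2) / 2))"
proof -
 have iv: "indep_vars (\<lambda>_. borel) (\<lambda>t \<omega>. \<epsilon> \<omega> t) {1..}" and
  dist: "\<And>t. t \<in> {1..} ==> distributed M lborel (\<lambda>\<omega>. \<epsilon> \<omega> t) (normal_density 0 \<sigma>)"
  using noise by (auto simp: iid_gaussian_noise_def)
 have "indep_vars (\<lambda>_. borel) (\<lambda>t \<omega>. b t * \<epsilon> \<omega> t) I"
  by (rule indep_vars_compose2[OF indep_vars_subset[OF iv I(2)]]) simp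
 from char_distr_sum[OF this, of 1]
 have "char (distr M borel (\<lambda>\<omega>. \<Sum>t\<in>I. b t * \<epsilon> \<omega> t)) 1 = (\<Prod>t\<in>I. char (distr M borel (\<lambda>\<omega>. b t * \<epsilon> \<omega> t)) 1)" .
 also have "\<dots> = (\<Prod>t\<in>I. complex_of_real (exp (- (\<sigma>\<^sup>2 * (b t)\<^sup>2 / 2))))"
 proof (intro prod.cong refl)
  fix t assume t: "t \<in> I"
  then have t1: "t \<in> {1..}" using I by auto
  note em = eps_measurable[of t]
  have e: "(\<lambda>\<omega>. \<epsilon> \<omega> t) \<in> borel_measurable M" using t1 by (intro em) simp
  have "distributed M lborel (\<lambda>\<omega>. (\<epsilon> \<omega> t - 0) / \<sigma>) std_normal_density"
   using dist[OF t1] normal_standard_normal_convert[OF \<sigma>, of "\<lambda>\<omega>. \<epsilon> \<omega> t" 0] by simp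
  then have d: "distr M lborel (\<lambda>\<omega>. \<epsilon> \<omega> t / \<sigma>) = std_normal_distribution" by (simp add: distributed_def)
  have "char (distr M borel (\<lambda>\<omega>. b t * \<epsilon> \<omega> t)) 1 = (CLINT \<omega>|M. iexp ((b t * \<sigma>) * (\<epsilon> \<omega> t / \<sigma>)))"
   unfolding char_def using e \<sigma> by (subst integral_distr) auto
  also have "\<dots> = (CLINT x|distr M lborel (\<lambda>\<omega>. \<epsilon> \<omega> t / \<sigma>). iexp ((b t * \<sigma>) * x))"
   using e by (subst integral_distr) auto
  also have "\<dots> = exp (- ((b t * \<sigma>)\<^sup>2 / 2))" unfolding d by (rule char_std_normal)
  finally show "char (distr M borel (\<lambda>\<omega>. b t * \<epsilon> \<omega> t)) 1 = complex_of_real (exp (- (\<sigma>\<^sup>2 * (b t)\<^sup>2 / 2)))"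
   by (simp add: power_mult_distrib mult.commute)
 qed
 also have "\<dots> = exp (- (\<sigma>\<^sup>2 * (\<Sum>t\<in>I. (b t)\<^sup>2) / 2))"
  using I by (simp add: exp_sum[symmetric] sum_negf sum_divide_distrib sum_distrib_left flip: of_real_prod)
 finally have "char (distr M borel (\<lambda>\<omega>. \<Sum>t\<in>I. b t * \<epsilon> \<omega> t)) 1 = exp (- (\<sigma>\<^sup>2 * (\<Sum>t\<in>I. (b t)\<^sup>2) / 2))" .
 moreover have "(\<lambda>\<omega>. \<Sum>t\<in>I. b t * \<epsilon> \<omega> t) \<in> borel_measurable M"
  using I by (intro borel_measurable_sum borel_measurable_times borel_measurable_const eps_measurable) auto
 ultimately show ?thesis unfolding char_def by (simp add: integral_distr)
qed

text \<open>Function values, noise and seed are independent, so the characteristic function of a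
  linear combination is a product of three. The seed takes part because past actions depend on
  it.\<close>

lemma char_joint:
 fixes n :: nat and c b :: "nat => real" and s :: real
 assumes y: "\<And>i. i < n ==> y i \<in> X" and I: "finite I" "I \<subseteq> {1..}"
 shows "(CLINT \<omega>|M. iexp ((\<Sum>i<n. c i * f \<omega> (y i)) + (\<Sum>t\<in>I. b t * \<epsilon> \<omega> t) + s * U \<omega>)) =
  complex_of_real (exp (- ((\<Sum>i<n. \<Sum>j<n. c i * c j * k (y i) (y j)) / 2))) * complex_of_real (exp (- (\<sigma>\<^sup>2 * (\<Sum>t\<in>I. (b t)\<^sup>2) / 2))) * (CLINT \<omega>|M. iexp (s * U \<omega>))"
proof -
 define F where "F \<omega> = (\<Sum>i<n. c i * f \<omega> (y i))" for \<omega>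
 define G where "G \<omega> = (\<Sum>t\<in>I. b t * \<epsilon> \<omega> t)" for \<omega>
 define Z where "Z i \<omega> = [F \<omega>, G \<omega>, s * U \<omega>] ! i" for i :: nat and \<omega>
 have Fm: "F \<in> borel_measurable M" unfolding F_def using y by (intro borel_measurable_sum borel_measurable_times borel_measurable_const f_measurable) auto
 have Gm: "G \<in> borel_measurable M" unfolding G_def
  using I by (intro borel_measurable_sum borel_measurable_times borel_measurable_const eps_measurable) auto
 have Um: "(\<lambda>\<omega>. s * U \<omega>) \<in> borel_measurable M" using U by simp
 have FA: "F -` A \<inter> space M \<in> generated_by M (PiM X (\<lambda>_. borel)) (\<lambda>\<omega>. restrict (f \<omega>) X)" if A: "A \<in> sets borel" for A
 proof -
  have "(\<lambda>\<omega>. \<Sum>i<n. c i * (restrict (f \<omega>) X) (y i)) -` A \<inter> space M \<in> generated_by M (PiM X (\<lambda>_. borel)) (\<lambda>\<omega>. restrict (f \<omega>) X)"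
   by (rule generated_by_vimage[where h="\<lambda>g. \<Sum>i<n. c i * g (y i)"])
    (use y A in \<open>auto simp: space_PiM intro!: borel_measurable_sum borel_measurable_times measurable_component_singleton\<close>)
  moreover have "(\<lambda>\<omega>. \<Sum>i<n. c i * (restrict (f \<omega>) X) (y i)) = F" using y by (auto simp: F_def fun_eq_iff intro!: sum.cong)
  ultimately show ?thesis by simp
 qed
 have GA: "G -` A \<inter> space M \<in> generated_by M (PiM {1..} (\<lambda>_. borel)) (\<lambda>\<omega>. restrict (\<epsilon> \<omega>) {1..})" if A: "A \<in> sets borel" for A
 proof -
  have "(\<lambda>\<omega>. \<Sum>t\<in>I. b t * (restrict (\<epsilon> \<omega>) {1..}) t) -` A \<inter> space M \<in> generated_by M (PiM {1..} (\<lambda>_. borel)) (\<lambda>\<omega>. restrict (\<epsilon> \<omega>) {1..})"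
   by (rule generated_by_vimage[where h="\<lambda>g. \<Sum>t\<in>I. b t * g t"])
    (use I A in \<open>auto simp: space_PiM split: if_splits intro!: borel_measurable_sum borel_measurable_times measurable_component_singleton\<close>)
  moreover have "(\<lambda>\<omega>. \<Sum>t\<in>I. b t * (restrict (\<epsilon> \<omega>) {1..}) t) = G" using I by (auto simp: G_def fun_eq_iff intro!: sum.cong)
  ultimately show ?thesis by simp
 qed
 have UA: "(\<lambda>\<omega>. s * U \<omega>) -` A \<inter> space M \<in> generated_by M borel U" if A: "A \<in> sets borel" for A
  by (rule generated_by_vimage[where h="\<lambda>u. s * u"]) (use A in auto)
 have lt3: "{..<3::nat} = {0, 1, 2}" by auto
 have Z: "Z 0 = F" "Z 1 = G" "Z 2 = (\<lambda>\<omega>. s * U \<omega>)" by (auto simp: Z_def fun_eq_iff)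
 have "indep_sets (\<lambda>i. {Z i -` A \<inter> space M |A. A \<in> sets borel}) {..<3}"
 proof (rule indep_sets_mono_sets[OF ind])
  fix i :: nat assume "i \<in> {..<3}"
  then consider "i = 0" | "i = 1" | "i = 2" by force
  then show "{Z i -` A \<inter> space M |A. A \<in> sets borel} \<subseteq> [generated_by M (PiM X (\<lambda>_. borel)) (\<lambda>\<omega>. restrict (f \<omega>) X),
         generated_by M (PiM {1..} (\<lambda>_. borel)) (\<lambda>\<omega>. restrict (\<epsilon> \<omega>) {1..}), generated_by M borel U] ! i"
  proof cases
   case 1
   then show ?thesis unfolding 1 Z nth_Cons_0 using FA by (intro subsetI) (elim CollectE exE conjE, simp only:)
  next
   case 2
   then show ?thesis unfolding 2 Z One_nat_def nth_Cons_Suc nth_Cons_0 using GA[unfolded One_nat_def] by (intro subsetI) (elim CollectE exE conjE, simp only: Z[unfolded One_nat_def])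
  next
   case 3
   then show ?thesis unfolding 3 Z numeral_2_eq_2 nth_Cons_Suc nth_Cons_0 using UA by (intro subsetI) (elim CollectE exE conjE, simp only: Z[unfolded numeral_2_eq_2])
  qed
 qed
 then have "indep_vars (\<lambda>_. borel) Z {..<3}"
  using Fm Gm Um unfolding indep_vars_def2 lt3 by (simp del: One_nat_def add: Z)
 from char_distr_sum[OF this, of 1]
 have "char (distr M borel (\<lambda>\<omega>. \<Sum>i<3. Z i \<omega>)) 1 = (\<Prod>i<3. char (distr M borel (Z i)) 1)" .
 also have "\<dots> = char (distr M borel F) 1 * char (distr M borel G) 1 * char (distr M borel (\<lambda>\<omega>. s * U \<omega>)) 1"
  unfolding lt3 by (simp del: One_nat_def add: Z mult.assoc)
 also have "(\<lambda>\<omega>. \<Sum>i<3. Z i \<omega>) = (\<lambda>\<omega>. F \<omega> + G \<omega> + s * U \<omega>)" by (simp add: lt3 Z_def fun_eq_iff)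
 also have "char (distr M borel F) 1 = exp (- ((\<Sum>i<n. \<Sum>j<n. c i * c j * k (y i) (y j)) / 2))"
 proof -
  have "distr M borel F = centred_normal (\<Sum>i<n. \<Sum>j<n. c i * c j * k (y i) (y j))"
   using gp y unfolding gaussian_process_def F_def[abs_def] by blast
  then show ?thesis using char_centred_normal[OF psd_kernelD[OF k, of n y c]] y by simp
 qed
 also have "char (distr M borel G) 1 = exp (- (\<sigma>\<^sup>2 * (\<Sum>t\<in>I. (b t)\<^sup>2) / 2))"
  using char_noise[OF I, of b] Gm unfolding char_def by (simp add: integral_distr G_def[abs_def])
 also have "char (distr M borel (\<lambda>\<omega>. s * U \<omega>)) 1 = (CLINT \<omega>|M. iexp (s * U \<omega>))"
  using Um unfolding char_def by (simp add: integral_distr)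
 finally have "char (distr M borel (\<lambda>\<omega>. F \<omega> + G \<omega> + s * U \<omega>)) 1 = exp (- ((\<Sum>i<n. \<Sum>j<n. c i * c j * k (y i) (y j)) / 2)) *
   exp (- (\<sigma>\<^sup>2 * (\<Sum>t\<in>I. (b t)\<^sup>2) / 2)) * (CLINT \<omega>|M. iexp (s * U \<omega>))" by simp
 moreover have "char (distr M borel (\<lambda>\<omega>. F \<omega> + G \<omega> + s * U \<omega>)) 1 = (CLINT \<omega>|M. iexp (F \<omega> + G \<omega> + s * U \<omega>))"
  unfolding char_def using Fm Gm Um by (subst integral_distr) (auto intro!: borel_measurable_add)
 ultimately show ?thesis unfolding F_def G_def by simp
qed

text \<open>The past as one vector for a fixed sequence of inputs, with the seed in the free slot
  0.\<close>

definition obs :: "(nat => real vec) => nat => 'w => real" where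
 "obs x i \<omega> = (if i = 0 then U \<omega> else f \<omega> (x i) + \<epsilon> \<omega> i)"

lemma obs_measurable: "(\<And>i. i \<ge> 1 ==> i < t ==> x i \<in> X) ==> i < t ==> obs x i \<in> borel_measurable M"
 unfolding obs_def[abs_def] using U f_measurable eps_measurable by (cases "i = 0") (auto intro!: borel_measurable_add)

text \<open>This concerns fixed inputs. The equations for \<open>\<alpha>\<close> say that the
  residual \<open>R\<close> is uncorrelated with every observation; the mixed term in the joint
  characteristic function cancels, so it factorizes and \<open>R\<close> is independent of the seed
  and the observations. Its variance is the posterior variance. The set \<open>S\<close> will
  describe a past of the algorithm.\<close>

lemma posterior_tail:
 assumes t: "t \<ge> 1" and x: "\<And>i. i \<ge> 1 ==> i < t ==> x i \<in> X" and x': "x' \<in> X" and r: "r > 0"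
  and S: "S \<in> sets (PiM {0..<t} (\<lambda>_. borel))"
 defines "B \<equiv> {\<omega> \<in> space M. (\<lambda>i\<in>{0..<t}. obs x i \<omega>) \<in> S \<and>
  \<bar>f \<omega> x' - post_mean k \<sigma> {1..<t} x (\<lambda>i. f \<omega> (x i) + \<epsilon> \<omega> i) x'\<bar> > r * post_sd k \<sigma> {1..<t} x x'}"
 shows "B \<in> events" "prob B \<le> prob {\<omega> \<in> space M. (\<lambda>i\<in>{0..<t}. obs x i \<omega>) \<in> S} * gtail r"
proof -
 have xx: "\<forall>i\<in>{1..<t}. x i \<in> X" using x by auto
 obtain \<alpha> where al: "\<forall>i\<in>{1..<t}. (\<Sum>j\<in>{1..<t}. k (x i) (x j) * \<alpha> j) + \<sigma>\<^sup>2 * \<alpha> i = k (x i) x'"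
  and mean: "\<forall>y. post_mean k \<sigma> {1..<t} x y x' = (\<Sum>i\<in>{1..<t}. \<alpha> i * y i)"
  and sd0: "0 \<le> post_sd k \<sigma> {1..<t} x x'"
  and sd2: "(post_sd k \<sigma> {1..<t} x x')\<^sup>2 = kdist k {1..<t} x x' \<alpha> + \<sigma>\<^sup>2 * (\<Sum>i\<in>{1..<t}. (\<alpha> i)\<^sup>2)"
  using posterior[OF k \<sigma> _ xx x'] by blast
 define s where "s = post_sd k \<sigma> {1..<t} x x'"
 define R where "R \<omega> = f \<omega> x' - (\<Sum>i\<in>{1..<t}. \<alpha> i * (f \<omega> (x i) + \<epsilon> \<omega> i))" for \<omega>
 have Rm: "R \<in> borel_measurable M"
  unfolding R_def using x x' by (intro borel_measurable_diff borel_measurable_sum borel_measurable_times borel_measurable_add borel_measurable_const f_measurable eps_measurable) auto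
 have Vm: "obs x i \<in> borel_measurable M" if "i \<in> {0..<t}" for i using obs_measurable[OF x, of t] that by auto
 have split: "(\<Sum>i<t. g i) = g 0 + (\<Sum>i\<in>{1..<t}. g i)" for g :: "nat => real"
  using t by (simp add: lessThan_atLeast0 sum.atLeast_Suc_lessThan)
 have split0: "(\<Sum>i\<in>{0..<t}. g i) = g 0 + (\<Sum>i\<in>{1..<t}. g i)" for g :: "nat => real"
  using t by (simp add: sum.atLeast_Suc_lessThan)
 \<comment> \<open>Index 0 is not a round; it stands for \<open>x'\<close>.\<close>
 define y where "y i = (if i = 0 then x' else x i)" for i
 define \<phi> where "\<phi> u = exp (- (((\<Sum>i\<in>{1..<t}. \<Sum>j\<in>{1..<t}. u i * u j * k (x i) (x j)) + \<sigma>\<^sup>2 * (\<Sum>i\<in>{1..<t}. (u i)\<^sup>2)) / 2)) * (CLINT \<omega>|M. iexp (u 0 * U \<omega>))" for u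
 have main: "(CLINT \<omega>|M. iexp ((\<Sum>i\<in>{0..<t}. u i * obs x i \<omega>) + q * R \<omega>)) = \<phi> u * exp (- (s\<^sup>2 * q\<^sup>2 / 2))" for u q
 proof -
  define c where "c i = (if i = 0 then q else u i - q * \<alpha> i)" for i
  define b where "b i = u i - q * \<alpha> i" for i
  have arg: "(\<Sum>i\<in>{0..<t}. u i * obs x i \<omega>) + q * R \<omega> = (\<Sum>i<t. c i * f \<omega> (y i)) + (\<Sum>i\<in>{1..<t}. b i * \<epsilon> \<omega> i) + u 0 * U \<omega>" for \<omega>
  proof -
   have "(\<Sum>i\<in>{1..<t}. u i * obs x i \<omega>) = (\<Sum>i\<in>{1..<t}. u i * f \<omega> (x i)) + (\<Sum>i\<in>{1..<t}. u i * \<epsilon> \<omega> i)"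
    unfolding sum.distrib[symmetric] by (intro sum.cong) (auto simp: obs_def distrib_left)
   moreover have "(\<Sum>i\<in>{1..<t}. c i * f \<omega> (y i)) = (\<Sum>i\<in>{1..<t}. u i * f \<omega> (x i)) - q * (\<Sum>i\<in>{1..<t}. \<alpha> i * f \<omega> (x i))"
    unfolding sum_distrib_left sum_subtractf[symmetric] by (intro sum.cong) (auto simp: c_def y_def left_diff_distrib)
   moreover have "(\<Sum>i\<in>{1..<t}. b i * \<epsilon> \<omega> i) = (\<Sum>i\<in>{1..<t}. u i * \<epsilon> \<omega> i) - q * (\<Sum>i\<in>{1..<t}. \<alpha> i * \<epsilon> \<omega> i)"
    unfolding sum_distrib_left sum_subtractf[symmetric] by (intro sum.cong) (auto simp: b_def left_diff_distrib)
   moreover have "q * R \<omega> = q * f \<omega> x' - q * (\<Sum>i\<in>{1..<t}. \<alpha> i * f \<omega> (x i)) - q * (\<Sum>i\<in>{1..<t}. \<alpha> i * \<epsilon> \<omega> i)"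
    unfolding R_def distrib_left[of "\<alpha> _"] sum.distrib by (simp add: right_diff_distrib distrib_left)
   moreover have "c 0 = q" "y 0 = x'" "obs x 0 \<omega> = U \<omega>" by (simp_all add: c_def y_def obs_def)
   ultimately show ?thesis unfolding split split0 by simp
  qed
  let ?bil = "\<lambda>v w. \<Sum>i\<in>{1..<t}. \<Sum>j\<in>{1..<t}. v i * w j * k (x i) (x j)"
  have sym: "k (x i) (x j) = k (x j) (x i)" if "i \<in> {1..<t}" "j \<in> {1..<t}" for i j
   using that xx psd_kernel_sym[OF k] by blast
  have bil_sym: "?bil u \<alpha> = ?bil \<alpha> u"
  proof -
   have "?bil u \<alpha> = (\<Sum>j\<in>{1..<t}. \<Sum>i\<in>{1..<t}. u i * \<alpha> j * k (x i) (x j))" by (rule sum.swap)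
   also have "\<dots> = ?bil \<alpha> u" using sym by (intro sum.cong refl) (simp add: mult.commute)
   finally show ?thesis .
  qed
  \<comment> \<open>The equations for \<open>\<alpha>\<close> paired with \<open>u\<close>; in
    \<open>quad\<close> they make the terms linear in \<open>q\<close> cancel.\<close>
  have cross: "?bil u \<alpha> + \<sigma>\<^sup>2 * (\<Sum>i\<in>{1..<t}. u i * \<alpha> i) = (\<Sum>i\<in>{1..<t}. u i * k (x i) x')"
  proof -
   have "(\<Sum>i\<in>{1..<t}. u i * k (x i) x') = (\<Sum>i\<in>{1..<t}. u i * ((\<Sum>j\<in>{1..<t}. k (x i) (x j) * \<alpha> j) + \<sigma>\<^sup>2 * \<alpha> i))"
    using al by (intro sum.cong refl) simp
   then show ?thesis by (simp add: distrib_left sum.distrib sum_distrib_left mult_ac)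
  qed
  have bb: "?bil b b = ?bil u u - 2 * q * ?bil u \<alpha> + q\<^sup>2 * ?bil \<alpha> \<alpha>"
  proof -
   have "?bil b b = ?bil u u - q * ?bil u \<alpha> - q * ?bil \<alpha> u + q\<^sup>2 * ?bil \<alpha> \<alpha>"
    unfolding sum_distrib_left sum_subtractf[symmetric] sum.distrib[symmetric]
    by (intro sum.cong refl) (simp add: b_def algebra_simps power2_eq_square)
   then show ?thesis using bil_sym by simp
  qed
  have b2: "(\<Sum>i\<in>{1..<t}. (b i)\<^sup>2) = (\<Sum>i\<in>{1..<t}. (u i)\<^sup>2) - 2 * q * (\<Sum>i\<in>{1..<t}. u i * \<alpha> i) + q\<^sup>2 * (\<Sum>i\<in>{1..<t}. (\<alpha> i)\<^sup>2)"
   unfolding sum_distrib_left sum_subtractf[symmetric] sum.distrib[symmetric]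
   by (intro sum.cong refl) (simp add: b_def algebra_simps power2_eq_square)
  have cy: "(\<Sum>j<t. c i * c j * k (y i) (y j)) = c i * q * k (y i) x' + (\<Sum>j\<in>{1..<t}. c i * b j * k (y i) (x j))" for i
   unfolding split by (simp add: c_def b_def y_def)
  have cc: "(\<Sum>i<t. \<Sum>j<t. c i * c j * k (y i) (y j)) = q\<^sup>2 * k x' x' + 2 * q * (\<Sum>i\<in>{1..<t}. b i * k (x i) x') + ?bil b b"
  proof -
   have "(\<Sum>i<t. \<Sum>j<t. c i * c j * k (y i) (y j)) =
    (q * q * k x' x' + (\<Sum>j\<in>{1..<t}. q * b j * k x' (x j))) + (\<Sum>i\<in>{1..<t}. b i * q * k (x i) x' + (\<Sum>j\<in>{1..<t}. b i * b j * k (x i) (x j)))"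
    unfolding cy unfolding split by (simp add: c_def b_def y_def)
   also have "(\<Sum>j\<in>{1..<t}. q * b j * k x' (x j)) = q * (\<Sum>i\<in>{1..<t}. b i * k (x i) x')"
    unfolding sum_distrib_left using psd_kernel_sym[OF k x'] xx by (intro sum.cong refl) simp
   also have "(\<Sum>i\<in>{1..<t}. b i * q * k (x i) x' + (\<Sum>j\<in>{1..<t}. b i * b j * k (x i) (x j))) = q * (\<Sum>i\<in>{1..<t}. b i * k (x i) x') + ?bil b b"
    unfolding sum.distrib sum_distrib_left by (simp add: mult_ac)
   finally show ?thesis by (simp add: power2_eq_square)
  qed
  have bk: "(\<Sum>i\<in>{1..<t}. b i * k (x i) x') = (\<Sum>i\<in>{1..<t}. u i * k (x i) x') - q * (\<Sum>i\<in>{1..<t}. \<alpha> i * k (x i) x')"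
   unfolding sum_distrib_left sum_subtractf[symmetric] by (intro sum.cong) (auto simp: b_def left_diff_distrib)
  have quad: "(\<Sum>i<t. \<Sum>j<t. c i * c j * k (y i) (y j)) + \<sigma>\<^sup>2 * (\<Sum>i\<in>{1..<t}. (b i)\<^sup>2) =
   (?bil u u + \<sigma>\<^sup>2 * (\<Sum>i\<in>{1..<t}. (u i)\<^sup>2)) + s\<^sup>2 * q\<^sup>2"
  proof -
   have s2: "s\<^sup>2 = k x' x' - 2 * (\<Sum>i\<in>{1..<t}. \<alpha> i * k (x i) x') + ?bil \<alpha> \<alpha> + \<sigma>\<^sup>2 * (\<Sum>i\<in>{1..<t}. (\<alpha> i)\<^sup>2)"
    unfolding s_def sd2 kdist_def by simp
   show ?thesis unfolding cc bb b2 bk cross[symmetric] s2 by (simp add: algebra_simps power2_eq_square)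
  qed
  have "(CLINT \<omega>|M. iexp ((\<Sum>i\<in>{0..<t}. u i * obs x i \<omega>) + q * R \<omega>)) =
   complex_of_real (exp (- ((\<Sum>i<t. \<Sum>j<t. c i * c j * k (y i) (y j)) / 2))) * complex_of_real (exp (- (\<sigma>\<^sup>2 * (\<Sum>i\<in>{1..<t}. (b i)\<^sup>2) / 2))) * (CLINT \<omega>|M. iexp (u 0 * U \<omega>))"
   unfolding arg by (rule char_joint) (use x x' in \<open>auto simp: y_def\<close>)
  also have "complex_of_real (exp (- ((\<Sum>i<t. \<Sum>j<t. c i * c j * k (y i) (y j)) / 2))) * complex_of_real (exp (- (\<sigma>\<^sup>2 * (\<Sum>i\<in>{1..<t}. (b i)\<^sup>2) / 2))) =
   complex_of_real (exp (- (((?bil u u + \<sigma>\<^sup>2 * (\<Sum>i\<in>{1..<t}. (u i)\<^sup>2)) + s\<^sup>2 * q\<^sup>2) / 2)))"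
   unfolding quad[symmetric] of_real_mult[symmetric] exp_add[symmetric] by (simp add: add_divide_distrib)
  also have "\<dots> = complex_of_real (exp (- ((?bil u u + \<sigma>\<^sup>2 * (\<Sum>i\<in>{1..<t}. (u i)\<^sup>2)) / 2))) * complex_of_real (exp (- (s\<^sup>2 * q\<^sup>2 / 2)))"
   unfolding of_real_mult[symmetric] exp_add[symmetric] by (simp add: add_divide_distrib)
  finally show ?thesis by (simp add: \<phi>_def mult_ac)
 qed
 have \<phi>0: "\<phi> (\<lambda>_. 0) = 1" unfolding \<phi>_def by (simp add: prob_space)
 have charR: "(CLINT \<omega>|M. iexp (q * R \<omega>)) = exp (- (s\<^sup>2 * q\<^sup>2 / 2))" for q
  using main[of "\<lambda>_. 0" q] \<phi>0 by simp
 have charV: "(CLINT \<omega>|M. iexp (\<Sum>i\<in>{0..<t}. u i * obs x i \<omega>)) = \<phi> u" for u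
  using main[of u 0] by simp
 have indep: "prob {\<omega> \<in> space M. (\<lambda>i\<in>{0..<t}. obs x i \<omega>) \<in> S \<and> R \<omega> \<in> C} =
   prob {\<omega> \<in> space M. (\<lambda>i\<in>{0..<t}. obs x i \<omega>) \<in> S} * prob {\<omega> \<in> space M. R \<omega> \<in> C}" if "C \<in> sets borel" for C
  by (rule indep_of_char_factorizes[of _ t, OF _ _ Vm Rm _ S that]) (use main charR charV in \<open>simp_all only: finite_atLeastLessThan, simp_all\<close>)
 have lawR: "distr M borel R = centred_normal (s\<^sup>2)"
 proof (rule Levy_uniqueness)
  show "real_distribution (distr M borel R)" using Rm by (rule real_distribution_distr)
  interpret N: prob_space std_normal_distribution by (rule prob_space_normal_density) simp
  show "real_distribution (centred_normal (s\<^sup>2))" unfolding centred_normal_def by (rule N.real_distribution_distr) simp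
  show "char (distr M borel R) = char (centred_normal (s\<^sup>2))"
  proof
   fix q
   have "char (distr M borel R) q = (CLINT \<omega>|M. iexp (q * R \<omega>))"
    unfolding char_def using Rm by (subst integral_distr) auto
   then show "char (distr M borel R) q = char (centred_normal (s\<^sup>2)) q"
    unfolding charR by (simp add: char_centred_normal)
  qed
 qed
 let ?C = "{w::real. \<bar>w\<bar> > r * s}"
 have C: "?C \<in> sets borel" by measurable
 have Cp: "prob {\<omega> \<in> space M. R \<omega> \<in> ?C} \<le> gtail r"
 proof -
  have "prob {\<omega> \<in> space M. R \<omega> \<in> ?C} = measure (distr M borel R) ?C"
   using Rm C by (subst measure_distr) (auto intro!: arg_cong[where f=prob])
  also have "\<dots> = measure std_normal_distribution {z. \<bar>s * z\<bar> > r * s}"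
   unfolding lawR centred_normal_def using C sd0
   by (subst measure_distr) (auto simp: s_def vimage_def intro!: arg_cong[where f="measure _"])
  also have "\<dots> \<le> gtail r"
  proof (cases "s = 0")
   case True
   then show ?thesis by (simp add: gtail_def)
  next
   case False
   then have "s > 0" using sd0 by (simp add: s_def)
   then have "{z. \<bar>s * z\<bar> > r * s} = {z. \<bar>z\<bar> > r}" by (auto simp: abs_mult mult.commute[of s])
   then show ?thesis by (simp add: gtail_def)
  qed
  finally show ?thesis .
 qed
 have B: "B = {\<omega> \<in> space M. (\<lambda>i\<in>{0..<t}. obs x i \<omega>) \<in> S \<and> R \<omega> \<in> ?C}"
  unfolding B_def R_def s_def using mean by auto
 have V: "(\<lambda>\<omega>. \<lambda>i\<in>{0..<t}. obs x i \<omega>) \<in> measurable M (PiM {0..<t} (\<lambda>_. borel))"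
  by (rule measurable_restrict) (use Vm in auto)
 show "B \<in> events" unfolding B
  using measurable_sets[OF V S] measurable_sets[OF Rm C]
  by (auto simp: vimage_def Int_def conj_commute intro!: sets.sets_Collect_conj)
 show "prob B \<le> prob {\<omega> \<in> space M. (\<lambda>i\<in>{0..<t}. obs x i \<omega>) \<in> S} * gtail r"
  unfolding B indep[OF C] by (intro mult_left_mono Cp) simp
qed

end

section \<open>Cutting the probability space along past actions\<close>

lemma arm_eq_col:
 assumes "Z \<in> carrier_mat d N" "i < N"
 shows "arm Z i = col Z i"
 using assms unfolding arm_def by (intro eq_vecI) auto

locale ucb_run = gp_model M X k f \<epsilon> U \<sigma>
 for M :: "'w measure" and X :: "real vec set" and k f \<epsilon> U \<sigma> +
 fixes N :: nat and z :: "nat => real mat" and \<beta> :: "nat => real" and a :: "'w => nat => nat"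
 assumes N: "N \<ge> 1" and arms: "\<And>t i. t \<ge> 1 ==> i < N ==> arm (z t) i \<in> X"
  and run: "ntk_ucb k \<sigma> \<beta> N z M U a (\<lambda>\<omega>. reward (f \<omega>) z (a \<omega>) (\<epsilon> \<omega>))"
begin

definition input :: "(nat => nat) => nat => real vec" where
 "input \<alpha> j = arm (z j) (\<alpha> j)"

definition prefix_event :: "nat => (nat => nat) => 'w set" where
 "prefix_event t \<alpha> = {\<omega> \<in> space M. \<forall>j\<in>{1..<t}. a \<omega> j = \<alpha> j}"

lemma a_lt: "t \<ge> 1 ==> \<omega> \<in> space M ==> a \<omega> t < N"
 using run unfolding ntk_ucb_def is_arg_max_def by blast

text \<open>While the actions agree with \<open>\<alpha>\<close>, the true history coincides with
  the observations at the fixed inputs of \<open>\<alpha>\<close>, so the next action is a function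
  of these. By induction, the event that the past is \<open>\<alpha>\<close> can be read off from
  the vector \<open>obs\<close>, in which no input is random.\<close>

lemma prefix_event_obs:
 assumes t: "t \<ge> 1" and \<alpha>: "\<forall>j\<in>{1..<t}. \<alpha> j < N"
 shows "\<exists>S\<in>sets (PiM {0..<t} (\<lambda>_. borel)).
  prefix_event t \<alpha> = {\<omega> \<in> space M. (\<lambda>i\<in>{0..<t}. obs (input \<alpha>) i \<omega>) \<in> S}"
 using t \<alpha>
proof (induction t rule: dec_induct)
 case base
 show ?case
  by (rule bexI[of _ "space (PiM {0..<1} (\<lambda>_. borel))"]) (auto simp: prefix_event_def space_PiM split: if_splits)
next
 case (step t)
 let ?y = "\<lambda>\<omega>. reward (f \<omega>) z (a \<omega>) (\<epsilon> \<omega>)"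
 let ?H = "\<lambda>\<omega>. (U \<omega>, restrict (?y \<omega>) {1..<t})"
 let ?PM = "\<lambda>t. PiM {0..<t} (\<lambda>_. borel :: real measure)"
 have "\<forall>j\<in>{1..<t}. \<alpha> j < N" using step.prems by auto
 then obtain S where S: "S \<in> sets (?PM t)" and eS: "prefix_event t \<alpha> = {\<omega> \<in> space M. (\<lambda>i\<in>{0..<t}. obs (input \<alpha>) i \<omega>) \<in> S}"
  using step.IH by blast
 have at: "\<alpha> t < N" using step.prems step.hyps by auto
 have "(\<lambda>\<omega>. a \<omega> t) \<in> measurable (history M U ?y t) (count_space {..<N})"
  using run step.hyps unfolding ntk_ucb_def by blast
 from measurable_sets[OF this, of "{\<alpha> t}"] at
 have "(\<lambda>\<omega>. a \<omega> t) -` {\<alpha> t} \<inter> space M \<in> sets (history M U ?y t)" by (simp add: history_def)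
 also have "sets (history M U ?y t) = {?H -` A \<inter> space M |A. A \<in> sets (borel \<Otimes>\<^sub>M PiM {1..<t} (\<lambda>_. borel))}"
  unfolding history_def by (rule sets_vimage_algebra2) (auto simp: space_pair_measure space_PiM)
 finally obtain A where A: "A \<in> sets (borel \<Otimes>\<^sub>M PiM {1..<t} (\<lambda>_. borel :: real measure))"
  and eA: "(\<lambda>\<omega>. a \<omega> t) -` {\<alpha> t} \<inter> space M = ?H -` A \<inter> space M" by blast
 define S' where "S' = {v \<in> space (?PM (Suc t)). restrict v {0..<t} \<in> S \<and> (v 0, restrict v {1..<t}) \<in> A}"
 have m1: "(\<lambda>v. restrict v {0..<t}) \<in> measurable (?PM (Suc t)) (?PM t)"
  by (rule measurable_restrict_subset) auto
 have m2: "(\<lambda>v. restrict v {1..<t}) \<in> measurable (?PM (Suc t)) (PiM {1..<t} (\<lambda>_. borel))"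
  by (rule measurable_restrict_subset) auto
 have m3: "(\<lambda>v. (v 0, restrict v {1..<t})) \<in> measurable (?PM (Suc t)) (borel \<Otimes>\<^sub>M PiM {1..<t} (\<lambda>_. borel))"
  by (rule measurable_Pair[OF _ m2]) (auto intro!: measurable_component_singleton)
 have "S' = ((\<lambda>v. restrict v {0..<t}) -` S \<inter> space (?PM (Suc t))) \<inter> ((\<lambda>v. (v 0, restrict v {1..<t})) -` A \<inter> space (?PM (Suc t)))"
  by (auto simp: S'_def)
 also have "\<dots> \<in> sets (?PM (Suc t))"
  by (intro sets.Int measurable_sets[OF m1 S] measurable_sets[OF m3 A])
 finally have S': "S' \<in> sets (?PM (Suc t))" .
 have "\<omega> \<in> prefix_event (Suc t) \<alpha> \<longleftrightarrow> (\<lambda>i\<in>{0..<Suc t}. obs (input \<alpha>) i \<omega>) \<in> S'" if w: "\<omega> \<in> space M" for \<omega>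
 proof -
  let ?v = "\<lambda>i\<in>{0..<Suc t}. obs (input \<alpha>) i \<omega>"
  have "{1..<Suc t} = insert t {1..<t}" using step.hyps by auto
  then have 1: "\<omega> \<in> prefix_event (Suc t) \<alpha> \<longleftrightarrow> \<omega> \<in> prefix_event t \<alpha> \<and> ?H \<omega> \<in> A"
   using w eA by (auto simp: prefix_event_def)
  have 2: "restrict ?v {0..<t} = (\<lambda>i\<in>{0..<t}. obs (input \<alpha>) i \<omega>)" by (auto simp: fun_eq_iff restrict_def)
  have 3: "?H \<omega> = (?v 0, restrict ?v {1..<t})" if "\<omega> \<in> prefix_event t \<alpha>"
   using that by (auto simp: fun_eq_iff prefix_event_def obs_def reward_def played_def input_def)
  have 4: "?v \<in> space (?PM (Suc t))" by (auto simp: space_PiM)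
  have 5: "\<omega> \<in> prefix_event t \<alpha> \<longleftrightarrow> restrict ?v {0..<t} \<in> S" unfolding 2 eS using w by simp
  show ?thesis unfolding 1 S'_def mem_Collect_eq using 3 4 5 by metis
 qed
 then have "prefix_event (Suc t) \<alpha> = {\<omega> \<in> space M. (\<lambda>i\<in>{0..<Suc t}. obs (input \<alpha>) i \<omega>) \<in> S'}"
  by (auto simp: prefix_event_def)
 then show ?case using S' by blast
qed

lemma input_in: "\<forall>j\<in>{1..<t}. \<alpha> j < N ==> i \<ge> 1 ==> i < t ==> input \<alpha> i \<in> X"
 unfolding input_def by (rule arms) auto

lemma prefix_event_measurable:
 assumes t: "t \<ge> 1" and \<alpha>: "\<forall>j\<in>{1..<t}. \<alpha> j < N"
 shows "prefix_event t \<alpha> \<in> events"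
proof -
 obtain S where S: "S \<in> sets (PiM {0..<t} (\<lambda>_. borel :: real measure))"
  and e: "prefix_event t \<alpha> = {\<omega> \<in> space M. (\<lambda>i\<in>{0..<t}. obs (input \<alpha>) i \<omega>) \<in> S}"
  using prefix_event_obs[OF t \<alpha>] by blast
 have "(\<lambda>\<omega>. \<lambda>i\<in>{0..<t}. obs (input \<alpha>) i \<omega>) \<in> measurable M (PiM {0..<t} (\<lambda>_. borel))"
  by (rule measurable_restrict, rule obs_measurable[OF input_in[OF \<alpha>]]) auto
 from measurable_sets[OF this S] show ?thesis unfolding e by (simp add: vimage_def Int_def conj_commute)
qed

text \<open>An action is given as measurable with respect to the history, whose rewards depend on
  earlier actions in turn; the prefix events turn this into measurability with respect to
  \<open>M\<close>.\<close>

lemma action_event: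
 assumes t: "t \<ge> 1"
 shows "{\<omega> \<in> space M. a \<omega> t = i} \<in> events"
proof (cases "i < N")
 case True
 have "{\<omega> \<in> space M. a \<omega> t = i} = (\<Union>\<alpha>\<in>{\<alpha> \<in> PiE {1..<Suc t} (\<lambda>_. {..<N}). \<alpha> t = i}. prefix_event (Suc t) \<alpha>)" (is "?L = ?R")
 proof
  show "?L \<subseteq> ?R"
  proof
   fix \<omega> assume w: "\<omega> \<in> ?L"
   then have "\<omega> \<in> prefix_event (Suc t) (restrict (a \<omega>) {1..<Suc t})" by (simp add: prefix_event_def)
   moreover have "restrict (a \<omega>) {1..<Suc t} \<in> {\<alpha> \<in> PiE {1..<Suc t} (\<lambda>_. {..<N}). \<alpha> t = i}"
    using w t a_lt by auto
   ultimately show "\<omega> \<in> ?R" by blast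
  qed
  show "?R \<subseteq> ?L" using t by (auto simp: prefix_event_def)
 qed
 also have "\<dots> \<in> events"
  by (intro sets.finite_UN prefix_event_measurable, rule finite_subset[OF _ finite_PiE[of "{1..<Suc t}" "\<lambda>_. {..<N}"]]) (blast, auto)
 finally show ?thesis .
next
 case False
 then have "{\<omega> \<in> space M. a \<omega> t = i} = {}" using a_lt[OF t] by auto
 then show ?thesis by (simp only: sets.empty_sets)
qed

definition deviates :: "nat => nat => real => 'w set" where
 "deviates t i r = {\<omega> \<in> space M.
  \<bar>f \<omega> (arm (z t) i) - post_mean k \<sigma> {1..<t} (played z (a \<omega>)) (reward (f \<omega>) z (a \<omega>) (\<epsilon> \<omega>)) (arm (z t) i)\<bar>
   > r * post_sd k \<sigma> {1..<t} (played z (a \<omega>)) (arm (z t) i)}"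

text \<open>On the event of a given past the deviation is that of a posterior with fixed inputs,
  whose tail is independent of this event. Summing over the disjoint pasts removes the dependence on
  the history.\<close>

lemma deviates:
 assumes t: "t \<ge> 1" and i: "i < N" and r: "r > 0"
 shows "deviates t i r \<in> events" "prob (deviates t i r) \<le> gtail r"
proof -
 define P where "P = PiE {1..<t} (\<lambda>_. {..<N})"
 have fin: "finite P" unfolding P_def by (intro finite_PiE) auto
 have PN: "\<forall>j\<in>{1..<t}. \<alpha> j < N" if "\<alpha> \<in> P" for \<alpha> using that by (auto simp: P_def PiE_iff)
 define D where "D \<alpha> = prefix_event t \<alpha> \<inter> deviates t i r" for \<alpha>
 have D: "D \<alpha> \<in> events \<and> prob (D \<alpha>) \<le> prob (prefix_event t \<alpha>) * gtail r" if a: "\<alpha> \<in> P" for \<alpha>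
 proof -
  obtain S where S: "S \<in> sets (PiM {0..<t} (\<lambda>_. borel :: real measure))"
   and e: "prefix_event t \<alpha> = {\<omega> \<in> space M. (\<lambda>i\<in>{0..<t}. obs (input \<alpha>) i \<omega>) \<in> S}"
   using prefix_event_obs[OF t PN[OF a]] by blast
  let ?B = "{\<omega> \<in> space M. (\<lambda>i\<in>{0..<t}. obs (input \<alpha>) i \<omega>) \<in> S \<and>
  \<bar>f \<omega> (arm (z t) i) - post_mean k \<sigma> {1..<t} (input \<alpha>) (\<lambda>i. f \<omega> (input \<alpha> i) + \<epsilon> \<omega> i) (arm (z t) i)\<bar> > r * post_sd k \<sigma> {1..<t} (input \<alpha>) (arm (z t) i)}"
  have eq: "post_mean k \<sigma> {1..<t} (played z (a \<omega>)) (reward (f \<omega>) z (a \<omega>) (\<epsilon> \<omega>)) (arm (z t) i) = post_mean k \<sigma> {1..<t} (input \<alpha>) (\<lambda>i. f \<omega> (input \<alpha> i) + \<epsilon> \<omega> i) (arm (z t) i)"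
   "post_sd k \<sigma> {1..<t} (played z (a \<omega>)) (arm (z t) i) = post_sd k \<sigma> {1..<t} (input \<alpha>) (arm (z t) i)"
   if "\<omega> \<in> prefix_event t \<alpha>" for \<omega>
   using that by (auto intro!: post_mean_cong simp: prefix_event_def input_def played_def reward_def)
  have "\<omega> \<in> D \<alpha> \<longleftrightarrow> \<omega> \<in> ?B" for \<omega>
  proof (cases "\<omega> \<in> prefix_event t \<alpha>")
   case True
   have "\<omega> \<in> space M" using True by (simp add: prefix_event_def)
   moreover have "(\<lambda>i\<in>{0..<t}. obs (input \<alpha>) i \<omega>) \<in> S" using True unfolding e by simp
   ultimately show ?thesis unfolding D_def deviates_def using True eq[OF True] by simp
  next
   case False
   then have "\<not> (\<omega> \<in> space M \<and> (\<lambda>i\<in>{0..<t}. obs (input \<alpha>) i \<omega>) \<in> S)" unfolding e by blast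
   then show ?thesis using False unfolding D_def by blast
  qed
  then have DB: "D \<alpha> = ?B" by blast
  show ?thesis unfolding DB e
   using posterior_tail[where t=t and x="input \<alpha>" and x'="arm (z t) i" and r=r and S=S, OF t input_in[OF PN[OF a]] arms[OF t i] r S]
   by simp
 qed
 have un: "deviates t i r = (\<Union>\<alpha>\<in>P. D \<alpha>)"
 proof
  show "deviates t i r \<subseteq> (\<Union>\<alpha>\<in>P. D \<alpha>)"
  proof
   fix \<omega> assume w: "\<omega> \<in> deviates t i r"
   then have "\<omega> \<in> D (restrict (a \<omega>) {1..<t})" by (simp add: D_def deviates_def prefix_event_def)
   moreover have "restrict (a \<omega>) {1..<t} \<in> P" using w a_lt by (auto simp: P_def deviates_def)
   ultimately show "\<omega> \<in> (\<Union>\<alpha>\<in>P. D \<alpha>)" by blast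
  qed
 qed (auto simp: D_def)
 show "deviates t i r \<in> events" unfolding un using fin D by (intro sets.finite_UN) auto
 have disj: "disjoint_family_on (prefix_event t) P"
  unfolding disjoint_family_on_def
 proof (intro ballI impI)
  fix \<alpha> \<gamma> assume ab: "\<alpha> \<in> P" "\<gamma> \<in> P" "\<alpha> \<noteq> \<gamma>"
  have "\<alpha> = \<gamma>" if "\<omega> \<in> prefix_event t \<alpha>" "\<omega> \<in> prefix_event t \<gamma>" for \<omega>
   using ab that unfolding P_def by (intro PiE_ext[of \<alpha> "{1..<t}" _ \<gamma>]) (auto simp: prefix_event_def)
  then show "prefix_event t \<alpha> \<inter> prefix_event t \<gamma> = {}" using ab(3) by blast
 qed
 have "prob (deviates t i r) \<le> (\<Sum>\<alpha>\<in>P. prob (D \<alpha>))"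
  unfolding un using fin D by (intro finite_measure_subadditive_finite) auto
 also have "\<dots> \<le> (\<Sum>\<alpha>\<in>P. prob (prefix_event t \<alpha>) * gtail r)" using D by (intro sum_mono) blast
 also have "\<dots> = prob (\<Union>\<alpha>\<in>P. prefix_event t \<alpha>) * gtail r"
  using fin disj prefix_event_measurable[OF t PN] by (subst finite_measure_finite_Union) (auto simp: sum_distrib_right)
 also have "\<dots> \<le> 1 * gtail r" by (intro mult_right_mono) (auto simp: gtail_def)
 finally show "prob (deviates t i r) \<le> gtail r" by simp
qed

lemma played_in: "\<omega> \<in> space M ==> t \<ge> 1 ==> played z (a \<omega>) t \<in> X"
 unfolding played_def by (intro arms a_lt)

lemma instant_regret_le:
 assumes w: "\<omega> \<in> space M" and t: "t \<ge> 1" and ok: "\<And>i. i < N ==> \<omega> \<notin> deviates t i (sqrt (\<beta> t))"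
 shows "Max ((\<lambda>i. f \<omega> (arm (z t) i)) ` {..<N}) - f \<omega> (played z (a \<omega>) t) \<le>
  2 * sqrt (\<beta> t) * post_sd k \<sigma> {1..<t} (played z (a \<omega>)) (played z (a \<omega>) t)"
proof -
 let ?m = "\<lambda>i. post_mean k \<sigma> {1..<t} (played z (a \<omega>)) (reward (f \<omega>) z (a \<omega>) (\<epsilon> \<omega>)) (arm (z t) i)"
 let ?s = "\<lambda>i. sqrt (\<beta> t) * post_sd k \<sigma> {1..<t} (played z (a \<omega>)) (arm (z t) i)"
 have conf: "\<bar>f \<omega> (arm (z t) i) - ?m i\<bar> \<le> ?s i" if "i < N" for i
  using ok[OF that] w by (simp add: deviates_def)
 have "Max ((\<lambda>i. f \<omega> (arm (z t) i)) ` {..<N}) \<in> (\<lambda>i. f \<omega> (arm (z t) i)) ` {..<N}"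
  using N by (intro Max_in) (auto simp: lessThan_empty_iff)
 then obtain i where i: "i < N" "Max ((\<lambda>i. f \<omega> (arm (z t) i)) ` {..<N}) = f \<omega> (arm (z t) i)" by auto
 have "is_arg_max (\<lambda>i. ucb k \<sigma> (\<beta> t) {1..<t} (played z (a \<omega>)) (reward (f \<omega>) z (a \<omega>) (\<epsilon> \<omega>)) (arm (z t) i)) (\<lambda>i. i < N) (a \<omega> t)"
  using run w t unfolding ntk_ucb_def by blast
 then have "?m i + ?s i \<le> ?m (a \<omega> t) + ?s (a \<omega> t)"
  using i(1) unfolding is_arg_max_linorder ucb_def by blast
 then show ?thesis unfolding i(2) using conf[OF i(1)] conf[OF a_lt[OF t w]] by (simp add: played_def)
qed

lemma regret_measurable: "(\<lambda>\<omega>. regret (f \<omega>) N z (a \<omega>) T) \<in> borel_measurable M"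
proof -
 have "(\<lambda>\<omega>. Max ((\<lambda>i. f \<omega> (arm (z t) i)) ` {..<N}) - f \<omega> (played z (a \<omega>) t)) \<in> borel_measurable M" if t: "t \<ge> 1" for t
 proof -
  have m: "(\<lambda>\<omega>. Max ((\<lambda>i. f \<omega> (arm (z t) i)) ` {..<N})) \<in> borel_measurable M"
   by (rule borel_measurable_Max) (use f_measurable arms t in auto)
  have "(\<lambda>\<omega>. \<Sum>i<N. if a \<omega> t = i then f \<omega> (arm (z t) i) else 0) \<in> borel_measurable M"
   by (intro borel_measurable_sum measurable_If f_measurable arms t borel_measurable_const action_event) auto
  then have "(\<lambda>\<omega>. f \<omega> (played z (a \<omega>) t)) \<in> borel_measurable M"
   by (rule measurable_cong[THEN iffD1, rotated]) (use a_lt[OF t] in \<open>auto simp: sum.delta played_def\<close>)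
  then show ?thesis by (rule borel_measurable_diff[OF m])
 qed
 then show ?thesis unfolding regret_def by (intro borel_measurable_sum) auto
qed

end

text \<open>The exponent arises because \<open>T * T powr ((d - 1) / d)\<close> is the square of
  \<open>T powr ((2 * d - 1) / (2 * d))\<close>. One logarithm under the root comes from
  \<open>v\<close> and one from the variances, so a first power remains; \<open>sqrt C\<close> is
  enlarged to \<open>C\<close>.\<close>

lemma regret_rate_combine:
 fixes T d :: nat and C v s b :: real
 assumes T: "T \<ge> 3" and d: "d \<ge> 1" and C: "C \<ge> 1" and b: "b \<ge> 0" and Kb: "0 \<le> v" "v \<le> b * ln (real T)" and s: "s \<ge> 0"
 shows "sqrt v * sqrt (real T * (C * s * real T powr ((real d - 1) / real d) * ln (real T)))
  \<le> regret_rate C (sqrt (b * s)) 1 d T"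
proof -
 have e3: "exp 1 \<le> (3::real)" by (rule exp_le)
 have l1: "ln (real T) \<ge> 1" using T e3 by (subst ln_ge_iff) auto
 have p: "real T * real T powr ((real d - 1) / real d) = (real T powr ((2 * real d - 1) / (2 * real d)))\<^sup>2"
 proof -
  have "real T * real T powr ((real d - 1) / real d) = real T powr (1 + (real d - 1) / real d)"
   using T by (simp add: powr_add)
  also have "1 + (real d - 1) / real d = (2 * real d - 1) / (2 * real d) + (2 * real d - 1) / (2 * real d)"
   using d by (simp add: field_simps)
  finally show ?thesis by (simp only: powr_add power2_eq_square)
 qed
 have "sqrt v * sqrt (real T * (C * s * real T powr ((real d - 1) / real d) * ln (real T))) =
  sqrt (v * ((C * s * ln (real T)) * (real T * real T powr ((real d - 1) / real d))))"
  by (simp add: real_sqrt_mult mult_ac)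
 also have "\<dots> \<le> sqrt ((b * ln (real T)) * ((C * s * ln (real T)) * (real T * real T powr ((real d - 1) / real d))))"
  using Kb C s l1 by (intro real_sqrt_le_mono mult_right_mono) auto
 also have "\<dots> \<le> sqrt ((b * s) * (C * real T powr ((2 * real d - 1) / (2 * real d)) * ln (real T))\<^sup>2)"
 proof (rule real_sqrt_le_mono)
  have "C * 1 \<le> C * C" using C by (intro mult_left_mono) auto
  then have "(b * s * (ln (real T))\<^sup>2 * (real T powr ((2 * real d - 1) / (2 * real d)))\<^sup>2) * C \<le> (b * s * (ln (real T))\<^sup>2 * (real T powr ((2 * real d - 1) / (2 * real d)))\<^sup>2) * (C * C)"
   using b s by (intro mult_left_mono) auto
  then show "(b * ln (real T)) * ((C * s * ln (real T)) * (real T * real T powr ((real d - 1) / real d))) \<le> (b * s) * (C * real T powr ((2 * real d - 1) / (2 * real d)) * ln (real T))\<^sup>2"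
   unfolding p by (simp add: power_mult_distrib power2_eq_square mult_ac)
 qed
 also have "\<dots> = sqrt (b * s) * (C * real T powr ((2 * real d - 1) / (2 * real d)) * ln (real T))"
  using C l1 by (simp add: real_sqrt_mult)
 finally show ?thesis by (simp add: regret_rate_def)
qed

lemma sum_le_sqrt_card:
 fixes w :: "'a => real"
 assumes "finite S" "card S \<le> T"
 shows "(\<Sum>t\<in>S. w t) \<le> sqrt (real T * (\<Sum>t\<in>S. (w t)\<^sup>2))"
proof -
 have "(\<Sum>t\<in>S. w t * 1)\<^sup>2 \<le> (\<Sum>t\<in>S. (w t)\<^sup>2) * (\<Sum>t\<in>S. 1\<^sup>2)" by (rule Cauchy_Schwarz_ineq_sum)
 also have "\<dots> \<le> (\<Sum>t\<in>S. (w t)\<^sup>2) * real T" using assms(2) by (intro mult_left_mono sum_nonneg) auto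
 finally have "(\<Sum>t\<in>S. w t)\<^sup>2 \<le> real T * (\<Sum>t\<in>S. (w t)\<^sup>2)" by (simp add: mult.commute)
 then show ?thesis using real_le_rsqrt by blast
qed

text \<open>The failure probabilities of all rounds are summable, so a single event of probability
  above \<open>1 - \<delta>\<close> serves all horizons at once.\<close>

lemma ntk_ucb_regret:
 fixes C :: "nat => nat => real" and \<delta> \<sigma> :: real
 assumes C1: "\<And>d L. C d L \<ge> 1"
  and var: "\<And>d L \<sigma> T S x. d \<ge> 1 ==> L \<ge> 1 ==> \<sigma> > 0 ==> T \<ge> 3 ==> S \<subseteq> {1..T} ==> \<forall>t\<in>S. x t \<in> unit_sphere d ==>
   (\<Sum>t\<in>S. (post_sd (ntk d L) \<sigma> {i\<in>S. i < t} x (x t))\<^sup>2) \<le> C d L * (1 + \<sigma>\<^sup>2) * real T powr ((real d - 1) / real d) * ln (real T)"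
  and N: "1 \<le> N" and \<delta>: "0 < \<delta>" "\<delta> < 1" and \<sigma>: "0 < \<sigma>"
 defines "\<beta> \<equiv> \<lambda>t. 2 * ln (real N * (real t)\<^sup>2 * pi\<^sup>2 / (6 * \<delta>))"
 defines "K \<equiv> 2 * sqrt ((2 * \<bar>ln (real N * pi\<^sup>2 / (6 * \<delta>))\<bar> + 4) * (1 + \<sigma>\<^sup>2))"
 assumes dL: "1 \<le> d" "1 \<le> L" and ctx: "contexts d N X z" and M: "prob_space M" and gp: "gaussian_process M X (ntk d L) f"
  and noise: "iid_gaussian_noise M {1..} \<sigma> \<epsilon>" and U: "U \<in> borel_measurable M"
  and ind: "prob_space.indep_sets M
      ((!) [generated_by M (PiM X (\<lambda>_. borel)) (\<lambda>\<omega>. restrict (f \<omega>) X),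
         generated_by M (PiM {1..} (\<lambda>_. borel)) (\<lambda>\<omega>. restrict (\<epsilon> \<omega>) {1..}),
         generated_by M borel U]) {..<3}"
  and run: "ntk_ucb (ntk d L) \<sigma> \<beta> N z M U a (\<lambda>\<omega>. reward (f \<omega>) z (a \<omega>) (\<epsilon> \<omega>))"
 shows "measure M {\<omega> \<in> space M. \<forall>T\<ge>3. regret (f \<omega>) N z (a \<omega>) T \<le> regret_rate (C d L) K 1 d T} > 1 - \<delta>"
proof -
 interpret prob_space M by (rule M)
 have XS: "X \<subseteq> unit_sphere d" and cols: "\<And>t i. t \<ge> 1 ==> i < N ==> arm (z t) i \<in> X"
  using ctx arm_eq_col by (auto simp: contexts_def)
 interpret ucb_run M X "ntk d L" f \<epsilon> U \<sigma> N z \<beta> a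
  using psd_kernel_mono[OF psd_kernel_ntk[OF dL(2)] XS] \<sigma> gp noise U ind N cols run
  by unfold_locales auto
 \<comment> \<open>\<open>q * (real t)\<^sup>2\<close> is the argument of the logarithm in
   \<open>\<beta> t\<close>. It exceeds 1 already in the first round, so \<open>\<beta> t\<close> is
   bounded away from 0.\<close>
 define q where "q = real N * pi\<^sup>2 / (6 * \<delta>)"
 have pi9: "9 < pi\<^sup>2" using power_strict_mono[OF pi_gt3, of 2] by simp
 have q: "q \<ge> pi\<^sup>2 / 6"
 proof -
  have "pi\<^sup>2 / 6 * \<delta> \<le> pi\<^sup>2 / 6 * real N" using N \<delta> by (intro mult_left_mono) auto
  then show ?thesis using \<delta> by (simp add: q_def field_simps)
 qed
 have q0: "q > 0" using q pi9 by linarith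
 have \<beta>: "\<beta> t = 2 * ln q + 4 * ln (real t)" if "t \<ge> 1" for t
 proof -
  have "real N * (real t)\<^sup>2 * pi\<^sup>2 / (6 * \<delta>) = q * (real t)\<^sup>2" by (simp add: q_def)
  then show ?thesis using that q0 unfolding \<beta>_def by (simp add: ln_mult ln_realpow)
 qed
 have lnq: "ln q \<ge> 1 / 3"
 proof -
  have "ln (1 / q) \<le> 1 / q - 1" using q0 by (intro ln_le_minus_one) simp
  moreover have "1 / q \<le> 2 / 3" using q q0 pi9 by (simp add: field_simps)
  ultimately show ?thesis using q0 by (simp add: ln_div)
 qed
 have \<beta>ge: "\<beta> t \<ge> 2 / 3" if "t \<ge> 1" for t
 proof -
  have "ln (real t) \<ge> 0" using that by simp
  then show ?thesis using lnq unfolding \<beta>[OF that] by linarith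
 qed
 \<comment> \<open>As \<open>\<beta> t\<close> is at least \<open>2 / 3\<close>, the prefactor of
   the Gaussian tail is at most \<open>sqrt (2 / pi) / sqrt (2 / 3)\<close>, which is this number
   below 1; it makes the failure probability strictly smaller than \<open>\<delta>\<close>.\<close>
 define c where "c = sqrt (3 / pi)"
 have c: "0 \<le> c" "c < 1" unfolding c_def using pi_gt3 by (auto intro!: real_sqrt_lt_1_iff[THEN iffD2])
 have tail: "gtail (sqrt (\<beta> t)) \<le> c * (6 * \<delta> / (real N * pi\<^sup>2)) * (1 / (real t)\<^sup>2)" if t: "t \<ge> 1" for t
 proof -
  have r: "sqrt (\<beta> t) \<ge> sqrt (2 / 3)" using \<beta>ge[OF t] by (rule real_sqrt_le_mono)
  have r0: "sqrt (\<beta> t) > 0" using \<beta>ge[OF t] by simp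
  have "sqrt (2 / pi) / sqrt (\<beta> t) \<le> sqrt (2 / pi) / sqrt (2 / 3)"
   using r by (intro divide_left_mono mult_pos_pos r0) auto
  also have "\<dots> = c" by (simp add: c_def real_sqrt_divide[symmetric])
  finally have 1: "sqrt (2 / pi) / sqrt (\<beta> t) \<le> c" .
  have 2: "exp (- (sqrt (\<beta> t))\<^sup>2 / 2) = (6 * \<delta> / (real N * pi\<^sup>2)) * (1 / (real t)\<^sup>2)"
  proof -
   have sq: "(sqrt (\<beta> t))\<^sup>2 = \<beta> t" using \<beta>ge[OF t] by simp
   have "ln (q * (real t)\<^sup>2) = ln q + 2 * ln (real t)" using q0 t by (simp add: ln_mult ln_realpow)
   then have "(sqrt (\<beta> t))\<^sup>2 / 2 = ln (q * (real t)\<^sup>2)" using sq \<beta>[OF t] by linarith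
   then have "exp (- (sqrt (\<beta> t))\<^sup>2 / 2) = exp (- ln (q * (real t)\<^sup>2))" by (simp only: minus_divide_left[symmetric])
   also have "\<dots> = 1 / (q * (real t)\<^sup>2)"
    using q0 t by (subst exp_minus, subst exp_ln) (auto simp: divide_inverse)
   also have "\<dots> = (6 * \<delta> / (real N * pi\<^sup>2)) * (1 / (real t)\<^sup>2)" by (simp add: q_def)
   finally show ?thesis .
  qed
  show ?thesis
   using order_trans[OF gtail_le[OF r0] mult_right_mono[OF 1 exp_ge_zero]] unfolding 2 mult.assoc .
 qed
 \<comment> \<open>Rounds start at 1, hence the successor.\<close>
 define Bd where "Bd n = (\<Union>i<N. deviates (Suc n) i (sqrt (\<beta> (Suc n))))" for n
 have r0: "sqrt (\<beta> (Suc n)) > 0" for n using \<beta>ge[of "Suc n"] by simp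
 have Bdm: "Bd n \<in> events" for n unfolding Bd_def using r0 by (intro sets.finite_UN deviates) auto
 have Bdp: "prob (Bd n) \<le> c * (6 * \<delta> / pi\<^sup>2) * (1 / (real n + 1)\<^sup>2)" for n
 proof -
  have "prob (Bd n) \<le> (\<Sum>i<N. prob (deviates (Suc n) i (sqrt (\<beta> (Suc n)))))"
   unfolding Bd_def using r0 deviates(1) by (intro finite_measure_subadditive_finite) auto
  also have "\<dots> \<le> (\<Sum>i<N. c * (6 * \<delta> / (real N * pi\<^sup>2)) * (1 / (real (Suc n))\<^sup>2))"
   by (intro sum_mono order_trans[OF deviates(2) tail] r0) auto
  also have "\<dots> = c * (6 * \<delta> / pi\<^sup>2) * (1 / (real n + 1)\<^sup>2)" using N by (simp add: field_simps)
  finally show ?thesis .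
 qed
 \<comment> \<open>Euler's sum of the inverse squares cancels the factor
   \<open>pi\<^sup>2 / 6\<close> built into \<open>\<beta>\<close>.\<close>
 have sm: "(\<lambda>n. c * (6 * \<delta> / pi\<^sup>2) * (1 / (real n + 1)\<^sup>2)) sums (c * \<delta>)"
  using sums_mult[OF inverse_squares_sums, of "c * (6 * \<delta> / pi\<^sup>2)"] by (simp add: add.commute)
 have sB: "summable (\<lambda>n. prob (Bd n))"
  by (rule summable_comparison_test[OF _ sums_summable[OF sm]]) (use Bdp in auto)
 have "prob (\<Union>n. Bd n) \<le> (\<Sum>n. prob (Bd n))"
  using Bdm sB by (intro finite_measure_subadditive_countably) auto
 also have "\<dots> \<le> c * \<delta>" using suminf_le[OF Bdp sB sums_summable[OF sm]] sums_unique[OF sm] by simp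
 also have "\<dots> < \<delta>" using c \<delta> by simp
 finally have pB: "prob (\<Union>n. Bd n) < \<delta>" .
 let ?G = "{\<omega> \<in> space M. \<forall>T\<ge>3. regret (f \<omega>) N z (a \<omega>) T \<le> regret_rate (C d L) K 1 d T}"
 have good: "space M - (\<Union>n. Bd n) \<subseteq> ?G"
 proof
  fix \<omega> assume "\<omega> \<in> space M - (\<Union>n. Bd n)"
  then have w: "\<omega> \<in> space M" and ok: "\<omega> \<notin> Bd n" for n by auto
  have "regret (f \<omega>) N z (a \<omega>) T \<le> regret_rate (C d L) K 1 d T" if T: "T \<ge> 3" for T
  proof -
   let ?s = "\<lambda>t. post_sd (ntk d L) \<sigma> {1..<t} (played z (a \<omega>)) (played z (a \<omega>) t)"
   have s0: "0 \<le> ?s t" if "t \<ge> 1" for t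
    by (rule post_sd_nonneg[OF k \<sigma>]) (use played_in[OF w] that in auto)
   have "Max ((\<lambda>i. f \<omega> (arm (z t) i)) ` {..<N}) - f \<omega> (played z (a \<omega>) t) \<le> 2 * sqrt (\<beta> T) * ?s t" if t: "t \<in> {1..T}" for t
   proof -
    have t1: "t \<ge> 1" "t \<le> T" using t by auto
    have "Max ((\<lambda>i. f \<omega> (arm (z t) i)) ` {..<N}) - f \<omega> (played z (a \<omega>) t) \<le> 2 * sqrt (\<beta> t) * ?s t"
    proof (rule instant_regret_le[OF w t1(1)])
     fix i assume "i < N"
     then show "\<omega> \<notin> deviates t i (sqrt (\<beta> t))" using ok[of "t - 1"] t1 by (auto simp: Bd_def)
    qed
    moreover have "\<beta> t \<le> \<beta> T" using t1 \<beta>[of t] \<beta>[of T] by simp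
    then have "2 * sqrt (\<beta> t) * ?s t \<le> 2 * sqrt (\<beta> T) * ?s t" using s0[OF t1(1)] by (intro mult_right_mono mult_left_mono) auto
    ultimately show ?thesis by linarith
   qed
   then have "regret (f \<omega>) N z (a \<omega>) T \<le> (\<Sum>t=1..T. 2 * sqrt (\<beta> T) * ?s t)"
    unfolding regret_def by (rule sum_mono)
   then have rs: "regret (f \<omega>) N z (a \<omega>) T \<le> 2 * sqrt (\<beta> T) * (\<Sum>t=1..T. ?s t)"
    unfolding sum_distrib_left[symmetric] .
   have m1: "(\<Sum>t=1..T. ?s t) \<le> sqrt (real T * (\<Sum>t=1..T. (?s t)\<^sup>2))" by (rule sum_le_sqrt_card) auto
   have "(\<Sum>t=1..T. (?s t)\<^sup>2) \<le> C d L * (1 + \<sigma>\<^sup>2) * real T powr ((real d - 1) / real d) * ln (real T)"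
   proof -
    have "{i \<in> {1..T}. i < t} = {1..<t}" if "t \<in> {1..T}" for t using that by auto
    then show ?thesis
     using var[OF dL \<sigma> T, of "{1..T}" "played z (a \<omega>)"] played_in[OF w] XS by (simp add: subset_iff)
   qed
   then have "sqrt (real T * (\<Sum>t=1..T. (?s t)\<^sup>2)) \<le> sqrt (real T * (C d L * (1 + \<sigma>\<^sup>2) * real T powr ((real d - 1) / real d) * ln (real T)))"
    by (intro real_sqrt_le_mono mult_left_mono) auto
   with m1 have m: "(\<Sum>t=1..T. ?s t) \<le> sqrt (real T * (C d L * (1 + \<sigma>\<^sup>2) * real T powr ((real d - 1) / real d) * ln (real T)))"
    by (rule order_trans)
   have "0 \<le> 2 * sqrt (\<beta> T)" using \<beta>ge[of T] T by simp
   from order_trans[OF rs mult_left_mono[OF m this]]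
   have "regret (f \<omega>) N z (a \<omega>) T \<le> 2 * (sqrt (\<beta> T) * sqrt (real T * (C d L * (1 + \<sigma>\<^sup>2) * real T powr ((real d - 1) / real d) * ln (real T))))"
    by (simp only: mult.assoc)
   also have "\<dots> \<le> 2 * regret_rate (C d L) (sqrt ((2 * \<bar>ln q\<bar> + 4) * (1 + \<sigma>\<^sup>2))) 1 d T"
   proof (intro mult_left_mono regret_rate_combine T dL C1)
    have l1: "ln (real T) \<ge> 1" using T exp_le by (subst ln_ge_iff) auto
    have "2 * \<bar>ln q\<bar> * 1 \<le> 2 * \<bar>ln q\<bar> * ln (real T)" using l1 by (intro mult_left_mono) auto
    then show "\<beta> T \<le> (2 * \<bar>ln q\<bar> + 4) * ln (real T)" using \<beta>[of T] T by (simp add: distrib_right)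
    show "0 \<le> \<beta> T" using \<beta>ge[of T] T by simp
   qed auto
   also have "\<dots> = regret_rate (C d L) K 1 d T" unfolding regret_rate_def K_def q_def by simp
   finally show ?thesis .
  qed
  then show "\<omega> \<in> ?G" using w by simp
 qed
 have Gm: "?G \<in> events"
 proof -
  have "?G = (\<Inter>T\<in>{3..}. {\<omega> \<in> space M. regret (f \<omega>) N z (a \<omega>) T \<le> regret_rate (C d L) K 1 d T})" by auto
  also have "\<dots> \<in> events"
   by (intro sets.countable_INT' image_subsetI) (use borel_measurable_le[OF regret_measurable borel_measurable_const] in auto)
  finally show ?thesis .
 qed
 have Um: "(\<Union>n. Bd n) \<in> events" using Bdm by blast
 have "1 - \<delta> < prob (space M - (\<Union>n. Bd n))" using pB prob_compl[OF Um] by simp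
 also have "\<dots> \<le> prob ?G" by (rule finite_measure_mono[OF good Gm])
 finally show ?thesis .
qed

section \<open>Reproducing kernel Hilbert spaces and elimination\<close>

lemma rkhs_Cauchy_Schwarz:
 assumes R: "rkhs X k H ip" and g: "g \<in> H" and h: "h \<in> H"
 shows "\<bar>ip g h\<bar> \<le> sqrt (ip g g) * sqrt (ip h h)"
proof -
 have add: "ip (\<lambda>x. u x + v x) w = ip u w + ip v w" if "u \<in> H" "v \<in> H" "w \<in> H" for u v w
  using R that unfolding rkhs_def by blast
 have scale: "ip (\<lambda>x. c * u x) w = c * ip u w" if "u \<in> H" "w \<in> H" for c u w
  using R that unfolding rkhs_def by blast
 have sym: "ip u v = ip v u" if "u \<in> H" "v \<in> H" for u v using R that unfolding rkhs_def by blast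
 have Hadd: "(\<lambda>x. u x + v x) \<in> H" if "u \<in> H" "v \<in> H" for u v using R that unfolding rkhs_def by blast
 have Hsc: "(\<lambda>x. c * u x) \<in> H" if "u \<in> H" for c u using R that unfolding rkhs_def by blast
 have pos: "0 \<le> ip u u" and def0: "ip u u = 0 ==> u = (\<lambda>_. 0)" if "u \<in> H" for u using R that unfolding rkhs_def by blast+
 have quad: "0 \<le> ip g g + 2 * c * ip g h + c\<^sup>2 * ip h h" for c
 proof -
  let ?v = "\<lambda>x. g x + c * h x"
  have v: "?v \<in> H" by (rule Hadd[OF g Hsc[OF h]])
  have e: "ip ?v w = ip g w + c * ip h w" if "w \<in> H" for w
   using add[OF g Hsc[OF h, of c] that] scale[OF h that, of c] by simp
  have "ip ?v ?v = ip ?v g + c * ip ?v h" using e[OF v] sym[OF g v] sym[OF h v] by simp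
  also have "\<dots> = ip g g + 2 * c * ip g h + c\<^sup>2 * ip h h"
   using e[OF g] e[OF h] sym[OF g h] by (simp add: algebra_simps power2_eq_square)
  finally show ?thesis using pos[OF v] by simp
 qed
 have "(ip g h)\<^sup>2 \<le> ip g g * ip h h"
 proof (cases "ip h h = 0")
  case True
  then have "h = (\<lambda>x. 0 * h x)" using def0[OF h] by (simp add: fun_eq_iff)
  then have "ip h g = 0" using scale[OF h g, of 0] by simp
  then show ?thesis using sym[OF g h] True by simp
 next
  case False
  then have hh: "ip h h > 0" using pos[OF h] by simp
  have "0 \<le> ip g g + 2 * (- ip g h / ip h h) * ip g h + (- ip g h / ip h h)\<^sup>2 * ip h h" by (rule quad)
  also have "\<dots> = ip g g - (ip g h)\<^sup>2 / ip h h" using hh by (simp add: power2_eq_square)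
  finally show ?thesis using hh by (simp add: field_simps)
 qed
 then have "sqrt ((ip g h)\<^sup>2) \<le> sqrt (ip g g * ip h h)" by (rule real_sqrt_le_mono)
 then show ?thesis by (simp add: real_sqrt_mult)
qed

text \<open>By the reproducing property the error is the inner product of \<open>f\<close> with
  \<open>h \<Psi>\<close>, the kernel function at \<open>x'\<close> minus the combination of those
  at the inputs; the squared norm of \<open>h \<Psi>\<close> is \<open>kdist\<close>.\<close>

lemma rkhs_ball_bias:
 fixes \<Psi> :: "nat set" and c :: "nat => real"
 assumes k: "psd_kernel X k" and f: "in_rkhs_ball X k B f" and fin: "finite \<Psi>" and x: "\<forall>i\<in>\<Psi>. x i \<in> X" and x': "x' \<in> X"
 shows "\<bar>f x' - (\<Sum>i\<in>\<Psi>. c i * f (x i))\<bar> \<le> B * sqrt (kdist k \<Psi> x x' c)"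
proof -
 obtain H ip where R: "rkhs X k H ip" and fH: "f \<in> H" and fB: "sqrt (ip f f) \<le> B"
  using f unfolding in_rkhs_ball_def by blast
 define K where "K v = (\<lambda>w. if w \<in> X then k v w else 0)" for v
 have K: "K v \<in> H" and rep: "\<And>g. g \<in> H ==> ip g (K v) = g v" if "v \<in> X" for v
  using R that unfolding rkhs_def K_def by blast+
 have add: "ip (\<lambda>x. u x + v x) w = ip u w + ip v w" if "u \<in> H" "v \<in> H" "w \<in> H" for u v w
  using R that unfolding rkhs_def by blast
 have scale: "ip (\<lambda>x. c * u x) w = c * ip u w" if "u \<in> H" "w \<in> H" for c u w
  using R that unfolding rkhs_def by blast
 have sym: "ip u v = ip v u" if "u \<in> H" "v \<in> H" for u v using R that unfolding rkhs_def by blast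
 have Hadd: "(\<lambda>x. u x + v x) \<in> H" if "u \<in> H" "v \<in> H" for u v using R that unfolding rkhs_def by blast
 have Hsc: "(\<lambda>x. c * u x) \<in> H" if "u \<in> H" for c u using R that unfolding rkhs_def by blast
 define h where "h I = (\<lambda>w. K x' w + (\<Sum>i\<in>I. - c i * K (x i) w))" for I
 have main: "h I \<in> H \<and> (\<forall>g\<in>H. ip g (h I) = g x' - (\<Sum>i\<in>I. c i * g (x i)))" if "I \<subseteq> \<Psi>" for I
  using finite_subset[OF that fin] that
 proof (induction I rule: finite_induct)
  case empty
  have "h {} = K x'" by (simp add: h_def)
  then show ?case using K[OF x'] rep[OF x'] by simp
 next
  case (insert i I)
  have xi: "x i \<in> X" using insert.prems x by blast
  have hI: "h I \<in> H" "\<And>g. g \<in> H ==> ip g (h I) = g x' - (\<Sum>i\<in>I. c i * g (x i))" using insert.IH insert.prems by auto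
  have e: "h (insert i I) = (\<lambda>w. h I w + (- c i) * K (x i) w)"
   using insert.hyps by (simp add: h_def fun_eq_iff)
  have H: "h (insert i I) \<in> H" unfolding e by (rule Hadd[OF hI(1) Hsc[OF K[OF xi]]])
  have "ip g (h (insert i I)) = g x' - (\<Sum>i\<in>insert i I. c i * g (x i))" if g: "g \<in> H" for g
  proof -
   have "ip g (h (insert i I)) = ip (h (insert i I)) g" by (rule sym[OF g H])
   also have "\<dots> = ip (h I) g + (- c i) * ip (K (x i)) g"
    unfolding e using add[OF hI(1) Hsc[OF K[OF xi], of "- c i"] g] scale[OF K[OF xi] g, of "- c i"] by simp
   also have "\<dots> = g x' - (\<Sum>i\<in>insert i I. c i * g (x i))"
    unfolding sym[OF hI(1) g] sym[OF K[OF xi] g] hI(2)[OF g] rep[OF xi g] using insert.hyps by simp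
   finally show ?thesis .
  qed
  then show ?case using H by blast
 qed
 have hH: "h \<Psi> \<in> H" and hip: "\<And>g. g \<in> H ==> ip g (h \<Psi>) = g x' - (\<Sum>i\<in>\<Psi>. c i * g (x i))" using main by auto
 have "ip (h \<Psi>) (h \<Psi>) = kdist k \<Psi> x x' c"
 proof -
  have hx: "h \<Psi> v = k v x' - (\<Sum>i\<in>\<Psi>. c i * k v (x i))" if v: "v \<in> X" for v
  proof -
   have "(\<Sum>i\<in>\<Psi>. - c i * K (x i) v) = (\<Sum>i\<in>\<Psi>. - (c i * k v (x i)))"
    using x v psd_kernel_sym[OF k v] by (intro sum.cong refl) (simp add: K_def)
   then show ?thesis using v psd_kernel_sym[OF k v x'] by (simp add: h_def K_def sum_negf)
  qed
  have e1: "(\<Sum>i\<in>\<Psi>. c i * h \<Psi> (x i)) = (\<Sum>i\<in>\<Psi>. c i * k (x i) x') - (\<Sum>i\<in>\<Psi>. \<Sum>j\<in>\<Psi>. c i * c j * k (x i) (x j))"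
   unfolding sum_subtractf[symmetric] using x by (intro sum.cong refl) (simp add: hx right_diff_distrib sum_distrib_left mult.assoc)
  have e2: "h \<Psi> x' = k x' x' - (\<Sum>i\<in>\<Psi>. c i * k (x i) x')"
   unfolding hx[OF x'] using x psd_kernel_sym[OF k x'] by simp
  show ?thesis unfolding hip[OF hH] e1 e2 kdist_def by (simp add: algebra_simps)
 qed
 then have "\<bar>f x' - (\<Sum>i\<in>\<Psi>. c i * f (x i))\<bar> \<le> sqrt (ip f f) * sqrt (kdist k \<Psi> x x' c)"
  using rkhs_Cauchy_Schwarz[OF R fH hH] hip[OF fH] by simp
 also have "\<dots> \<le> B * sqrt (kdist k \<Psi> x x' c)"
  using fB kdist_nonneg[OF k fin x x'] by (intro mult_right_mono) auto
 finally show ?thesis .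
qed

lemma rkhs_ball_nonneg: "in_rkhs_ball X k B f ==> 0 \<le> B"
proof -
 assume "in_rkhs_ball X k B f"
 then obtain H ip where "rkhs X k H ip" "f \<in> H" "sqrt (ip f f) \<le> B" unfolding in_rkhs_ball_def by blast
 moreover from this have "0 \<le> ip f f" unfolding rkhs_def by blast
 ultimately show "0 \<le> B" using real_sqrt_ge_zero by (meson order_trans)
qed

lemma rkhs_ball_bound:
 assumes k: "psd_kernel X k" and f: "in_rkhs_ball X k B f" and x: "x \<in> X"
 shows "\<bar>f x\<bar> \<le> B * sqrt (k x x)"
 using rkhs_ball_bias[OF k f, of "{}" _ x] x by (simp add: kdist_def)

section \<open>Rounds of the elimination algorithm\<close>

lemma active_Suc:
 "r \<ge> 1 ==> active k \<sigma> \<beta> N \<Psi> x y Z (Suc r) = {i \<in> active k \<sigma> \<beta> N \<Psi> x y Z r.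
  ucb k \<sigma> \<beta> (\<Psi> r) x y (arm Z i) \<ge> Max ((\<lambda>i. ucb k \<sigma> \<beta> (\<Psi> r) x y (arm Z i)) ` active k \<sigma> \<beta> N \<Psi> x y Z r) - \<sigma> * 2 powr (1 - real r)}"
 by (cases r) (simp_all add: Let_def)

lemma active_subset: "r \<ge> 1 ==> active k \<sigma> \<beta> N \<Psi> x y Z r \<subseteq> {..<N}"
proof (induction r rule: dec_induct)
 case (step r)
 then show ?case unfolding active_Suc[OF step(1)] by blast
qed simp

text \<open>The body of \<open>sup_ntk_ucb\<close> for one round that stops at level
  \<open>s\<close>, cut out so that the index sets, which are existentially bound there, can be
  named.\<close>

definition sup_round where
 "sup_round k \<sigma> \<beta> N T z pick a y \<Psi> t s \<longleftrightarrow>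
  (let x = played z a;
       A = active k \<sigma> \<beta> N (\<Psi> t) x y (z t);
       w = (\<lambda>r i. width k \<sigma> \<beta> (\<Psi> t r) x (arm (z t) i));
       settled = (\<lambda>r. \<forall>i\<in>A r. w r i \<le> \<sigma> / sqrt (real T));
       narrow = (\<lambda>r. \<forall>i\<in>A r. w r i \<le> \<sigma> * 2 powr (- real r))
     in (\<forall>r\<in>{1..<s}. \<not> settled r \<and> narrow r) \<and>
       (settled s \<and>
        is_arg_max (\<lambda>i. ucb k \<sigma> \<beta> (\<Psi> t s) x y (arm (z t) i)) (\<lambda>i. i \<in> A s) (a t) \<and>
        \<Psi> (Suc t) = \<Psi> t
       \<or>
       \<not> settled s \<and> \<not> narrow s \<and>
        a t = pick t {i \<in> A s. w s i > \<sigma> * 2 powr (- real s)} \<and>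
        \<Psi> (Suc t) = (\<Psi> t)(s := insert t (\<Psi> t s))))"

lemma sup_ntk_ucb_rounds:
 "sup_ntk_ucb k \<sigma> \<beta> N T z pick a y \<longleftrightarrow>
  (\<exists>\<Psi>. \<Psi> 1 = (\<lambda>_. {}) \<and> (\<forall>t\<in>{1..T}. \<exists>s\<in>{1..nat \<lceil>ln (real T)\<rceil>}. sup_round k \<sigma> \<beta> N T z pick a y \<Psi> t s))"
 unfolding sup_ntk_ucb_def sup_round_def ..

lemma two_powr_level:
 "\<sigma> * 2 powr (1 - real (Suc r)) = 2 * (\<sigma> * 2 powr (- real (Suc r)))"
 "\<sigma> * 2 powr (- real r) = 2 * (\<sigma> * 2 powr (- real (Suc r)))"
 "\<sigma> * 2 powr (1 - real r) = 4 * (\<sigma> * 2 powr (- real (Suc r)))"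
 by (simp_all add: powr_diff powr_minus powr_add field_simps)

context
 fixes k :: "real vec => real vec => real" and \<sigma> \<beta> :: real and N :: nat and \<Psi> :: "nat => nat set"
  and x :: "nat => real vec" and y :: "nat => real" and Z :: "real mat" and f :: "real vec => real" and s :: nat and o' :: nat
 assumes s: "s \<ge> 1"
  and conf: "\<And>r i. r \<in> {1..s} ==> i < N ==> \<bar>f (arm Z i) - post_mean k \<sigma> (\<Psi> r) x y (arm Z i)\<bar> \<le> width k \<sigma> \<beta> (\<Psi> r) x (arm Z i)"
  and narrow: "\<And>r i. r \<in> {1..<s} ==> i \<in> active k \<sigma> \<beta> N \<Psi> x y Z r ==> width k \<sigma> \<beta> (\<Psi> r) x (arm Z i) \<le> \<sigma> * 2 powr (- real r)"
  and opt: "o' < N" "\<And>i. i < N ==> f (arm Z i) \<le> f (arm Z o')"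
begin

lemma ucb_bounds:
 assumes "r \<in> {1..s}" "i < N"
 shows "f (arm Z i) \<le> ucb k \<sigma> \<beta> (\<Psi> r) x y (arm Z i)"
  and "ucb k \<sigma> \<beta> (\<Psi> r) x y (arm Z i) \<le> f (arm Z i) + 2 * width k \<sigma> \<beta> (\<Psi> r) x (arm Z i)"
 using conf[OF assms] unfolding ucb_def width_def by linarith+

text \<open>The elimination threshold is twice the bound on the widths at level \<open>r\<close>,
  and an upper confidence bound exceeds the function value by at most two widths; so a best action
  is never removed.\<close>

lemma optimal_active: "r \<ge> 1 ==> r \<le> s ==> o' \<in> active k \<sigma> \<beta> N \<Psi> x y Z r"
proof (induction r rule: dec_induct)
 case base
 then show ?case using opt(1) by simp
next
 case (step r)
 let ?A = "active k \<sigma> \<beta> N \<Psi> x y Z r" and ?u = "\<lambda>i. ucb k \<sigma> \<beta> (\<Psi> r) x y (arm Z i)"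
 have r: "r \<in> {1..s}" "r \<in> {1..<s}" using step by auto
 have oA: "o' \<in> ?A" using step by simp
 have sub: "?A \<subseteq> {..<N}" by (rule active_subset[OF step(1)])
 have "Max (?u ` ?A) \<in> ?u ` ?A" using oA finite_subset[OF sub] by (intro Max_in) auto
 then obtain j where j: "j \<in> ?A" "Max (?u ` ?A) = ?u j" by auto
 have jN: "j < N" using j sub by auto
 have "?u j \<le> f (arm Z j) + 2 * (\<sigma> * 2 powr (- real r))"
  using ucb_bounds(2)[OF r(1) jN] narrow[OF r(2) j(1)] by linarith
 also have "\<dots> \<le> ?u o' + \<sigma> * 2 powr (1 - real r)"
  using opt(2)[OF jN] ucb_bounds(1)[OF r(1) opt(1)] two_powr_level(2)[of \<sigma> r] two_powr_level(3)[of \<sigma> r] by linarith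
 finally show ?case unfolding active_Suc[OF step(1)] j(2) using oA by simp
qed

text \<open>Surviving level \<open>r = s - 1\<close> costs two widths and the threshold, four times
  \<open>\<sigma> * 2 powr (- r)\<close> in all. Level 1 is excluded because nothing has been
  eliminated before it.\<close>

lemma active_gap:
 assumes i: "i \<in> active k \<sigma> \<beta> N \<Psi> x y Z s" and s2: "s \<ge> 2"
 shows "f (arm Z o') - f (arm Z i) \<le> 8 * (\<sigma> * 2 powr (- real s))"
proof -
 obtain r where sr: "s = Suc r" and r1: "r \<ge> 1" using s2 by (cases s) auto
 let ?A = "active k \<sigma> \<beta> N \<Psi> x y Z r" and ?u = "\<lambda>i. ucb k \<sigma> \<beta> (\<Psi> r) x y (arm Z i)"
 have r: "r \<in> {1..s}" "r \<in> {1..<s}" using r1 sr by auto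
 have sub: "?A \<subseteq> {..<N}" by (rule active_subset[OF r1])
 have iA: "i \<in> ?A" and iu: "?u i \<ge> Max (?u ` ?A) - \<sigma> * 2 powr (1 - real r)" using i unfolding sr active_Suc[OF r1] by auto
 have oA: "o' \<in> ?A" using optimal_active r by auto
 have "?u o' \<le> Max (?u ` ?A)" using oA finite_subset[OF sub] by (intro Max_ge) auto
 then have "f (arm Z o') \<le> ?u i + \<sigma> * 2 powr (1 - real r)"
  using ucb_bounds(1)[OF r(1) opt(1)] iu by linarith
 also have "\<dots> \<le> f (arm Z i) + 2 * (\<sigma> * 2 powr (- real r)) + \<sigma> * 2 powr (1 - real r)"
  using ucb_bounds(2)[OF r(1) subsetD[OF sub iA, unfolded lessThan_iff]] narrow[OF r(2) iA] by linarith
 finally show ?thesis using two_powr_level(2)[of \<sigma> r] two_powr_level(3)[of \<sigma> r] unfolding sr by linarith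
qed

lemma settled_gap:
 assumes "is_arg_max (\<lambda>i. ucb k \<sigma> \<beta> (\<Psi> s) x y (arm Z i)) (\<lambda>i. i \<in> active k \<sigma> \<beta> N \<Psi> x y Z s) i"
  and w: "\<forall>i\<in>active k \<sigma> \<beta> N \<Psi> x y Z s. width k \<sigma> \<beta> (\<Psi> s) x (arm Z i) \<le> e"
 shows "f (arm Z o') - f (arm Z i) \<le> 2 * e"
proof -
 have sr: "s \<in> {1..s}" using s by simp
 have i: "i \<in> active k \<sigma> \<beta> N \<Psi> x y Z s" and
  "ucb k \<sigma> \<beta> (\<Psi> s) x y (arm Z o') \<le> ucb k \<sigma> \<beta> (\<Psi> s) x y (arm Z i)"
  using assms(1) optimal_active[OF s] unfolding is_arg_max_linorder by auto
 moreover have "width k \<sigma> \<beta> (\<Psi> s) x (arm Z i) \<le> e" using w i by blast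
 moreover have "i < N" using i active_subset[OF s, of k \<sigma> \<beta> N \<Psi> x y Z] by auto
 ultimately show ?thesis using ucb_bounds(1)[OF sr opt(1)] ucb_bounds(2)[OF sr, of i] by linarith
qed

end

text \<open>The regret of a recorded round is compared with its own width, so that it can be paid
  for by the sum of the widths of its level. At level 1 no gap is known, and only the lower bound on
  the width is kept.\<close>

lemma sup_round_good:
 assumes run: "sup_round k \<sigma> \<beta> N T z pick a y \<Psi> t s" and s: "s \<ge> 1" and N: "N \<ge> 1"
  and pick: "\<And>E. E \<noteq> {} ==> E \<subseteq> {..<N} ==> pick t E \<in> E"
  and conf: "\<And>r i. r \<in> {1..s} ==> i < N ==> \<bar>f (arm (z t) i) - post_mean k \<sigma> (\<Psi> t r) (played z a) y (arm (z t) i)\<bar> \<le> width k \<sigma> \<beta> (\<Psi> t r) (played z a) (arm (z t) i)"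
 defines "reg \<equiv> Max ((\<lambda>i. f (arm (z t) i)) ` {..<N}) - f (played z a t)"
 shows "reg \<le> 2 * (\<sigma> / sqrt (real T)) \<or>
  t \<in> \<Psi> (Suc t) s \<and> \<sigma> * 2 powr (- real s) < width k \<sigma> \<beta> (\<Psi> t s) (played z a) (played z a t) \<and>
  (s \<ge> 2 \<longrightarrow> reg \<le> 8 * width k \<sigma> \<beta> (\<Psi> t s) (played z a) (played z a t))"
proof -
 have "Max ((\<lambda>i. f (arm (z t) i)) ` {..<N}) \<in> (\<lambda>i. f (arm (z t) i)) ` {..<N}"
  using N by (intro Max_in) (auto simp: lessThan_empty_iff)
 then obtain j where j: "j < N" "Max ((\<lambda>i. f (arm (z t) i)) ` {..<N}) = f (arm (z t) j)" by auto
 have opt: "f (arm (z t) i) \<le> f (arm (z t) j)" if "i < N" for i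
  unfolding j(2)[symmetric] using that by (intro Max_ge) auto
 let ?A = "active k \<sigma> \<beta> N (\<Psi> t) (played z a) y (z t)"
 let ?w = "\<lambda>r i. width k \<sigma> \<beta> (\<Psi> t r) (played z a) (arm (z t) i)"
 have narrow: "?w r i \<le> \<sigma> * 2 powr (- real r)" if "r \<in> {1..<s}" "i \<in> ?A r" for r i
  using run that unfolding sup_round_def Let_def by blast
 note ctx = s conf narrow j(1) opt
 consider (settled) "\<forall>i\<in>?A s. ?w s i \<le> \<sigma> / sqrt (real T)" "is_arg_max (\<lambda>i. ucb k \<sigma> \<beta> (\<Psi> t s) (played z a) y (arm (z t) i)) (\<lambda>i. i \<in> ?A s) (a t)"
  | (pick) "\<not> (\<forall>i\<in>?A s. ?w s i \<le> \<sigma> * 2 powr (- real s))" "a t = pick t {i \<in> ?A s. ?w s i > \<sigma> * 2 powr (- real s)}" "\<Psi> (Suc t) = (\<Psi> t)(s := insert t (\<Psi> t s))"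
  using run unfolding sup_round_def Let_def by blast
 then show ?thesis
 proof cases
  case settled
  have "f (arm (z t) j) - f (arm (z t) (a t)) \<le> 2 * (\<sigma> / sqrt (real T))"
   by (rule settled_gap[of s N f "z t" k \<sigma> "\<Psi> t" "played z a" y \<beta>]) (use ctx settled in blast)+
  then show ?thesis unfolding reg_def j(2) played_def by simp
 next
  case pick
  let ?E = "{i \<in> ?A s. ?w s i > \<sigma> * 2 powr (- real s)}"
  have "?E \<noteq> {}" using pick(1) by (auto simp: not_le)
  moreover have "?E \<subseteq> {..<N}" using active_subset[OF s] by blast
  ultimately have aE: "a t \<in> ?E" unfolding pick(2) by (rule assms(4))
  have gap: "f (arm (z t) j) - f (arm (z t) (a t)) \<le> 8 * (\<sigma> * 2 powr (- real s))" if "s \<ge> 2"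
   by (rule active_gap[of s N f "z t" k \<sigma> "\<Psi> t" "played z a" y \<beta>]) (use ctx aE that in blast)+
  have "t \<in> \<Psi> (Suc t) s" unfolding pick(3) by simp
  moreover have w: "\<sigma> * 2 powr (- real s) < ?w s (a t)" using aE by blast
  moreover have "f (arm (z t) j) - f (arm (z t) (a t)) \<le> 8 * ?w s (a t)" if "s \<ge> 2" using gap[OF that] w by linarith
  ultimately show ?thesis unfolding reg_def j(2) by (simp add: played_def)
 qed
qed

text \<open>Index sets only grow, and round \<open>v\<close> adds nothing but \<open>v\<close>. So
  each earlier set is an initial part of the final one, which is the form in which variances are
  summed.\<close>

lemma sup_sets_prefix:
 assumes \<Psi>1: "\<Psi> 1 = (\<lambda>_. {})" and run: "\<And>t. t \<in> {1..T} ==> \<exists>s. sup_round k \<sigma> \<beta> N T z pick a y \<Psi> t s"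
 shows "v \<ge> 1 ==> v \<le> Suc T ==> \<Psi> v r \<subseteq> {1..<v} \<and> (\<forall>u\<in>{1..v}. \<Psi> u r = {i\<in>\<Psi> v r. i < u})"
proof (induction v rule: dec_induct)
 case base
 then show ?case using \<Psi>1 by simp
next
 case (step v)
 have vT: "v \<le> Suc T" "v \<in> {1..T}" using step(1,2,4) by auto
 note IH' = step.IH[OF vT(1)]
 note IH = conjunct1[OF IH'] bspec[OF conjunct2[OF IH']]
 obtain s where "sup_round k \<sigma> \<beta> N T z pick a y \<Psi> v s" using run[OF vT(2)] by (elim exE)
 then have "\<Psi> (Suc v) = \<Psi> v \<or> \<Psi> (Suc v) = (\<Psi> v)(s := insert v (\<Psi> v s))"
  unfolding sup_round_def Let_def by (elim conjE disjE) (simp_all only: simp_thms)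
 then have cases: "\<Psi> (Suc v) r = \<Psi> v r \<or> \<Psi> (Suc v) r = insert v (\<Psi> v r)" by (cases "r = s") auto
 have sub: "\<Psi> (Suc v) r \<subseteq> {1..<Suc v}" using cases
 proof
  assume "\<Psi> (Suc v) r = \<Psi> v r"
  then show ?thesis using IH(1) step(1) by (simp only:) auto
 next
  assume "\<Psi> (Suc v) r = insert v (\<Psi> v r)"
  then show ?thesis using IH(1) step(1) by (simp only:) auto
 qed
 have "\<Psi> u r = {i\<in>\<Psi> (Suc v) r. i < u}" if u: "u \<in> {1..Suc v}" for u
 proof (cases "u = Suc v")
  case True
  then show ?thesis using sub by auto
 next
  case False
  then have uv: "u \<in> {1..v}" using u by auto
  have "{i\<in>\<Psi> (Suc v) r. i < u} = {i\<in>\<Psi> v r. i < u}" using cases uv by auto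
  then show ?thesis using IH(2)[OF uv] by (rule trans[OF _ sym, rotated])
 qed
 then show ?case using sub by (intro conjI ballI)
qed

text \<open>A deterministic bound. Settled rounds add up to at most
  \<open>2 * \<sigma> * sqrt T\<close>, rounds in \<open>Bad\<close> are charged the trivial
  \<open>2 * G\<close>, and recorded rounds are paid for by their widths. At level 1 a recorded
  round has only the trivial bound too, but its width exceeds \<open>\<sigma> / 2\<close>; this
  explains the summand \<open>4 * G / \<sigma>\<close>.\<close>

lemma sup_regret_le:
 assumes \<Psi>1: "\<Psi> 1 = (\<lambda>_. {})" and run: "\<And>t. t \<in> {1..T} ==> \<exists>s\<in>{1..S}. sup_round k \<sigma> \<beta> N T z pick a y \<Psi> t s"
  and N: "N \<ge> 1" and \<sigma>: "\<sigma> > 0" and T: "T \<ge> 1" and k: "psd_kernel X k" and \<beta>: "\<beta> \<ge> 0"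
  and arms: "\<And>t i. t \<ge> 1 ==> i < N ==> arm (z t) i \<in> X" and a: "\<And>t. t \<in> {1..T} ==> a t < N"
  and pick: "\<And>t E. E \<noteq> {} ==> E \<subseteq> {..<N} ==> pick t E \<in> E"
  and G: "\<And>v. v \<in> X ==> \<bar>f v\<bar> \<le> G"
  and conf: "\<And>t r i. t \<in> {1..T} ==> t \<notin> Bad ==> r \<in> {1..S} ==> i < N ==>
   \<bar>f (arm (z t) i) - post_mean k \<sigma> (\<Psi> t r) (played z a) y (arm (z t) i)\<bar> \<le> width k \<sigma> \<beta> (\<Psi> t r) (played z a) (arm (z t) i)"
  and Bad: "Bad \<subseteq> {1..T}"
 shows "regret f N z a T \<le> 2 * \<sigma> * sqrt (real T) + (8 + 4 * G / \<sigma>) * (\<Sum>s=1..S. \<Sum>t\<in>\<Psi> (Suc T) s. width k \<sigma> \<beta> {i\<in>\<Psi> (Suc T) s. i < t} (played z a) (played z a t)) + real (card Bad) * (2 * G)"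
proof -
 have run': "\<exists>s. sup_round k \<sigma> \<beta> N T z pick a y \<Psi> t s" if "t \<in> {1..T}" for t using run[OF that] by blast
 have sets: "\<Psi> (Suc T) r \<subseteq> {1..T}" "\<And>u. u \<in> {1..Suc T} ==> \<Psi> u r = {i\<in>\<Psi> (Suc T) r. i < u}" for r
 proof -
  note p = sup_sets_prefix[OF \<Psi>1 run', of "Suc T" r, simplified]
  show "\<Psi> (Suc T) r \<subseteq> {1..T}" using conjunct1[OF p] by (auto simp: less_Suc_eq_le)
  show "\<Psi> u r = {i\<in>\<Psi> (Suc T) r. i < u}" if "u \<in> {1..Suc T}" for u using bspec[OF conjunct2[OF p], of u] that by (simp only: One_nat_def)
 qed
 let ?w = "\<lambda>s t. width k \<sigma> \<beta> {i\<in>\<Psi> (Suc T) s. i < t} (played z a) (played z a t)"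
 have xX: "played z a t \<in> X" if "t \<in> {1..T}" for t unfolding played_def using that a by (intro arms) auto
 have G0: "0 \<le> G" using G[OF xX[of 1]] T by fastforce
 have w0: "0 \<le> ?w s t" if "t \<in> {1..T}" for s t
  unfolding width_def using sets[of s] that xX \<beta> by (intro mult_nonneg_nonneg post_sd_nonneg[OF k \<sigma>]) (auto intro: finite_subset)
 let ?reg = "\<lambda>t. Max ((\<lambda>i. f (arm (z t) i)) ` {..<N}) - f (played z a t)"
 let ?c = "8 + 4 * G / \<sigma>"
 have c0: "0 \<le> ?c" using G0 \<sigma> by simp
 have round: "?reg t \<le> 2 * (\<sigma> / sqrt (real T)) + ?c * (\<Sum>s=1..S. if t \<in> \<Psi> (Suc T) s then ?w s t else 0) + (if t \<in> Bad then 2 * G else 0)"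
  if t: "t \<in> {1..T}" for t
 proof -
  have triv: "?reg t \<le> 2 * G"
  proof -
   have "Max ((\<lambda>i. f (arm (z t) i)) ` {..<N}) \<in> (\<lambda>i. f (arm (z t) i)) ` {..<N}"
    using N by (intro Max_in) (auto simp: lessThan_empty_iff)
   then obtain j where j: "j < N" "Max ((\<lambda>i. f (arm (z t) i)) ` {..<N}) = f (arm (z t) j)" by auto
   have "arm (z t) j \<in> X" using t j by (intro arms) auto
   then show ?thesis unfolding j(2) using G[OF xX[OF t]] G[of "arm (z t) j"] by linarith
  qed
  have s0: "0 \<le> \<sigma> / sqrt (real T)" using \<sigma> by simp
  have sum0: "0 \<le> (\<Sum>s=1..S. if t \<in> \<Psi> (Suc T) s then ?w s t else 0)" using w0[OF t] by (intro sum_nonneg) auto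
  show ?thesis
  proof (cases "t \<in> Bad")
   case True
   then show ?thesis using triv s0 mult_nonneg_nonneg[OF c0 sum0] by simp
  next
   case False
   obtain s where s: "s \<in> {1..S}" and rd: "sup_round k \<sigma> \<beta> N T z pick a y \<Psi> t s" using run[OF t] by blast
   have s1: "s \<ge> 1" using s by simp
   have pt: "\<Psi> t s = {i\<in>\<Psi> (Suc T) s. i < t}" using sets(2)[of t s] t by simp
   have cf: "\<bar>f (arm (z t) i) - post_mean k \<sigma> (\<Psi> t r) (played z a) y (arm (z t) i)\<bar> \<le> width k \<sigma> \<beta> (\<Psi> t r) (played z a) (arm (z t) i)"
    if "r \<in> {1..s}" "i < N" for r i using conf[OF t False _ that(2), of r] that(1) s by auto
   from sup_round_good[OF rd s1 N pick cf]
   consider (settled) "?reg t \<le> 2 * (\<sigma> / sqrt (real T))"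
    | (pick) "t \<in> \<Psi> (Suc t) s" "\<sigma> * 2 powr (- real s) < ?w s t" "s \<ge> 2 \<longrightarrow> ?reg t \<le> 8 * ?w s t"
    unfolding pt by blast
   then show ?thesis
   proof cases
    case settled
    then show ?thesis using mult_nonneg_nonneg[OF c0 sum0] False by simp
   next
    case pick
    have w: "0 \<le> ?w s t" by (rule w0[OF t])
    have reg: "?reg t \<le> ?c * ?w s t"
    proof (cases "s \<ge> 2")
     case True
     have "0 \<le> 4 * G / \<sigma> * ?w s t" using G0 \<sigma> w by (intro mult_nonneg_nonneg) auto
     then show ?thesis using pick(3) True by (simp add: distrib_right)
    next
     case False
     then have "s = 1" using s by simp
     then have half: "\<sigma> / 2 \<le> ?w s t" using pick(2) by (simp add: powr_minus field_simps)
     have "2 * G = 4 * G / \<sigma> * (\<sigma> / 2)" using \<sigma> by simp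
     also have "\<dots> \<le> 4 * G / \<sigma> * ?w s t" using half G0 \<sigma> by (intro mult_left_mono) auto
     also have "\<dots> \<le> ?c * ?w s t" using w by (intro mult_right_mono) auto
     finally show ?thesis using triv by linarith
    qed
    have "t \<in> \<Psi> (Suc T) s" using pick(1) sets(2)[of "Suc t" s] t by auto
    then have "?w s t \<le> (\<Sum>s=1..S. if t \<in> \<Psi> (Suc T) s then ?w s t else 0)"
     using member_le_sum[of s "{1..S}" "\<lambda>s. if t \<in> \<Psi> (Suc T) s then ?w s t else 0"] s w0[OF t] by simp
    from mult_left_mono[OF this c0] reg show ?thesis using s0 False by simp
   qed
  qed
 qed
 have "regret f N z a T \<le> (\<Sum>t=1..T. 2 * (\<sigma> / sqrt (real T)) + ?c * (\<Sum>s=1..S. if t \<in> \<Psi> (Suc T) s then ?w s t else 0) + (if t \<in> Bad then 2 * G else 0))"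
  unfolding regret_def by (rule sum_mono) (rule round)
 also have "\<dots> = (\<Sum>t=1..T. 2 * (\<sigma> / sqrt (real T))) + ?c * (\<Sum>t=1..T. \<Sum>s=1..S. if t \<in> \<Psi> (Suc T) s then ?w s t else 0) + (\<Sum>t=1..T. if t \<in> Bad then 2 * G else 0)"
  by (simp only: sum.distrib sum_distrib_left[symmetric])
 also have "(\<Sum>t=1..T. 2 * (\<sigma> / sqrt (real T))) = 2 * \<sigma> * sqrt (real T)"
  using T by (simp add: real_div_sqrt field_simps)
 also have "(\<Sum>t=1..T. \<Sum>s=1..S. if t \<in> \<Psi> (Suc T) s then ?w s t else 0) = (\<Sum>s=1..S. \<Sum>t=1..T. if t \<in> \<Psi> (Suc T) s then ?w s t else 0)"
  by (rule sum.swap)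
 also have "\<dots> = (\<Sum>s=1..S. \<Sum>t\<in>\<Psi> (Suc T) s. ?w s t)"
  using sets(1) by (intro sum.cong refl sum.mono_neutral_cong_right) auto
 also have "(\<Sum>t=1..T. if t \<in> Bad then 2 * G else 0) = real (card Bad) * (2 * G)"
 proof -
  have "(\<Sum>t=1..T. if t \<in> Bad then 2 * G else 0) = (\<Sum>t\<in>Bad. 2 * G)"
   using Bad by (intro sum.mono_neutral_cong_right) auto
  then show ?thesis by simp
 qed
 finally show ?thesis .
qed

section \<open>Simulating the elimination algorithm\<close>

text \<open>Linearity in the rewards holds for every index set, whether or not the matrix is
  invertible; the measurability of the simulated run rests on it.\<close>

lemma post_mean_linear:
 "\<exists>c. \<forall>y. post_mean k \<sigma> \<Psi> x y x' = (\<Sum>j<card \<Psi>. c j * y (sorted_list_of_set \<Psi> ! j))"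
proof -
 let ?K = "kernel_inv k \<sigma> \<Psi> x" and ?c = "kernel_col k \<Psi> x x'"
 have "post_mean k \<sigma> \<Psi> x y x' = (\<Sum>j<card \<Psi>. (\<Sum>i<dim_row ?K. vec_index ?c i * vec_index (row ?K i) j) * y (sorted_list_of_set \<Psi> ! j))" for y
 proof -
  have "post_mean k \<sigma> \<Psi> x y x' = (\<Sum>i<dim_row ?K. vec_index ?c i * (\<Sum>j<card \<Psi>. vec_index (row ?K i) j * y (sorted_list_of_set \<Psi> ! j)))"
   unfolding post_mean_def scalar_prod_def by (simp add: lessThan_atLeast0 scalar_prod_def)
  also have "\<dots> = (\<Sum>i<dim_row ?K. \<Sum>j<card \<Psi>. vec_index ?c i * vec_index (row ?K i) j * y (sorted_list_of_set \<Psi> ! j))"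
   by (simp only: sum_distrib_left mult.assoc)
  also have "\<dots> = (\<Sum>j<card \<Psi>. \<Sum>i<dim_row ?K. vec_index ?c i * vec_index (row ?K i) j * y (sorted_list_of_set \<Psi> ! j))"
   by (rule sum.swap)
  finally show ?thesis by (simp only: sum_distrib_right)
 qed
 then show ?thesis by (intro exI allI)
qed

lemma ucb_measurable:
 assumes "finite \<Psi>" "\<And>j. j \<in> \<Psi> ==> (\<lambda>v. y v j) \<in> borel_measurable \<N>"
 shows "(\<lambda>v. ucb k \<sigma> \<beta> \<Psi> x (y v) x') \<in> borel_measurable \<N>"
proof -
 obtain c where c': "\<forall>y. post_mean k \<sigma> \<Psi> x y x' = (\<Sum>j<card \<Psi>. c j * y (sorted_list_of_set \<Psi> ! j))"
  using post_mean_linear[of k \<sigma> \<Psi> x x'] by (elim exE)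
 note c = spec[OF c']
 have "sorted_list_of_set \<Psi> ! j \<in> \<Psi>" if "j < card \<Psi>" for j
  using that assms(1) nth_mem[of j "sorted_list_of_set \<Psi>"] by simp
 then show ?thesis unfolding ucb_def c
  by (intro borel_measurable_add borel_measurable_sum borel_measurable_times borel_measurable_const assms(2)) auto
qed

text \<open>Active sets take finitely many values. Each elimination is split by the value of the
  previous set, after which the maximum runs over a fixed set of actions.\<close>

lemma active_measurable:
 assumes \<Psi>: "\<And>r. finite (\<Psi> r)" and y: "\<And>r j. j \<in> \<Psi> r ==> (\<lambda>v. y v j) \<in> borel_measurable \<N>" and r: "r \<ge> 1"
 shows "{v \<in> space \<N>. active k \<sigma> \<beta> N \<Psi> x (y v) Z r = A} \<in> sets \<N>"
 using r
proof (induction r arbitrary: A rule: dec_induct)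
 case base
 show ?case by simp
next
 case (step r)
 let ?act = "\<lambda>v. active k \<sigma> \<beta> N \<Psi> x (y v) Z r"
 let ?u = "\<lambda>v i. ucb k \<sigma> \<beta> (\<Psi> r) x (y v) (arm Z i)"
 have um: "(\<lambda>v. ?u v i) \<in> borel_measurable \<N>" for i by (rule ucb_measurable[OF \<Psi> y])
 let ?F = "\<lambda>v A'. {i \<in> A'. ?u v i \<ge> Max (?u v ` A') - \<sigma> * 2 powr (1 - real r)}"
 have F: "{v \<in> space \<N>. ?F v A' = A} \<in> sets \<N>" if A': "A' \<subseteq> {..<N}" for A'
 proof (cases "A' = {}")
  case False
  have fin: "finite A'" using A' finite_subset by blast
  have "(\<lambda>v. Max ((\<lambda>i. ?u v i) ` A')) \<in> borel_measurable \<N>"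
   by (rule borel_measurable_Max) (use fin um in auto)
  then have m: "{v \<in> space \<N>. Max (?u v ` A') - \<sigma> * 2 powr (1 - real r) \<le> ?u v i} \<in> sets \<N>" for i
   by (intro borel_measurable_le borel_measurable_diff borel_measurable_const um)
  have m2: "{v \<in> space \<N>. (Max (?u v ` A') - \<sigma> * 2 powr (1 - real r) \<le> ?u v i) \<longleftrightarrow> i \<in> A} \<in> sets \<N>" for i
   using m[of i] sets.sets_Collect_neg[OF m[of i]] by (cases "i \<in> A") (simp_all only: simp_thms)
  have "{v \<in> space \<N>. ?F v A' = A} = {v \<in> space \<N>. A \<subseteq> A' \<and> (\<forall>i\<in>A'. (Max (?u v ` A') - \<sigma> * 2 powr (1 - real r) \<le> ?u v i) \<longleftrightarrow> i \<in> A)}"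
   by blast
  also have "\<dots> \<in> sets \<N>"
   by (intro sets.sets_Collect_conj sets.sets_Collect_const sets.sets_Collect_finite_All fin m2)
  finally show ?thesis .
 qed simp
 have "{v \<in> space \<N>. active k \<sigma> \<beta> N \<Psi> x (y v) Z (Suc r) = A} =
  (\<Union>A'\<in>Pow {..<N}. {v \<in> space \<N>. ?act v = A'} \<inter> {v \<in> space \<N>. ?F v A' = A})"
 proof (rule equalityI; rule subsetI)
  fix v assume "v \<in> {v \<in> space \<N>. active k \<sigma> \<beta> N \<Psi> x (y v) Z (Suc r) = A}"
  then show "v \<in> (\<Union>A'\<in>Pow {..<N}. {v \<in> space \<N>. ?act v = A'} \<inter> {v \<in> space \<N>. ?F v A' = A})"
   using active_subset[OF step(1), of k \<sigma> \<beta> N \<Psi> x "y v" Z] unfolding active_Suc[OF step(1)]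
   by (intro UN_I[of "?act v"]) simp_all
 next
  fix v assume "v \<in> (\<Union>A'\<in>Pow {..<N}. {v \<in> space \<N>. ?act v = A'} \<inter> {v \<in> space \<N>. ?F v A' = A})"
  then show "v \<in> {v \<in> space \<N>. active k \<sigma> \<beta> N \<Psi> x (y v) Z (Suc r) = A}"
   unfolding active_Suc[OF step(1)] by (elim UN_E) simp
 qed
 also have "\<dots> \<in> sets \<N>" by (intro sets.finite_UN sets.Int step.IH F) auto
 finally show ?case .
qed

lemma active_cong:
 assumes "\<And>r'. r' \<in> {1..<r} ==> \<Psi> r' = \<Psi>2 r'" "\<And>r'. r' \<in> {1..<r} ==> finite (\<Psi>2 r')"
  "\<And>r' j. r' \<in> {1..<r} ==> j \<in> \<Psi>2 r' ==> x j = x2 j" "\<And>r' j. r' \<in> {1..<r} ==> j \<in> \<Psi>2 r' ==> y j = y2 j" and r: "r \<ge> 1"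
 shows "active k \<sigma> \<beta> N \<Psi> x y Z r = active k \<sigma> \<beta> N \<Psi>2 x2 y2 Z r"
 using r assms(1-4)
proof (induction r rule: dec_induct)
 case (step r)
 have r: "r \<in> {1..<Suc r}" using step(1) by simp
 have e: "\<Psi> r = \<Psi>2 r" "finite (\<Psi>2 r)" "\<And>j. j \<in> \<Psi>2 r ==> x j = x2 j" "\<And>j. j \<in> \<Psi>2 r ==> y j = y2 j"
  using step.prems r by blast+
 have u: "ucb k \<sigma> \<beta> (\<Psi> r) x y (arm Z i) = ucb k \<sigma> \<beta> (\<Psi>2 r) x2 y2 (arm Z i)" for i
  unfolding ucb_def e(1) using post_mean_cong[OF e(2), of x x2 y y2 k \<sigma> "arm Z i"] e(3,4) by simp
 have sub: "r' \<in> {1..<Suc r}" if "r' \<in> {1..<r}" for r' using that by auto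
 have IH: "active k \<sigma> \<beta> N \<Psi> x y Z r = active k \<sigma> \<beta> N \<Psi>2 x2 y2 Z r"
  by (rule step.IH) (use step.prems sub in blast)+
 show ?case unfolding active_Suc[OF step(1)] u IH ..
qed simp

text \<open>
 A run of the algorithm that looks at the levels up to R only. Unlike the actual run it determines
 the actions, because those of settled rounds are not recorded; they are not used either, as such
 rounds enter no index set.
\<close>

locale sup_sim =
 fixes k :: "real vec => real vec => real" and \<sigma> \<beta> :: real and N T :: nat and z :: "nat => real mat" and f :: "real vec => real"
begin

definition acts where "acts \<Psi> \<alpha> e t r = active k \<sigma> \<beta> N \<Psi> (played z \<alpha>) (reward f z \<alpha> e) (z t) r"

definition wid where "wid \<Psi> \<alpha> t r i = width k \<sigma> \<beta> (\<Psi> r) (played z \<alpha>) (arm (z t) i)"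

definition settled where "settled \<Psi> \<alpha> t r A \<longleftrightarrow> (\<forall>i\<in>A. wid \<Psi> \<alpha> t r i \<le> \<sigma> / sqrt (real T))"

definition stops where
 "stops \<Psi> \<alpha> t r A \<longleftrightarrow> settled \<Psi> \<alpha> t r A \<or> \<not> (\<forall>i\<in>A. wid \<Psi> \<alpha> t r i \<le> \<sigma> * 2 powr (- real r))"

definition upd where
 "upd \<Psi> \<alpha> t s A p = (if settled \<Psi> \<alpha> t s A then (\<Psi>, \<alpha>)
  else (\<Psi>(s := insert t (\<Psi> s)), \<alpha>(t := p t {i \<in> A. wid \<Psi> \<alpha> t s i > \<sigma> * 2 powr (- real s)})))"

text \<open>The active sets are an argument, so that measurability can be shown for fixed sets
  first. A round that stops at no level up to \<open>R\<close> changes nothing, since what it does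
  later concerns higher levels.\<close>

definition decide where
 "decide R \<Psi> \<alpha> t As p = (if \<exists>s. s \<in> {1..R} \<and> stops \<Psi> \<alpha> t s (As s)
  then upd \<Psi> \<alpha> t (LEAST s. s \<in> {1..R} \<and> stops \<Psi> \<alpha> t s (As s)) (As (LEAST s. s \<in> {1..R} \<and> stops \<Psi> \<alpha> t s (As s))) p
  else (\<Psi>, \<alpha>))"

text \<open>\<open>sim R p e t\<close> is the state before round \<open>t\<close>, so 0 and 1 both
  give the initial state. Rounds that are not recorded keep the default action 0.\<close>

fun sim :: "nat => (nat => nat set => nat) => (nat => real) => nat => (nat => nat set) \<times> (nat => nat)" where
 "sim R p e 0 = (\<lambda>_. {}, \<lambda>_. 0)"
| "sim R p e (Suc t) = (if t = 0 then (\<lambda>_. {}, \<lambda>_. 0)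
  else decide R (fst (sim R p e t)) (snd (sim R p e t)) t (acts (fst (sim R p e t)) (snd (sim R p e t)) e t) p)"

lemma decide_cases:
 assumes "\<And>D. D = (\<Psi>, \<alpha>) ==> decide R \<Psi> \<alpha> t As p = D ==> P D"
  and "\<And>s D. s \<in> {1..R} ==> stops \<Psi> \<alpha> t s (As s) ==> \<not> settled \<Psi> \<alpha> t s (As s) ==>
   D = (\<Psi>(s := insert t (\<Psi> s)), \<alpha>(t := p t {i \<in> As s. wid \<Psi> \<alpha> t s i > \<sigma> * 2 powr (- real s)})) ==> decide R \<Psi> \<alpha> t As p = D ==> P D"
 shows "P (decide R \<Psi> \<alpha> t As p)"
proof (cases "\<exists>s. s \<in> {1..R} \<and> stops \<Psi> \<alpha> t s (As s)")
 case True
 let ?s = "LEAST s. s \<in> {1..R} \<and> stops \<Psi> \<alpha> t s (As s)"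
 have s: "?s \<in> {1..R} \<and> stops \<Psi> \<alpha> t ?s (As ?s)" using True by (rule LeastI_ex)
 have d: "decide R \<Psi> \<alpha> t As p = upd \<Psi> \<alpha> t ?s (As ?s) p" unfolding decide_def using True by (rule if_P)
 show ?thesis
 proof (cases "settled \<Psi> \<alpha> t ?s (As ?s)")
  case True
  then have "decide R \<Psi> \<alpha> t As p = (\<Psi>, \<alpha>)" unfolding d upd_def by simp
  then show ?thesis by (rule assms(1)) (rule refl)
 next
  case False
  then show ?thesis using d s unfolding upd_def by (intro assms(2)[of ?s]) simp_all
 qed
next
 case False
 then have "decide R \<Psi> \<alpha> t As p = (\<Psi>, \<alpha>)" unfolding decide_def by (rule if_not_P)
 then show ?thesis by (rule assms(1)) (rule refl)
qed

lemma decide_cong: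
 assumes "\<And>r. r \<in> {1..R} ==> As r = Bs r"
 shows "decide R \<Psi> \<alpha> t As p = decide R \<Psi> \<alpha> t Bs p"
proof (cases "\<exists>s. s \<in> {1..R} \<and> stops \<Psi> \<alpha> t s (As s)")
 case True
 have e: "(s \<in> {1..R} \<and> stops \<Psi> \<alpha> t s (As s)) = (s \<in> {1..R} \<and> stops \<Psi> \<alpha> t s (Bs s))" for s
  using assms[of s] by auto
 have "As (LEAST s. s \<in> {1..R} \<and> stops \<Psi> \<alpha> t s (As s)) = Bs (LEAST s. s \<in> {1..R} \<and> stops \<Psi> \<alpha> t s (As s))"
  using LeastI_ex[OF True] by (intro assms) blast
 then show ?thesis unfolding decide_def e by (simp only:)
next
 case False
 then have no: "\<not> (\<exists>s. s \<in> {1..R} \<and> stops \<Psi> \<alpha> t s (Bs s))" using assms by auto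
 show ?thesis unfolding decide_def if_not_P[OF False] if_not_P[OF no] ..
qed

text \<open>Default values outside the levels up to \<open>R\<close> and the rounds before
  \<open>t\<close> make this set finite, so that probabilities can be summed over it.\<close>

definition states :: "nat => nat => ((nat => nat set) \<times> (nat => nat)) set" where
 "states R t = {\<Psi>. \<forall>r. (r \<in> {1..R} \<longrightarrow> \<Psi> r \<in> Pow {1..<t}) \<and> (r \<notin> {1..R} \<longrightarrow> \<Psi> r = {})} \<times>
  {\<alpha>. \<forall>j. (j \<in> {1..<t} \<longrightarrow> \<alpha> j \<in> {..<N}) \<and> (j \<notin> {1..<t} \<longrightarrow> \<alpha> j = 0)}"

lemma finite_states: "finite (states R t)"
 unfolding states_def by (intro finite_cartesian_product finite_set_of_finite_funs) auto

lemma sim_states: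
 assumes N: "N \<ge> 1" and p: "\<And>t E. E \<noteq> {} ==> E \<subseteq> {..<N} ==> p t E \<in> E"
 shows "sim R p e t \<in> states R t"
proof (induction t)
 case 0
 show ?case by (simp add: states_def)
next
 case (Suc t)
 show ?case
 proof (cases "t = 0")
  case True
  then show ?thesis by (auto simp: states_def)
 next
  case False
  obtain \<Psi> \<alpha> where D: "sim R p e t = (\<Psi>, \<alpha>)" by (cases "sim R p e t")
  have IH: "\<And>r. r \<in> {1..R} ==> \<Psi> r \<subseteq> {1..<t}" "\<And>r. r \<notin> {1..R} ==> \<Psi> r = {}"
   "\<And>j. j \<in> {1..<t} ==> \<alpha> j < N" "\<And>j. j \<notin> {1..<t} ==> \<alpha> j = 0"
   using Suc unfolding D states_def by simp_all
  have mono: "{1..<Suc t} = insert t {1..<t}" using False by auto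
  have "decide R \<Psi> \<alpha> t (acts \<Psi> \<alpha> e t) p \<in> states R (Suc t)"
  proof (rule decide_cases)
   fix D assume "D = (\<Psi>, \<alpha>)"
   then show "D \<in> states R (Suc t)" unfolding states_def mono using IH N by auto
  next
   fix s D
   let ?E = "{i \<in> acts \<Psi> \<alpha> e t s. wid \<Psi> \<alpha> t s i > \<sigma> * 2 powr (- real s)}"
   assume s: "s \<in> {1..R}" "stops \<Psi> \<alpha> t s (acts \<Psi> \<alpha> e t s)" "\<not> settled \<Psi> \<alpha> t s (acts \<Psi> \<alpha> e t s)"
    and D: "D = (\<Psi>(s := insert t (\<Psi> s)), \<alpha>(t := p t ?E))"
   have "?E \<noteq> {}" using s(2,3) unfolding stops_def by (auto simp: not_le)
   moreover have "?E \<subseteq> {..<N}" using s(1) active_subset[of s k \<sigma> \<beta> N \<Psi> "played z \<alpha>" "reward f z \<alpha> e" "z t"] by (auto simp: acts_def)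
   ultimately have "p t ?E < N" using p[of ?E t] by blast
   then show "D \<in> states R (Suc t)" unfolding states_def mono D using IH s(1) by auto
  qed
  then show ?thesis using False D by simp
 qed
qed

lemma sim_disjoint:
 "(\<forall>r. fst (sim R p e t) r \<subseteq> {1..<t}) \<and> (\<forall>r r'. r \<noteq> r' \<longrightarrow> fst (sim R p e t) r \<inter> fst (sim R p e t) r' = {})"
proof (induction t)
 case (Suc t)
 show ?case
 proof (cases "t = 0")
  case False
  obtain \<Psi> \<alpha> where D: "sim R p e t = (\<Psi>, \<alpha>)" by (cases "sim R p e t")
  have IH: "\<And>r. \<Psi> r \<subseteq> {1..<t}" "\<And>r r'. r \<noteq> r' ==> \<Psi> r \<inter> \<Psi> r' = {}" using Suc unfolding D by simp_all
  have nt: "t \<notin> \<Psi> r" for r using IH(1)[of r] by auto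
  have mono: "{1..<Suc t} = insert t {1..<t}" using False by auto
  have "(\<forall>r. fst (decide R \<Psi> \<alpha> t (acts \<Psi> \<alpha> e t) p) r \<subseteq> {1..<Suc t}) \<and>
   (\<forall>r r'. r \<noteq> r' \<longrightarrow> fst (decide R \<Psi> \<alpha> t (acts \<Psi> \<alpha> e t) p) r \<inter> fst (decide R \<Psi> \<alpha> t (acts \<Psi> \<alpha> e t) p) r' = {})"
  proof (rule decide_cases)
   fix D assume "D = (\<Psi>, \<alpha>)"
   then show "(\<forall>r. fst D r \<subseteq> {1..<Suc t}) \<and> (\<forall>r r'. r \<noteq> r' \<longrightarrow> fst D r \<inter> fst D r' = {})"
    unfolding mono using IH by (simp add: subset_insertI2)
  next
   fix s D
   assume "D = (\<Psi>(s := insert t (\<Psi> s)), \<alpha>(t := p t {i \<in> acts \<Psi> \<alpha> e t s. wid \<Psi> \<alpha> t s i > \<sigma> * 2 powr (- real s)}))"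
   then have D: "fst D r = (if r = s then insert t (\<Psi> s) else \<Psi> r)" for r by simp
   show "(\<forall>r. fst D r \<subseteq> {1..<Suc t}) \<and> (\<forall>r r'. r \<noteq> r' \<longrightarrow> fst D r \<inter> fst D r' = {})"
    unfolding mono D using IH nt by (auto simp: subset_insertI2 insert_mono)
  qed
  then show ?thesis using False D by simp
 qed simp
qed simp

lemma sim_mono_Suc: "fst (sim R p e t) r \<subseteq> fst (sim R p e (Suc t)) r"
proof (cases "t = 0")
 case False
 obtain \<Psi> \<alpha> where D: "sim R p e t = (\<Psi>, \<alpha>)" by (cases "sim R p e t")
 have "\<Psi> r \<subseteq> fst (decide R \<Psi> \<alpha> t (acts \<Psi> \<alpha> e t) p) r"
  by (rule decide_cases) auto
 then show ?thesis using False D by simp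
qed simp

lemma sim_mono: "u \<le> t ==> fst (sim R p e u) r \<subseteq> fst (sim R p e t) r"
proof (induction t rule: dec_induct)
 case (step t)
 show ?case using step.IH sim_mono_Suc[of R p e t r] by (rule order_trans)
qed simp

text \<open>
 The decisions concerning levels up to R use only the rewards of the levels below R, and the
 index sets of different levels are disjoint.
\<close>

lemma sim_ignores_own_level:
 assumes e: "\<And>j. j \<in> {1..<t} ==> j \<notin> fst (sim R p e t) R ==> e j = e2 j"
 shows "sim R p e2 t = sim R p e t"
proof -
 have "sim R p e2 u = sim R p e u" if "u \<le> t" for u
  using that
 proof (induction u)
  case (Suc u)
  show ?case
  proof (cases "u = 0")
   case False
   obtain \<Psi> \<alpha> where D: "sim R p e u = (\<Psi>, \<alpha>)" by (cases "sim R p e u")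
   have IH: "sim R p e2 u = (\<Psi>, \<alpha>)" using Suc D by simp
   have sub: "\<Psi> r \<subseteq> fst (sim R p e t) r" for r using sim_mono[of u t R p e r] Suc.prems D by simp
   have fin: "finite (\<Psi> r)" for r
    using sim_disjoint[of R p e u] D finite_subset[of "\<Psi> r" "{1..<u}"] by simp
   have ee: "e j = e2 j" if "j \<in> \<Psi> r" "r \<noteq> R" for j r
   proof (rule e)
    have "j \<in> fst (sim R p e t) r" using sub that by blast
    then show "j \<in> {1..<t}" "j \<notin> fst (sim R p e t) R" using sim_disjoint[of R p e t] that(2) by blast+
   qed
   have acts: "acts \<Psi> \<alpha> e2 u r = acts \<Psi> \<alpha> e u r" if "r \<in> {1..R}" for r
    unfolding acts_def by (rule active_cong) (use that fin ee in \<open>auto simp: reward_def\<close>)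
   have "decide R \<Psi> \<alpha> u (acts \<Psi> \<alpha> e2 u) p = decide R \<Psi> \<alpha> u (acts \<Psi> \<alpha> e u) p"
    by (rule decide_cong) (rule acts)
   then show ?thesis using D IH by simp
  qed simp
 qed simp
 then show ?thesis by simp
qed

text \<open>If the actual round stops at a level \<open>s\<close> up to \<open>R\<close>, then
  \<open>s\<close> is also the first level where the simulated round stops; otherwise neither of
  them touches the levels up to \<open>R\<close>. The actions agree on recorded rounds, the ones
  that enter posteriors.\<close>

lemma sim_eq_run:
 assumes \<Psi>1: "\<Psi> 1 = (\<lambda>_. {})" and run: "\<And>t. t \<in> {1..T} ==> \<exists>s\<ge>1. sup_round k \<sigma> \<beta> N T z p a (reward f z a e) \<Psi> t s"
  and t: "t \<ge> 1" "t \<le> Suc T" and r: "r \<in> {1..R}"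
 shows "fst (sim R p e t) r = \<Psi> t r \<and> (\<forall>j\<in>\<Psi> t r. snd (sim R p e t) j = a j)"
proof -
 have run': "\<exists>s. sup_round k \<sigma> \<beta> N T z p a (reward f z a e) \<Psi> t s" if "t \<in> {1..T}" for t using run[OF that] by blast
 have "\<forall>r\<in>{1..R}. fst (sim R p e t) r = \<Psi> t r \<and> (\<forall>j\<in>\<Psi> t r. snd (sim R p e t) j = a j)"
  using t
 proof (induction t rule: dec_induct)
  case base
  show ?case using fun_cong[OF \<Psi>1] by simp
 next
  case (step t)
  obtain P \<alpha> where D: "sim R p e t = (P, \<alpha>)" by (cases "sim R p e t")
  have tT: "t \<in> {1..T}" "t \<le> Suc T" using step by auto
  have IH: "\<And>r. r \<in> {1..R} ==> P r = \<Psi> t r" "\<And>r j. r \<in> {1..R} ==> j \<in> \<Psi> t r ==> \<alpha> j = a j"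
   using step.IH[OF tT(2)] unfolding D fst_conv snd_conv by blast+
  have fin: "finite (\<Psi> t r)" for r
   using conjunct1[OF sup_sets_prefix[OF \<Psi>1 run' step(1) tT(2), of r]] finite_subset by blast
  obtain s where s1: "s \<ge> 1" and rd: "sup_round k \<sigma> \<beta> N T z p a (reward f z a e) \<Psi> t s" using run[OF tT(1)] by blast
  let ?A = "active k \<sigma> \<beta> N (\<Psi> t) (played z a) (reward f z a e) (z t)"
  let ?w = "\<lambda>r i. width k \<sigma> \<beta> (\<Psi> t r) (played z a) (arm (z t) i)"
  have acts: "acts P \<alpha> e t r = ?A r" if "r \<in> {1..R}" for r
  proof -
   have sub: "r' \<in> {1..R}" if "r' \<in> {1..<r}" for r' using that \<open>r \<in> {1..R}\<close> by auto
   show ?thesis unfolding acts_def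
   proof (rule active_cong)
    fix r' assume r': "r' \<in> {1..<r}"
    show "P r' = \<Psi> t r'" by (rule IH(1)[OF sub[OF r']])
    show "finite (\<Psi> t r')" by (rule fin)
    fix j assume j: "j \<in> \<Psi> t r'"
    show "played z \<alpha> j = played z a j" "reward f z \<alpha> e j = reward f z a e j"
     using IH(2)[OF sub[OF r'] j] by (simp_all add: reward_def played_def)
   qed (use that in simp)
  qed
  have wid: "wid P \<alpha> t r i = ?w r i" if r: "r \<in> {1..R}" for r i
   unfolding wid_def width_def IH(1)[OF r] using IH(2)[OF r] post_mean_cong(2)[OF fin, of r "played z \<alpha>" "played z a" "\<lambda>_. 0" "\<lambda>_. 0"]
   by (simp add: played_def)
  let ?set = "\<lambda>r. \<forall>i\<in>?A r. ?w r i \<le> \<sigma> / sqrt (real T)" and ?nar = "\<lambda>r. \<forall>i\<in>?A r. ?w r i \<le> \<sigma> * 2 powr (- real r)"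
  have st: "stops P \<alpha> t r (acts P \<alpha> e t r) \<longleftrightarrow> ?set r \<or> \<not> ?nar r" "settled P \<alpha> t r (acts P \<alpha> e t r) \<longleftrightarrow> ?set r" if "r \<in> {1..R}" for r
   unfolding stops_def settled_def acts[OF that] wid[OF that] by (rule refl)+
  have pre: "\<not> ?set r \<and> ?nar r" if "r \<in> {1..<s}" for r
   using rd that unfolding sup_round_def Let_def by blast
  have split_disj: "(S \<or> \<not> Q) \<and> (E \<and> S \<or> \<not> S \<and> G \<and> H)" if "P' \<and> (S \<and> C \<and> E \<or> \<not> S \<and> \<not> Q \<and> G \<and> H)" for P' S C E Q G H
   using that by blast
  note ext = split_disj[OF rd[unfolded sup_round_def Let_def]]
  have stop: "?set s \<or> \<not> ?nar s" by (rule conjunct1[OF ext])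
  have res: "\<Psi> (Suc t) = \<Psi> t \<and> ?set s \<or> \<not> ?set s \<and> a t = p t {i \<in> ?A s. ?w s i > \<sigma> * 2 powr (- real s)} \<and> \<Psi> (Suc t) = (\<Psi> t)(s := insert t (\<Psi> t s))"
   by (rule conjunct2[OF ext])
  let ?L = "LEAST s. s \<in> {1..R} \<and> stops P \<alpha> t s (acts P \<alpha> e t s)"
  have sim: "sim R p e (Suc t) = decide R P \<alpha> t (acts P \<alpha> e t) p" using step(1) D by simp
  show ?case
  proof (cases "s \<le> R")
   case True
   then have sR: "s \<in> {1..R}" using s1 by simp
   have L: "?L = s"
   proof (rule Least_equality)
    show "s \<in> {1..R} \<and> stops P \<alpha> t s (acts P \<alpha> e t s)" using sR stop st(1)[OF sR] by blast
    show "s \<le> r" if r: "r \<in> {1..R} \<and> stops P \<alpha> t r (acts P \<alpha> e t r)" for r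
    proof (rule ccontr)
     assume "\<not> s \<le> r"
     then have "r \<in> {1..<s}" using r by auto
     then show False using pre st(1) r by blast
    qed
   qed
   have ex: "\<exists>s. s \<in> {1..R} \<and> stops P \<alpha> t s (acts P \<alpha> e t s)" using sR stop st(1)[OF sR] by blast
   have dec: "sim R p e (Suc t) = (if ?set s then (P, \<alpha>) else (P(s := insert t (P s)), \<alpha>(t := p t {i \<in> ?A s. ?w s i > \<sigma> * 2 powr (- real s)})))"
    unfolding sim decide_def if_P[OF ex] L upd_def st(2)[OF sR] unfolding acts[OF sR] wid[OF sR] ..
   from res show ?thesis
   proof (elim disjE conjE)
    assume "\<Psi> (Suc t) = \<Psi> t" "?set s"
    then show ?thesis unfolding dec using IH by simp
   next
    assume a: "\<not> ?set s" "a t = p t {i \<in> ?A s. ?w s i > \<sigma> * 2 powr (- real s)}" "\<Psi> (Suc t) = (\<Psi> t)(s := insert t (\<Psi> t s))"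
    show ?thesis unfolding dec if_not_P[OF a(1)] a(2)[symmetric] a(3) using IH sR by auto
   qed
  next
   case False
   have no: "\<not> (\<exists>s. s \<in> {1..R} \<and> stops P \<alpha> t s (acts P \<alpha> e t s))"
   proof
    assume "\<exists>s. s \<in> {1..R} \<and> stops P \<alpha> t s (acts P \<alpha> e t s)"
    then obtain r where r: "r \<in> {1..R}" "stops P \<alpha> t r (acts P \<alpha> e t r)" by blast
    then have "r \<in> {1..<s}" using False by auto
    then show False using pre st(1)[OF r(1)] r(2) by blast
   qed
   have "\<Psi> (Suc t) r = \<Psi> t r" if "r \<in> {1..R}" for r using res that False by auto
   then show ?thesis unfolding sim decide_def if_not_P[OF no] using IH by simp
  qed
 qed
 then show ?thesis using r by blast
qed

lemma decide_measurable:
 assumes pick: "choice_rule N pick" and u: "u \<in> borel_measurable \<N>" and As: "\<And>r. r \<in> {1..R} ==> As r \<subseteq> {..<N}"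
 shows "{v \<in> space \<N>. decide R \<Psi> \<alpha> t As (pick (u v)) = D} \<in> sets \<N>"
proof (cases "\<exists>s. s \<in> {1..R} \<and> stops \<Psi> \<alpha> t s (As s)")
 case True
 let ?s = "LEAST s. s \<in> {1..R} \<and> stops \<Psi> \<alpha> t s (As s)"
 let ?E = "{i \<in> As ?s. wid \<Psi> \<alpha> t ?s i > \<sigma> * 2 powr (- real ?s)}"
 have s: "?s \<in> {1..R}" "stops \<Psi> \<alpha> t ?s (As ?s)" using LeastI_ex[OF True] by auto
 have d: "decide R \<Psi> \<alpha> t As p = upd \<Psi> \<alpha> t ?s (As ?s) p" for p unfolding decide_def using True by (rule if_P)
 show ?thesis
 proof (cases "settled \<Psi> \<alpha> t ?s (As ?s)")
  case True
  then show ?thesis unfolding d upd_def by simp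
 next
  case False
  have "?E \<noteq> {}" using s(2) False unfolding stops_def by (auto simp: not_le)
  moreover have "?E \<subseteq> {..<N}" using As[OF s(1)] by blast
  ultimately have E: "?E \<noteq> {} \<and> ?E \<subseteq> {..<N}" by (rule conjI)
  have "\<forall>E. E \<noteq> {} \<and> E \<subseteq> {..<N} \<longrightarrow> (\<lambda>w. pick w t E) \<in> measurable borel (count_space UNIV)"
   using pick unfolding choice_rule_def by blast
  from measurable_compose[OF u mp[OF spec[OF this] E]]
  have m: "(\<lambda>v. pick (u v) t ?E) \<in> measurable \<N> (count_space UNIV)" .
  have "{v \<in> space \<N>. decide R \<Psi> \<alpha> t As (pick (u v)) = D} =
   (\<lambda>v. pick (u v) t ?E) -` {i. (\<Psi>(?s := insert t (\<Psi> ?s)), \<alpha>(t := i)) = D} \<inter> space \<N>"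
   unfolding d upd_def if_not_P[OF False] by (rule equalityI; rule subsetI) (simp_all only: mem_Collect_eq Int_iff vimage_eq simp_thms)
  also have "\<dots> \<in> sets \<N>" by (rule measurable_sets[OF m]) simp
  finally show ?thesis .
 qed
next
 case False
 show ?thesis unfolding decide_def if_not_P[OF False] by simp
qed

text \<open>By induction over the rounds, splitting by the finitely many previous states; once the
  state is fixed, only the active sets and the random choice still vary.\<close>

lemma sim_measurable:
 assumes N: "N \<ge> 1" and pick: "choice_rule N pick" and u: "u \<in> borel_measurable \<N>" and e: "\<And>j. j \<ge> 1 ==> (\<lambda>v. e v j) \<in> borel_measurable \<N>"
 shows "{v \<in> space \<N>. sim R (pick (u v)) (e v) t = D} \<in> sets \<N>"
proof (induction t arbitrary: D)
 case (Suc t)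
 show ?case
 proof (cases "t = 0")
  case False
  have pk: "pick w t' E \<in> E" if "E \<noteq> {}" "E \<subseteq> {..<N}" for w t' E
   using pick that unfolding choice_rule_def by blast
  have M: "{v \<in> space \<N>. decide R \<Psi> \<alpha> t (acts \<Psi> \<alpha> (e v) t) (pick (u v)) = D} \<in> sets \<N>"
   if st: "(\<Psi>, \<alpha>) \<in> states R t" for \<Psi> \<alpha>
  proof -
   have sub: "\<Psi> r \<subseteq> {1..<t}" for r using st unfolding states_def by (cases "r \<in> {1..R}") auto
   have ms: "{v \<in> space \<N>. acts \<Psi> \<alpha> (e v) t r = A} \<in> sets \<N>" if "r \<in> {1..R}" for r A
    unfolding acts_def
   proof (rule active_measurable)
    show "finite (\<Psi> r)" for r using sub finite_subset by blast
    show "(\<lambda>v. reward f z \<alpha> (e v) j) \<in> borel_measurable \<N>" if "j \<in> \<Psi> r" for r j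
     unfolding reward_def using sub[of r] that by (intro borel_measurable_add borel_measurable_const e) auto
    show "1 \<le> r" using that by simp
   qed
   let ?Q = "PiE {1..R} (\<lambda>_. Pow {..<N})"
   have "{v \<in> space \<N>. decide R \<Psi> \<alpha> t (acts \<Psi> \<alpha> (e v) t) (pick (u v)) = D} =
    (\<Union>As\<in>?Q. {v \<in> space \<N>. \<forall>r\<in>{1..R}. acts \<Psi> \<alpha> (e v) t r = As r} \<inter> {v \<in> space \<N>. decide R \<Psi> \<alpha> t As (pick (u v)) = D})" (is "?L = ?U")
   proof
    show "?L \<subseteq> ?U"
    proof
     fix v assume v: "v \<in> ?L"
     let ?As = "restrict (acts \<Psi> \<alpha> (e v) t) {1..R}"
     have "decide R \<Psi> \<alpha> t ?As (pick (u v)) = decide R \<Psi> \<alpha> t (acts \<Psi> \<alpha> (e v) t) (pick (u v))"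
      by (rule decide_cong) simp
     moreover have "?As \<in> ?Q"
      unfolding acts_def[abs_def] using active_subset by (intro restrict_PiE_iff[THEN iffD2]) auto
     ultimately show "v \<in> ?U" using v by (intro UN_I[of ?As]) auto
    qed
    show "?U \<subseteq> ?L"
    proof
     fix v assume "v \<in> ?U"
     then obtain As where As: "v \<in> space \<N>" "\<forall>r\<in>{1..R}. acts \<Psi> \<alpha> (e v) t r = As r" "decide R \<Psi> \<alpha> t As (pick (u v)) = D" by blast
     have "decide R \<Psi> \<alpha> t (acts \<Psi> \<alpha> (e v) t) (pick (u v)) = decide R \<Psi> \<alpha> t As (pick (u v))"
      by (rule decide_cong) (use As(2) in blast)
     then show "v \<in> ?L" using As by simp
    qed
   qed
   also have "\<dots> \<in> sets \<N>"
    by (intro sets.finite_UN sets.Int sets.sets_Collect_finite_All ms decide_measurable[OF pick u] finite_PiE) (auto simp: PiE_iff)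
   finally show ?thesis .
  qed
  have "{v \<in> space \<N>. sim R (pick (u v)) (e v) (Suc t) = D} =
   (\<Union>S\<in>states R t. {v \<in> space \<N>. sim R (pick (u v)) (e v) t = S} \<inter> {v \<in> space \<N>. decide R (fst S) (snd S) t (acts (fst S) (snd S) (e v) t) (pick (u v)) = D})"
  proof -
   have st: "sim R (pick w) e' t \<in> states R t" for w e' by (rule sim_states[OF N pk])
   have e: "sim R (pick (u v)) (e v) (Suc t) = decide R (fst (sim R (pick (u v)) (e v) t)) (snd (sim R (pick (u v)) (e v) t)) t
    (acts (fst (sim R (pick (u v)) (e v) t)) (snd (sim R (pick (u v)) (e v) t)) (e v) t) (pick (u v))" for v
    using False by simp
   show ?thesis unfolding e
   proof (rule equalityI; rule subsetI)
    fix v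
    let ?S = "sim R (pick (u v)) (e v) t"
    assume "v \<in> {v \<in> space \<N>. decide R (fst (sim R (pick (u v)) (e v) t)) (snd (sim R (pick (u v)) (e v) t)) t
     (acts (fst (sim R (pick (u v)) (e v) t)) (snd (sim R (pick (u v)) (e v) t)) (e v) t) (pick (u v)) = D}"
    then show "v \<in> (\<Union>S\<in>states R t. {v \<in> space \<N>. sim R (pick (u v)) (e v) t = S} \<inter> {v \<in> space \<N>. decide R (fst S) (snd S) t (acts (fst S) (snd S) (e v) t) (pick (u v)) = D})"
     using st[of "u v" "e v"] by (intro UN_I[of ?S]) (simp_all only: mem_Collect_eq Int_iff simp_thms)
   next
    fix v assume "v \<in> (\<Union>S\<in>states R t. {v \<in> space \<N>. sim R (pick (u v)) (e v) t = S} \<inter> {v \<in> space \<N>. decide R (fst S) (snd S) t (acts (fst S) (snd S) (e v) t) (pick (u v)) = D})"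
    then show "v \<in> {v \<in> space \<N>. decide R (fst (sim R (pick (u v)) (e v) t)) (snd (sim R (pick (u v)) (e v) t)) t
     (acts (fst (sim R (pick (u v)) (e v) t)) (snd (sim R (pick (u v)) (e v) t)) (e v) t) (pick (u v)) = D}"
     by (elim UN_E IntE CollectE conjE) (simp only: mem_Collect_eq simp_thms)
   qed
  qed
  also have "\<dots> \<in> sets \<N>"
  proof (intro sets.finite_UN sets.Int Suc finite_states)
   fix S assume "S \<in> states R t"
   then show "{v \<in> space \<N>. decide R (fst S) (snd S) t (acts (fst S) (snd S) (e v) t) (pick (u v)) = D} \<in> sets \<N>"
    by (intro M) (simp only: prod.collapse)
  qed
  finally show ?thesis .
 qed simp
qed simp

end

section \<open>Sub-Gaussian noise and the number of bad rounds\<close>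

lemma (in prob_space) subgaussian_sum_upper_tail:
 fixes \<epsilon> :: "nat => 'a => real"
 assumes fin: "finite I" and iv: "indep_vars (\<lambda>_. borel) \<epsilon> I"
  and mgf: "\<And>t u. t \<in> I ==> integrable M (\<lambda>\<omega>. exp (u * \<epsilon> t \<omega>)) \<and> (\<integral>\<omega>. exp (u * \<epsilon> t \<omega>) \<partial>M) \<le> exp (u\<^sup>2 * \<sigma>\<^sup>2 / 2)"
  and r: "r > 0" and q: "q > 0" "q\<^sup>2 = \<sigma>\<^sup>2 * (\<Sum>t\<in>I. (c t)\<^sup>2)"
 shows "prob {\<omega> \<in> space M. (\<Sum>t\<in>I. c t * \<epsilon> t \<omega>) > r * q} \<le> exp (- r\<^sup>2 / 2)"
proof -
 \<comment> \<open>The parameter that minimises the exponent in Chernoff's bound.\<close>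
 define u where "u = r / q"
 let ?X = "\<lambda>t \<omega>. exp ((u * c t) * \<epsilon> t \<omega>)"
 have ivX: "indep_vars (\<lambda>_. borel) ?X I" by (rule indep_vars_compose2[OF iv]) simp
 have int: "integrable M (?X t)" if "t \<in> I" for t using mgf[OF that] by blast
 have prod: "exp (u * (\<Sum>t\<in>I. c t * \<epsilon> t \<omega>)) = (\<Prod>t\<in>I. ?X t \<omega>)" for \<omega>
  using fin by (simp add: exp_sum sum_distrib_left mult.assoc)
 have int_prod: "integrable M (\<lambda>\<omega>. exp (u * (\<Sum>t\<in>I. c t * \<epsilon> t \<omega>)))"
  unfolding prod by (rule indep_vars_integrable[OF fin ivX int])
 have "(\<integral>\<omega>. exp (u * (\<Sum>t\<in>I. c t * \<epsilon> t \<omega>)) \<partial>M) = (\<Prod>t\<in>I. \<integral>\<omega>. ?X t \<omega> \<partial>M)"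
  unfolding prod by (rule indep_vars_lebesgue_integral[OF fin ivX int])
 also have "\<dots> \<le> (\<Prod>t\<in>I. exp ((u * c t)\<^sup>2 * \<sigma>\<^sup>2 / 2))"
  using mgf by (intro prod_mono conjI integral_nonneg_AE) auto
 also have "\<dots> = exp (\<Sum>t\<in>I. (u * c t)\<^sup>2 * \<sigma>\<^sup>2 / 2)" using fin by (simp add: exp_sum)
 also have "(\<Sum>t\<in>I. (u * c t)\<^sup>2 * \<sigma>\<^sup>2 / 2) = u\<^sup>2 / 2 * (\<sigma>\<^sup>2 * (\<Sum>t\<in>I. (c t)\<^sup>2))"
  by (simp add: sum_distrib_left sum_divide_distrib power_mult_distrib mult_ac)
 also have "\<dots> = r\<^sup>2 / 2" unfolding q(2)[symmetric] u_def using q(1) by (simp add: power_divide)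
 finally have E: "(\<integral>\<omega>. exp (u * (\<Sum>t\<in>I. c t * \<epsilon> t \<omega>)) \<partial>M) \<le> exp (r\<^sup>2 / 2)" .
 have u0: "u > 0" using r q(1) by (simp add: u_def)
 have urq: "u * (r * q) = r\<^sup>2" using q(1) by (simp add: u_def power2_eq_square)
 have m: "(\<lambda>\<omega>. exp (u * (\<Sum>t\<in>I. c t * \<epsilon> t \<omega>))) \<in> borel_measurable M" using int_prod by (rule borel_measurable_integrable)
 have "prob {\<omega> \<in> space M. (\<Sum>t\<in>I. c t * \<epsilon> t \<omega>) > r * q} \<le> prob {\<omega> \<in> space M. exp (u * (\<Sum>t\<in>I. c t * \<epsilon> t \<omega>)) \<ge> exp (r\<^sup>2)}"
 proof (rule finite_measure_mono)
  show "{\<omega> \<in> space M. (\<Sum>t\<in>I. c t * \<epsilon> t \<omega>) > r * q} \<subseteq> {\<omega> \<in> space M. exp (u * (\<Sum>t\<in>I. c t * \<epsilon> t \<omega>)) \<ge> exp (r\<^sup>2)}"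
  proof
   fix \<omega> assume w: "\<omega> \<in> {\<omega> \<in> space M. (\<Sum>t\<in>I. c t * \<epsilon> t \<omega>) > r * q}"
   then have "u * (r * q) \<le> u * (\<Sum>t\<in>I. c t * \<epsilon> t \<omega>)" using u0 by (intro mult_left_mono) auto
   then show "\<omega> \<in> {\<omega> \<in> space M. exp (u * (\<Sum>t\<in>I. c t * \<epsilon> t \<omega>)) \<ge> exp (r\<^sup>2)}" using w urq by simp
  qed
  show "{\<omega> \<in> space M. exp (u * (\<Sum>t\<in>I. c t * \<epsilon> t \<omega>)) \<ge> exp (r\<^sup>2)} \<in> events"
   by (intro borel_measurable_le m borel_measurable_const)
 qed
 also have "\<dots> \<le> (\<integral>\<omega>. exp (u * (\<Sum>t\<in>I. c t * \<epsilon> t \<omega>)) \<partial>M) / exp (r\<^sup>2)"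
  by (rule integral_Markov_inequality_measure[where A="{}", OF int_prod]) auto
 also have "\<dots> \<le> exp (r\<^sup>2 / 2) / exp (r\<^sup>2)" using E by (intro divide_right_mono) auto
 also have "\<dots> = exp (- r\<^sup>2 / 2)" by (simp add: exp_diff[symmetric])
 finally show ?thesis .
qed

lemma (in prob_space) subgaussian_sum_tail:
 fixes \<epsilon> :: "nat => 'a => real"
 assumes fin: "finite I" and iv: "indep_vars (\<lambda>_. borel) \<epsilon> I"
  and mgf: "\<And>t u. t \<in> I ==> integrable M (\<lambda>\<omega>. exp (u * \<epsilon> t \<omega>)) \<and> (\<integral>\<omega>. exp (u * \<epsilon> t \<omega>) \<partial>M) \<le> exp (u\<^sup>2 * \<sigma>\<^sup>2 / 2)"
  and r: "r > 0" and q: "q \<ge> 0" "q\<^sup>2 = \<sigma>\<^sup>2 * (\<Sum>t\<in>I. (c t)\<^sup>2)" and \<sigma>: "\<sigma> > 0"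
 shows "prob {\<omega> \<in> space M. \<bar>\<Sum>t\<in>I. c t * \<epsilon> t \<omega>\<bar> > r * q} \<le> 2 * exp (- r\<^sup>2 / 2)"
\<comment> \<open>Chernoff's parameter divides by \<open>q\<close>. For \<open>q = 0\<close> all
  coefficients vanish and the event is empty.\<close>
proof (cases "q = 0")
 case True
 then have "(\<Sum>t\<in>I. (c t)\<^sup>2) = 0" using q(2) \<sigma> by simp
 then have "c t = 0" if "t \<in> I" for t using that fin by (simp add: sum_nonneg_eq_0_iff)
 then have "{\<omega> \<in> space M. \<bar>\<Sum>t\<in>I. c t * \<epsilon> t \<omega>\<bar> > r * q} = {}" using True by simp
 then show ?thesis by (simp only: measure_empty) simp
next
 case False
 then have q0: "q > 0" using q by simp
 have m: "(\<lambda>\<omega>. \<Sum>t\<in>I. d t * \<epsilon> t \<omega>) \<in> borel_measurable M" for d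
  using iv unfolding indep_vars_def by (intro borel_measurable_sum borel_measurable_times borel_measurable_const) auto
 have ev: "{\<omega> \<in> space M. (\<Sum>t\<in>I. d t * \<epsilon> t \<omega>) > r * q} \<in> events" for d
  by (intro borel_measurable_less m borel_measurable_const)
 have "{\<omega> \<in> space M. \<bar>\<Sum>t\<in>I. c t * \<epsilon> t \<omega>\<bar> > r * q} = {\<omega> \<in> space M. (\<Sum>t\<in>I. c t * \<epsilon> t \<omega>) > r * q} \<union> {\<omega> \<in> space M. (\<Sum>t\<in>I. - c t * \<epsilon> t \<omega>) > r * q}"
  by (auto simp: sum_negf)
 then have "prob {\<omega> \<in> space M. \<bar>\<Sum>t\<in>I. c t * \<epsilon> t \<omega>\<bar> > r * q} \<le> prob {\<omega> \<in> space M. (\<Sum>t\<in>I. c t * \<epsilon> t \<omega>) > r * q} + prob {\<omega> \<in> space M. (\<Sum>t\<in>I. - c t * \<epsilon> t \<omega>) > r * q}"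
  using measure_Un_le[OF ev ev] by (simp only:)
 also have "\<dots> \<le> exp (- r\<^sup>2 / 2) + exp (- r\<^sup>2 / 2)"
  by (intro add_mono subgaussian_sum_upper_tail[OF fin iv mgf r q0]) (use q in auto)
 finally show ?thesis by simp
qed

section \<open>Confidence bounds for the simulated run\<close>

locale sup_run = prob_space M + sup_sim k \<sigma> \<beta> N T z f
 for M :: "'w measure" and k \<sigma> \<beta> N T z f +
 fixes X :: "real vec set" and \<epsilon> :: "'w => nat => real" and U :: "'w => real"
  and pick :: "real => nat => nat set => nat" and B :: real
 assumes k: "psd_kernel X k" and \<sigma>: "\<sigma> > 0" and N: "N \<ge> 1" and T: "T \<ge> 1" and \<beta>: "\<beta> > 0"
  and arms: "\<And>t i. t \<ge> 1 ==> i < N ==> arm (z t) i \<in> X"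
  and ball: "in_rkhs_ball X k B f"
  and noise: "iid_subgaussian_noise M {1..T} \<sigma> \<epsilon>"
  and U: "U \<in> borel_measurable M"
  and ind: "indep_set
      (generated_by M (PiM {1..T} (\<lambda>_. borel)) (\<lambda>\<omega>. restrict (\<epsilon> \<omega>) {1..T}))
      (generated_by M borel U)"
  and pick: "choice_rule N pick"
begin

text \<open>Seed and noise as a single independent family, with the seed in slot 0.\<close>

definition V :: "nat => 'w => real" where
 "V i \<omega> = (if i = 0 then U \<omega> else \<epsilon> \<omega> i)"

lemma noise_indep: "indep_vars (\<lambda>_. borel) (\<lambda>t \<omega>. \<epsilon> \<omega> t) {1..T}"
 using noise by (simp add: iid_subgaussian_noise_def)

lemma noise_measurable: "t \<in> {1..T} ==> (\<lambda>\<omega>. \<epsilon> \<omega> t) \<in> borel_measurable M"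
 using noise_indep unfolding indep_vars_def by blast

lemma V_measurable: "i \<in> {0..T} ==> V i \<in> borel_measurable M"
 using U noise_measurable[of i] unfolding V_def[abs_def] by (cases "i = 0") auto

lemma V_indep: "indep_vars (\<lambda>_. borel) V {0..T}"
proof -
 have "prob (\<Inter>j\<in>{0..T}. V j -` A j \<inter> space M) = (\<Prod>j\<in>{0..T}. prob (V j -` A j \<inter> space M))"
  if A: "A \<in> (\<Pi> i\<in>{0..T}. sets borel)" for A
 proof -
  have Aj: "A j \<in> sets borel" if "j \<in> {0..T}" for j using A that by auto
  have I: "{0..T} = insert 0 {1..T}" by auto
  let ?E = "\<Inter>j\<in>{1..T}. (\<lambda>\<omega>. \<epsilon> \<omega> j) -` A j \<inter> space M"
  have VE: "V j -` A j \<inter> space M = (\<lambda>\<omega>. \<epsilon> \<omega> j) -` A j \<inter> space M" if "j \<in> {1..T}" for j using that by (auto simp: V_def)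
  have V0: "V 0 -` A 0 \<inter> space M = U -` A 0 \<inter> space M" by (auto simp: V_def)
  have E: "?E = (\<lambda>\<omega>. restrict (\<epsilon> \<omega>) {1..T}) -` (PiE {1..T} A) \<inter> space M"
  proof (rule equalityI; rule subsetI)
   fix \<omega> assume "\<omega> \<in> ?E"
   then show "\<omega> \<in> (\<lambda>\<omega>. restrict (\<epsilon> \<omega>) {1..T}) -` (PiE {1..T} A) \<inter> space M"
    using T by (auto intro!: restrict_PiE_iff[THEN iffD2] split: if_splits)
  next
   fix \<omega> assume w: "\<omega> \<in> (\<lambda>\<omega>. restrict (\<epsilon> \<omega>) {1..T}) -` (PiE {1..T} A) \<inter> space M"
   then have "\<epsilon> \<omega> j \<in> A j" if "j \<in> {1..T}" for j using that restrict_PiE_iff[of "\<epsilon> \<omega>" "{1..T}" A] by blast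
   then show "\<omega> \<in> ?E" using w by blast
  qed
  have E1: "?E \<in> generated_by M (PiM {1..T} (\<lambda>_. borel)) (\<lambda>\<omega>. restrict (\<epsilon> \<omega>) {1..T})"
   unfolding E generated_by_def using Aj by (intro in_vimage_algebra sets_PiM_I_finite) auto
  have E2: "U -` A 0 \<inter> space M \<in> generated_by M borel U"
   unfolding generated_by_def using Aj[of 0] by (intro in_vimage_algebra) auto
  have "(\<Inter>j\<in>{0..T}. V j -` A j \<inter> space M) = (V 0 -` A 0 \<inter> space M) \<inter> (\<Inter>j\<in>{1..T}. V j -` A j \<inter> space M)"
   unfolding I by (rule INT_insert)
  also have "\<dots> = ?E \<inter> (U -` A 0 \<inter> space M)"
  proof -
   have "(\<Inter>j\<in>{1..T}. V j -` A j \<inter> space M) = ?E" by (rule INF_cong[OF refl VE])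
   then show ?thesis unfolding V0 by (simp only: Int_commute)
  qed
  finally have "prob (\<Inter>j\<in>{0..T}. V j -` A j \<inter> space M) = prob ?E * prob (U -` A 0 \<inter> space M)"
   using indep_setD[OF ind E1 E2] by (simp only:)
  also have "prob ?E = (\<Prod>j\<in>{1..T}. prob ((\<lambda>\<omega>. \<epsilon> \<omega> j) -` A j \<inter> space M))"
   by (rule indep_varsD[OF noise_indep]) (use T Aj in auto)
  also have "\<dots> = (\<Prod>j\<in>{1..T}. prob (V j -` A j \<inter> space M))" by (intro prod.cong refl) (simp only: VE)
  finally show ?thesis unfolding I by (simp add: V0 mult.commute)
 qed
 moreover have "sets borel = sigma_sets (space borel) (sets (borel :: real measure))" by (rule sets.sigma_sets_eq[symmetric])
 ultimately show ?thesis
  using V_measurable sets.Int_stable[of "borel :: real measure"] sets.space_closed[of "borel :: real measure"]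
  by (subst indep_vars_finite[where E="\<lambda>_. sets borel"]) (auto simp del: space_borel)
qed

lemma pick_in: "E \<noteq> {} ==> E \<subseteq> {..<N} ==> pick w t E \<in> E"
 using pick unfolding choice_rule_def by blast

definition state :: "nat => nat => 'w => (nat => nat set) \<times> (nat => nat)" where
 "state R t \<omega> = sim R (pick (U \<omega>)) (\<epsilon> \<omega>) t"

text \<open>Whether the state before round \<open>t\<close> is \<open>(P, \<alpha>)\<close> is
  decided by the seed and the noise of the rounds outside \<open>P R\<close>, since decisions up to
  level \<open>R\<close> never read rewards of level \<open>R\<close>. So the noise on
  \<open>P R\<close> may be replaced by 0 without changing this event, which is therefore
  independent of it.\<close>

lemma state_event_indep:
 assumes t: "t \<in> {1..T}" and P: "P R \<subseteq> {1..T}"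
 shows "{\<omega> \<in> space M. state R t \<omega> = (P, \<alpha>)} \<in> events"
  and "prob ({\<omega> \<in> space M. state R t \<omega> = (P, \<alpha>)} \<inter> {\<omega> \<in> space M. \<bar>\<Sum>j\<in>P R. c j * \<epsilon> \<omega> j\<bar> > w}) =
   prob {\<omega> \<in> space M. state R t \<omega> = (P, \<alpha>)} * prob {\<omega> \<in> space M. \<bar>\<Sum>j\<in>P R. c j * \<epsilon> \<omega> j\<bar> > w}"
proof -
 let ?J = "{0..T} - P R"
 let ?\<N> = "PiM ?J (\<lambda>_. borel :: real measure)" and ?\<N>2 = "PiM (P R) (\<lambda>_. borel :: real measure)"
 let ?e = "\<lambda>v j. if j \<in> {1..T} - P R then v j else 0"
 let ?G = "{v \<in> space ?\<N>. sim R (pick (v 0)) (?e v) t = (P, \<alpha>)}"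
 let ?H = "{v \<in> space ?\<N>2. \<bar>\<Sum>j\<in>P R. c j * v j\<bar> > w}"
 let ?V = "\<lambda>\<omega>. \<lambda>i\<in>?J. V i \<omega>" and ?W = "\<lambda>\<omega>. \<lambda>i\<in>P R. V i \<omega>"
 have zero: "0 \<in> ?J" using P by auto
 have finP: "finite (P R)" using P finite_subset by blast
 have G: "?G \<in> sets ?\<N>"
 proof (rule sim_measurable[OF N pick])
  show "(\<lambda>v. v 0) \<in> borel_measurable ?\<N>" by (rule measurable_component_singleton[OF zero])
  show "(\<lambda>v. ?e v j) \<in> borel_measurable ?\<N>" for j
   by (cases "j \<in> {1..T} - P R") (auto intro!: measurable_component_singleton)
 qed
 have H: "?H \<in> sets ?\<N>2"
  by (intro borel_measurable_less borel_measurable_const borel_measurable_abs borel_measurable_sum borel_measurable_times measurable_component_singleton)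
 have iv: "indep_var ?\<N> ?V ?\<N>2 ?W"
  using indep_var_restrict[OF V_indep, of ?J "P R"] P by (simp add: subset_iff Int_commute Diff_disjoint)
 have Vm: "?V \<in> measurable M ?\<N>" by (rule measurable_restrict, rule V_measurable) auto
 have sim_eq: "state R t \<omega> = (P, \<alpha>) \<longleftrightarrow> sim R (pick (U \<omega>)) (?e (?V \<omega>)) t = (P, \<alpha>)" for \<omega>
 proof -
  have e: "\<epsilon> \<omega> j = ?e (?V \<omega>) j" if "j \<in> {1..<t}" "j \<notin> P R" for j using that t by (simp add: V_def)
  show ?thesis
  proof
   assume s: "state R t \<omega> = (P, \<alpha>)"
   have "sim R (pick (U \<omega>)) (?e (?V \<omega>)) t = sim R (pick (U \<omega>)) (\<epsilon> \<omega>) t"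
   proof (rule sim_ignores_own_level)
    fix j assume "j \<in> {1..<t}" "j \<notin> fst (sim R (pick (U \<omega>)) (\<epsilon> \<omega>) t) R"
    then show "\<epsilon> \<omega> j = ?e (?V \<omega>) j" using s by (intro e) (simp_all only: state_def fst_conv not_False_eq_True)
   qed
   then show "sim R (pick (U \<omega>)) (?e (?V \<omega>)) t = (P, \<alpha>)" using s by (simp only: state_def)
  next
   assume s: "sim R (pick (U \<omega>)) (?e (?V \<omega>)) t = (P, \<alpha>)"
   have "sim R (pick (U \<omega>)) (\<epsilon> \<omega>) t = sim R (pick (U \<omega>)) (?e (?V \<omega>)) t"
   proof (rule sim_ignores_own_level)
    fix j assume "j \<in> {1..<t}" "j \<notin> fst (sim R (pick (U \<omega>)) (?e (?V \<omega>)) t) R"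
    then show "?e (?V \<omega>) j = \<epsilon> \<omega> j" using s by (intro e[symmetric]) (simp_all only: fst_conv not_False_eq_True)
   qed
   then show "state R t \<omega> = (P, \<alpha>)" using s by (simp only: state_def)
  qed
 qed
 have VU: "?V \<omega> 0 = U \<omega>" for \<omega> using zero by (simp add: V_def)
 have Vsp: "?V \<omega> \<in> space ?\<N>" "?W \<omega> \<in> space ?\<N>2" for \<omega> by (simp_all add: space_PiM)
 have S: "{\<omega> \<in> space M. state R t \<omega> = (P, \<alpha>)} = ?V -` ?G \<inter> space M"
  unfolding sim_eq vimage_def using Vsp VU by (simp add: Int_def conj_commute)
 have Ws: "(\<Sum>j\<in>P R. c j * ?W \<omega> j) = (\<Sum>j\<in>P R. c j * \<epsilon> \<omega> j)" for \<omega>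
  using P by (intro sum.cong refl) (auto simp: V_def)
 have W: "{\<omega> \<in> space M. \<bar>\<Sum>j\<in>P R. c j * \<epsilon> \<omega> j\<bar> > w} = ?W -` ?H \<inter> space M"
  unfolding vimage_def Ws[symmetric] using Vsp by (simp add: Int_def conj_commute)
 show "{\<omega> \<in> space M. state R t \<omega> = (P, \<alpha>)} \<in> events" unfolding S by (rule measurable_sets[OF Vm G])
 have "(?V -` ?G \<inter> space M) \<inter> (?W -` ?H \<inter> space M) = (\<lambda>x. (?V x, ?W x)) -` (?G \<times> ?H) \<inter> space M" by blast
 then show "prob ({\<omega> \<in> space M. state R t \<omega> = (P, \<alpha>)} \<inter> {\<omega> \<in> space M. \<bar>\<Sum>j\<in>P R. c j * \<epsilon> \<omega> j\<bar> > w}) =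
   prob {\<omega> \<in> space M. state R t \<omega> = (P, \<alpha>)} * prob {\<omega> \<in> space M. \<bar>\<Sum>j\<in>P R. c j * \<epsilon> \<omega> j\<bar> > w}"
  unfolding S W by (simp only: indep_varD[OF iv G H])
qed

definition deviates :: "nat => nat => nat => 'w set" where
 "deviates t R i = {\<omega> \<in> space M.
  \<bar>f (arm (z t) i) - post_mean k \<sigma> (fst (state R t \<omega>) R) (played z (snd (state R t \<omega>))) (reward f z (snd (state R t \<omega>)) (\<epsilon> \<omega>)) (arm (z t) i)\<bar>
   > width k \<sigma> \<beta> (fst (state R t \<omega>) R) (played z (snd (state R t \<omega>))) (arm (z t) i)}"

text \<open>The bias is at most \<open>B * p\<close> and the noise is compared with
  \<open>r * q\<close>, where \<open>p\<^sup>2 + q\<^sup>2\<close> is the posterior variance and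
  \<open>B\<^sup>2 + r\<^sup>2 = \<beta>\<close>. Their sum stays within the width, so only noise
  above \<open>r * q\<close> can break the bound, and its tail is sub-Gaussian. The pieces over
  which probabilities are summed are the possible states.\<close>

lemma deviates:
 assumes t: "t \<in> {1..T}" and R: "R \<ge> 1" and i: "i < N"
 shows "deviates t R i \<in> events" "prob (deviates t R i) \<le> 2 * exp (- (\<beta> - B\<^sup>2) / 2)"
proof -
 let ?x = "arm (z t) i"
 let ?F = "\<lambda>D. {\<omega> \<in> space M. state R t \<omega> = D}"
 have x': "?x \<in> X" using t i by (intro arms) auto
 have B0: "0 \<le> B" by (rule rkhs_ball_nonneg[OF ball])
 have st: "state R t \<omega> \<in> states R t" for \<omega> unfolding state_def by (rule sim_states[OF N pick_in])
 have D: "?F D \<inter> deviates t R i \<in> events \<and> ?F D \<in> events \<and> prob (?F D \<inter> deviates t R i) \<le> prob (?F D) * (2 * exp (- (\<beta> - B\<^sup>2) / 2))"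
  if DS: "D \<in> states R t" for D
 proof -
  obtain P \<alpha> where DP: "D = (P, \<alpha>)" by (cases D)
  have PR: "P R \<subseteq> {1..<t}" and \<alpha>: "\<And>j. j \<in> {1..<t} ==> \<alpha> j < N"
   using DS R unfolding DP states_def by auto
  have PT: "P R \<subseteq> {1..T}" using PR t by auto
  have fin: "finite (P R)" using PR finite_subset by blast
  let ?p = "played z \<alpha>"
  have pX: "\<forall>j\<in>P R. ?p j \<in> X" unfolding played_def using PR \<alpha> by (intro ballI arms) auto
  obtain c where mean: "\<And>y. post_mean k \<sigma> (P R) ?p y ?x = (\<Sum>j\<in>P R. c j * y j)"
   and sd0: "0 \<le> post_sd k \<sigma> (P R) ?p ?x"
   and sd: "(post_sd k \<sigma> (P R) ?p ?x)\<^sup>2 = kdist k (P R) ?p ?x c + \<sigma>\<^sup>2 * (\<Sum>j\<in>P R. (c j)\<^sup>2)"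
   using posterior[OF k \<sigma> fin pX x'] by blast
  let ?h = "f ?x - (\<Sum>j\<in>P R. c j * f (?p j))"
  have dev: "\<omega> \<in> deviates t R i \<longleftrightarrow> \<omega> \<in> space M \<and> \<bar>?h - (\<Sum>j\<in>P R. c j * \<epsilon> \<omega> j)\<bar> > sqrt \<beta> * post_sd k \<sigma> (P R) ?p ?x"
   if "state R t \<omega> = D" for \<omega>
   unfolding deviates_def width_def mem_Collect_eq that DP fst_conv snd_conv mean reward_def
   by (simp add: distrib_left sum.distrib diff_diff_eq)
  have noise_m: "(\<lambda>\<omega>. \<Sum>j\<in>P R. c j * \<epsilon> \<omega> j) \<in> borel_measurable M"
   using PT by (intro borel_measurable_sum borel_measurable_times borel_measurable_const noise_measurable) auto
  have F: "?F D \<in> events" unfolding DP by (rule state_event_indep(1)[where P=P and R=R and \<alpha>=\<alpha>, OF t PT])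
  have eq: "?F D \<inter> deviates t R i = ?F D \<inter> {\<omega> \<in> space M. sqrt \<beta> * post_sd k \<sigma> (P R) ?p ?x < \<bar>?h - (\<Sum>j\<in>P R. c j * \<epsilon> \<omega> j)\<bar>}"
   using dev by blast
  have ev: "?F D \<inter> deviates t R i \<in> events" unfolding eq
   by (intro sets.Int F borel_measurable_less borel_measurable_const borel_measurable_abs borel_measurable_diff noise_m)
  have "prob (?F D \<inter> deviates t R i) \<le> prob (?F D) * (2 * exp (- (\<beta> - B\<^sup>2) / 2))"
  \<comment> \<open>If \<open>\<beta>\<close> is at most \<open>B\<^sup>2\<close> there is no room
    for noise, but then the claimed factor is at least 1.\<close>
  proof (cases "\<beta> \<le> B\<^sup>2")
   case True
   then have "1 \<le> exp (- (\<beta> - B\<^sup>2) / 2)" by simp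
   then have "1 \<le> 2 * exp (- (\<beta> - B\<^sup>2) / 2)" by linarith
   then have "prob (?F D) * 1 \<le> prob (?F D) * (2 * exp (- (\<beta> - B\<^sup>2) / 2))" by (intro mult_left_mono) auto
   moreover have "prob (?F D \<inter> deviates t R i) \<le> prob (?F D)" using F by (intro finite_measure_mono) auto
   ultimately show ?thesis by simp
  next
   case False
   define r where "r = sqrt (\<beta> - B\<^sup>2)"
   define q where "q = \<sigma> * sqrt (\<Sum>j\<in>P R. (c j)\<^sup>2)"
   define p where "p = sqrt (kdist k (P R) ?p ?x c)"
   have r: "r > 0" "r\<^sup>2 = \<beta> - B\<^sup>2" using False by (simp_all add: r_def)
   have q: "q \<ge> 0" "q\<^sup>2 = \<sigma>\<^sup>2 * (\<Sum>j\<in>P R. (c j)\<^sup>2)" using \<sigma> by (simp_all add: q_def power_mult_distrib sum_nonneg)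
   have kd: "0 \<le> kdist k (P R) ?p ?x c" by (rule kdist_nonneg[OF k fin pX x'])
   have p: "p \<ge> 0" "p\<^sup>2 = kdist k (P R) ?p ?x c" using kd by (simp_all add: p_def)
   have CS: "B * p + r * q \<le> sqrt \<beta> * post_sd k \<sigma> (P R) ?p ?x"
   proof -
    have "(B * p + r * q)\<^sup>2 \<le> (B\<^sup>2 + r\<^sup>2) * (p\<^sup>2 + q\<^sup>2)"
    proof -
     have "(B\<^sup>2 + r\<^sup>2) * (p\<^sup>2 + q\<^sup>2) - (B * p + r * q)\<^sup>2 = (B * q - r * p)\<^sup>2" by (simp add: power2_eq_square algebra_simps)
     then show ?thesis using zero_le_power2[of "B * q - r * p"] by linarith
    qed
    also have "\<dots> = (sqrt \<beta> * post_sd k \<sigma> (P R) ?p ?x)\<^sup>2"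
     unfolding power_mult_distrib sd p(2) q(2) r(2) using \<beta> by simp
    finally show ?thesis by (rule power2_le_imp_le) (use \<beta> sd0 in auto)
   qed
   have bias: "\<bar>?h\<bar> \<le> B * p" unfolding p_def by (rule rkhs_ball_bias[OF k ball fin pX x'])
   let ?W = "{\<omega> \<in> space M. \<bar>\<Sum>j\<in>P R. c j * \<epsilon> \<omega> j\<bar> > r * q}"
   have "?F D \<inter> deviates t R i \<subseteq> ?F D \<inter> ?W" unfolding eq
   proof
    fix \<omega> assume w: "\<omega> \<in> ?F D \<inter> {\<omega> \<in> space M. sqrt \<beta> * post_sd k \<sigma> (P R) ?p ?x < \<bar>?h - (\<Sum>j\<in>P R. c j * \<epsilon> \<omega> j)\<bar>}"
    then have "sqrt \<beta> * post_sd k \<sigma> (P R) ?p ?x < \<bar>?h\<bar> + \<bar>\<Sum>j\<in>P R. c j * \<epsilon> \<omega> j\<bar>"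
     using abs_triangle_ineq4[of ?h "\<Sum>j\<in>P R. c j * \<epsilon> \<omega> j"] by auto
    then show "\<omega> \<in> ?F D \<inter> ?W" using w bias CS by auto
   qed
   moreover have Wev: "?W \<in> events" by (intro borel_measurable_less borel_measurable_const borel_measurable_abs noise_m)
   ultimately have "prob (?F D \<inter> deviates t R i) \<le> prob (?F D \<inter> ?W)" using F by (intro finite_measure_mono) auto
   also have "\<dots> = prob (?F D) * prob ?W" unfolding DP by (rule state_event_indep(2)[where P=P and R=R and \<alpha>=\<alpha>, OF t PT])
   also have "\<dots> \<le> prob (?F D) * (2 * exp (- r\<^sup>2 / 2))"
   proof (intro mult_left_mono subgaussian_sum_tail[OF fin _ _ r(1) q \<sigma>])
    show "indep_vars (\<lambda>_. borel) (\<lambda>j \<omega>. \<epsilon> \<omega> j) (P R)" by (rule indep_vars_subset[OF noise_indep PT])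
    show "integrable M (\<lambda>\<omega>. exp (u * \<epsilon> \<omega> j)) \<and> (\<integral>\<omega>. exp (u * \<epsilon> \<omega> j) \<partial>M) \<le> exp (u\<^sup>2 * \<sigma>\<^sup>2 / 2)" if "j \<in> P R" for j u
     using noise PT that unfolding iid_subgaussian_noise_def by blast
   qed simp
   finally show ?thesis unfolding r(2) .
  qed
  then show ?thesis using ev F by blast
 qed
 have un: "deviates t R i = (\<Union>D\<in>states R t. ?F D \<inter> deviates t R i)"
  using st by (auto simp: deviates_def)
 show "deviates t R i \<in> events" by (subst un, intro sets.finite_UN finite_states) (use D in blast)
 have disj: "disjoint_family_on ?F (states R t)" by (auto simp: disjoint_family_on_def)
 have "prob (deviates t R i) \<le> (\<Sum>D\<in>states R t. prob (?F D \<inter> deviates t R i))"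
  by (subst un, intro finite_measure_subadditive_finite finite_states) (use D in blast)
 also have "\<dots> \<le> (\<Sum>D\<in>states R t. prob (?F D) * (2 * exp (- (\<beta> - B\<^sup>2) / 2)))" using D by (intro sum_mono) blast
 also have "\<dots> = prob (\<Union>D\<in>states R t. ?F D) * (2 * exp (- (\<beta> - B\<^sup>2) / 2))"
  using finite_states disj D by (subst finite_measure_finite_Union) (auto simp: sum_distrib_right)
 also have "\<dots> \<le> 1 * (2 * exp (- (\<beta> - B\<^sup>2) / 2))" by (intro mult_right_mono) auto
 finally show "prob (deviates t R i) \<le> 2 * exp (- (\<beta> - B\<^sup>2) / 2)" by simp
qed

text \<open>\<open>Z\<close> counts the failing confidence bounds over rounds, levels and arms, and
  it dominates the number of bad rounds. Its mean is at most \<open>S * Q * \<delta>\<close>, so by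
  Markov's inequality it stays below \<open>c\<close> with probability above
  \<open>1 - \<delta>\<close>.\<close>

lemma sup_run_regret_prob:
 assumes a: "\<forall>t\<in>{1..T}. (\<lambda>\<omega>. a \<omega> t) \<in> measurable M (count_space {..<N})"
  and run: "\<forall>\<omega>\<in>space M. sup_ntk_ucb k \<sigma> \<beta> N T z (pick (U \<omega>)) (a \<omega>) (reward f z (a \<omega>) (\<epsilon> \<omega>))"
  and G: "\<And>v. v \<in> X ==> \<bar>f v\<bar> \<le> G"
  and W: "\<And>S' x. S' \<subseteq> {1..T} ==> \<forall>t\<in>S'. x t \<in> X ==> (\<Sum>t\<in>S'. width k \<sigma> \<beta> {i\<in>S'. i < t} x (x t)) \<le> W"
  and Q: "real T * real N * (2 * exp (- (\<beta> - B\<^sup>2) / 2)) \<le> Q * \<delta>" and \<delta>: "0 < \<delta>" "0 \<le> Q"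
  and rate: "2 * \<sigma> * sqrt (real T) + (8 + 4 * G / \<sigma>) * (real (nat \<lceil>ln (real T)\<rceil>) * W) + (real (nat \<lceil>ln (real T)\<rceil>) * Q + 1) * (2 * G) \<le> rho"
 shows "measure M {\<omega> \<in> space M. regret f N z (a \<omega>) T \<le> rho} > 1 - \<delta>"
proof -
 define S where "S = nat \<lceil>ln (real T)\<rceil>"
 define Z where "Z \<omega> = (\<Sum>t=1..T. \<Sum>R=1..S. \<Sum>i<N. indicator (deviates t R i) \<omega> :: real)" for \<omega>
 \<comment> \<open>The summand 1 makes Markov's inequality strict and keeps \<open>c\<close>
   positive if \<open>S * Q\<close> is 0.\<close>
 define c where "c = real S * Q + 1"
 have c: "c > 0" using \<delta> by (simp add: c_def add_nonneg_pos)
 have dev: "deviates t R i \<in> events" "prob (deviates t R i) \<le> 2 * exp (- (\<beta> - B\<^sup>2) / 2)"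
  if "t \<in> {1..T}" "R \<in> {1..S}" "i \<in> {..<N}" for t R i using deviates[of t R i] that by auto
 have int1: "integrable M (indicator (deviates t R i) :: 'w => real)" if "t \<in> {1..T}" "R \<in> {1..S}" "i \<in> {..<N}" for t R i
  using dev(1)[OF that] by (intro integrable_real_indicator) (auto simp: less_top[symmetric])
 have intZ: "integrable M Z" unfolding Z_def[abs_def] by (intro Bochner_Integration.integrable_sum int1)
 have "(\<integral>\<omega>. Z \<omega> \<partial>M) = (\<Sum>t=1..T. \<integral>\<omega>. (\<Sum>R=1..S. \<Sum>i<N. indicator (deviates t R i) \<omega>) \<partial>M)"
  unfolding Z_def by (rule Bochner_Integration.integral_sum) (intro Bochner_Integration.integrable_sum int1)
 also have "\<dots> = (\<Sum>t=1..T. \<Sum>R=1..S. \<integral>\<omega>. (\<Sum>i<N. indicator (deviates t R i) \<omega>) \<partial>M)"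
  by (intro sum.cong refl Bochner_Integration.integral_sum Bochner_Integration.integrable_sum int1)
 also have "\<dots> = (\<Sum>t=1..T. \<Sum>R=1..S. \<Sum>i<N. \<integral>\<omega>. indicator (deviates t R i) \<omega> \<partial>M)"
  by (intro sum.cong refl Bochner_Integration.integral_sum int1)
 also have "\<dots> = (\<Sum>t=1..T. \<Sum>R=1..S. \<Sum>i<N. prob (deviates t R i))"
  using dev(1) by (intro sum.cong refl) (simp add: Int_absorb2 sets.sets_into_space)
 also have "\<dots> \<le> (\<Sum>t=1..T. \<Sum>R=1..S. \<Sum>i<N. 2 * exp (- (\<beta> - B\<^sup>2) / 2))"
  by (intro sum_mono dev(2))
 also have "\<dots> = real S * (real T * real N * (2 * exp (- (\<beta> - B\<^sup>2) / 2)))" by (simp add: mult_ac)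
 also have "\<dots> \<le> real S * (Q * \<delta>)" using Q by (intro mult_left_mono) auto
 also have "\<dots> < c * \<delta>" using \<delta> by (simp add: c_def distrib_right)
 finally have EZ: "(\<integral>\<omega>. Z \<omega> \<partial>M) < c * \<delta>" .
 have Z0: "0 \<le> Z \<omega>" for \<omega> unfolding Z_def by (intro sum_nonneg) simp
 have "prob {\<omega> \<in> space M. Z \<omega> \<ge> c} \<le> (\<integral>\<omega>. Z \<omega> \<partial>M) / c"
  by (rule integral_Markov_inequality_measure[where A="{}", OF intZ]) (use Z0 c in auto)
 also have "\<dots> < \<delta>" using EZ c by (simp add: field_simps)
 finally have pZ: "prob {\<omega> \<in> space M. Z \<omega> \<ge> c} < \<delta>" .
 let ?E = "{\<omega> \<in> space M. Z \<omega> \<ge> c}" and ?H = "{\<omega> \<in> space M. regret f N z (a \<omega>) T \<le> rho}"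
 have E: "?E \<in> events" using intZ by (intro borel_measurable_le borel_measurable_const borel_measurable_integrable)
 have aN: "a \<omega> t < N" if "\<omega> \<in> space M" "t \<in> {1..T}" for \<omega> t
  using measurable_space[OF bspec[OF a that(2)] that(1)] by simp
 have G0: "0 \<le> G" using G[OF arms[of 1 0]] N by fastforce
 have "space M - ?E \<subseteq> ?H"
 proof
  fix \<omega> assume "\<omega> \<in> space M - ?E"
  then have w: "\<omega> \<in> space M" and Zc: "Z \<omega> < c" by auto
  obtain \<Psi> where \<Psi>1: "\<Psi> 1 = (\<lambda>_. {})" and rounds: "\<forall>t\<in>{1..T}. \<exists>s\<in>{1..S}. sup_round k \<sigma> \<beta> N T z (pick (U \<omega>)) (a \<omega>) (reward f z (a \<omega>) (\<epsilon> \<omega>)) \<Psi> t s"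
   using bspec[OF run w] unfolding sup_ntk_ucb_rounds S_def by (elim exE conjE)
  let ?Bad = "{t\<in>{1..T}. \<exists>R\<in>{1..S}. \<exists>i<N. \<omega> \<in> deviates t R i}"
  have r1: "\<exists>s\<ge>1. sup_round k \<sigma> \<beta> N T z (pick (U \<omega>)) (a \<omega>) (reward f z (a \<omega>) (\<epsilon> \<omega>)) \<Psi> t s" if "t \<in> {1..T}" for t
   using bspec[OF rounds that] by (elim bexE) (intro exI conjI, auto)
  have conf: "\<bar>f (arm (z t) i) - post_mean k \<sigma> (\<Psi> t r) (played z (a \<omega>)) (reward f z (a \<omega>) (\<epsilon> \<omega>)) (arm (z t) i)\<bar> \<le> width k \<sigma> \<beta> (\<Psi> t r) (played z (a \<omega>)) (arm (z t) i)"
   if t: "t \<in> {1..T}" "t \<notin> ?Bad" and r: "r \<in> {1..S}" and i: "i < N" for t r i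
  proof -
   have t': "t \<ge> 1" "t \<le> Suc T" and rr: "r \<in> {1..r}" using t r by auto
   have s: "fst (state r t \<omega>) r = \<Psi> t r" "\<And>j. j \<in> \<Psi> t r ==> snd (state r t \<omega>) j = a \<omega> j"
    using sim_eq_run[OF \<Psi>1 r1 t' rr] unfolding state_def by blast+
   have fin: "finite (\<Psi> t r)"
    using sim_disjoint[of r "pick (U \<omega>)" "\<epsilon> \<omega>" t] s(1) finite_subset[of "\<Psi> t r" "{1..<t}"] unfolding state_def by auto
   have "\<omega> \<notin> deviates t r i" using t r i by blast
   then have "\<bar>f (arm (z t) i) - post_mean k \<sigma> (\<Psi> t r) (played z (snd (state r t \<omega>))) (reward f z (snd (state r t \<omega>)) (\<epsilon> \<omega>)) (arm (z t) i)\<bar>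
    \<le> width k \<sigma> \<beta> (\<Psi> t r) (played z (snd (state r t \<omega>))) (arm (z t) i)"
    using w unfolding deviates_def mem_Collect_eq unfolding s(1) by (simp add: not_less)
   moreover have "post_mean k \<sigma> (\<Psi> t r) (played z (snd (state r t \<omega>))) (reward f z (snd (state r t \<omega>)) (\<epsilon> \<omega>)) (arm (z t) i) = post_mean k \<sigma> (\<Psi> t r) (played z (a \<omega>)) (reward f z (a \<omega>) (\<epsilon> \<omega>)) (arm (z t) i)"
    "post_sd k \<sigma> (\<Psi> t r) (played z (snd (state r t \<omega>))) (arm (z t) i) = post_sd k \<sigma> (\<Psi> t r) (played z (a \<omega>)) (arm (z t) i)"
    using s(2) by (auto intro!: post_mean_cong fin simp: played_def reward_def)
   ultimately show ?thesis unfolding width_def by simp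
  qed
  have rd: "\<exists>s\<in>{1..S}. sup_round k \<sigma> \<beta> N T z (pick (U \<omega>)) (a \<omega>) (reward f z (a \<omega>) (\<epsilon> \<omega>)) \<Psi> t s" if "t \<in> {1..T}" for t
   using bspec[OF rounds that] .
  have reg: "regret f N z (a \<omega>) T \<le> 2 * \<sigma> * sqrt (real T) + (8 + 4 * G / \<sigma>) * (\<Sum>s=1..S. \<Sum>t\<in>\<Psi> (Suc T) s. width k \<sigma> \<beta> {i\<in>\<Psi> (Suc T) s. i < t} (played z (a \<omega>)) (played z (a \<omega>) t)) + real (card ?Bad) * (2 * G)"
  proof (rule sup_regret_le[OF \<Psi>1 rd N \<sigma> T k _ arms aN[OF w] pick_in G conf])
   show "0 \<le> \<beta>" using \<beta> by simp
   show "?Bad \<subseteq> {1..T}" by blast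
  qed
  have sub: "\<Psi> (Suc T) s \<subseteq> {1..T}" for s
  proof -
   have "\<exists>s. sup_round k \<sigma> \<beta> N T z (pick (U \<omega>)) (a \<omega>) (reward f z (a \<omega>) (\<epsilon> \<omega>)) \<Psi> t s" if "t \<in> {1..T}" for t
    using r1[OF that] by blast
   from conjunct1[OF sup_sets_prefix[OF \<Psi>1 this, of "Suc T" s]]
   have "\<Psi> (Suc T) s \<subseteq> {1..<Suc T}" by simp
   then show ?thesis by (simp add: atLeastLessThanSuc_atLeastAtMost)
  qed
  have "(\<Sum>s=1..S. \<Sum>t\<in>\<Psi> (Suc T) s. width k \<sigma> \<beta> {i\<in>\<Psi> (Suc T) s. i < t} (played z (a \<omega>)) (played z (a \<omega>) t)) \<le> (\<Sum>s=1..S. W)"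
  proof (rule sum_mono)
   fix s
   have "played z (a \<omega>) t \<in> X" if "t \<in> \<Psi> (Suc T) s" for t
    using sub[of s] that aN[OF w, of t] unfolding played_def by (intro arms) auto
   then show "(\<Sum>t\<in>\<Psi> (Suc T) s. width k \<sigma> \<beta> {i\<in>\<Psi> (Suc T) s. i < t} (played z (a \<omega>)) (played z (a \<omega>) t)) \<le> W"
    by (intro W sub ballI)
  qed
  then have 1: "(8 + 4 * G / \<sigma>) * (\<Sum>s=1..S. \<Sum>t\<in>\<Psi> (Suc T) s. width k \<sigma> \<beta> {i\<in>\<Psi> (Suc T) s. i < t} (played z (a \<omega>)) (played z (a \<omega>) t)) \<le> (8 + 4 * G / \<sigma>) * (real S * W)"
   using G0 \<sigma> by (intro mult_left_mono) auto
  have "real (card ?Bad) = (\<Sum>t\<in>?Bad. 1)" by simp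
  also have "\<dots> \<le> (\<Sum>t\<in>?Bad. \<Sum>R=1..S. \<Sum>i<N. indicator (deviates t R i) \<omega>)"
  proof (rule sum_mono)
   fix t assume "t \<in> ?Bad"
   then obtain R i where Ri: "R \<in> {1..S}" "i \<in> {..<N}" "\<omega> \<in> deviates t R i" by auto
   have "1 \<le> (\<Sum>i<N. indicator (deviates t R i) \<omega> :: real)"
    using member_le_sum[of i "{..<N}" "\<lambda>i. indicator (deviates t R i) \<omega> :: real"] Ri by simp
   also have "\<dots> \<le> (\<Sum>R=1..S. \<Sum>i<N. indicator (deviates t R i) \<omega>)"
    using Ri(1) by (intro member_le_sum[of R "{1..S}" "\<lambda>R. \<Sum>i<N. indicator (deviates t R i) \<omega> :: real"]) (auto intro!: sum_nonneg)
   finally show "(1 :: real) \<le> (\<Sum>R=1..S. \<Sum>i<N. indicator (deviates t R i) \<omega>)" .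
  qed
  also have "\<dots> \<le> Z \<omega>" unfolding Z_def by (intro sum_mono2) (auto intro!: sum_nonneg)
  finally have "real (card ?Bad) * (2 * G) \<le> c * (2 * G)" using Zc G0 by (intro mult_right_mono) auto
  then have "regret f N z (a \<omega>) T \<le> rho" using reg 1 rate unfolding c_def S_def by linarith
  then show "\<omega> \<in> ?H" using w by simp
 qed
 moreover have "?H \<in> events"
 proof -
  have "(\<lambda>\<omega>. f (played z (a \<omega>) t)) \<in> borel_measurable M" if "t \<in> {1..T}" for t
   unfolding played_def by (rule measurable_compose[OF bspec[OF a that]]) simp
  then have "(\<lambda>\<omega>. regret f N z (a \<omega>) T) \<in> borel_measurable M"
   unfolding regret_def by (intro borel_measurable_sum borel_measurable_diff borel_measurable_const)
  then show ?thesis by (intro borel_measurable_le borel_measurable_const)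
 qed
 ultimately have "prob (space M - ?E) \<le> prob ?H" by (rule finite_measure_mono)
 then show ?thesis using pZ prob_compl[OF E] by simp
qed

end

text \<open>All three terms of the regret bound are compared with one quantity \<open>Y\<close>. The
  square of the coefficient arises where the bound \<open>G\<close> on the values of
  \<open>f\<close> multiplies a sum of widths, and the second logarithm is the number of
  levels.\<close>

lemma sup_ntk_ucb_regret:
 fixes C :: "nat => nat => real" and \<delta> \<sigma> B :: real
 assumes C1: "\<And>d L. C d L \<ge> 1" and CL: "\<And>d L. C d L \<ge> real L + 1"
  and var: "\<And>d L \<sigma> T S x. d \<ge> 1 ==> L \<ge> 1 ==> \<sigma> > 0 ==> T \<ge> 3 ==> S \<subseteq> {1..T} ==> \<forall>t\<in>S. x t \<in> unit_sphere d ==>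
   (\<Sum>t\<in>S. (post_sd (ntk d L) \<sigma> {i\<in>S. i < t} x (x t))\<^sup>2) \<le> C d L * (1 + \<sigma>\<^sup>2) * real T powr ((real d - 1) / real d) * ln (real T)"
  and N: "1 \<le> N" and \<delta>: "0 < \<delta>" "\<delta> < 1" and \<sigma>: "0 < \<sigma>"
 defines "b \<equiv> 2 * \<bar>ln (2 * real N / \<delta>)\<bar> + 2"
 defines "K \<equiv> 2 * \<sigma> + (8 + 4 * B / \<sigma>) * (2 * sqrt (b * (1 + \<sigma>\<^sup>2))) + (2 * exp (B\<^sup>2 / 2) + 1) * (2 * B)"
 defines "\<beta> \<equiv> \<lambda>T. 2 * ln (2 * real T * real N / \<delta>)"
 assumes T3: "3 \<le> T" and dL: "1 \<le> d" "1 \<le> L" and ctx: "contexts d N X z" and M: "prob_space M" and ball: "in_rkhs_ball X (ntk d L) B f"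
  and noise: "iid_subgaussian_noise M {1..T} \<sigma> \<epsilon>" and U: "U \<in> borel_measurable M"
  and ind: "prob_space.indep_set M
      (generated_by M (PiM {1..T} (\<lambda>_. borel)) (\<lambda>\<omega>. restrict (\<epsilon> \<omega>) {1..T}))
      (generated_by M borel U)"
  and pick: "choice_rule N pick"
  and a: "\<forall>t\<in>{1..T}. (\<lambda>\<omega>. a \<omega> t) \<in> measurable M (count_space {..<N})"
  and run: "\<forall>\<omega>\<in>space M. sup_ntk_ucb (ntk d L) \<sigma> (\<beta> T) N T z (pick (U \<omega>)) (a \<omega>) (reward f z (a \<omega>) (\<epsilon> \<omega>))"
 shows "measure M {\<omega> \<in> space M. regret f N z (a \<omega>) T \<le> regret_rate ((C d L)\<^sup>2) K 2 d T} > 1 - \<delta>"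
proof -
 interpret prob_space M by (rule M)
 have XS: "X \<subseteq> unit_sphere d" and cols: "\<And>t i. t \<ge> 1 ==> i < N ==> arm (z t) i \<in> X"
  using ctx arm_eq_col by (auto simp: contexts_def)
 have kX: "psd_kernel X (ntk d L)" by (rule psd_kernel_mono[OF psd_kernel_ntk[OF dL(2)] XS])
 have B: "0 \<le> B" by (rule rkhs_ball_nonneg[OF ball])
 have l1: "ln (real T) \<ge> 1" using T3 exp_le by (subst ln_ge_iff) auto
 have q: "1 < 2 * real T * real N / \<delta>"
 proof -
  have "1 * 1 \<le> real T * real N" using T3 N by (intro mult_mono) auto
  then show ?thesis using \<delta> by (simp add: less_divide_eq)
 qed
 have \<beta>0: "\<beta> T > 0" unfolding \<beta>_def using q by simp
 have \<beta>b: "\<beta> T \<le> b * ln (real T)"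
 proof -
  have "ln (2 * real T * real N / \<delta>) = ln (real T * (2 * real N / \<delta>))" by (simp add: mult_ac)
  also have "\<dots> = ln (real T) + ln (2 * real N / \<delta>)" using T3 N \<delta> by (intro ln_mult_pos) auto
  finally have "\<beta> T = 2 * ln (2 * real N / \<delta>) + 2 * ln (real T)" by (simp add: \<beta>_def)
  moreover have "2 * \<bar>ln (2 * real N / \<delta>)\<bar> * 1 \<le> 2 * \<bar>ln (2 * real N / \<delta>)\<bar> * ln (real T)" using l1 by (intro mult_left_mono) auto
  ultimately show ?thesis by (simp add: b_def distrib_right)
 qed
 interpret sup_run M "ntk d L" \<sigma> "\<beta> T" N T z f X \<epsilon> U pick B
  by unfold_locales (use kX \<sigma> N T3 \<beta>0 cols ball noise U ind pick in auto)
 \<comment> \<open>On the diagonal the kernel is \<open>real L + 1\<close>, whose square root is at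
   most \<open>C d L\<close>; this keeps \<open>L\<close> out of the constant
   \<open>K\<close>.\<close>
 define G where "G = B * C d L"
 have CC: "1 \<le> C d L" by (rule C1)
 have G: "\<bar>f v\<bar> \<le> G" if "v \<in> X" for v
 proof -
  have "\<bar>f v\<bar> \<le> B * sqrt (real L + 1)" using rkhs_ball_bound[OF kX ball that] ntk_diag[of v d L] that XS dL by auto
  also have "\<dots> \<le> B * C d L"
  proof (rule mult_left_mono[OF _ B])
   have "sqrt (real L + 1) \<le> sqrt ((real L + 1)\<^sup>2)" by (intro real_sqrt_le_mono) (simp add: power2_eq_square)
   also have "\<dots> = real L + 1" by simp
   finally show "sqrt (real L + 1) \<le> C d L" using CL[of L d] by linarith
  qed
  finally show ?thesis by (simp add: G_def)
 qed
 define W where "W = regret_rate (C d L) (sqrt (b * (1 + \<sigma>\<^sup>2))) 1 d T"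
 have b0: "0 \<le> b" by (simp add: b_def)
 have W: "(\<Sum>t\<in>S'. width (ntk d L) \<sigma> (\<beta> T) {i\<in>S'. i < t} x (x t)) \<le> W" if S: "S' \<subseteq> {1..T}" and x: "\<forall>t\<in>S'. x t \<in> X" for S' x
 proof -
  let ?s = "\<lambda>t. post_sd (ntk d L) \<sigma> {i\<in>S'. i < t} x (x t)"
  have "card S' \<le> card {1..T}" using S by (intro card_mono) auto
  then have "(\<Sum>t\<in>S'. ?s t) \<le> sqrt (real T * (\<Sum>t\<in>S'. (?s t)\<^sup>2))"
   using S finite_subset by (intro sum_le_sqrt_card) auto
  also have "\<dots> \<le> sqrt (real T * (C d L * (1 + \<sigma>\<^sup>2) * real T powr ((real d - 1) / real d) * ln (real T)))"
   using x XS by (intro real_sqrt_le_mono mult_left_mono var dL \<sigma> T3 S) auto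
  finally have "sqrt (\<beta> T) * (\<Sum>t\<in>S'. ?s t) \<le> sqrt (\<beta> T) * sqrt (real T * (C d L * (1 + \<sigma>\<^sup>2) * real T powr ((real d - 1) / real d) * ln (real T)))"
   using \<beta>0 by (intro mult_left_mono) auto
  also have "\<dots> \<le> W" unfolding W_def by (rule regret_rate_combine[OF T3 dL(1) CC b0 _ \<beta>b]) (use \<beta>0 in auto)
  finally show ?thesis unfolding width_def sum_distrib_left .
 qed
 \<comment> \<open>Without the bias the sum over rounds and arms would be exactly
   \<open>\<delta>\<close>; subtracting \<open>B\<^sup>2\<close> from \<open>\<beta> T\<close>
   multiplies it by \<open>exp (B\<^sup>2 / 2)\<close>, a factor free of \<open>d\<close>,
   \<open>L\<close> and \<open>T\<close>.\<close>
 have Q: "real T * real N * (2 * exp (- (\<beta> T - B\<^sup>2) / 2)) \<le> exp (B\<^sup>2 / 2) * \<delta>"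
 proof -
  have "- (\<beta> T - B\<^sup>2) / 2 = B\<^sup>2 / 2 + - ln (2 * real T * real N / \<delta>)" by (simp add: \<beta>_def field_simps)
  then have "exp (- (\<beta> T - B\<^sup>2) / 2) = exp (B\<^sup>2 / 2) * inverse (2 * real T * real N / \<delta>)"
   using q by (simp only: exp_add exp_minus) (subst exp_ln, simp_all)
  then show ?thesis using T N \<delta> by (simp add: field_simps)
 qed
 define P where "P = real T powr ((2 * real d - 1) / (2 * real d))"
 define l where "l = ln (real T)"
 have sqrtP: "sqrt (real T) \<le> P"
 proof -
  have "1 / 2 \<le> (2 * real d - 1) / (2 * real d)" using dL by (simp add: field_simps)
  then have "real T powr (1 / 2) \<le> P" unfolding P_def using T by (intro powr_mono) auto
  then show ?thesis using T by (simp add: powr_half_sqrt)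
 qed
 have P1: "1 \<le> P" using sqrtP T real_sqrt_ge_1_iff[of "real T"] by linarith
 have S: "real (nat \<lceil>ln (real T)\<rceil>) \<le> 2 * l" using l1 unfolding l_def by linarith
 define Y where "Y = (C d L)\<^sup>2 * P * l\<^sup>2"
 have l: "1 \<le> l" using l1 by (simp add: l_def)
 have C2: "1 \<le> (C d L)\<^sup>2" "C d L \<le> (C d L)\<^sup>2" using CC by (simp_all add: one_le_power self_le_power)
 have l2: "1 \<le> l\<^sup>2" "l \<le> l\<^sup>2" using l by (simp_all add: one_le_power self_le_power)
 have y1: "sqrt (real T) \<le> Y"
 proof -
  have "1 * P * 1 \<le> (C d L)\<^sup>2 * P * l\<^sup>2" using C2 l2 P1 by (intro mult_mono) auto
  then show ?thesis using sqrtP unfolding Y_def by simp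
 qed
 have y2: "l * C d L \<le> Y"
 proof -
  have "C d L * 1 * l \<le> (C d L)\<^sup>2 * P * l\<^sup>2" using C2 l2 P1 CC l by (intro mult_mono) auto
  then show ?thesis unfolding Y_def by (simp add: mult.commute)
 qed
 let ?R = "sqrt (b * (1 + \<sigma>\<^sup>2))"
 have W0: "W = ?R * (C d L * P * l)" unfolding W_def regret_rate_def P_def l_def by simp
 have R0: "0 \<le> ?R" using b0 by simp
 have cpl: "0 \<le> C d L * P * l" using CC P1 l by simp
 have t2: "(8 + 4 * G / \<sigma>) * (real (nat \<lceil>ln (real T)\<rceil>) * W) \<le> (8 + 4 * B / \<sigma>) * (2 * ?R) * Y"
 proof -
  have "8 + 4 * G / \<sigma> \<le> (8 + 4 * B / \<sigma>) * C d L" using CC by (simp add: G_def distrib_right)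
  moreover have "real (nat \<lceil>ln (real T)\<rceil>) * W \<le> (2 * l) * W" using S W0 R0 cpl by (intro mult_right_mono) auto
  ultimately have "(8 + 4 * G / \<sigma>) * (real (nat \<lceil>ln (real T)\<rceil>) * W) \<le> ((8 + 4 * B / \<sigma>) * C d L) * ((2 * l) * W)"
   by (rule mult_mono) (use B \<sigma> CC W0 R0 cpl S l in auto)
  also have "\<dots> = (8 + 4 * B / \<sigma>) * (2 * ?R) * Y" unfolding W0 Y_def by (simp only: power2_eq_square mult_ac)
  finally show ?thesis .
 qed
 have t3: "(real (nat \<lceil>ln (real T)\<rceil>) * exp (B\<^sup>2 / 2) + 1) * (2 * G) \<le> (2 * exp (B\<^sup>2 / 2) + 1) * (2 * B) * Y"
 proof -
  have "real (nat \<lceil>ln (real T)\<rceil>) * exp (B\<^sup>2 / 2) \<le> (2 * l) * exp (B\<^sup>2 / 2)" using S by (intro mult_right_mono) auto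
  then have "real (nat \<lceil>ln (real T)\<rceil>) * exp (B\<^sup>2 / 2) + 1 \<le> (2 * exp (B\<^sup>2 / 2) + 1) * l"
  proof -
   have "(2 * exp (B\<^sup>2 / 2) + 1) * l = (2 * l) * exp (B\<^sup>2 / 2) + l" by (simp add: algebra_simps)
   then show ?thesis using \<open>real (nat \<lceil>ln (real T)\<rceil>) * exp (B\<^sup>2 / 2) \<le> (2 * l) * exp (B\<^sup>2 / 2)\<close> l by linarith
  qed
  then have "(real (nat \<lceil>ln (real T)\<rceil>) * exp (B\<^sup>2 / 2) + 1) * (2 * G) \<le> ((2 * exp (B\<^sup>2 / 2) + 1) * l) * (2 * G)"
   using B CC by (intro mult_right_mono) (auto simp: G_def)
  also have "\<dots> = (2 * exp (B\<^sup>2 / 2) + 1) * (2 * B) * (l * C d L)" unfolding G_def by (simp only: mult_ac)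
  also have "\<dots> \<le> (2 * exp (B\<^sup>2 / 2) + 1) * (2 * B) * Y" using y2 B by (intro mult_left_mono) (auto intro: add_nonneg_nonneg)
  finally show ?thesis .
 qed
 have t1: "2 * \<sigma> * sqrt (real T) \<le> 2 * \<sigma> * Y" using y1 \<sigma> by (intro mult_left_mono) auto
 have rr: "regret_rate ((C d L)\<^sup>2) K 2 d T = K * Y" unfolding regret_rate_def Y_def P_def l_def by simp
 have "2 * \<sigma> * sqrt (real T) + (8 + 4 * G / \<sigma>) * (real (nat \<lceil>ln (real T)\<rceil>) * W) + (real (nat \<lceil>ln (real T)\<rceil>) * exp (B\<^sup>2 / 2) + 1) * (2 * G)
  \<le> regret_rate ((C d L)\<^sup>2) K 2 d T"
  unfolding rr unfolding K_def distrib_right[of _ _ Y] by (intro add_mono t1 t2 t3)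
 from sup_run_regret_prob[OF a run G W Q \<delta>(1) _ this] show ?thesis by simp
qed

theorem corollary3p4:
  shows "\<exists>C :: nat \<Rightarrow> nat \<Rightarrow> real. (\<forall>d L. C d L > 0) \<and>
    (\<forall>(N :: nat) (\<delta> :: real) (\<sigma> :: real). 1 \<le> N \<and> 0 < \<delta> \<and> \<delta> < 1 \<and> 0 < \<sigma> \<longrightarrow>
      (\<exists>(K :: real) (p :: nat) (T0 :: nat).
        \<forall>(d :: nat) (L :: nat) (X :: real vec set) (z :: nat \<Rightarrow> real mat) (M :: 'w measure)
          (f :: 'w \<Rightarrow> real vec \<Rightarrow> real) (\<epsilon> :: 'w \<Rightarrow> nat \<Rightarrow> real) (U :: 'w \<Rightarrow> real)
          (a :: 'w \<Rightarrow> nat \<Rightarrow> nat).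
          1 \<le> d \<and> 1 \<le> L \<and> contexts d N X z \<and>
          prob_space M \<and>
          gaussian_process M X (ntk d L) f \<and>
          iid_gaussian_noise M {1..} \<sigma> \<epsilon> \<and>
          U \<in> borel_measurable M \<and>
          prob_space.indep_sets M
            ((!) [generated_by M (PiM X (\<lambda>_. borel)) (\<lambda>\<omega>. restrict (f \<omega>) X),
                  generated_by M (PiM {1..} (\<lambda>_. borel)) (\<lambda>\<omega>. restrict (\<epsilon> \<omega>) {1..}),
                  generated_by M borel U]) {..<3} \<and>
          ntk_ucb (ntk d L) \<sigma> (\<lambda>t. 2 * ln (real N * (real t)\<^sup>2 * pi\<^sup>2 / (6 * \<delta>)))
            N z M U a (\<lambda>\<omega>. reward (f \<omega>) z (a \<omega>) (\<epsilon> \<omega>))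
          \<longrightarrow> measure M {\<omega> \<in> space M.
                \<forall>T\<ge>T0. regret (f \<omega>) N z (a \<omega>) T \<le> regret_rate (C d L) K p d T} > 1 - \<delta>) \<and>
      (\<forall>B :: real. \<exists>(K :: real) (p :: nat) (T0 :: nat).
        \<forall>(T :: nat) (d :: nat) (L :: nat) (X :: real vec set) (z :: nat \<Rightarrow> real mat)
          (M :: 'w measure) (f :: real vec \<Rightarrow> real) (\<epsilon> :: 'w \<Rightarrow> nat \<Rightarrow> real) (U :: 'w \<Rightarrow> real)
          (pick :: real \<Rightarrow> nat \<Rightarrow> nat set \<Rightarrow> nat) (a :: 'w \<Rightarrow> nat \<Rightarrow> nat).
          T0 \<le> T \<and> 1 \<le> d \<and> 1 \<le> L \<and> contexts d N X z \<and>
          prob_space M \<and>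
          in_rkhs_ball X (ntk d L) B f \<and>
          iid_subgaussian_noise M {1..T} \<sigma> \<epsilon> \<and>
          U \<in> borel_measurable M \<and>
          prob_space.indep_set M
            (generated_by M (PiM {1..T} (\<lambda>_. borel)) (\<lambda>\<omega>. restrict (\<epsilon> \<omega>) {1..T}))
            (generated_by M borel U) \<and>
          choice_rule N pick \<and>
          (\<forall>t\<in>{1..T}. (\<lambda>\<omega>. a \<omega> t) \<in> measurable M (count_space {..<N})) \<and>
          (\<forall>\<omega>\<in>space M.
             sup_ntk_ucb (ntk d L) \<sigma> (2 * ln (2 * real T * real N / \<delta>)) N T z
               (pick (U \<omega>)) (a \<omega>) (reward f z (a \<omega>) (\<epsilon> \<omega>)))
          \<longrightarrow> measure M {\<omega> \<in> space M.
                regret f N z (a \<omega>) T \<le> regret_rate (C d L) K p d T} > 1 - \<delta>))"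
proof -
 obtain C :: "nat => nat => real" where C: "\<forall>d L. C d L \<ge> 1 \<and> C d L \<ge> real L + 1"
  and V: "\<forall>d L \<sigma> T S x. d \<ge> 1 \<and> L \<ge> 1 \<and> \<sigma> > 0 \<and> T \<ge> 3 \<and> S \<subseteq> {1..T} \<and> (\<forall>t\<in>S. x t \<in> unit_sphere d) \<longrightarrow>
   (\<Sum>t\<in>S. (post_sd (ntk d L) \<sigma> {i\<in>S. i < t} x (x t))\<^sup>2) \<le> C d L * (1 + \<sigma>\<^sup>2) * real T powr ((real d - 1) / real d) * ln (real T)"
  using ntk_variance_sum by (elim exE conjE)
 have C1: "C d L \<ge> 1" "C d L \<ge> real L + 1" for d L using C by blast+
 have var: "(\<Sum>t\<in>S. (post_sd (ntk d L) \<sigma> {i\<in>S. i < t} x (x t))\<^sup>2) \<le> C d L * (1 + \<sigma>\<^sup>2) * real T powr ((real d - 1) / real d) * ln (real T)"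
  if "d \<ge> 1" "L \<ge> 1" "\<sigma> > 0" "T \<ge> 3" "S \<subseteq> {1..T}" "\<forall>t\<in>S. x t \<in> unit_sphere d" for d L T :: nat and \<sigma> :: real and S x
  using V that by blast
 have C2: "(C d L)\<^sup>2 \<ge> 1" "C d L \<le> (C d L)\<^sup>2" for d L using C1[of d L] by (simp_all add: one_le_power self_le_power)
 \<comment> \<open>Both statements share one coefficient. The variance bound with \<open>C\<close>
   passes to its square because \<open>C d L\<close> is at least 1.\<close>
 have var2: "(\<Sum>t\<in>S. (post_sd (ntk d L) \<sigma> {i\<in>S. i < t} x (x t))\<^sup>2) \<le> (C d L)\<^sup>2 * (1 + \<sigma>\<^sup>2) * real T powr ((real d - 1) / real d) * ln (real T)"
  if h: "d \<ge> 1" "L \<ge> 1" "\<sigma> > 0" "T \<ge> 3" "S \<subseteq> {1..T}" "\<forall>t\<in>S. x t \<in> unit_sphere d" for d L T :: nat and \<sigma> :: real and S x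
 proof -
  have "C d L * ((1 + \<sigma>\<^sup>2) * (real T powr ((real d - 1) / real d) * ln (real T))) \<le> (C d L)\<^sup>2 * ((1 + \<sigma>\<^sup>2) * (real T powr ((real d - 1) / real d) * ln (real T)))"
   using C2(2) h(4) by (intro mult_right_mono mult_nonneg_nonneg) auto
  then show ?thesis using var[OF h] by (simp add: mult.assoc)
 qed
 show ?thesis
 proof (intro exI[of _ "\<lambda>d L. (C d L)\<^sup>2"] conjI allI impI, goal_cases)
  case (1 d L)
  show ?case using C2(1)[of d L] by linarith
 next
  case (2 N \<delta> \<sigma>)
  \<comment> \<open>From horizon 3 on the logarithm is at least 1 and absorbs additive constants;
    hence the threshold 3 here and in the next case.\<close>
  show ?case
   by (intro exI[of _ "2 * sqrt ((2 * \<bar>ln (real N * pi\<^sup>2 / (6 * \<delta>))\<bar> + 4) * (1 + \<sigma>\<^sup>2))"] exI[of _ "1::nat"] exI[of _ "3::nat"] allI impI,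
     elim conjE, rule ntk_ucb_regret[where \<delta>=\<delta> and \<sigma>=\<sigma>, OF C2(1) var2]) (use 2 in \<open>blast+\<close>)
 next
  case (3 N \<delta> \<sigma> B)
  show ?case
   by (rule exI, rule exI[of _ 2], rule exI[of _ 3], intro allI impI, elim conjE,
     rule sup_ntk_ucb_regret[where \<delta>=\<delta> and \<sigma>=\<sigma> and B=B, OF C1 var]) (use 3 in \<open>blast+\<close>)
 qed
qed

end
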